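(* Let $\Phi_2(s_1,s_2;1,\Lambda)$ denote the meromorphic continuation to $\mathbb{C}^2$ of the double series $$\sum_{m_1=1}^\infty\sum_{m_2=1}^\infty\frac{\Lambda(m_2)}{m_1^{s_1}(m_1+m_2)^{s_2}}\qquad(\Re s_2>1,\ \Re(s_1+s_2)>2).$$ The singularities of $\Phi_2(s_1,s_2;1,\Lambda)$ are located only on the subsets of $\mathbb{C}^2$ defined by one of the following equations: $$\begin{aligned} & s_2=1,\\ & s_2=-l\quad(l\in\mathbb{N},\ l\ge2),\\ & s_1+s_2=2-l\quad(l\in\mathbb{N}_0),\\ & s_2=-l+\rho_n\quad(n\in\mathbb{N},\ l\in\mathbb{N}_0),\\ & s_1+s_2=1+\rho_n\quad(n\in\mathbb{N}), \end{aligned}$$ and all of these subsets are true singularities of $\Phi_2(s_1,s_2;1,\Lambda)$.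
   Context: $\mathbb{N}=\{1,2,3,\dots\}$, $\mathbb{N}_0=\mathbb{N}\cup\{0\}$. $\Lambda$ is the von Mangoldt function: $\Lambda(n)=\log p$ if $n=p^m$ with $p$ prime and $m\in\mathbb{N}$, and $\Lambda(n)=0$ otherwise. $\{\rho_n\}_{n\ge1}$ are the non-trivial zeros of the Riemann zeta function $\zeta(s)$, numbered by the size of the absolute values of their imaginary parts. The double series converges absolutely for $\Re s_2>1$, $\Re(s_1+s_2)>2$ and is known to extend meromorphically to all of $\mathbb{C}^2$. "True" singularity means that the function is actually singular along the hyperplane in question, i.e. the singularity is not cancelled. *)

theory Defs
  imports
    "HOL-Complex_Analysis.Complex_Analysis"
    "HOL-Number_Theory.Prime_Powers"
begin

section \<open>The Riemann zeta function\<close>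

text \<open>
  The value at \<open>1\<close> is left open, and no definition below refers to it; on \<open>- {1}\<close> the
  function is determined uniquely by the identity theorem.
\<close>

definition zeta :: "complex \<Rightarrow> complex" where
  "zeta = (SOME f. f holomorphic_on - {1} \<and>
                   (\<forall>s. Re s > 1 \<longrightarrow> f s = (\<Sum>\<^sub>\<infinity>n\<in>{1::nat..}. 1 / of_nat n powr s)))"

text \<open>The trivial zeros are the negative even integers.\<close>

definition zeta_nontrivial_zeros :: "complex set" where
  "zeta_nontrivial_zeros =
     {s. s \<noteq> 1 \<and> zeta s = 0 \<and> \<not> (\<exists>k::nat. k \<ge> 1 \<and> s = - 2 * of_nat k)}"


section \<open>Meromorphic functions of two complex variables\<close>

text \<open>
  The Frechet derivative is required to be complex linear.
  The definition is meant for open sets \<open>U\<close>.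
\<close>

definition holomorphic2_on :: "(complex \<times> complex \<Rightarrow> complex) \<Rightarrow> (complex \<times> complex) set \<Rightarrow> bool" where
  "holomorphic2_on f U \<longleftrightarrow>
     (\<forall>z\<in>U. \<exists>a b. (f has_derivative (\<lambda>(u, v). a * u + b * v)) (at z))"

text \<open>
  A meromorphic function on \<open>\<complex>\<^sup>2\<close> is locally a quotient of holomorphic functions with a
  denominator that does not vanish identically. It is represented by a total function, whose
  values on the zero sets of the denominators carry no information.
\<close>

definition meromorphic2 :: "(complex \<times> complex \<Rightarrow> complex) \<Rightarrow> bool" where
  "meromorphic2 F \<longleftrightarrow>
     (\<forall>p. \<exists>U g h. open U \<and> connected U \<and> p \<in> U \<and>
        holomorphic2_on g U \<and> holomorphic2_on h U \<and> (\<exists>z\<in>U. h z \<noteq> 0) \<and>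
        (\<forall>z\<in>U. h z \<noteq> 0 \<longrightarrow> F z = g z / h z))"

text \<open>
  Accordingly, \<open>F\<close> is regular at \<open>p\<close> if near \<open>p\<close> it agrees with a holomorphic function \<open>G\<close> off the
  zero set of some holomorphic \<open>h\<close> that does not vanish identically. Poles and points of
  indeterminacy are singular; removable singularities are not.
\<close>

definition regular2_at :: "(complex \<times> complex \<Rightarrow> complex) \<Rightarrow> complex \<times> complex \<Rightarrow> bool" where
  "regular2_at F p \<longleftrightarrow>
     (\<exists>U G h. open U \<and> connected U \<and> p \<in> U \<and>
        holomorphic2_on G U \<and> holomorphic2_on h U \<and> (\<exists>z\<in>U. h z \<noteq> 0) \<and>
        (\<forall>z\<in>U. h z \<noteq> 0 \<longrightarrow> F z = G z))"

definition singularities2 :: "(complex \<times> complex \<Rightarrow> complex) \<Rightarrow> (complex \<times> complex) set" where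
  "singularities2 F = {p. \<not> regular2_at F p}"

definition meromorphic_continuation2 ::
  "(complex \<times> complex \<Rightarrow> complex) \<Rightarrow> (complex \<times> complex) set \<Rightarrow> (complex \<times> complex \<Rightarrow> complex) \<Rightarrow> bool" where
  "meromorphic_continuation2 f D F \<longleftrightarrow> meromorphic2 F \<and> (\<forall>s\<in>D. F s = f s)"


section \<open>The double series\<close>

definition double_series ::
  "(nat \<Rightarrow> complex) \<Rightarrow> (nat \<Rightarrow> complex) \<Rightarrow> complex \<times> complex \<Rightarrow> complex" where
  "double_series a1 a2 = (\<lambda>(s1, s2).
     \<Sum>\<^sub>\<infinity>(m1, m2)\<in>{1..} \<times> {1..}.
       a1 m1 * a2 m2 / (of_nat m1 powr s1 * of_nat (m1 + m2) powr s2))"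

definition double_series_domain :: "(complex \<times> complex) set" where
  "double_series_domain = {(s1, s2). Re s2 > 1 \<and> Re (s1 + s2) > 2}"

text \<open>
  Two continuations can only differ in their values on a nowhere dense set, and
  \<^const>\<open>singularities2\<close> is insensitive to that difference, so the choice is immaterial.
\<close>

definition Phi2 ::
  "(nat \<Rightarrow> complex) \<Rightarrow> (nat \<Rightarrow> complex) \<Rightarrow> complex \<times> complex \<Rightarrow> complex" where
  "Phi2 a1 a2 =
     (SOME F. meromorphic_continuation2 (double_series a1 a2) double_series_domain F)"

definition singular_hyperplanes :: "(complex \<times> complex) set set" where
  "singular_hyperplanes =
     { {(s1, s2). s2 = 1} }
   \<union> { {(s1, s2). s2 = - of_nat l} | l::nat. l \<ge> 2 }
   \<union> { {(s1, s2). s1 + s2 = 2 - of_nat l} | l::nat. True }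
   \<union> { {(s1, s2). s2 = - of_nat l + \<rho>} | (l::nat) \<rho>. \<rho> \<in> zeta_nontrivial_zeros }
   \<union> { {(s1, s2). s1 + s2 = 1 + \<rho>} | \<rho>. \<rho> \<in> zeta_nontrivial_zeros }"

end

theory Submission
  imports Defs "HOL-Library.Nat_Bijection"
begin

text \<open>
  Writing \<open>(m\<^sub>1 + m\<^sub>2) powr - s\<^sub>2\<close> as a Mellin integral and splitting it at \<open>t = 1/2\<close>, the part over \<open>t > 1/2\<close>
  is entire. For small \<open>t\<close>, the sum over \<open>m\<^sub>1\<close> is replaced by its expansion
  \<open>\<Sum>\<^sub>m m powr - s * exp (- m t) = \<Gamma>(1 - s) t powr (s - 1) + \<Sum>\<^sub>k zcoeff k s * t ^ k\<close>, which gives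
  \<open>\<Gamma>(s\<^sub>2) \<Phi>\<^sub>2 = zW s\<^sub>1 s\<^sub>2 + \<Gamma>(1 - s\<^sub>1) zH(s\<^sub>1 + s\<^sub>2 - 1) + \<Sum>\<^sub>k zcoeff k s\<^sub>1 * zH(s\<^sub>2 + k)\<close>,
  where \<open>zH\<close> is the Mellin integral of \<open>\<Sum>\<^sub>m \<Lambda>(m) exp (- m t)\<close> over \<open>(0, 1/2)\<close> and differs from
  \<open>- \<Gamma> \<zeta>' / \<zeta>\<close> by an entire function. The poles at \<open>s\<^sub>1 \<in> \<nat>\<close> of \<open>\<Gamma>(1 - s\<^sub>1)\<close> and \<open>zcoeff k s\<^sub>1\<close> cancel, so that
  all singularities come from \<open>zH\<close>; the factor \<open>1 / \<Gamma>(s\<^sub>2)\<close> removes those of \<open>zH(s\<^sub>2 + k)\<close> caused by \<open>\<Gamma>\<close>.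
  A singularity along \<open>s\<^sub>2 = b\<close> is true since its residue \<open>\<Sum>\<^sub>k \<kappa>\<^sub>k zcoeff k s\<^sub>1\<close> has a pole in \<open>s\<^sub>1\<close> and hence does
  not vanish identically. For \<open>s\<^sub>1 + s\<^sub>2 = 1 - n\<close> one needs that \<open>\<zeta>' / \<zeta>\<close> does not vanish at \<open>- n\<close>, which
  follows from the functional equation and estimates of the digamma function.
\<close>

section \<open>Holomorphic and meromorphic functions of two variables\<close>

text \<open>The cut at 1/2 settles a race of growth rates: \<open>zcoeff k\<close> is locally
  bounded by a constant times \<open>(4/3) ^ k\<close>, while the factor \<open>t ^ k\<close> on (0,
  1/2) makes \<open>zH (s + k)\<close> decay like \<open>(1/2) ^ k\<close>. The sum over k thus
  converges like a geometric series of ratio 2/3, and only finitely many terms can be singular near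
  a given point. In classical terms \<open>zcoeff k s\<close> is (-1)^k/k! times zeta(s - k), so
  \<open>zcoeff 0\<close> continues zeta itself; this ties the function selected in the definition
  of \<open>zeta\<close> to an explicit entire function. Two obstacles shape the rest. A
  continuation is determined only up to its values on thin sets, so equality is meant off the zero
  set of a holomorphic function. And every point of a hyperplane has to be singular, including its
  intersections with other hyperplanes and the points where s_1 is a positive integer; since
  regularity is an open condition, it suffices to refute it at a nearby generic point of the same
  hyperplane. The nonvanishing of zeta'/zeta is delicate only at 0 and the odd negative integers,
  because at the even negative ones zeta'/zeta has poles.\<close>

lemma holomorphic2_onI:
  assumes "\<And>z. z \<in> U \<Longrightarrow> (f has_derivative (\<lambda>h. a z * fst h + b z * snd h)) (at z)"
  shows "holomorphic2_on f U"
  unfolding holomorphic2_on_def case_prod_beta using assms by blast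

lemma holomorphic2_onE:
  assumes "holomorphic2_on f U" "z \<in> U"
  obtains a b where "(f has_derivative (\<lambda>h. a * fst h + b * snd h)) (at z)"
  using assms unfolding holomorphic2_on_def case_prod_beta by blast

lemma holomorphic2_on_subset:
  assumes "holomorphic2_on f U" "V \<subseteq> U"
  shows "holomorphic2_on f V"
  using assms unfolding holomorphic2_on_def by blast

lemma holomorphic2_on_imp_continuous_on:
  assumes "holomorphic2_on f U"
  shows "continuous_on U f"
proof (rule continuous_at_imp_continuous_on, rule)
  fix z assume "z \<in> U"
  then obtain a b where "(f has_derivative (\<lambda>h. a * fst h + b * snd h)) (at z)"
    by (rule holomorphic2_onE[OF assms])
  thus "isCont f z" by (rule has_derivative_continuous)
qed

lemma holomorphic2_on_const: "holomorphic2_on (\<lambda>_. c) U"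
  by (rule holomorphic2_onI[where a = "\<lambda>_. 0" and b = "\<lambda>_. 0"]) (auto intro!: derivative_eq_intros)

lemma holomorphic2_on_add:
  assumes "holomorphic2_on f U" "holomorphic2_on g U"
  shows "holomorphic2_on (\<lambda>z. f z + g z) U"
  unfolding holomorphic2_on_def case_prod_beta
proof
  fix z assume z: "z \<in> U"
  obtain a b where 1: "(f has_derivative (\<lambda>h. a * fst h + b * snd h)) (at z)"
    using holomorphic2_onE[OF assms(1) z] .
  obtain a' b' where 2: "(g has_derivative (\<lambda>h. a' * fst h + b' * snd h)) (at z)"
    using holomorphic2_onE[OF assms(2) z] .
  have "((\<lambda>z. f z + g z) has_derivative (\<lambda>h. (a + a') * fst h + (b + b') * snd h)) (at z)"
    by (rule has_derivative_eq_rhs[OF has_derivative_add[OF 1 2]]) (simp add: algebra_simps)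
  thus "\<exists>a b. ((\<lambda>z. f z + g z) has_derivative (\<lambda>p. a * fst p + b * snd p)) (at z)" by blast
qed

lemma holomorphic2_on_mult:
  assumes "holomorphic2_on f U" "holomorphic2_on g U"
  shows "holomorphic2_on (\<lambda>z. f z * g z) U"
  unfolding holomorphic2_on_def case_prod_beta
proof
  fix z assume z: "z \<in> U"
  obtain a b where 1: "(f has_derivative (\<lambda>h. a * fst h + b * snd h)) (at z)"
    using holomorphic2_onE[OF assms(1) z] .
  obtain a' b' where 2: "(g has_derivative (\<lambda>h. a' * fst h + b' * snd h)) (at z)"
    using holomorphic2_onE[OF assms(2) z] .
  have "((\<lambda>z. f z * g z) has_derivative
      (\<lambda>h. (f z * a' + a * g z) * fst h + (f z * b' + b * g z) * snd h)) (at z)"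
    by (rule has_derivative_eq_rhs[OF has_derivative_mult[OF 1 2]]) (simp add: algebra_simps)
  thus "\<exists>a b. ((\<lambda>z. f z * g z) has_derivative (\<lambda>p. a * fst p + b * snd p)) (at z)" by blast
qed

lemma holomorphic2_on_diff:
  assumes "holomorphic2_on f U" "holomorphic2_on g U"
  shows "holomorphic2_on (\<lambda>z. f z - g z) U"
proof -
  have "holomorphic2_on (\<lambda>z. f z + (-1) * g z) U"
    by (intro holomorphic2_on_add holomorphic2_on_mult holomorphic2_on_const assms)
  thus ?thesis by simp
qed

lemma holomorphic2_on_sum:
  assumes "\<And>i. i \<in> I \<Longrightarrow> holomorphic2_on (f i) U"
  shows "holomorphic2_on (\<lambda>z. \<Sum>i\<in>I. f i z) U"
  using assms
  by (induction I rule: infinite_finite_induct)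
     (simp_all add: holomorphic2_on_const holomorphic2_on_add)

lemma holomorphic2_on_compose_affine:
  assumes "f holomorphic_on S" "open S" "\<And>z. z \<in> U \<Longrightarrow> c * fst z + d * snd z + e \<in> S"
  shows "holomorphic2_on (\<lambda>z. f (c * fst z + d * snd z + e)) U"
proof (rule holomorphic2_onI)
  fix z assume z: "z \<in> U"
  let ?l = "\<lambda>z. c * fst z + d * snd z + e"
  have 1: "(?l has_derivative (\<lambda>h. c * fst h + d * snd h)) (at z)"
    by (auto intro!: derivative_eq_intros)
  have "(f has_field_derivative deriv f (?l z)) (at (?l z))"
    using assms z holomorphic_derivI by blast
  hence 2: "(f has_derivative (*) (deriv f (?l z))) (at (?l z))"
    by (simp add: has_field_derivative_def)
  show "((\<lambda>z. f (?l z)) has_derivative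
      (\<lambda>h. (deriv f (?l z) * c) * fst h + (deriv f (?l z) * d) * snd h)) (at z)"
    by (rule has_derivative_eq_rhs[OF has_derivative_compose[OF 1 2]]) (simp add: algebra_simps)
qed

lemma holomorphic2_on_fst:
  assumes "f holomorphic_on S" "open S" "\<And>z. z \<in> U \<Longrightarrow> fst z \<in> S"
  shows "holomorphic2_on (\<lambda>z. f (fst z)) U"
  using holomorphic2_on_compose_affine[OF assms(1,2), of U 1 0 0] assms(3) by simp

lemma holomorphic2_on_snd:
  assumes "f holomorphic_on S" "open S" "\<And>z. z \<in> U \<Longrightarrow> snd z \<in> S"
  shows "holomorphic2_on (\<lambda>z. f (snd z)) U"
  using holomorphic2_on_compose_affine[OF assms(1,2), of U 0 1 0] assms(3) by simp

text \<open>Restriction to the complex line through \<open>p\<close> with direction \<open>q\<close>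
  brings the one-variable identity theorem to bear on functions of two variables.\<close>

lemma holomorphic2_on_line:
  assumes "holomorphic2_on f U"
  shows "(\<lambda>w. f (fst p + w * fst q, snd p + w * snd q)) holomorphic_on
           {w. (fst p + w * fst q, snd p + w * snd q) \<in> U}"
  unfolding holomorphic_on_def
proof
  let ?l = "\<lambda>w. (fst p + w * fst q, snd p + w * snd q)"
  fix w assume "w \<in> {w. ?l w \<in> U}"
  then obtain a b where 1: "(f has_derivative (\<lambda>h. a * fst h + b * snd h)) (at (?l w))"
    using holomorphic2_onE[OF assms] by blast
  have 2: "(?l has_derivative (\<lambda>h. (h * fst q, h * snd q))) (at w within {w. ?l w \<in> U})"
    by (auto intro!: derivative_eq_intros)
  have "((\<lambda>w. f (?l w)) has_derivative (*) (a * fst q + b * snd q)) (at w within {w. ?l w \<in> U})"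
    by (rule has_derivative_eq_rhs[OF has_derivative_compose[OF 2 1]])
       (simp add: algebra_simps fun_eq_iff)
  thus "(\<lambda>w. f (?l w)) field_differentiable at w within {w. ?l w \<in> U}"
    unfolding field_differentiable_def has_field_derivative_def by blast
qed

text \<open>Cauchy's inequality on discs of radius \<open>R/4\<close> bounds the derivatives of the
  factors by \<open>4/R\<close> times their majorants, so the termwise differentiated series
  converges uniformly on the polydisc of half the radius. The product form, one factor per variable,
  lets one-variable estimates do all the work; the two-variable series below are arranged to have
  it.\<close>

lemma holomorphic2_on_suminf_mult:
  fixes f g :: "nat \<Rightarrow> complex \<Rightarrow> complex"
  assumes R: "R > 0"
    and f: "\<And>n. f n holomorphic_on ball a R" "\<And>n s. s \<in> ball a R \<Longrightarrow> norm (f n s) \<le> F n"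
    and g: "\<And>n. g n holomorphic_on ball b R" "\<And>n s. s \<in> ball b R \<Longrightarrow> norm (g n s) \<le> G n"
    and sm: "summable (\<lambda>n. F n * G n)"
  shows "holomorphic2_on (\<lambda>z. \<Sum>n. f n (fst z) * g n (snd z)) (ball a (R/2) \<times> ball b (R/2))"
proof -
  define S where "S = ball a (R/2) \<times> ball b (R/2)"
  have Fnn: "F n \<ge> 0" for n using f(2)[of a n] R norm_ge_zero order_trans centre_in_ball by blast
  have Gnn: "G n \<ge> 0" for n using g(2)[of b n] R norm_ge_zero order_trans centre_in_ball by blast
  have deriv_bound: "norm (deriv u w) \<le> 4 / R * B"
    if u: "u holomorphic_on ball c R" and B: "\<And>s. s \<in> ball c R \<Longrightarrow> norm (u s) \<le> B"
      and w: "w \<in> ball c (R/2)" for u c w B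
  proof -
    have sub: "cball w (R/4) \<subseteq> ball c R"
    proof
      fix x assume "x \<in> cball w (R/4)"
      hence "dist c x < R/2 + R/4" using w dist_triangle[of c x w] by (auto simp: dist_commute)
      thus "x \<in> ball c R" using R by auto
    qed
    have "norm ((deriv ^^ 1) u w) \<le> fact 1 * B / (R/4) ^ 1"
    proof (rule Cauchy_inequality)
      show "u holomorphic_on ball w (R/4)"
        using u sub ball_subset_cball holomorphic_on_subset by blast
      show "continuous_on (cball w (R/4)) u"
        using u sub holomorphic_on_imp_continuous_on continuous_on_subset by blast
      show "norm (u x) \<le> B" if "norm (w - x) = R/4" for x
        using that sub B[of x] by (auto simp: dist_norm subset_iff)
    qed (use R in auto)
    thus ?thesis by (simp add: field_simps)
  qed
  have df: "norm (deriv (f n) w) \<le> 4 / R * F n" if "w \<in> ball a (R/2)" for n w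
    using deriv_bound[OF f that] by blast
  have dg: "norm (deriv (g n) w) \<le> 4 / R * G n" if "w \<in> ball b (R/2)" for n w
    using deriv_bound[OF g that] by blast
  have half: "ball c (R/2) \<subseteq> ball c R" for c :: complex using R by auto
  define T where "T = (\<lambda>n. F n * G n)"
  have Tnn: "T n \<ge> 0" for n using Fnn Gnn by (simp add: T_def)
  have b1: "norm (deriv (f n) (fst x) * g n (snd x)) \<le> 4 / R * T n" if "x \<in> S" for n x
  proof -
    have "norm (deriv (f n) (fst x)) * norm (g n (snd x)) \<le> (4 / R * F n) * G n"
      using that half R Fnn by (intro mult_mono df g(2)) (auto simp: S_def)
    thus ?thesis by (simp add: norm_mult T_def mult_ac)
  qed
  have b2: "norm (f n (fst x) * deriv (g n) (snd x)) \<le> 4 / R * T n" if "x \<in> S" for n x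
  proof -
    have "norm (f n (fst x)) * norm (deriv (g n) (snd x)) \<le> F n * (4 / R * G n)"
      using that half R Fnn by (intro mult_mono dg f(2)) (auto simp: S_def)
    thus ?thesis by (simp add: norm_mult T_def mult_ac)
  qed
  have b0: "norm (f n (fst x) * g n (snd x)) \<le> T n" if "x \<in> S" for n x
    using that half[THEN subsetD] Fnn unfolding norm_mult T_def
    by (intro mult_mono f(2) g(2)) (auto simp: S_def simp del: mem_ball)
  have smT: "summable T" using sm by (simp add: T_def)
  have smT': "summable (\<lambda>n. 4 / R * T n)" by (intro summable_mult smT)
  define A where "A = (\<lambda>x. \<Sum>n. deriv (f n) (fst x) * g n (snd x))"
  define B where "B = (\<lambda>x. \<Sum>n. f n (fst x) * deriv (g n) (snd x))"
  have smA: "summable (\<lambda>n. deriv (f n) (fst x) * g n (snd x))" if "x \<in> S" for x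
    using b1[OF that] smT' by (rule summable_comparison_test'[rotated])
  have smB: "summable (\<lambda>n. f n (fst x) * deriv (g n) (snd x))" if "x \<in> S" for x
    using b2[OF that] smT' by (rule summable_comparison_test'[rotated])
  have sm0: "summable (\<lambda>n. f n (fst x) * g n (snd x))" if "x \<in> S" for x
    using b0[OF that] smT by (rule summable_comparison_test'[rotated])
  define D where "D = (\<lambda>n x h. (deriv (f n) (fst x) * g n (snd x)) * fst h +
                               (f n (fst x) * deriv (g n) (snd x)) * snd h)"
  have "\<exists>k. \<forall>x\<in>S. (\<lambda>n. f n (fst x) * g n (snd x)) sums (k x) \<and>
             (k has_derivative (\<lambda>h. A x * fst h + B x * snd h)) (at x within S)"
  proof (rule has_derivative_series[where f' = D and x = "(a, b)"])
    show "convex S" unfolding S_def by (intro convex_Times convex_ball)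
    show "((\<lambda>x. f n (fst x) * g n (snd x)) has_derivative D n x) (at x within S)" if "x \<in> S" for n x
    proof -
      have x: "fst x \<in> ball a R" "snd x \<in> ball b R"
        using that half[THEN subsetD] by (auto simp: S_def simp del: mem_ball)
      have 1: "(f n has_derivative (*) (deriv (f n) (fst x))) (at (fst x))"
        using holomorphic_derivI[OF f(1) open_ball x(1)] by (simp add: has_field_derivative_def)
      have 2: "(g n has_derivative (*) (deriv (g n) (snd x))) (at (snd x))"
        using holomorphic_derivI[OF g(1) open_ball x(2)] by (simp add: has_field_derivative_def)
      have 3: "(fst has_derivative fst) (at x within S)" "(snd has_derivative snd) (at x within S)"
        by (intro has_derivative_fst has_derivative_snd has_derivative_ident)+
      have 4: "((\<lambda>x. f n (fst x)) has_derivative (\<lambda>h. deriv (f n) (fst x) * fst h)) (at x within S)"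
        using has_derivative_compose[OF 3(1) 1] by simp
      have 5: "((\<lambda>x. g n (snd x)) has_derivative (\<lambda>h. deriv (g n) (snd x) * snd h)) (at x within S)"
        using has_derivative_compose[OF 3(2) 2] by simp
      show ?thesis unfolding D_def
        by (rule has_derivative_eq_rhs[OF has_derivative_mult[OF 4 5]]) (simp add: algebra_simps fun_eq_iff)
    qed
    show "(a, b) \<in> S" using R by (simp add: S_def)
    show "(\<lambda>n. f n (fst (a, b)) * g n (snd (a, b))) sums (\<Sum>n. f n a * g n b)"
      using sm0[of "(a, b)"] R by (simp add: S_def summable_sums)
    fix e :: real assume e: "e > 0"
    \<comment> \<open>Each of the two partial derivatives costs a factor \<open>4/R\<close>, so a
      tail of \<open>T\<close> below \<open>e * R / 8\<close> makes the error at most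
      \<open>e\<close> times the norm of \<open>h\<close>.\<close>
    have "(\<lambda>n. \<Sum>i. T (i + n)) \<longlonglongrightarrow> 0" by (rule suminf_exist_split2[OF smT])
    hence "\<forall>\<^sub>F n in sequentially. (\<Sum>i. T (i + n)) < e * R / 8"
      by (rule order_tendstoD) (use e R in auto)
    thus "\<forall>\<^sub>F n in sequentially. \<forall>x\<in>S. \<forall>h.
        norm ((\<Sum>i<n. D i x h) - (A x * fst h + B x * snd h)) \<le> e * norm h"
    proof eventually_elim
      case (elim n)
      show ?case
      proof (intro ballI allI)
        fix x h assume x: "x \<in> S"
        have smD: "summable (\<lambda>i. D i x h)" unfolding D_def
          by (intro summable_add summable_mult2 smA smB x)
        have "(\<Sum>i. D i x h) = A x * fst h + B x * snd h"
          unfolding D_def A_def B_def using smA[OF x] smB[OF x]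
          by (simp add: suminf_add[symmetric] summable_mult2 suminf_mult2)
        hence "(\<Sum>i<n. D i x h) - (A x * fst h + B x * snd h) = - (\<Sum>i. D (i + n) x h)"
          using suminf_split_initial_segment[OF smD, of n] by (simp add: algebra_simps)
        also have "norm \<dots> \<le> (\<Sum>i. 8 / R * norm h * T (i + n))"
        proof (subst norm_minus_cancel, rule norm_suminf_le)
          fix i
          have h: "norm (fst h) \<le> norm h" "norm (snd h) \<le> norm h"
            by (metis norm_fst_le prod.collapse) (metis norm_snd_le prod.collapse)
          have nn: "4 / R * T (i + n) \<ge> 0" using R Tnn by simp
          have "norm (D (i + n) x h) \<le> norm (deriv (f (i + n)) (fst x) * g (i + n) (snd x)) * norm (fst h) +
              norm (f (i + n) (fst x) * deriv (g (i + n)) (snd x)) * norm (snd h)"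
            unfolding D_def norm_mult[of _ "fst h", symmetric] norm_mult[of _ "snd h", symmetric]
            by (rule norm_triangle_ineq)
          also have "\<dots> \<le> 4 / R * T (i + n) * norm h + 4 / R * T (i + n) * norm h"
            by (intro add_mono mult_mono b1 b2 x h nn norm_ge_zero)
          also have "\<dots> = 8 / R * norm h * T (i + n)" using R by (simp add: field_simps)
          finally show "norm (D (i + n) x h) \<le> 8 / R * norm h * T (i + n)" .
        next
          show "summable (\<lambda>i. 8 / R * norm h * T (i + n))"
            using smT by (intro summable_mult) (simp add: summable_iff_shift)
        qed
        also have "\<dots> = 8 / R * norm h * (\<Sum>i. T (i + n))"
          using smT by (intro suminf_mult) (simp add: summable_iff_shift)
        also have "\<dots> \<le> 8 / R * norm h * (e * R / 8)"
          using elim R by (intro mult_left_mono) auto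
        also have "\<dots> = e * norm h" using R by simp
        finally show "norm ((\<Sum>i<n. D i x h) - (A x * fst h + B x * snd h)) \<le> e * norm h" .
      qed
    qed
  qed
  then obtain k where k: "\<And>x. x \<in> S \<Longrightarrow> (\<lambda>n. f n (fst x) * g n (snd x)) sums (k x)"
    "\<And>x. x \<in> S \<Longrightarrow> (k has_derivative (\<lambda>h. A x * fst h + B x * snd h)) (at x within S)" by blast
  have opS: "open S" unfolding S_def by (intro open_Times open_ball)
  show ?thesis unfolding S_def[symmetric]
  proof (rule holomorphic2_onI)
    fix z assume z: "z \<in> S"
    have "(k has_derivative (\<lambda>h. A z * fst h + B z * snd h)) (at z)"
      using k(2)[OF z] at_within_open[OF z opS] by simp
    thus "((\<lambda>z. \<Sum>n. f n (fst z) * g n (snd z)) has_derivative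
            (\<lambda>h. A z * fst h + B z * snd h)) (at z)"
      by (rule has_derivative_transform_within_open[OF _ opS z]) (rule sums_unique[OF k(1)])
  qed
qed

text \<open>The interior of the zero set is also closed in \<open>U\<close>: if a ball inside
  \<open>U\<close> meets it at \<open>q\<close>, any point \<open>x\<close> of the ball lies on a
  complex line through \<open>q\<close>, and on the convex trace of the ball on that line the
  one-variable identity theorem applies.\<close>

lemma holomorphic2_identity:
  assumes U: "open U" "connected U" and f: "holomorphic2_on f U"
    and V: "open V" "V \<noteq> {}" "V \<subseteq> U" "\<And>z. z \<in> V \<Longrightarrow> f z = 0" and z: "z \<in> U"
  shows "f z = 0"
proof -
  define S where "S = interior {z\<in>U. f z = 0}"
  have SU: "S \<subseteq> U" unfolding S_def using interior_subset by blast
  have S0: "f q = 0" if "q \<in> S" for q using that interior_subset unfolding S_def by blast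
  have opS: "open S" by (simp add: S_def)
  have "open (U - S)"
    unfolding open_contains_ball
  proof
    fix p assume p: "p \<in> U - S"
    then obtain e where e: "e > 0" "ball p e \<subseteq> U" using U(1) open_contains_ball by blast
    have "ball p e \<inter> S = {}"
    proof (rule ccontr)
      assume "ball p e \<inter> S \<noteq> {}"
      then obtain q where q: "q \<in> ball p e" "q \<in> S" by blast
      have zero: "f x = 0" if x: "x \<in> ball p e" for x
      proof -
        let ?d = "x - q"
        let ?l = "\<lambda>w. (fst q + w * fst ?d, snd q + w * snd ?d)"
        have cont: "continuous_on UNIV ?l" by (intro continuous_intros)
        \<comment> \<open>The parametrisation is affine rather than linear, so it respects only
          combinations whose weights add up to 1. These are what convexity, and hence connectedness,
          of the preimage of the ball is about.\<close>
        have l: "?l (u *\<^sub>R a + v *\<^sub>R b) = u *\<^sub>R ?l a + v *\<^sub>R ?l b" if "u + v = 1" for u v :: real and a b :: complex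
        proof -
          have "of_real u + of_real v = (1::complex)" using that by (metis of_real_1 of_real_add)
          hence e: "(of_real u + of_real v) * c = c" for c :: complex by simp
          have "fst (?l (u *\<^sub>R a + v *\<^sub>R b)) = fst (u *\<^sub>R ?l a + v *\<^sub>R ?l b)"
            using e[of "fst q"] by (simp add: scaleR_conv_of_real algebra_simps)
          moreover have "snd (?l (u *\<^sub>R a + v *\<^sub>R b)) = snd (u *\<^sub>R ?l a + v *\<^sub>R ?l b)"
            using e[of "snd q"] by (simp add: scaleR_conv_of_real algebra_simps)
          ultimately show ?thesis by (simp only: prod_eq_iff simp_thms)
        qed
        have conv: "convex (?l -` ball p e)"
        proof (rule convexI)
          fix a b u v assume *: "a \<in> ?l -` ball p e" "b \<in> ?l -` ball p e" "(u::real) \<ge> 0" "(v::real) \<ge> 0" "u + v = 1"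
          have "u *\<^sub>R ?l a + v *\<^sub>R ?l b \<in> ball p e"
            by (rule convexD[OF convex_ball]) (use * in auto)
          thus "u *\<^sub>R a + v *\<^sub>R b \<in> ?l -` ball p e" using l[OF *(5)] by (simp only: vimage_eq)
        qed
        have op: "open (?l -` T)" if "open T" for T
          by (rule open_vimage[OF that cont])
        have hol: "(\<lambda>w. f (?l w)) holomorphic_on ?l -` ball p e"
          using holomorphic2_on_line[OF holomorphic2_on_subset[OF f e(2)], of q ?d]
          by (simp add: vimage_def)
        have "f (?l 1) = 0"
        proof (rule analytic_continuation_open[where s = "?l -` (ball p e \<inter> S)" and s' = "?l -` ball p e"
              and f = "\<lambda>w. f (?l w)" and g = "\<lambda>_. 0"])
          show "open (?l -` (ball p e \<inter> S))" by (intro op open_Int opS open_ball)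
          show "?l -` (ball p e \<inter> S) \<noteq> {}" using q by (intro ex_in_conv[THEN iffD1] exI[of _ 0]) simp
          show "1 \<in> ?l -` ball p e" using x by simp
          show "f (?l w) = 0" if "w \<in> ?l -` (ball p e \<inter> S)" for w using that S0 by simp
          show "open (?l -` ball p e)" by (rule op[OF open_ball])
          show "connected (?l -` ball p e)" using conv by (rule convex_connected)
        qed (use hol in auto)
        thus ?thesis by simp
      qed
      have "ball p e \<subseteq> {z\<in>U. f z = 0}" using zero e by blast
      hence "p \<in> S" unfolding S_def using e(1) by (meson centre_in_ball interiorI open_ball)
      thus False using p by simp
    qed
    thus "\<exists>e>0. ball p e \<subseteq> U - S" using e by blast
  qed
  moreover have "V \<subseteq> S" unfolding S_def using V by (intro interior_maximal) auto
  ultimately have "S = U"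
    using U(2) opS SU V(2) unfolding connected_def by blast
  thus ?thesis using z S0 by blast
qed

lemma holomorphic2_nonzero_dense:
  assumes U: "open U" "connected U" and f: "holomorphic2_on f U" "\<exists>z\<in>U. f z \<noteq> 0"
    and V: "open V" "V \<noteq> {}" "V \<subseteq> U"
  obtains z where "z \<in> V" "f z \<noteq> 0"
  using holomorphic2_identity[OF U f(1) V] f(2) by blast

lemma open_nonzero:
  assumes "holomorphic2_on f U" "open V" "V \<subseteq> U"
  shows "open {z\<in>V. f z \<noteq> 0}"
proof -
  have "continuous_on V f"
    using assms holomorphic2_on_imp_continuous_on continuous_on_subset by blast
  hence "open (V \<inter> f -` (-{0}))"
    using assms(2) by (rule continuous_open_preimage) (intro open_Compl closed_singleton)
  moreover have "V \<inter> f -` (-{0}) = {z\<in>V. f z \<noteq> 0}" by auto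
  ultimately show ?thesis by simp
qed

section \<open>Uniqueness of meromorphic continuation and invariance of regularity\<close>

definition generically_equal_at ::
  "(complex \<times> complex \<Rightarrow> complex) \<Rightarrow> (complex \<times> complex \<Rightarrow> complex) \<Rightarrow> complex \<times> complex \<Rightarrow> bool" where
  "generically_equal_at F F' p \<longleftrightarrow>
     (\<exists>U h. open U \<and> connected U \<and> p \<in> U \<and> holomorphic2_on h U \<and> (\<exists>z\<in>U. h z \<noteq> 0) \<and>
            (\<forall>z\<in>U. h z \<noteq> 0 \<longrightarrow> F z = F' z))"

text \<open>The set of points near which the two functions agree generically is open and closed. For
  closedness, write them as g/h and g'/h' on a common ball: agreement on an open part of it makes
  \<open>g * h' - g' * h\<close> vanish there, hence on the whole ball by the identity
  theorem.\<close>

lemma meromorphic_continuation2_unique: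
  assumes F: "meromorphic2 F" and F': "meromorphic2 F'"
    and D: "open D" "D \<noteq> {}" "\<And>z. z \<in> D \<Longrightarrow> F z = F' z"
  shows "generically_equal_at F F' p"
proof -
  define S where "S = {p. generically_equal_at F F' p}"
  have "open S"
    unfolding open_subopen[of S]
  proof
    fix p assume "p \<in> S"
    then obtain U h where "open U" "connected U" "p \<in> U" "holomorphic2_on h U" "\<exists>z\<in>U. h z \<noteq> 0"
      "\<forall>z\<in>U. h z \<noteq> 0 \<longrightarrow> F z = F' z" unfolding S_def generically_equal_at_def by auto
    thus "\<exists>T. open T \<and> p \<in> T \<and> T \<subseteq> S"
      unfolding S_def generically_equal_at_def by (intro exI[of _ U]) blast
  qed
  moreover have "open (- S)"
    unfolding open_subopen[of "- S"]
  proof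
    fix p assume p: "p \<in> - S"
    obtain U g h where U: "open U" "connected U" "p \<in> U" "holomorphic2_on g U" "holomorphic2_on h U"
      "\<exists>z\<in>U. h z \<noteq> 0" "\<forall>z\<in>U. h z \<noteq> 0 \<longrightarrow> F z = g z / h z"
      using F unfolding meromorphic2_def by blast
    obtain U' g' h' where U': "open U'" "connected U'" "p \<in> U'" "holomorphic2_on g' U'" "holomorphic2_on h' U'"
      "\<exists>z\<in>U'. h' z \<noteq> 0" "\<forall>z\<in>U'. h' z \<noteq> 0 \<longrightarrow> F' z = g' z / h' z"
      using F' unfolding meromorphic2_def by blast
    obtain e where e: "e > 0" "ball p e \<subseteq> U \<inter> U'"
      using U(1,3) U'(1,3) open_contains_ball[of "U \<inter> U'"] by (meson IntI open_Int)
    define B where "B = ball p e"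
    have B: "open B" "connected B" "p \<in> B" "B \<subseteq> U" "B \<subseteq> U'"
      using e by (auto simp: B_def)
    have holk: "holomorphic2_on (\<lambda>z. g z * h' z - g' z * h z) B"
      by (intro holomorphic2_on_diff holomorphic2_on_mult)
         (use U(4,5) U'(4,5) B holomorphic2_on_subset in blast)+
    have holhh: "holomorphic2_on (\<lambda>z. h z * h' z) B"
      by (intro holomorphic2_on_mult) (use U(4,5) U'(4,5) B holomorphic2_on_subset in blast)+
    have nz: "\<exists>z\<in>V. h z * h' z \<noteq> 0" if V: "open V" "V \<noteq> {}" "V \<subseteq> B" for V
    proof -
      obtain x where x: "x \<in> V" "h x \<noteq> 0"
        using holomorphic2_nonzero_dense[OF U(1,2,5,6) V(1,2)] V B by blast
      have "open {z\<in>V. h z \<noteq> 0}" using open_nonzero[OF U(5) V(1)] V B by blast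
      then obtain y where "y \<in> {z\<in>V. h z \<noteq> 0}" "h' y \<noteq> 0"
        using holomorphic2_nonzero_dense[OF U'(1,2,5,6), of "{z\<in>V. h z \<noteq> 0}"] x V B by blast
      thus ?thesis by auto
    qed
    have "B \<inter> S = {}"
    proof (rule ccontr)
      assume "B \<inter> S \<noteq> {}"
      then obtain q where q: "q \<in> B" "generically_equal_at F F' q" by (auto simp: S_def)
      then obtain W k where W: "open W" "connected W" "q \<in> W" "holomorphic2_on k W" "\<exists>z\<in>W. k z \<noteq> 0"
         "\<forall>z\<in>W. k z \<noteq> 0 \<longrightarrow> F z = F' z" unfolding generically_equal_at_def by blast
      \<comment> \<open>Zero sets of the nonzero functions \<open>k\<close>, \<open>h\<close> and
        \<open>h'\<close> have dense complement, so removing all three leaves a nonempty open set on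
        which both quotients are genuine and equal.\<close>
      define V where "V = {z\<in>{z\<in>B \<inter> W. k z \<noteq> 0}. h z * h' z \<noteq> 0}"
      have 1: "open {z\<in>B \<inter> W. k z \<noteq> 0}"
        by (rule open_nonzero[OF W(4)]) (use B W in auto)
      obtain x where "x \<in> B \<inter> W" "k x \<noteq> 0"
        using holomorphic2_nonzero_dense[OF W(1,2,4,5), of "B \<inter> W"] q B W by blast
      hence 2: "{z\<in>B \<inter> W. k z \<noteq> 0} \<noteq> {}" by blast
      have 3: "open V" unfolding V_def
        by (rule open_nonzero[OF holhh 1]) auto
      have 4: "V \<noteq> {}" using nz[OF 1 2] unfolding V_def by blast
      have "g z * h' z - g' z * h z = 0" if "z \<in> V" for z
      proof -
        have "F z = g z / h z" "F' z = g' z / h' z" "F z = F' z" "h z \<noteq> 0" "h' z \<noteq> 0"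
          using that U(7) U'(7) W(6) B unfolding V_def by auto
        thus ?thesis by (simp add: field_simps)
      qed
      hence 5: "g z * h' z - g' z * h z = 0" if "z \<in> B" for z
        using holomorphic2_identity[OF B(1,2) holk 3 4 _ _ that] V_def by blast
      have "F z = F' z" if z: "z \<in> B" "h z * h' z \<noteq> 0" for z
      proof -
        have "F z = g z / h z" "F' z = g' z / h' z" using U(7) U'(7) z B by auto
        moreover have "g z / h z = g' z / h' z" using 5[OF z(1)] z(2) by (simp add: frac_eq_eq)
        ultimately show ?thesis by simp
      qed
      moreover have "\<exists>z\<in>B. h z * h' z \<noteq> 0" using nz[OF B(1)] B by blast
      ultimately have "generically_equal_at F F' p"
        unfolding generically_equal_at_def using B(1-3) holhh by blast
      thus False using p by (simp add: S_def)
    qed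
    thus "\<exists>T. open T \<and> p \<in> T \<and> T \<subseteq> - S" using B by blast
  qed
  moreover have "S \<noteq> {}"
  proof -
    obtain q where q: "q \<in> D" using D by blast
    then obtain e where e: "e > 0" "ball q e \<subseteq> D" using D(1) open_contains_ball by blast
    have "q \<in> ball q e" using e by simp
    moreover have "\<forall>z\<in>ball q e. F z = F' z" using e D(3) by blast
    ultimately have "generically_equal_at F F' q"
      unfolding generically_equal_at_def
      by (intro exI[of _ "ball q e"] exI[of _ "\<lambda>_. 1"] conjI bexI[of _ q])
         (auto intro: holomorphic2_on_const)
    thus ?thesis unfolding S_def by blast
  qed
  ultimately have "S = UNIV"
    using connected_UNIV[where 'a = "complex \<times> complex"] unfolding connected_def by blast
  thus ?thesis by (auto simp: S_def)
qed

text \<open>The product of the two exceptional functions serves as a common one; it is not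
  identically zero because zero sets have dense complement. Hence \<open>singularities2\<close> does
  not depend on which continuation is selected.\<close>

lemma regular2_at_cong:
  assumes eq: "generically_equal_at F F' p" and reg: "regular2_at F p"
  shows "regular2_at F' p"
proof -
  obtain U h where U: "open U" "connected U" "p \<in> U" "holomorphic2_on h U" "\<exists>z\<in>U. h z \<noteq> 0"
      "\<forall>z\<in>U. h z \<noteq> 0 \<longrightarrow> F z = F' z" using eq unfolding generically_equal_at_def by auto
  obtain U' G h' where U': "open U'" "connected U'" "p \<in> U'" "holomorphic2_on G U'" "holomorphic2_on h' U'"
      "\<exists>z\<in>U'. h' z \<noteq> 0" "\<forall>z\<in>U'. h' z \<noteq> 0 \<longrightarrow> F z = G z" using reg unfolding regular2_at_def by auto
  obtain e where e: "e > 0" "ball p e \<subseteq> U \<inter> U'"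
    using U(1,3) U'(1,3) open_contains_ball[of "U \<inter> U'"] by (meson IntI open_Int)
  define B where "B = ball p e"
  have B: "open B" "connected B" "p \<in> B" "B \<subseteq> U" "B \<subseteq> U'"
    using e by (auto simp: B_def)
  have 1: "open {z\<in>B. h z \<noteq> 0}" using open_nonzero[OF U(4) B(1,4)] .
  obtain x where "x \<in> B" "h x \<noteq> 0"
    using holomorphic2_nonzero_dense[OF U(1,2,4,5) B(1) _ B(4)] B(3) by blast
  then obtain y where y: "y \<in> {z\<in>B. h z \<noteq> 0}" "h' y \<noteq> 0"
    using holomorphic2_nonzero_dense[OF U'(1,2,5,6) 1] B(5) by blast
  show ?thesis unfolding regular2_at_def
  proof (rule exI[of _ B], rule exI[of _ G], rule exI[of _ "\<lambda>z. h z * h' z"], intro conjI)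
    show "holomorphic2_on (\<lambda>z. h z * h' z) B"
      by (intro holomorphic2_on_mult) (use U(4) U'(5) B holomorphic2_on_subset in blast)+
    show "holomorphic2_on G B" using U'(4) B holomorphic2_on_subset by blast
    show "\<exists>z\<in>B. h z * h' z \<noteq> 0" using y by auto
    show "\<forall>z\<in>B. h z * h' z \<noteq> 0 \<longrightarrow> F' z = G z" using U(6) U'(7) B by force
  qed (use B in auto)
qed

lemma generically_equal_at_sym: "generically_equal_at F F' p \<Longrightarrow> generically_equal_at F' F p"
  unfolding generically_equal_at_def by metis

text \<open>The zero set of \<open>h\<close> has dense complement, so continuity of \<open>F\<close>
  carries the equality over to the points where \<open>h\<close> vanishes.\<close>

lemma regular2_at_imp_eq_on:
  assumes U: "open U" "connected U" "holomorphic2_on G U" "holomorphic2_on h U" "\<exists>z\<in>U. h z \<noteq> 0"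
    and F: "\<And>z. z \<in> U \<Longrightarrow> h z \<noteq> 0 \<Longrightarrow> F z = G z"
    and z: "z \<in> U" "continuous_on W F" "open W" "z \<in> W"
  shows "F z = G z"
proof (rule ccontr)
  assume "F z \<noteq> G z"
  define V where "V = {z\<in>U \<inter> W. F z - G z \<noteq> 0}"
  have "continuous_on (U \<inter> W) (\<lambda>z. F z - G z)"
    using z(2) holomorphic2_on_imp_continuous_on[OF U(3)]
    by (intro continuous_on_diff) (auto elim: continuous_on_subset)
  hence "open ((\<lambda>z. F z - G z) -` (-{0}) \<inter> (U \<inter> W))"
    using continuous_open_preimage[of "U \<inter> W" "\<lambda>z. F z - G z" "-{0}"] U(1) z(3)
    by (auto simp: Int_commute)
  moreover have "(\<lambda>z. F z - G z) -` (-{0}) \<inter> (U \<inter> W) = V" unfolding V_def by blast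
  ultimately have "open V" by simp
  moreover have "z \<in> V" "V \<subseteq> U" using z \<open>F z \<noteq> G z\<close> by (auto simp: V_def)
  ultimately obtain y where "y \<in> V" "h y \<noteq> 0"
    using holomorphic2_nonzero_dense[OF U(1,2,4,5), of V] by blast
  thus False using F[of y] unfolding V_def by simp
qed

section \<open>Expansion of the exponentially weighted zeta series\<close>

text \<open>Difference quotients are dominated by \<open>2 / r * g\<close>, thanks to Cauchy's
  inequality on discs of radius just below \<open>r/2\<close>, so dominated convergence yields
  complex differentiability.\<close>

lemma holomorphic_on_lebesgue_integral:
  fixes f :: "complex \<Rightarrow> 'a \<Rightarrow> complex"
  assumes S: "open S"
    and meas: "\<And>s. s \<in> S \<Longrightarrow> f s \<in> borel_measurable M"
    and hol: "\<And>t. t \<in> space M \<Longrightarrow> (\<lambda>s. f s t) holomorphic_on S"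
    and g: "integrable M g"
    and bound: "\<And>s t. s \<in> S \<Longrightarrow> t \<in> space M \<Longrightarrow> norm (f s t) \<le> g t"
  shows "(\<lambda>s. \<integral>t. f s t \<partial>M) holomorphic_on S"
  unfolding holomorphic_on_open[OF S]
proof
  fix z assume z: "z \<in> S"
  then obtain r where r: "r > 0" "ball z r \<subseteq> S" using S open_contains_ball by blast
  define D where "D = (\<lambda>t. deriv (\<lambda>s. f s t) z)"
  have int: "integrable M (f s)" if "s \<in> S" for s
    by (rule Bochner_Integration.integrable_bound[OF g meas[OF that]])
       (use bound[OF that] in \<open>auto intro!: AE_I2 order_trans[OF _ abs_ge_self]\<close>)
  have quot_bound: "norm ((f w t - f z t) / (w - z)) \<le> 2 / r * g t"
    if w: "w \<in> ball z (r/2)" and t: "t \<in> space M" for w t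
  proof -
    have sub: "ball z (r/2) \<subseteq> S" using r by (auto simp: subset_iff)
    have "norm (f w t - f z t) \<le> (2 / r * g t) * norm (w - z)"
    proof (rule field_differentiable_bound[where S = "ball z (r/2)" and f' = "deriv (\<lambda>s. f s t)"])
      show "((\<lambda>s. f s t) has_field_derivative deriv (\<lambda>s. f s t) u) (at u within ball z (r/2))"
        if "u \<in> ball z (r/2)" for u
        using holomorphic_derivI[OF hol[OF t] S] that sub by (meson has_field_derivative_at_within subsetD)
      show "norm (deriv (\<lambda>s. f s t) u) \<le> 2 / r * g t" if u: "u \<in> ball z (r/2)" for u
      proof -
        have sub2: "ball u (r/2) \<subseteq> S"
        proof
          fix x assume "x \<in> ball u (r/2)"
          hence "dist z x < r" using u dist_triangle[of z x u] by auto
          thus "x \<in> S" using r by auto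
        qed
        show ?thesis
        proof (rule field_le_epsilon)
          fix e :: real assume e: "e > 0"
          have gt: "g t \<ge> 0" using bound[OF z t] norm_ge_zero order_trans by blast
          \<comment> \<open>Cauchy's inequality asks for a closed disc inside \<open>S\<close>,
            which radius \<open>r/2\<close> need not provide. The radius \<open>q\<close> solves
            \<open>g t / q = 2 / r * g t + e\<close> and is therefore slightly smaller; it
            degenerates if \<open>g t = 0\<close>, whence the case distinction.\<close>
          define q where "q = g t / (2 / r * g t + e)"
          have qpos: "2 / r * g t + e > 0" using gt e r(1) by (simp add: add_nonneg_pos)
          show "norm (deriv (\<lambda>s. f s t) u) \<le> 2 / r * g t + e"
          proof (cases "g t = 0")
            case True
            have "deriv (\<lambda>s. f s t) u = deriv (\<lambda>s. 0) u"
              by (rule complex_derivative_transform_within_open[OF hol[OF t] holomorphic_on_const S])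
                 (use u sub bound[OF _ t] True in auto)
            thus ?thesis using e True by simp
          next
            case False
            have q: "q > 0" "q < r/2" using False gt qpos e r(1)
              by (auto simp: q_def field_simps)
            have "norm ((deriv ^^ 1) (\<lambda>s. f s t) u) \<le> fact 1 * g t / q ^ 1"
            proof (rule Cauchy_inequality)
              have cb: "cball u q \<subseteq> S" using sub2 q by (auto simp: subset_iff)
              show "(\<lambda>s. f s t) holomorphic_on ball u q"
                using hol[OF t] cb ball_subset_cball holomorphic_on_subset by blast
              show "continuous_on (cball u q) (\<lambda>s. f s t)"
                using hol[OF t] cb holomorphic_on_imp_continuous_on continuous_on_subset by blast
              show "norm (f x t) \<le> g t" if "norm (u - x) = q" for x
                using that cb t by (intro bound) (auto simp: dist_norm subset_iff)
            qed (use q in auto)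
            also have "\<dots> = 2 / r * g t + e" using False by (simp add: q_def)
            finally show ?thesis by simp
          qed
        qed
      qed
    qed (use w r in auto)
    moreover have "g t \<ge> 0" using bound[OF z t] norm_ge_zero order_trans by blast
    ultimately show ?thesis using r(1) by (cases "w = z") (auto simp: norm_divide divide_simps)
  qed
  have "((\<lambda>s. \<integral>t. f s t \<partial>M) has_field_derivative (\<integral>t. D t \<partial>M)) (at z within ball z (r/2))"
    unfolding has_field_derivative_iff tendsto_at_iff_sequentially
  proof (intro allI impI)
    fix X :: "nat \<Rightarrow> complex"
    assume X: "\<forall>i. X i \<in> ball z (r/2) - {z}" "X \<longlonglongrightarrow> z"
    have XS: "X i \<in> S" for i
      using X(1)[rule_format, of i] r(1) by (intro subsetD[OF r(2)]) auto
    have lim: "(\<lambda>i. (f (X i) t - f z t) / (X i - z)) \<longlonglongrightarrow> D t" if t: "t \<in> space M" for t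
    proof -
      have "((\<lambda>s. f s t) has_field_derivative D t) (at z)"
        unfolding D_def by (rule holomorphic_derivI[OF hol[OF t] S z])
      hence "((\<lambda>w. (f w t - f z t) / (w - z)) \<longlongrightarrow> D t) (at z)" by (simp add: has_field_derivative_iff)
      thus ?thesis using X unfolding tendsto_at_iff_sequentially by (auto simp: o_def)
    qed
    have Dmeas: "D \<in> borel_measurable M"
      by (rule borel_measurable_LIMSEQ_metric[where f = "\<lambda>i t. (f (X i) t - f z t) / (X i - z)"])
         (use lim meas XS z in auto)
    have "(\<lambda>i. \<integral>t. (f (X i) t - f z t) / (X i - z) \<partial>M) \<longlonglongrightarrow> (\<integral>t. D t \<partial>M)"
    proof (rule integral_dominated_convergence[where w = "\<lambda>t. 2 / r * g t"])
      show "AE t in M. norm ((f (X i) t - f z t) / (X i - z)) \<le> 2 / r * g t" for i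
        using quot_bound X(1) by (intro AE_I2) blast
    qed (use Dmeas g lim meas XS z in auto)
    moreover have "(\<integral>t. (f (X i) t - f z t) / (X i - z) \<partial>M) =
        ((\<integral>t. f (X i) t \<partial>M) - (\<integral>t. f z t \<partial>M)) / (X i - z)" for i
      using int[OF XS] int[OF z] by (simp only: integral_divide_zero Bochner_Integration.integral_diff)
    ultimately show "((\<lambda>y. ((\<integral>t. f y t \<partial>M) - (\<integral>t. f z t \<partial>M)) / (y - z)) \<circ> X) \<longlonglongrightarrow> (\<integral>t. D t \<partial>M)"
      unfolding o_def by (simp only:)
  qed
  moreover have "at z within ball z (r/2) = at z"
    by (rule at_within_open) (use r in auto)
  ultimately show "\<exists>f'. ((\<lambda>s. \<integral>t. f s t \<partial>M) has_field_derivative f') (at z)" by auto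
qed

section \<open>Mellin integrals of exponentials and their truncation\<close>

definition mellin_exp :: "complex \<Rightarrow> real \<Rightarrow> real \<Rightarrow> complex" where
  "mellin_exp s x t = of_real t powr (s - 1) * of_real (exp (- (x * t)))"

lemma mellin_exp_measurable [measurable]: "mellin_exp s x \<in> borel_measurable borel"
  unfolding mellin_exp_def by measurable

lemma norm_mellin_exp: "t > 0 \<Longrightarrow> norm (mellin_exp s x t) = t powr (Re s - 1) * exp (- (x * t))"
  by (simp add: mellin_exp_def norm_mult norm_powr_real_powr)

lemma mellin_exp_integrable:
  assumes "Re s > 0" "x > 0"
  shows "set_integrable lborel {0<..} (mellin_exp s x)"
proof -
  have "(\<lambda>t. complex_of_real t powr (s - 1) / of_real (exp (x * t))) absolutely_integrable_on {0<..}"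
    by (rule absolutely_integrable_Gamma_integral) fact+
  also have "(\<lambda>t. complex_of_real t powr (s - 1) / of_real (exp (x * t))) = mellin_exp s x"
    by (simp add: mellin_exp_def fun_eq_iff exp_minus field_simps)
  finally show ?thesis
    unfolding set_integrable_def by (subst (asm) integrable_completion) auto
qed

text \<open>For \<open>x = 1\<close> this is Euler's integral; the substitution of
  \<open>x * t\<close> for \<open>t\<close> gives the rest.\<close>

lemma mellin_exp_integral:
  assumes s: "Re s > 0" and x: "x > 0"
  shows "(LINT t:{0<..}|lborel. mellin_exp s x t) = Gamma s * of_real x powr (- s)"
proof -
  have "((\<lambda>t. of_real t powr (s - 1) / of_real (exp t)) has_integral Gamma s) {0<..}"
    by (rule Gamma_integral_complex'[OF s])
  also have "(\<lambda>t. complex_of_real t powr (s - 1) / of_real (exp t)) = mellin_exp s 1"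
    by (simp add: mellin_exp_def fun_eq_iff exp_minus field_simps)
  finally have "integral {0<..} (mellin_exp s 1) = Gamma s" by (simp add: integral_unique)
  hence 1: "(LINT t:{0<..}|lborel. mellin_exp s 1 t) = Gamma s"
    using set_borel_integral_eq_integral(2)[OF mellin_exp_integrable[OF s, of 1]] by simp
  have "Gamma s = \<bar>x\<bar> *\<^sub>R (\<integral>t. indicator {0<..} (0 + x * t) *\<^sub>R mellin_exp s 1 (0 + x * t) \<partial>lborel)"
    unfolding 1[symmetric] set_lebesgue_integral_def
    by (rule lborel_integral_real_affine) (use x in auto)
  also have "(\<lambda>t. indicator {0<..} (0 + x * t) *\<^sub>R mellin_exp s 1 (0 + x * t)) =
      (\<lambda>t. of_real x powr (s - 1) * (indicator {0<..} t *\<^sub>R mellin_exp s x t))"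
    using x by (auto simp: fun_eq_iff mellin_exp_def indicator_def zero_less_mult_iff powr_times_real)
  also have "(\<integral>t. \<dots> t \<partial>lborel) = of_real x powr (s - 1) * (LINT t:{0<..}|lborel. mellin_exp s x t)"
    unfolding set_lebesgue_integral_def by (rule integral_mult_right_zero)
  finally have "Gamma s = of_real x powr s * (LINT t:{0<..}|lborel. mellin_exp s x t)"
    using x by (simp add: powr_diff scaleR_conv_of_real)
  thus ?thesis using x by (simp add: powr_minus field_simps)
qed

lemma mellin_exp_integral_real:
  fixes s x :: real
  assumes s: "s > 0" and x: "x > 0"
  shows "set_integrable lborel {0<..} (\<lambda>t. t powr (s - 1) * exp (- (x * t)))"
    and "(LINT t:{0<..}|lborel. t powr (s - 1) * exp (- (x * t))) = Gamma s * x powr (- s)"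
proof -
  have eq: "mellin_exp (of_real s) x t = of_real (t powr (s - 1) * exp (- (x * t)))" if "t \<in> {0<..}" for t
    using that powr_of_real[of t "s - 1"] by (simp add: mellin_exp_def)
  have "set_integrable lborel {0<..} (\<lambda>t. norm (mellin_exp (of_real s) x t))"
    by (rule set_integrable_norm[OF mellin_exp_integrable]) (use assms in auto)
  thus "set_integrable lborel {0<..} (\<lambda>t. t powr (s - 1) * exp (- (x * t)))"
    by (rule set_integrable_cong[THEN iffD1, rotated 3]) (auto simp: norm_mellin_exp)
  have "complex_of_real (LINT t:{0<..}|lborel. t powr (s - 1) * exp (- (x * t))) =
      (LINT t:{0<..}|lborel. mellin_exp (of_real s) x t)"
    unfolding set_integral_complex_of_real[symmetric]
    by (rule set_lebesgue_integral_cong) (use eq in auto)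
  also have "\<dots> = Gamma (of_real s) * of_real x powr (- of_real s)"
    by (rule mellin_exp_integral) (use assms in auto)
  also have "\<dots> = of_real (Gamma s * x powr (- s))"
    using assms by (simp add: Gamma_complex_of_real powr_of_real[symmetric])
  finally show "(LINT t:{0<..}|lborel. t powr (s - 1) * exp (- (x * t))) = Gamma s * x powr (- s)"
    by (simp only: of_real_eq_iff)
qed

text \<open>Up to the factor \<open>x powr - s\<close> this is the upper incomplete Gamma function
  at \<open>a * x\<close>. As the integral stays away from 0, it is entire in \<open>s\<close> and
  decays exponentially in \<open>x\<close>, so sums with polynomially bounded weights against it are
  harmless.\<close>

definition inc_Gamma :: "real \<Rightarrow> complex \<Rightarrow> real \<Rightarrow> complex" where
  "inc_Gamma a s x = (LINT t:{a..}|lborel. mellin_exp s x t)"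

context
  fixes a :: real
  assumes a: "0 < a" "a \<le> 1"
begin

text \<open>For \<open>t \<ge> a\<close> and \<open>a \<le> 1\<close> the quotient
  \<open>t / a\<^sup>2\<close> dominates 1, \<open>t\<close> and \<open>1 / t\<close>, so one power
  of it covers exponents \<open>Re s - 1\<close> of either sign. Since \<open>x \<ge> 1\<close>, the
  decay in \<open>x\<close> can be split off as \<open>exp (a - a * x)\<close>, leaving the
  integrable \<open>exp (- t)\<close>.\<close>

lemma mellin_exp_tail_bound:
  assumes "\<bar>Re s - 1\<bar> \<le> real N" "x \<ge> 1" "t \<ge> a"
  shows "norm (mellin_exp s x t) \<le>
    exp (a - a * x) * ((1 / a ^ 2) ^ N * (t powr (real N + 1 - 1) * exp (- (1 * t))))"
proof -
  have t: "t > 0" using assms a by simp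
  have ta: "t / a\<^sup>2 \<ge> t" using a t by (simp add: field_simps power_le_one)
  have ta1: "t * (t / a\<^sup>2) \<ge> 1"
  proof -
    have "t\<^sup>2 \<ge> a\<^sup>2" using assms a by (intro power_mono) auto
    thus ?thesis using a by (simp add: field_simps power2_eq_square)
  qed
  have ta2: "t / a\<^sup>2 \<ge> 1"
  proof -
    have "a ^ 2 \<le> a" using a by (simp add: power2_eq_square mult_left_le)
    thus ?thesis using assms(3) a by (simp add: field_simps)
  qed
  have "t powr (Re s - 1) \<le> (t / a\<^sup>2) powr real N"
  proof (cases "t \<ge> 1")
    case True
    have "t powr (Re s - 1) \<le> t powr real N" using assms True by (intro powr_mono) auto
    also have "\<dots> \<le> (t / a\<^sup>2) powr real N" using ta t by (intro powr_mono2) auto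
    finally show ?thesis .
  next
    case False
    have "t powr (Re s - 1) \<le> t powr (- real N)" using assms False t by (intro powr_mono') auto
    also have "\<dots> = (1 / t) powr real N" using t by (simp add: powr_minus powr_divide field_simps)
    also have "\<dots> \<le> (t / a\<^sup>2) powr real N"
      using ta1 t by (intro powr_mono2) (auto simp: field_simps)
    finally show ?thesis .
  qed
  also have "\<dots> = (1 / a\<^sup>2) ^ N * t powr real N"
    using t a by (simp add: powr_realpow power_divide field_simps)
  finally have 1: "t powr (Re s - 1) \<le> (1 / a\<^sup>2) ^ N * t powr real N" .
  have "(x - 1) * a \<le> (x - 1) * t" using assms by (intro mult_left_mono) auto
  hence "exp (- (x * t)) \<le> exp (a - a * x + (- t))" by (simp add: algebra_simps)
  hence 2: "exp (- (x * t)) \<le> exp (a - a * x) * exp (- t)" by (subst (asm) exp_add)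
  have "norm (mellin_exp s x t) = t powr (Re s - 1) * exp (- (x * t))" by (rule norm_mellin_exp[OF t])
  also have "\<dots> \<le> ((1 / a\<^sup>2) ^ N * t powr real N) * (exp (a - a * x) * exp (- t))"
    by (intro mult_mono 1 2) (use a t in auto)
  finally show ?thesis by (simp add: mult_ac)
qed

lemma tail_majorant_integrable:
  "set_integrable lborel {a..} (\<lambda>t. C * ((1 / a ^ 2) ^ N * (t powr (real N + 1 - 1) * exp (- (1 * t)))))"
  by (intro set_integrable_mult_right set_integrable_subset[OF mellin_exp_integral_real(1)])
     (use a in auto)

lemma mellin_exp_tail_integrable:
  assumes "x \<ge> 1"
  shows "set_integrable lborel {a..} (mellin_exp s x)"
proof -
  obtain N where N: "\<bar>Re s - 1\<bar> \<le> real N" using real_arch_simple by blast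
  show ?thesis
    unfolding set_integrable_def
    by (rule Bochner_Integration.integrable_bound[OF
          tail_majorant_integrable[of "exp (a - a * x)" N, unfolded set_integrable_def]])
       (use mellin_exp_tail_bound[OF N assms] in
         \<open>auto simp: indicator_def intro!: AE_I2 order_trans[OF _ abs_ge_self]\<close>)
qed

lemma inc_Gamma_bound:
  "\<exists>C\<ge>0. \<forall>s x. \<bar>Re s - 1\<bar> \<le> real N \<longrightarrow> x \<ge> 1 \<longrightarrow> norm (inc_Gamma a s x) \<le> C * exp (- (a * x))"
proof -
  define D where "D = (LINT t:{a..}|lborel. (1 / a ^ 2) ^ N * (t powr (real N + 1 - 1) * exp (- (1 * t))))"
  have D: "D \<ge> 0" unfolding D_def set_lebesgue_integral_def by (intro Bochner_Integration.integral_nonneg) auto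
  have "norm (inc_Gamma a s x) \<le> exp a * D * exp (- (a * x))"
    if s: "\<bar>Re s - 1\<bar> \<le> real N" and x: "x \<ge> 1" for s x
  proof -
    have "norm (inc_Gamma a s x) \<le> (LINT t:{a..}|lborel. norm (mellin_exp s x t))"
      unfolding inc_Gamma_def by (rule set_integral_norm_bound[OF mellin_exp_tail_integrable[OF x]])
    also have "\<dots> \<le> (LINT t:{a..}|lborel. exp (a - a * x) * ((1 / a ^ 2) ^ N * (t powr (real N + 1 - 1) * exp (- (1 * t)))))"
      by (rule set_integral_mono[OF set_integrable_norm[OF mellin_exp_tail_integrable[OF x]] tail_majorant_integrable])
         (use mellin_exp_tail_bound[OF s x] in auto)
    also have "\<dots> = exp (a - a * x) * D" unfolding D_def by (rule set_integral_mult_right)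
    also have "\<dots> = exp a * D * exp (- (a * x))" by (simp add: exp_diff exp_minus field_simps)
    finally show ?thesis .
  qed
  thus ?thesis using D by (intro exI[of _ "exp a * D"]) auto
qed

lemma inc_Gamma_holomorphic:
  assumes "x \<ge> 1"
  shows "(\<lambda>s. inc_Gamma a s x) holomorphic_on A"
proof -
  have "(\<lambda>s. inc_Gamma a s x) holomorphic_on {s. \<bar>Re s - 1\<bar> < real N}" for N
    unfolding inc_Gamma_def set_lebesgue_integral_def
  proof (rule holomorphic_on_lebesgue_integral[OF _ _ _
        tail_majorant_integrable[of "exp (a - a * x)" N, unfolded set_integrable_def]])
    show "open {s. \<bar>Re s - 1\<bar> < real N}" by (intro open_Collect_less continuous_intros)
    show "(\<lambda>s. indicator {a..} t *\<^sub>R mellin_exp s x t) holomorphic_on {s. \<bar>Re s - 1\<bar> < real N}" for t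
      unfolding mellin_exp_def scaleR_conv_of_real using a
      by (cases "t \<in> {a..}") (auto intro!: holomorphic_intros)
  qed (use mellin_exp_tail_bound[of _ N] assms in \<open>auto simp: indicator_def\<close>)
  hence "(\<lambda>s. inc_Gamma a s x) holomorphic_on (\<Union>N. {s. \<bar>Re s - 1\<bar> < real N})"
    by (intro holomorphic_on_UN_open open_Collect_less continuous_intros) auto
  moreover have "(\<Union>N. {s. \<bar>Re s - 1\<bar> < real N}) = UNIV"
    using reals_Archimedean2 by auto
  ultimately show ?thesis using holomorphic_on_subset by fastforce
qed

end

lemma mellin_exp_head_integrable:
  assumes "Re s > 0" "x > 0"
  shows "set_integrable lborel {0<..<a} (mellin_exp s x)"
  by (rule set_integrable_subset[OF mellin_exp_integrable[OF assms]]) auto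

lemma mellin_exp_head:
  assumes s: "Re s > 0" and x: "x \<ge> 1" and a: "0 < a" "a \<le> 1"
  shows "(LINT t:{0<..<a}|lborel. mellin_exp s x t) = Gamma s * of_real x powr (- s) - inc_Gamma a s x"
proof -
  have "{0<..} = {0<..<a} \<union> {a..}" using a by auto
  moreover have "(LINT t:{0<..<a} \<union> {a..}|lborel. mellin_exp s x t) =
      (LINT t:{0<..<a}|lborel. mellin_exp s x t) + inc_Gamma a s x"
    unfolding inc_Gamma_def using s x
    by (intro set_integral_Un mellin_exp_head_integrable mellin_exp_tail_integrable[OF a x]) auto
  ultimately have "(LINT t:{0<..}|lborel. mellin_exp s x t) =
      (LINT t:{0<..<a}|lborel. mellin_exp s x t) + inc_Gamma a s x" by simp
  thus ?thesis using mellin_exp_integral[of s x] s x by simp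
qed

text \<open>Termwise integration over (0, a), justified by the absolute convergence of the full
  Mellin integrals. The frequencies \<open>x\<close> are general because the lemma is applied to the
  positive integers, with exponential and with von Mangoldt weights, and also to the sums m_1 +
  m_2.\<close>

lemma mellin_exp_sum:
  fixes c :: "nat \<Rightarrow> complex" and x :: "nat \<Rightarrow> real"
  assumes s: "Re s > 0" and x: "\<And>n. x n \<ge> 1" and a: "0 < a" "a \<le> 1"
    and c: "summable (\<lambda>n. norm (c n) * x n powr (- Re s))"
    and ct: "\<And>t. t > 0 \<Longrightarrow> summable (\<lambda>n. norm (c n) * exp (- (x n * t)))"
  shows "set_integrable lborel {0<..<a} (\<lambda>t. of_real t powr (s - 1) * (\<Sum>n. c n * of_real (exp (- (x n * t)))))"
    and "(\<lambda>n. c n * (Gamma s * of_real (x n) powr (- s) - inc_Gamma a s (x n))) sums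
         (LINT t:{0<..<a}|lborel. of_real t powr (s - 1) * (\<Sum>n. c n * of_real (exp (- (x n * t)))))"
proof -
  define f where "f = (\<lambda>n t. indicator {0<..<a} t *\<^sub>R (c n * mellin_exp s (x n) t))"
  have x0: "x n > 0" for n using x[of n] by linarith
  have int: "integrable lborel (f n)" for n
    unfolding f_def set_integrable_def[symmetric]
    by (intro set_integrable_mult_right mellin_exp_head_integrable s x0)
  have sums: "summable (\<lambda>n. norm (f n t))" for t
  proof (cases "t \<in> {0<..<a}")
    case True
    have "norm (f n t) = t powr (Re s - 1) * (norm (c n) * exp (- (x n * t)))" for n
      using True by (simp add: f_def norm_mult norm_mellin_exp)
    thus ?thesis using ct[of t] True by (simp add: summable_mult)
  qed (auto simp: f_def)
  have sum_int: "summable (\<lambda>n. \<integral>t. norm (f n t) \<partial>lborel)"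
  proof (rule summable_comparison_test'[OF summable_mult[OF c, of "Gamma (Re s)"]])
    fix n :: nat assume "n \<ge> 0"
    have "(\<integral>t. norm (f n t) \<partial>lborel) \<le>
        (\<integral>t. norm (c n) * (indicator {0<..} t *\<^sub>R (t powr (Re s - 1) * exp (- (x n * t)))) \<partial>lborel)"
    proof (rule integral_mono)
      show "integrable lborel (\<lambda>t. norm (c n) * (indicator {0<..} t *\<^sub>R (t powr (Re s - 1) * exp (- (x n * t)))))"
        using mellin_exp_integral_real(1)[OF s x0] unfolding set_integrable_def
        by (intro integrable_mult_right)
      show "integrable lborel (\<lambda>t. norm (f n t))" by (rule integrable_norm[OF int])
    qed (auto simp: f_def indicator_def norm_mult norm_mellin_exp)
    also have "\<dots> = norm (c n) * (Gamma (Re s) * x n powr (- Re s))"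
      using mellin_exp_integral_real(2)[OF s x0] by (simp add: set_lebesgue_integral_def)
    finally show "norm (\<integral>t. norm (f n t) \<partial>lborel) \<le> Gamma (Re s) * (norm (c n) * x n powr (- Re s))"
      by (simp add: mult_ac)
  qed
  have eq: "(\<Sum>n. f n t) =
      indicator {0<..<a} t *\<^sub>R (of_real t powr (s - 1) * (\<Sum>n. c n * of_real (exp (- (x n * t)))))" for t
  proof (cases "t \<in> {0<..<a}")
    case True
    have "summable (\<lambda>n. c n * of_real (exp (- (x n * t))))"
      by (rule summable_norm_cancel) (use ct[of t] True in \<open>simp add: norm_mult\<close>)
    thus ?thesis using True by (simp add: f_def mellin_exp_def suminf_mult[symmetric] mult_ac)
  qed (auto simp: f_def)
  show "set_integrable lborel {0<..<a} (\<lambda>t. of_real t powr (s - 1) * (\<Sum>n. c n * of_real (exp (- (x n * t)))))"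
    unfolding set_integrable_def eq[symmetric]
    by (rule integrable_suminf[OF int _ sum_int]) (use sums in auto)
  have "(\<lambda>n. integral\<^sup>L lborel (f n)) sums (\<integral>t. (\<Sum>n. f n t) \<partial>lborel)"
    by (rule sums_integral[OF int _ sum_int]) (use sums in auto)
  moreover have "integral\<^sup>L lborel (f n) = c n * (Gamma s * of_real (x n) powr (- s) - inc_Gamma a s (x n))" for n
    using mellin_exp_head[OF s x a, of n] unfolding set_lebesgue_integral_def f_def
    by (simp only: mult_scaleR_right[symmetric] integral_mult_right_zero)
  ultimately show "(\<lambda>n. c n * (Gamma s * of_real (x n) powr (- s) - inc_Gamma a s (x n))) sums
         (LINT t:{0<..<a}|lborel. of_real t powr (s - 1) * (\<Sum>n. c n * of_real (exp (- (x n * t)))))"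
    unfolding eq set_lebesgue_integral_def by simp
qed

section \<open>Interchange of summations and holomorphy of series\<close>

lemma sums_swap:
  fixes f :: "nat \<Rightarrow> nat \<Rightarrow> complex"
  assumes A: "\<And>m. summable (\<lambda>k. norm (f m k))" and B: "summable (\<lambda>m. \<Sum>k. norm (f m k))"
  shows "summable (\<lambda>m. norm (f m k))"
    and "(\<lambda>k. \<Sum>m. f m k) sums (\<Sum>m. \<Sum>k. f m k)"
    and "summable (\<lambda>k. norm (\<Sum>m. f m k))"
proof -
  show 1: "summable (\<lambda>m. norm (f m k))" for k
  proof (rule summable_comparison_test'[OF B])
    fix m :: nat
    have "norm (f m k) = sum (\<lambda>k. norm (f m k)) {k}" by simp
    also have "\<dots> \<le> (\<Sum>k. norm (f m k))" by (rule sum_le_suminf[OF A]) auto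
    finally show "norm (norm (f m k)) \<le> (\<Sum>k. norm (f m k))" by simp
  qed
  have int: "integrable (count_space UNIV) (f m)" for m
    using A by (simp add: integrable_count_space_nat_iff)
  have nint: "(\<integral>k. norm (f m k) \<partial>count_space UNIV) = (\<Sum>k. norm (f m k))" for m
    using A by (intro integral_count_space_nat) (simp add: integrable_count_space_nat_iff)
  have B': "summable (\<lambda>m. \<integral>k. norm (f m k) \<partial>count_space UNIV)"
    using B by (simp add: nint)
  have I: "integrable (count_space UNIV) (\<lambda>k. \<Sum>m. f m k)"
    by (rule integrable_suminf[OF int _ B']) (use 1 in auto)
  have "(\<lambda>m. \<integral>k. f m k \<partial>count_space UNIV) sums (\<integral>k. (\<Sum>m. f m k) \<partial>count_space UNIV)"
    by (rule sums_integral[OF int _ B']) (use 1 in auto)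
  moreover have "(\<integral>k. f m k \<partial>count_space UNIV) = (\<Sum>k. f m k)" for m
    using int by (rule integral_count_space_nat)
  ultimately have "(\<integral>k. (\<Sum>m. f m k) \<partial>count_space UNIV) = (\<Sum>m. \<Sum>k. f m k)"
    by (simp add: sums_iff)
  thus "(\<lambda>k. \<Sum>m. f m k) sums (\<Sum>m. \<Sum>k. f m k)"
    using sums_integral_count_space_nat[OF I] by simp
  show "summable (\<lambda>k. norm (\<Sum>m. f m k))" using I by (simp add: integrable_count_space_nat_iff)
qed

text \<open>Extension by zero above the diagonal reduces the triangular sum to
  \<open>sums_swap\<close>; column \<open>k\<close> starts at row \<open>k\<close>, which is where
  the shift \<open>i + k\<close> comes from.\<close>

lemma sums_swap_triangle:
  fixes f :: "nat \<Rightarrow> nat \<Rightarrow> complex"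
  assumes B: "summable (\<lambda>m. \<Sum>k\<le>m. norm (f m k))"
  shows "summable (\<lambda>i. norm (f (i + k) k))"
    and "(\<lambda>k. \<Sum>i. f (i + k) k) sums (\<Sum>m. \<Sum>k\<le>m. f m k)"
    and "summable (\<lambda>k. norm (\<Sum>i. f (i + k) k))"
proof -
  define g where "g = (\<lambda>m k. if k \<le> m then f m k else 0)"
  have fin: "finite {..m::nat}" for m by simp
  have g1: "(\<Sum>k. norm (g m k)) = (\<Sum>k\<le>m. norm (f m k))" for m
    by (subst suminf_finite[of "{..m}"]) (auto simp: g_def)
  have g2: "(\<Sum>k. g m k) = (\<Sum>k\<le>m. f m k)" for m
    by (subst suminf_finite[of "{..m}"]) (auto simp: g_def)
  have A: "summable (\<lambda>k. norm (g m k))" for m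
    by (rule summable_finite[of "{..m}"]) (auto simp: g_def)
  have B': "summable (\<lambda>m. \<Sum>k. norm (g m k))" using B by (simp add: g1)
  note sw = sums_swap[OF A B']
  show 1: "summable (\<lambda>i. norm (f (i + k) k))" for k
    using sw(1)[of k] summable_iff_shift[of "\<lambda>m. norm (g m k)" k] by (simp add: g_def)
  have 2: "(\<Sum>m. g m k) = (\<Sum>i. f (i + k) k)" for k
    using suminf_split_initial_segment[OF summable_norm_cancel[OF sw(1)], of k k]
    by (simp add: g_def)
  show "(\<lambda>k. \<Sum>i. f (i + k) k) sums (\<Sum>m. \<Sum>k\<le>m. f m k)"
    and "summable (\<lambda>k. norm (\<Sum>i. f (i + k) k))"
    using sw(2,3) by (simp_all add: 2 g2)
qed

lemma holomorphic_on_suminf: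
  fixes f :: "nat \<Rightarrow> complex \<Rightarrow> complex"
  assumes S: "open S" and f: "\<And>n. f n holomorphic_on S"
    and M: "\<And>z. z \<in> S \<Longrightarrow> \<exists>r>0. \<exists>M. cball z r \<subseteq> S \<and> summable M \<and> (\<forall>n. \<forall>w\<in>cball z r. norm (f n w) \<le> M n)"
  shows "(\<lambda>z. \<Sum>n. f n z) holomorphic_on S"
proof (rule holomorphic_uniform_sequence[OF S])
  show "(\<lambda>z. \<Sum>i<n. f i z) holomorphic_on S" for n
    by (intro holomorphic_on_sum f)
  fix z assume z: "z \<in> S"
  obtain r M where r: "r > 0" "cball z r \<subseteq> S" "summable M" "\<forall>n. \<forall>w\<in>cball z r. norm (f n w) \<le> M n"
    using M[OF z] by auto
  have "uniform_limit (cball z r) (\<lambda>n z. \<Sum>i<n. f i z) (\<lambda>z. \<Sum>i. f i z) sequentially"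
    by (rule Weierstrass_m_test[OF _ r(3)]) (use r(4) in auto)
  thus "\<exists>d>0. cball z d \<subseteq> S \<and> uniform_limit (cball z d) (\<lambda>n z. \<Sum>i<n. f i z) (\<lambda>z. \<Sum>i. f i z) sequentially"
    using r by blast
qed

lemma entire_suminf:
  fixes f :: "nat \<Rightarrow> complex \<Rightarrow> complex"
  assumes f: "\<And>n. f n holomorphic_on UNIV"
    and M: "\<And>R. \<exists>M. summable M \<and> (\<forall>n s. norm s \<le> R \<longrightarrow> norm (f n s) \<le> M n)"
  shows "(\<lambda>z. \<Sum>n. f n z) holomorphic_on UNIV"
proof (rule holomorphic_on_suminf[OF open_UNIV f])
  fix z :: complex
  obtain M where "summable M" "\<forall>n s. norm s \<le> norm z + 1 \<longrightarrow> norm (f n s) \<le> M n"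
    using M by blast
  moreover have "norm w \<le> norm z + 1" if "w \<in> cball z 1" for w
    using that norm_triangle_ineq2[of w z] by (simp add: dist_norm norm_minus_commute)
  ultimately have "\<forall>n. \<forall>w\<in>cball z 1. norm (f n w) \<le> M n" by blast
  thus "\<exists>r>0. \<exists>M. cball z r \<subseteq> UNIV \<and> summable M \<and> (\<forall>n. \<forall>w\<in>cball z r. norm (f n w) \<le> M n)"
    using \<open>summable M\<close> by (intro exI[of _ "1::real"] exI[of _ M] conjI) simp_all
qed

section \<open>Taylor coefficients of 1/(exp z - 1) - 1/z and the entire part of the
  coefficients\<close>

definition Bexp :: "complex \<Rightarrow> complex" where "Bexp z = 1 / (exp z - 1) - 1 / z"

text \<open>The quotient (exp z - 1)/z is entire with zeros only at nonzero multiples of 2 pi i, and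
  6 < 2 pi. So its reciprocal is holomorphic for \<open>norm z < 6\<close>; subtracting the value 1
  at the origin and dividing by z once more gives \<open>Bexp\<close>. The weight
  \<open>2 ^ j\<close> leaves room for arguments \<open>t + u\<close> with
  \<open>t \<le> 1/2\<close> and \<open>u < 1\<close>.\<close>

lemma exists_Bexp_series:
  "\<exists>c. (\<forall>z. z \<noteq> 0 \<and> norm z < 6 \<longrightarrow> (\<lambda>j. c j * z ^ j) sums Bexp z) \<and> summable (\<lambda>j::nat. norm (c j) * 2 ^ j)"
proof -
  define q where "q = (\<lambda>z::complex. if z = 0 then 1 else (exp z - 1) / z)"
  have "(\<lambda>z. if z = 0 then deriv exp 0 else (exp z - exp 0) / (z - 0)) holomorphic_on (UNIV :: complex set)"
    by (rule pole_lemma) (auto intro!: holomorphic_intros)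
  also have "(\<lambda>z::complex. if z = 0 then deriv exp 0 else (exp z - exp 0) / (z - 0)) = q"
    using DERIV_imp_deriv[OF DERIV_exp[of "0::complex"]] by (auto simp: q_def fun_eq_iff)
  finally have holq: "q holomorphic_on UNIV" .
  have q0: "q z \<noteq> 0" if z: "z \<in> ball 0 6" for z
  proof
    assume *: "q z = 0"
    hence nz: "z \<noteq> 0" by (auto simp: q_def)
    hence "exp z = 1" using * by (simp add: q_def)
    then obtain n where n: "Re z = 0" "Im z = of_int (2 * n) * pi" using exp_eq_1 by blast
    have "n \<noteq> 0" using n nz by (auto simp: complex_eq_iff)
    hence "\<bar>of_int n\<bar> \<ge> (1::real)" by linarith
    hence "2 * pi * \<bar>of_int n\<bar> \<ge> 2 * pi * 1" by (intro mult_left_mono) auto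
    hence "\<bar>Im z\<bar> \<ge> 2 * pi" unfolding n by (simp add: abs_mult mult_ac)
    moreover have "pi > 3" using pi_gt3 .
    ultimately show False using z abs_Im_le_cmod[of z] by auto
  qed
  define g where "g = (\<lambda>z. 1 / q z)"
  have holg: "g holomorphic_on ball 0 6"
    unfolding g_def using q0 holq by (intro holomorphic_intros) (auto intro: holomorphic_on_subset)
  define C where "C = (\<lambda>z. if z = 0 then deriv g 0 else (g z - g 0) / (z - 0))"
  have holC: "C holomorphic_on ball 0 6"
    unfolding C_def by (rule pole_lemma[OF holg]) auto
  define c where "c = (\<lambda>j. (deriv ^^ j) C 0 / fact j)"
  have sums: "(\<lambda>j. c j * z ^ j) sums C z" if "norm z < 6" for z
    using holomorphic_power_series[OF holC, of z] that by (simp add: c_def)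
  have "C z = Bexp z" if "z \<noteq> 0" "norm z < 6" for z
  proof -
    have "exp z - 1 \<noteq> 0" using q0[of z] that by (auto simp: q_def)
    thus ?thesis using that by (simp add: C_def g_def q_def Bexp_def field_simps)
  qed
  moreover have "summable (\<lambda>j. norm (c j * 2 ^ j))"
    by (rule powser_insidea[of _ 3]) (use sums[of 3] in \<open>auto simp: sums_iff\<close>)
  ultimately show ?thesis using sums
    by (intro exI[of _ c] conjI allI impI) (metis, simp add: norm_mult norm_power)
qed

text \<open>In terms of Bernoulli numbers, \<open>bcoeff j\<close> is B_(j+1)/(j+1)!. What enters
  below is the expansion with its summability and the value at index 0, so the coefficients are
  selected by their expansion.\<close>

definition bcoeff :: "nat \<Rightarrow> complex" where
  "bcoeff = (SOME c. (\<forall>z. z \<noteq> 0 \<and> norm z < 6 \<longrightarrow> (\<lambda>j. c j * z ^ j) sums Bexp z) \<and>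
                     summable (\<lambda>j::nat. norm (c j) * 2 ^ j))"

lemma bcoeff_sums: "z \<noteq> 0 \<Longrightarrow> norm z < 6 \<Longrightarrow> (\<lambda>j. bcoeff j * z ^ j) sums Bexp z"
  and bcoeff_summable: "summable (\<lambda>j. norm (bcoeff j) * 2 ^ j)"
proof -
  have *: "(\<forall>z. z \<noteq> 0 \<and> norm z < 6 \<longrightarrow> (\<lambda>j. bcoeff j * z ^ j) sums Bexp z) \<and>
      summable (\<lambda>j::nat. norm (bcoeff j) * 2 ^ j)"
    unfolding bcoeff_def by (rule someI_ex[OF exists_Bexp_series])
  show "z \<noteq> 0 \<Longrightarrow> norm z < 6 \<Longrightarrow> (\<lambda>j. bcoeff j * z ^ j) sums Bexp z" using * by simp
  show "summable (\<lambda>j. norm (bcoeff j) * 2 ^ j)" using * by simp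
qed

text \<open>\<open>rGamma s / (s + j)\<close> with its removable singularity removed.\<close>

definition rGamma_div :: "nat \<Rightarrow> complex \<Rightarrow> complex" where
  "rGamma_div j s = pochhammer s j * rGamma (s + of_nat j + 1)"

lemma rGamma_div_eq: "s + of_nat j \<noteq> 0 \<Longrightarrow> rGamma_div j s = rGamma s / (s + of_nat j)"
  using pochhammer_rGamma[of s "Suc j"]
  by (simp add: rGamma_div_def pochhammer_Suc field_simps)

lemma holomorphic_pochhammer [holomorphic_intros]: "(\<lambda>s::complex. pochhammer s n) holomorphic_on A"
  unfolding pochhammer_prod by (intro holomorphic_intros)

lemma rGamma_div_holomorphic: "rGamma_div j holomorphic_on A"
  unfolding rGamma_div_def by (intro holomorphic_intros)

lemma bounded_on_cball:
  fixes f :: "complex \<Rightarrow> complex"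
  assumes "continuous_on UNIV f"
  shows "\<exists>C\<ge>0. \<forall>s. norm s \<le> R \<longrightarrow> norm (f s) \<le> C"
proof -
  have "compact (f ` cball 0 R)"
    using assms by (intro compact_continuous_image compact_cball) (auto elim: continuous_on_subset)
  hence "bounded (f ` cball 0 R)" by (rule compact_imp_bounded)
  then obtain C where "\<forall>x\<in>f ` cball 0 R. norm x \<le> C" unfolding bounded_iff by auto
  thus ?thesis by (intro exI[of _ "max 0 C"] conjI allI impI) (simp_all add: le_max_iff_disj)
qed

text \<open>For \<open>j \<ge> R + 1\<close> the denominator \<open>s + j\<close> has modulus at
  least 1, and a bound for \<open>rGamma\<close> suffices; the finitely many smaller
  \<open>j\<close> are bounded by compactness.\<close>

lemma rGamma_div_bound:
  "\<exists>C\<ge>0. \<forall>j s. norm s \<le> R \<longrightarrow> norm (rGamma_div j s) \<le> C"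
proof -
  obtain N :: nat where N: "R + 1 \<le> real N" using real_arch_simple by blast
  have "\<forall>j. \<exists>C\<ge>0. \<forall>s. norm s \<le> R \<longrightarrow> norm (rGamma_div j s) \<le> C"
    by (intro allI bounded_on_cball holomorphic_on_imp_continuous_on rGamma_div_holomorphic)
  then obtain C where C: "\<And>j. C j \<ge> 0" "\<And>j s. norm s \<le> R \<Longrightarrow> norm (rGamma_div j s) \<le> C j" by metis
  obtain D where D: "D \<ge> 0" "\<And>s. norm s \<le> R \<Longrightarrow> norm (rGamma s :: complex) \<le> D"
    using bounded_on_cball[OF holomorphic_on_imp_continuous_on[OF holomorphic_rGamma], of R] by blast
  have "norm (rGamma_div j s) \<le> D + (\<Sum>j<N. C j)" if s: "norm s \<le> R" for j s
  proof (cases "j < N")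
    case True
    have "norm (rGamma_div j s) \<le> C j" by (rule C(2)[OF s])
    also have "C j \<le> (\<Sum>j<N. C j)" using True C(1) by (intro member_le_sum) auto
    finally show ?thesis using D(1) by simp
  next
    case False
    have "real j = norm (of_nat j :: complex)" by simp
    also have "\<dots> \<le> norm (s + of_nat j) + norm s" using norm_triangle_ineq4[of "s + of_nat j" s] by simp
    finally have n: "norm (s + of_nat j) \<ge> 1" using s N False by linarith
    hence "norm (rGamma_div j s) = norm (rGamma s) / norm (s + of_nat j)"
      by (subst rGamma_div_eq) (auto simp: norm_divide)
    also have "\<dots> \<le> norm (rGamma s)" using n by (simp add: divide_le_eq mult_le_cancel_left1)
    also have "\<dots> \<le> D" by (rule D(2)[OF s])
    finally show ?thesis using sum_nonneg[of "{..<N}" C] C(1) by simp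
  qed
  moreover have "D + (\<Sum>j<N. C j) \<ge> 0" using D(1) C(1) by (simp add: sum_nonneg)
  ultimately show ?thesis by blast
qed

text \<open>This is \<open>rGamma s\<close> times the coefficient of \<open>t ^ k\<close> in the
  integral of \<open>u powr (s - 1) * Bexp (t + u)\<close> over (0, 1). The factor
  \<open>rGamma\<close> cancels the poles of 1/(s + j), so the sum is entire.\<close>

definition zcoeff_reg1 :: "nat \<Rightarrow> complex \<Rightarrow> complex" where
  "zcoeff_reg1 k s = (\<Sum>j. bcoeff (j + k) * of_nat (j + k choose k) * rGamma_div j s)"

text \<open>The coefficient of \<open>t ^ k\<close> in the sum over n \<ge> 1 of
  \<open>exp (- n * t) * inc_Gamma 1 s n\<close>, the part of the Mellin integral over u \<ge>
  1.\<close>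

definition zcoeff_reg2 :: "nat \<Rightarrow> complex \<Rightarrow> complex" where
  "zcoeff_reg2 k s = (\<Sum>m. (- of_nat (Suc m)) ^ k / fact k * inc_Gamma 1 s (real (Suc m)))"

definition zcoeff_reg :: "nat \<Rightarrow> complex \<Rightarrow> complex" where
  "zcoeff_reg k s = zcoeff_reg1 k s + rGamma s * zcoeff_reg2 k s"

text \<open>A single term of the binomial expansion of \<open>(3/4 + 1) ^ (j + k)\<close>, which is
  at most \<open>2 ^ (j + k)\<close>, bounds the binomial coefficient by
  \<open>(4/3) ^ k * 2 ^ (j + k)\<close>; the power of 2 is absorbed by \<open>bcoeff\<close>. The
  rate 4/3 lies below 2 and is later beaten by the decay of \<open>zH\<close>.\<close>

lemma zcoeff_reg1_majorant:
  assumes "\<And>j. norm (rGamma_div j s) \<le> C" "C \<ge> 0"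
  shows "norm (bcoeff (j + k) * of_nat (j + k choose k) * rGamma_div j s) \<le>
    C * (4/3) ^ k * (norm (bcoeff (j + k)) * 2 ^ (j + k))"
proof -
  have "of_nat (j + k choose k) * (3/4) ^ k * (1::real) ^ (j + k - k) \<le> (\<Sum>i\<le>j + k. of_nat (j + k choose i) * (3/4) ^ i * 1 ^ (j + k - i))"
    by (rule member_le_sum[of k "{..j + k}" "\<lambda>i. of_nat (j + k choose i) * (3/4) ^ i * (1::real) ^ (j + k - i)"]) auto
  also have "\<dots> = (3/4 + 1) ^ (j + k)" by (rule binomial_ring[symmetric])
  also have "\<dots> \<le> (2::real) ^ (j + k)" by (intro power_mono) auto
  finally have "real (j + k choose k) \<le> (4/3) ^ k * 2 ^ (j + k)"
    by (simp add: power_divide field_simps)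
  hence "norm (bcoeff (j + k)) * real (j + k choose k) * norm (rGamma_div j s) \<le>
      norm (bcoeff (j + k)) * ((4/3) ^ k * 2 ^ (j + k)) * C"
    using assms by (intro mult_mono mult_left_mono) auto
  thus ?thesis by (simp add: norm_mult mult_ac)
qed

lemma exp_summable_quarter: "summable (\<lambda>m. exp (- (real (Suc m) / 4)))"
proof -
  have "exp (- (real (Suc m) / 4)) = exp (- 1/4) * exp (- 1/4) ^ m" for m
    unfolding exp_of_nat_mult[symmetric] exp_add[symmetric] by (simp add: field_simps)
  moreover have "summable (\<lambda>m. exp (- 1/4) * exp (- 1/4 :: real) ^ m)"
    by (intro summable_mult summable_geometric) simp
  ultimately show ?thesis by (simp only:)
qed

text \<open>With n = \<open>Suc m\<close>, one term of the exponential series at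
  \<open>3/4 * n\<close> bounds \<open>n ^ k / fact k\<close> by
  \<open>(4/3) ^ k * exp (3/4 * n)\<close>, and the decay \<open>exp (- n)\<close> of
  \<open>inc_Gamma\<close> leaves \<open>exp (- n / 4)\<close> for the summation.\<close>

lemma zcoeff_reg2_majorant:
  assumes "norm (inc_Gamma 1 s (real (Suc m))) \<le> C * exp (- (1 * real (Suc m)))" "C \<ge> 0"
  shows "norm ((- of_nat (Suc m)) ^ k / fact k * inc_Gamma 1 s (real (Suc m))) \<le>
    C * (4/3) ^ k * exp (- (real (Suc m) / 4))"
proof -
  define y where "y = 3/4 * real (Suc m)"
  have "y ^ k / fact k = sum (\<lambda>n. y ^ n /\<^sub>R fact n) {k}" by (simp add: divide_inverse mult.commute)
  also have "\<dots> \<le> exp y"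
    unfolding exp_def by (rule sum_le_suminf[OF summable_exp_generic]) (auto simp: y_def)
  finally have "real (Suc m) ^ k / fact k \<le> (4/3) ^ k * exp y"
    unfolding y_def power_mult_distrib by (simp add: power_divide field_simps)
  hence "real (Suc m) ^ k / fact k * norm (inc_Gamma 1 s (real (Suc m))) \<le>
      ((4/3) ^ k * exp y) * (C * exp (- (1 * real (Suc m))))"
    using assms by (intro mult_mono) auto
  also have "\<dots> = C * (4/3) ^ k * exp (- (real (Suc m) / 4))"
    by (simp add: y_def exp_add[symmetric] field_simps)
  finally show ?thesis by (simp add: norm_mult norm_divide norm_power del: of_nat_Suc)
qed

lemma zcoeff_reg1_holomorphic: "zcoeff_reg1 k holomorphic_on UNIV"
  unfolding zcoeff_reg1_def
proof (rule entire_suminf)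
  show "(\<lambda>s. bcoeff (j + k) * of_nat (j + k choose k) * rGamma_div j s) holomorphic_on UNIV" for j
    by (intro holomorphic_intros rGamma_div_holomorphic)
  fix R :: real
  obtain C where C: "C \<ge> 0" "\<forall>j s. norm s \<le> R \<longrightarrow> norm (rGamma_div j s) \<le> C"
    using rGamma_div_bound by blast
  have "summable (\<lambda>j. C * (4/3) ^ k * (norm (bcoeff (j + k)) * 2 ^ (j + k)))"
    by (intro summable_mult summable_ignore_initial_segment[OF bcoeff_summable])
  thus "\<exists>M. summable M \<and> (\<forall>j s. norm s \<le> R \<longrightarrow>
        norm (bcoeff (j + k) * of_nat (j + k choose k) * rGamma_div j s) \<le> M j)"
    using zcoeff_reg1_majorant[OF _ C(1)] C(2) by blast
qed

lemma inc_Gamma_bound_ball: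
  assumes a: "0 < a" "a \<le> 1"
  shows "\<exists>C\<ge>0. \<forall>s x. norm s \<le> R \<longrightarrow> x \<ge> 1 \<longrightarrow> norm (inc_Gamma a s x) \<le> C * exp (- (a * x))"
proof -
  obtain N :: nat where N: "R + 1 \<le> real N" using real_arch_simple by blast
  have "\<bar>Re s - 1\<bar> \<le> real N" if "norm s \<le> R" for s
    using abs_Re_le_cmod[of s] that N by linarith
  thus ?thesis using inc_Gamma_bound[OF a, of N] by blast
qed

lemma zcoeff_reg2_holomorphic: "zcoeff_reg2 k holomorphic_on UNIV"
  unfolding zcoeff_reg2_def
proof (rule entire_suminf)
  show "(\<lambda>s. (- of_nat (Suc m)) ^ k / fact k * inc_Gamma 1 s (real (Suc m))) holomorphic_on UNIV" for m
    by (intro holomorphic_intros inc_Gamma_holomorphic) auto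
  fix R :: real
  obtain C where C: "C \<ge> 0" "\<forall>s x. norm s \<le> R \<longrightarrow> x \<ge> 1 \<longrightarrow> norm (inc_Gamma 1 s x) \<le> C * exp (- (1 * x))"
    using inc_Gamma_bound_ball[of 1 R] by auto
  have "summable (\<lambda>m. C * (4/3) ^ k * exp (- (real (Suc m) / 4)))"
    by (intro summable_mult exp_summable_quarter)
  moreover have "norm ((- of_nat (Suc m)) ^ k / fact k * inc_Gamma 1 s (real (Suc m))) \<le>
      C * (4/3) ^ k * exp (- (real (Suc m) / 4))" if "norm s \<le> R" for m s
  proof (rule zcoeff_reg2_majorant[OF _ C(1)])
    show "norm (inc_Gamma 1 s (real (Suc m))) \<le> C * exp (- (1 * real (Suc m)))"
      using C(2)[rule_format, OF that, of "real (Suc m)"] by simp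
  qed
  ultimately show "\<exists>M. summable M \<and> (\<forall>m s. norm s \<le> R \<longrightarrow>
        norm ((- of_nat (Suc m)) ^ k / fact k * inc_Gamma 1 s (real (Suc m))) \<le> M m)"
    by blast
qed

lemma zcoeff_reg_holomorphic: "zcoeff_reg k holomorphic_on A"
proof -
  have "zcoeff_reg k holomorphic_on UNIV"
    unfolding zcoeff_reg_def
    by (intro holomorphic_intros zcoeff_reg1_holomorphic zcoeff_reg2_holomorphic)
  thus ?thesis by (rule holomorphic_on_subset) simp
qed

lemma zcoeff_reg_bound:
  "\<exists>C\<ge>0. \<forall>k s. norm s \<le> R \<longrightarrow> norm (zcoeff_reg k s) \<le> C * (4/3) ^ k"
proof -
  obtain C where C: "C \<ge> 0" "\<forall>j s. norm s \<le> R \<longrightarrow> norm (rGamma_div j s) \<le> C"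
    using rGamma_div_bound by blast
  obtain C' where C': "C' \<ge> 0" "\<forall>s x. norm s \<le> R \<longrightarrow> x \<ge> 1 \<longrightarrow> norm (inc_Gamma 1 s x) \<le> C' * exp (- (1 * x))"
    using inc_Gamma_bound_ball[of 1 R] by auto
  obtain D where D: "D \<ge> 0" "\<forall>s. norm s \<le> R \<longrightarrow> norm (rGamma s :: complex) \<le> D"
    using bounded_on_cball[OF holomorphic_on_imp_continuous_on[OF holomorphic_rGamma], of R] by blast
  define S1 where "S1 = (\<Sum>j. norm (bcoeff j) * 2 ^ j)"
  define S2 where "S2 = (\<Sum>m. exp (- (real (Suc m) / 4)))"
  have S1: "S1 \<ge> 0" unfolding S1_def by (intro suminf_nonneg bcoeff_summable) auto
  have S2: "S2 \<ge> 0" unfolding S2_def by (intro suminf_nonneg exp_summable_quarter) auto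
  have "norm (zcoeff_reg k s) \<le> (C * S1 + D * (C' * S2)) * (4/3) ^ k" if s: "norm s \<le> R" for k s
  proof -
    have sm: "summable (\<lambda>j. C * (4/3) ^ k * (norm (bcoeff (j + k)) * 2 ^ (j + k)))"
      by (intro summable_mult summable_ignore_initial_segment[OF bcoeff_summable])
    have "norm (zcoeff_reg1 k s) \<le> (\<Sum>j. C * (4/3) ^ k * (norm (bcoeff (j + k)) * 2 ^ (j + k)))"
      unfolding zcoeff_reg1_def
      by (intro norm_suminf_le[OF _ sm] zcoeff_reg1_majorant) (use C s in auto)
    also have "\<dots> = C * (4/3) ^ k * (\<Sum>j. norm (bcoeff (j + k)) * 2 ^ (j + k))"
      by (intro suminf_mult summable_ignore_initial_segment[OF bcoeff_summable])
    also have "(\<Sum>j. norm (bcoeff (j + k)) * 2 ^ (j + k)) \<le> S1"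
      unfolding S1_def using suminf_split_initial_segment[OF bcoeff_summable, of k]
      by (simp add: sum_nonneg)
    finally have 1: "norm (zcoeff_reg1 k s) \<le> C * (4/3) ^ k * S1" using C by (simp add: mult_left_mono)
    have sm2: "summable (\<lambda>m. C' * (4/3) ^ k * exp (- (real (Suc m) / 4)))"
      by (intro summable_mult exp_summable_quarter)
    have "norm (zcoeff_reg2 k s) \<le> (\<Sum>m. C' * (4/3) ^ k * exp (- (real (Suc m) / 4)))"
      unfolding zcoeff_reg2_def
    proof (intro norm_suminf_le[OF _ sm2] zcoeff_reg2_majorant)
      show "norm (inc_Gamma 1 s (real (Suc m))) \<le> C' * exp (- (1 * real (Suc m)))" for m
        using C'(2)[rule_format, OF s, of "real (Suc m)"] by simp
    qed (rule C')
    also have "\<dots> = C' * (4/3) ^ k * S2"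
      unfolding S2_def by (intro suminf_mult exp_summable_quarter)
    finally have 2: "norm (zcoeff_reg2 k s) \<le> C' * (4/3) ^ k * S2" .
    have "norm (zcoeff_reg k s) \<le> norm (zcoeff_reg1 k s) + norm (rGamma s) * norm (zcoeff_reg2 k s)"
      unfolding zcoeff_reg_def norm_mult[symmetric] by (rule norm_triangle_ineq)
    also have "\<dots> \<le> C * (4/3) ^ k * S1 + D * (C' * (4/3) ^ k * S2)"
      by (intro add_mono mult_mono 1 2) (use D s in auto)
    finally show ?thesis by (simp add: algebra_simps)
  qed
  moreover have "C * S1 + D * (C' * S2) \<ge> 0" using C C' D S1 S2 by simp
  ultimately show ?thesis by blast
qed

text \<open>Half of the exponential absorbs the power: compare
  \<open>y ^ N / fact N \<le> exp y\<close> at \<open>y = x * t / 2\<close>.\<close>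

lemma poly_exp_bound:
  fixes t x :: real
  assumes "t > 0" "x \<ge> 0"
  shows "x ^ N * exp (- (x * t)) \<le> fact N * (2 / t) ^ N * exp (- (x * (t / 2)))"
proof -
  define y where "y = x * (t / 2)"
  have y: "y \<ge> 0" using assms by (simp add: y_def)
  have "y ^ N / fact N = sum (\<lambda>n. y ^ n /\<^sub>R fact n) {N}" by (simp add: divide_inverse mult.commute)
  also have "\<dots> \<le> exp y"
    unfolding exp_def by (rule sum_le_suminf[OF summable_exp_generic]) (use y in auto)
  finally have "y ^ N \<le> fact N * exp y" by (simp add: field_simps)
  hence "x ^ N \<le> fact N * (2 / t) ^ N * exp y"
    using assms unfolding y_def by (simp add: power_mult_distrib power_divide field_simps)
  hence "x ^ N * exp (- (x * t)) \<le> fact N * (2 / t) ^ N * exp y * exp (- (x * t))"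
    by (rule mult_right_mono) simp
  also have "\<dots> = fact N * (2 / t) ^ N * exp (- (x * (t / 2)))"
    unfolding mult.assoc exp_add[symmetric] by (simp add: y_def field_simps)
  finally show ?thesis .
qed

lemma summable_exp_nat: "t > 0 \<Longrightarrow> summable (\<lambda>n. exp (- (real (Suc n) * t)))"
proof -
  assume t: "t > 0"
  have "exp (- (real (Suc n) * t)) = exp (- t) * exp (- t) ^ n" for n
    unfolding exp_of_nat_mult[symmetric] exp_add[symmetric] by (simp add: field_simps)
  moreover have "summable (\<lambda>m. exp (- t) * exp (- t :: real) ^ m)"
    by (intro summable_mult summable_geometric) (use t in simp)
  ultimately show ?thesis by (simp only:)
qed

lemma summable_poly_exp:
  assumes "t > 0"
  shows "summable (\<lambda>n. real (Suc n) ^ N * exp (- (real (Suc n) * t)))"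
proof (rule summable_comparison_test'[OF summable_mult[OF summable_exp_nat[of "t/2"]]])
  show "norm (real (Suc n) ^ N * exp (- (real (Suc n) * t))) \<le>
      fact N * (2 / t) ^ N * exp (- (real (Suc n) * (t / 2)))" for n
    using poly_exp_bound[OF assms, of "real (Suc n)" N] by (simp del: of_nat_Suc)
qed (use assms in auto)

section \<open>The polylogarithm of order s at exp(-t)\<close>

definition expzeta :: "complex \<Rightarrow> real \<Rightarrow> complex" where
  "expzeta s t = (\<Sum>n. of_nat (Suc n) powr (- s) * of_real (exp (- (real (Suc n) * t))))"

lemma norm_nat_powr: "norm (of_nat (Suc n) powr s :: complex) = real (Suc n) powr Re s"
  using norm_powr_real_powr[of "of_nat (Suc n)" s] by simp

lemma nat_powr_le:
  assumes "\<bar>r\<bar> \<le> real N"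
  shows "real (Suc n) powr r \<le> real (Suc n) ^ N"
proof -
  have "real (Suc n) powr r \<le> real (Suc n) powr real N" using assms by (intro powr_mono) auto
  thus ?thesis by (simp add: powr_realpow)
qed

lemma expzeta_norm_summable:
  assumes "t > 0"
  shows "summable (\<lambda>n. norm (of_nat (Suc n) powr (- s) * complex_of_real (exp (- (real (Suc n) * t)))))"
proof -
  obtain N where N: "\<bar>- Re s\<bar> \<le> real N" using real_arch_simple by blast
  show ?thesis
    by (rule summable_comparison_test'[OF summable_poly_exp[OF assms, of N]])
       (use nat_powr_le[OF N] in \<open>auto simp: norm_mult norm_nat_powr simp del: of_nat_Suc\<close>)
qed

lemma expzeta_holomorphic:
  assumes "t > 0"
  shows "(\<lambda>s. expzeta s t) holomorphic_on A"
proof -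
  have "(\<lambda>s. expzeta s t) holomorphic_on UNIV" unfolding expzeta_def
  proof (rule entire_suminf)
    show "(\<lambda>s. of_nat (Suc n) powr (- s) * complex_of_real (exp (- (real (Suc n) * t)))) holomorphic_on UNIV" for n
      by (intro holomorphic_intros) (auto simp del: of_nat_Suc)
    fix R :: real
    obtain N where N: "R \<le> real N" using real_arch_simple by blast
    have "norm (of_nat (Suc n) powr (- s) * complex_of_real (exp (- (real (Suc n) * t)))) \<le>
        real (Suc n) ^ N * exp (- (real (Suc n) * t))" if "norm s \<le> R" for n s
    proof -
      have "\<bar>- Re s\<bar> \<le> real N" using abs_Re_le_cmod[of s] that N by linarith
      from nat_powr_le[OF this] show ?thesis by (auto simp: norm_mult norm_nat_powr simp del: of_nat_Suc)
    qed
    thus "\<exists>M. summable M \<and> (\<forall>n s. norm s \<le> R \<longrightarrow>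
        norm (of_nat (Suc n) powr (- s) * complex_of_real (exp (- (real (Suc n) * t)))) \<le> M n)"
      using summable_poly_exp[OF assms, of N] by blast
  qed
  thus ?thesis by (rule holomorphic_on_subset) simp
qed

section \<open>Elementary integrals of powers and the beta integral\<close>

lemma set_integrable_nonneg_has_integral:
  fixes f :: "real \<Rightarrow> real"
  assumes "(f has_integral I) A" "\<And>x. x \<in> A \<Longrightarrow> f x \<ge> 0" "set_borel_measurable lborel A f"
  shows "set_integrable lborel A f" "(LINT x:A|lborel. f x) = I"
proof -
  have "f absolutely_integrable_on A"
    using assms(1,2) by (subst absolutely_integrable_on_iff_nonneg) auto
  thus int: "set_integrable lborel A f"
    using assms(3) unfolding set_integrable_def set_borel_measurable_def
    by (subst (asm) integrable_completion) auto
  show "(LINT x:A|lborel. f x) = I"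
    using set_borel_integral_eq_integral(2)[OF int] assms(1) by (simp add: integral_unique)
qed

lemma powr_integral_head:
  assumes "(s::real) > 0"
  shows "set_integrable lborel {0<..<1} (\<lambda>u. u powr (s - 1))" "(LINT u:{0<..<1}|lborel. u powr (s - 1)) = 1 / s"
proof -
  have "((\<lambda>u::real. u powr (s - 1)) has_integral 1 powr (s - 1 + 1) / (s - 1 + 1)) {0..1}"
    by (rule has_integral_powr_from_0) (use assms in auto)
  hence "((\<lambda>u::real. u powr (s - 1)) has_integral 1 / s) {0<..<1}"
    using has_integral_open_interval[of "\<lambda>u::real. u powr (s - 1)" "1 / s" 0 1] by (simp add: box_real)
  thus "set_integrable lborel {0<..<1} (\<lambda>u. u powr (s - 1))" "(LINT u:{0<..<1}|lborel. u powr (s - 1)) = 1 / s"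
    by (intro set_integrable_nonneg_has_integral; simp add: set_borel_measurable_def)+
qed

lemma powr_integral_tail:
  assumes "(s::real) < 0"
  shows "set_integrable lborel {1..} (\<lambda>u. u powr (s - 1))" "(LINT u:{1..}|lborel. u powr (s - 1)) = - 1 / s"
proof -
  have "((\<lambda>u::real. u powr (s - 1)) has_integral - (1 powr (s - 1 + 1)) / (s - 1 + 1)) {1..}"
    by (rule has_integral_powr_to_inf) (use assms in auto)
  hence "((\<lambda>u::real. u powr (s - 1)) has_integral - 1 / s) {1..}" by simp
  thus "set_integrable lborel {1..} (\<lambda>u. u powr (s - 1))" "(LINT u:{1..}|lborel. u powr (s - 1)) = - 1 / s"
    by (intro set_integrable_nonneg_has_integral; simp add: set_borel_measurable_def)+
qed

lemma nn_mellin: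
  assumes "(s::real) > 0" "x > 0"
  shows "(\<integral>\<^sup>+t. ennreal (indicator {0<..} t * (t powr (s - 1) * exp (- (x * t)))) \<partial>lborel) =
     ennreal (Gamma s * x powr (- s))"
  using mellin_exp_integral_real[OF assms] unfolding set_integrable_def set_lebesgue_integral_def
  by (subst nn_integral_eq_integral) auto

text \<open>Writing 1/(t + u) as the integral of \<open>exp (- ((t + u) * x))\<close> over x > 0 and
  exchanging the order of integration by Tonelli leaves two Gamma integrals. The term
  \<open>Gamma (1 - s) * t powr (s - 1)\<close> of the expansion originates here.\<close>

lemma beta_integral:
  fixes s t :: real
  assumes s: "0 < s" "s < 1" and t: "t > 0"
  shows "set_integrable lborel {0<..} (\<lambda>u. u powr (s - 1) / (t + u))"
    and "(LINT u:{0<..}|lborel. u powr (s - 1) / (t + u)) = Gamma s * Gamma (1 - s) * t powr (s - 1)"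
proof -
  define f where "f = (\<lambda>x u. ennreal (indicator {0<..} x * indicator {0<..} u * u powr (s - 1) *
      exp (- (x * u)) * exp (- (t * x))))"
  have meas: "case_prod f \<in> borel_measurable (lborel \<Otimes>\<^sub>M lborel)"
    unfolding f_def by measurable
  have 1: "(\<integral>\<^sup>+u. f x u \<partial>lborel) = ennreal (Gamma s) * ennreal (indicator {0<..} x * (x powr (1 - s - 1) * exp (- (t * x))))" for x
  proof (cases "x > 0")
    case True
    have "(\<integral>\<^sup>+u. f x u \<partial>lborel) = (\<integral>\<^sup>+u. ennreal (exp (- (t * x))) *
        ennreal (indicator {0<..} u * (u powr (s - 1) * exp (- (x * u)))) \<partial>lborel)"
      unfolding f_def using True
      by (intro nn_integral_cong) (simp add: ennreal_mult[symmetric] mult_ac)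
    also have "\<dots> = ennreal (exp (- (t * x))) * ennreal (Gamma s * x powr (- s))"
      using nn_mellin[OF s(1) True] by (subst nn_integral_cmult) auto
    finally show ?thesis using True Gamma_real_pos[OF s(1)]
      by (simp add: ennreal_mult[symmetric] mult_ac)
  qed (simp add: f_def)
  have 2: "(\<integral>\<^sup>+x. f x u \<partial>lborel) = ennreal (indicator {0<..} u * (u powr (s - 1) / (t + u)))" for u
  proof (cases "u > 0")
    case True
    have "(\<integral>\<^sup>+x. f x u \<partial>lborel) = (\<integral>\<^sup>+x. ennreal (u powr (s - 1)) *
        ennreal (indicator {0<..} x * (x powr (1 - 1) * exp (- ((t + u) * x)))) \<partial>lborel)"
      unfolding f_def using True
      by (intro nn_integral_cong) (auto simp: ennreal_mult[symmetric] mult_ac indicator_def exp_add[symmetric] algebra_simps)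
    also have "\<dots> = ennreal (u powr (s - 1)) * ennreal (Gamma 1 * (t + u) powr (- 1))"
      using nn_mellin[of 1 "t + u"] True t by (subst nn_integral_cmult) auto
    finally show ?thesis using True t
      by (simp add: ennreal_mult[symmetric] powr_minus divide_inverse)
  qed (simp add: f_def)
  have "(\<integral>\<^sup>+u. ennreal (indicator {0<..} u * (u powr (s - 1) / (t + u))) \<partial>lborel) =
      (\<integral>\<^sup>+u. \<integral>\<^sup>+x. f x u \<partial>lborel \<partial>lborel)" by (simp add: 2)
  also have "\<dots> = (\<integral>\<^sup>+x. \<integral>\<^sup>+u. f x u \<partial>lborel \<partial>lborel)"
    by (rule lborel_pair.Fubini'[OF meas])
  also have "\<dots> = ennreal (Gamma s) * ennreal (Gamma (1 - s) * t powr (- (1 - s)))"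
    unfolding 1 using nn_mellin[of "1 - s" t] s t by (subst nn_integral_cmult) auto
  also have "\<dots> = ennreal (Gamma s * Gamma (1 - s) * t powr (s - 1))"
    using Gamma_real_pos s by (simp add: ennreal_mult[symmetric] mult_ac)
  finally have "has_bochner_integral lborel (\<lambda>u. indicator {0<..} u * (u powr (s - 1) / (t + u)))
      (Gamma s * Gamma (1 - s) * t powr (s - 1))"
    by (intro has_bochner_integral_nn_integral) (use t Gamma_real_pos s in \<open>auto simp: indicator_def\<close>)
  thus "set_integrable lborel {0<..} (\<lambda>u. u powr (s - 1) / (t + u))"
    "(LINT u:{0<..}|lborel. u powr (s - 1) / (t + u)) = Gamma s * Gamma (1 - s) * t powr (s - 1)"
    by (auto simp: has_bochner_integral_iff set_integrable_def set_lebesgue_integral_def)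
qed

text \<open>For \<open>t < 1 \<le> u\<close> the geometric series of \<open>1 / (t + u)\<close> in
  powers of \<open>t / u\<close> may be integrated term by term, and each term is integrable at
  infinity because \<open>s < 1\<close>.\<close>

lemma beta_tail_sums:
  fixes s t :: real
  assumes s: "0 < s" "s < 1" and t: "0 < t" "t < 1"
  shows "set_integrable lborel {1..} (\<lambda>u. u powr (s - 1) / (t + u))"
    and "(\<lambda>k. - ((- t) ^ k / (s - real (Suc k)))) sums (LINT u:{1..}|lborel. u powr (s - 1) / (t + u))"
proof -
  define f where "f = (\<lambda>k u. indicator {1..} u *\<^sub>R ((- t) ^ k * u powr (s - real (Suc k) - 1)))"
  have neg: "s - real (Suc k) < 0" for k using s by simp
  have int: "integrable lborel (f k)" for k
    unfolding f_def set_integrable_def[symmetric]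
    by (intro set_integrable_mult_right powr_integral_tail(1) neg)
  have ints: "integral\<^sup>L lborel (f k) = - ((- t) ^ k / (s - real (Suc k)))" for k
    using powr_integral_tail(2)[OF neg, of k] unfolding f_def set_lebesgue_integral_def
    by (simp only: mult_scaleR_right[symmetric] integral_mult_right_zero) simp
  have ints_norm: "(\<integral>u. norm (f k u) \<partial>lborel) = - (t ^ k / (s - real (Suc k)))" for k
  proof -
    have "(\<lambda>u. norm (f k u)) = (\<lambda>u. t ^ k * (indicator {1..} u *\<^sub>R u powr (s - real (Suc k) - 1)))"
      using t by (auto simp: f_def fun_eq_iff indicator_def norm_mult norm_power power_abs abs_mult)
    thus ?thesis using powr_integral_tail(2)[OF neg, of k] unfolding set_lebesgue_integral_def
      by (simp only: integral_mult_right_zero) simp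
  qed
  have geo: "(\<lambda>k. f k u) sums (indicator {1..} u *\<^sub>R (u powr (s - 1) / (t + u)))" for u
  proof (cases "u \<in> {1..}")
    case True
    hence u: "u \<ge> 1" by simp
    have "norm (- t / u) < 1" using t u by (simp add: field_simps)
    hence "(\<lambda>k. u powr (s - 2) * (- t / u) ^ k) sums (u powr (s - 2) * (1 / (1 - (- t / u))))"
      by (intro sums_mult geometric_sums)
    also have "(\<lambda>k. u powr (s - 2) * (- t / u) ^ k) = (\<lambda>k. f k u)"
    proof
      fix k
      have "u powr (s - real (Suc k) - 1) = u powr (s - 2) / u ^ k"
        using u by (simp add: powr_diff powr_realpow powr_add field_simps flip: power_Suc)
      thus "u powr (s - 2) * (- t / u) ^ k = f k u" using True by (simp only: f_def power_divide) simp
    qed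
    also have "u powr (s - 2) * (1 / (1 - (- t / u))) = u powr (s - 1) / (t + u)"
    proof -
      have "u powr (s - 1) = u powr (s - 2) * u" using u by (simp add: powr_diff field_simps powr_numeral power2_eq_square)
      thus ?thesis using u t by (simp add: field_simps)
    qed
    finally show ?thesis using True by simp
  qed (simp add: f_def)
  have sumn: "summable (\<lambda>k. norm (f k u))" for u
  proof (cases "u \<in> {1..}")
    case True
    have "norm (f k u) \<le> t ^ k" for k
    proof -
      have "norm (f k u) = t ^ k * u powr (s - real (Suc k) - 1)"
        using True t by (simp add: f_def norm_mult norm_power power_abs abs_mult)
      also have "\<dots> \<le> t ^ k * u powr 0"
        using True t s by (intro mult_left_mono powr_mono) auto
      finally show ?thesis using True by simp
    qed
    thus ?thesis by (intro summable_comparison_test'[OF summable_geometric[of t]]) (use t in auto)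
  qed (simp add: f_def)
  have sum_int: "summable (\<lambda>k. \<integral>u. norm (f k u) \<partial>lborel)"
  proof (rule summable_comparison_test'[OF summable_mult[OF summable_geometric[of t], of "1 / (1 - s)"]])
    fix k :: nat
    have "- (t ^ k / (s - real (Suc k))) = t ^ k / (real (Suc k) - s)" using neg[of k] by (simp add: field_simps)
    also have "\<dots> \<le> t ^ k / (1 - s)" using s t by (intro frac_le) auto
    finally have "- (t ^ k / (s - real (Suc k))) \<le> 1 / (1 - s) * t ^ k" by simp
    moreover have "t ^ k / (s - real (Suc k)) \<le> 0"
      by (rule divide_nonneg_neg) (use neg t in auto)
    ultimately show "norm (\<integral>u. norm (f k u) \<partial>lborel) \<le> 1 / (1 - s) * t ^ k"
      unfolding ints_norm unfolding real_norm_def by linarith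
  qed (use t in auto)
  have eq: "(\<Sum>k. f k u) = indicator {1..} u *\<^sub>R (u powr (s - 1) / (t + u))" for u
    using geo[of u] by (simp add: sums_iff)
  show "set_integrable lborel {1..} (\<lambda>u. u powr (s - 1) / (t + u))"
    unfolding set_integrable_def eq[symmetric]
    by (rule integrable_suminf[OF int _ sum_int]) (use sumn in auto)
  have "(\<lambda>k. integral\<^sup>L lborel (f k)) sums (\<integral>u. (\<Sum>k. f k u) \<partial>lborel)"
    by (rule sums_integral[OF int _ sum_int]) (use sumn in auto)
  thus "(\<lambda>k. - ((- t) ^ k / (s - real (Suc k)))) sums (LINT u:{1..}|lborel. u powr (s - 1) / (t + u))"
    unfolding ints eq set_lebesgue_integral_def .
qed

text \<open>The head is the full beta integral minus the tail. Its expansion in \<open>t\<close>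
  therefore consists of the power \<open>t powr (s - 1)\<close> and of coefficients with poles at
  \<open>s = Suc k\<close>.\<close>

lemma beta_head:
  fixes s t :: real
  assumes s: "0 < s" "s < 1" and t: "0 < t" "t < 1"
  shows "set_integrable lborel {0<..<1} (\<lambda>u. u powr (s - 1) / (t + u))"
    and "(\<lambda>k. (- t) ^ k / (s - real (Suc k))) sums
           ((LINT u:{0<..<1}|lborel. u powr (s - 1) / (t + u)) - Gamma s * Gamma (1 - s) * t powr (s - 1))"
proof -
  show int: "set_integrable lborel {0<..<1} (\<lambda>u. u powr (s - 1) / (t + u))"
    by (rule set_integrable_subset[OF beta_integral(1)[OF s t(1)]]) auto
  have "(LINT u:{0<..<1} \<union> {1..}|lborel. u powr (s - 1) / (t + u)) =
      (LINT u:{0<..<1}|lborel. u powr (s - 1) / (t + u)) + (LINT u:{1..}|lborel. u powr (s - 1) / (t + u))"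
    by (intro set_integral_Un int beta_tail_sums(1)[OF s t]) auto
  moreover have "{0<..<1} \<union> {1..} = {0::real<..}" by auto
  ultimately have "Gamma s * Gamma (1 - s) * t powr (s - 1) =
      (LINT u:{0<..<1}|lborel. u powr (s - 1) / (t + u)) + (LINT u:{1..}|lborel. u powr (s - 1) / (t + u))"
    using beta_integral(2)[OF s t(1)] by simp
  thus "(\<lambda>k. (- t) ^ k / (s - real (Suc k))) sums
           ((LINT u:{0<..<1}|lborel. u powr (s - 1) / (t + u)) - Gamma s * Gamma (1 - s) * t powr (s - 1))"
    using sums_minus[OF beta_tail_sums(2)[OF s t]] by simp
qed

section \<open>Expansion of the truncated Mellin integral of the geometric sum\<close>

lemma has_bochner_powr_binomial:
  fixes s t :: real
  assumes s: "s > 0"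
  shows "has_bochner_integral lborel (\<lambda>u. indicator {0<..<1} u * (u powr (s - 1) * (t + u) ^ j))
           (\<Sum>k\<le>j. of_nat (j choose k) * t ^ k / (s + real (j - k)))"
proof -
  have "has_bochner_integral lborel
      (\<lambda>u. \<Sum>k\<le>j. of_nat (j choose k) * t ^ k * (indicator {0<..<1} u *\<^sub>R u powr (s + real (j - k) - 1)))
      (\<Sum>k\<le>j. of_nat (j choose k) * t ^ k * (1 / (s + real (j - k))))"
  proof (intro has_bochner_integral_sum has_bochner_integral_mult_right)
    fix k
    have "s + real (j - k) > 0" using s by simp
    thus "has_bochner_integral lborel (\<lambda>u. indicator {0<..<1} u *\<^sub>R u powr (s + real (j - k) - 1)) (1 / (s + real (j - k)))"
      using powr_integral_head[of "s + real (j - k)"]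
      unfolding has_bochner_integral_iff set_integrable_def set_lebesgue_integral_def by simp
  qed
  also have "(\<lambda>u. \<Sum>k\<le>j. of_nat (j choose k) * t ^ k * (indicator {0<..<1} u *\<^sub>R u powr (s + real (j - k) - 1))) =
      (\<lambda>u. indicator {0<..<1} u * (u powr (s - 1) * (t + u) ^ j))"
  proof
    fix u :: real
    show "(\<Sum>k\<le>j. of_nat (j choose k) * t ^ k * (indicator {0<..<1} u *\<^sub>R u powr (s + real (j - k) - 1))) =
      indicator {0<..<1} u * (u powr (s - 1) * (t + u) ^ j)"
    proof (cases "u \<in> {0<..<1}")
      case True
      have "u powr (s + real (j - k) - 1) = u powr (s - 1) * u ^ (j - k)" for k
        using True by (simp add: powr_realpow[symmetric] powr_add[symmetric] algebra_simps)
      hence "(\<Sum>k\<le>j. of_nat (j choose k) * t ^ k * (indicator {0<..<1} u *\<^sub>R u powr (s + real (j - k) - 1))) =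
          (\<Sum>k\<le>j. u powr (s - 1) * (of_nat (j choose k) * t ^ k * u ^ (j - k)))"
        using True by (intro sum.cong) (simp_all only: indicator_simps scaleR_one mult_ac)
      also have "\<dots> = u powr (s - 1) * (t + u) ^ j"
        by (simp only: binomial_ring sum_distrib_left)
      finally show ?thesis using True by simp
    qed simp
  qed
  finally show ?thesis by simp
qed

text \<open>For t \<le> 1/2 and u < 1 the argument \<open>t + u\<close> stays below 2, where the
  series of \<open>Bexp\<close> converges absolutely. Termwise integration leaves polynomials in
  \<open>t\<close> of degree at most \<open>j\<close>, and \<open>sums_swap_triangle\<close>
  regroups them by powers of \<open>t\<close>.\<close>

lemma Bexp_head:
  fixes s t :: real
  assumes s: "s > 0" and t: "0 \<le> t" "t \<le> 1 / 2"
  shows "set_integrable lborel {0<..<1} (\<lambda>u. of_real (u powr (s - 1)) * Bexp (of_real (t + u)))"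
    and "(\<lambda>k. \<Sum>i. bcoeff (i + k) * of_nat (i + k choose k) * of_real t ^ k / (of_real s + of_nat i)) sums
         (LINT u:{0<..<1}|lborel. of_real (u powr (s - 1)) * Bexp (of_real (t + u)))"
    and "summable (\<lambda>i. norm (bcoeff (i + k) * of_nat (i + k choose k) * of_real t ^ k / (of_real s + of_nat i)))"
proof -
  define g where "g = (\<lambda>j u. indicator {0<..<1} u * (u powr (s - 1) * (t + u) ^ j))"
  define I where "I = (\<lambda>j. \<Sum>k\<le>j. of_nat (j choose k) * t ^ k / (s + real (j - k)))"
  define f where "f = (\<lambda>j u. bcoeff j * of_real (g j u))"
  have g: "has_bochner_integral lborel (g j) (I j)" for j
    unfolding g_def I_def by (rule has_bochner_powr_binomial[OF s])
  have gnn: "g j u \<ge> 0" for j u unfolding g_def using t by (auto simp: indicator_def)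
  have I0: "I j \<ge> 0" for j unfolding I_def using s t by (intro sum_nonneg) auto
  have I: "I j \<le> 1 / s * 2 ^ j" for j
  proof -
    have "I j \<le> (\<Sum>k\<le>j. of_nat (j choose k) * t ^ k * 1 ^ (j - k) / s)"
      unfolding I_def using s t by (intro sum_mono) (auto intro!: divide_left_mono mult_pos_pos)
    also have "\<dots> = (t + 1) ^ j / s" by (simp add: binomial_ring sum_divide_distrib)
    also have "\<dots> \<le> 2 ^ j / s" using s t by (intro divide_right_mono power_mono) auto
    finally show ?thesis by simp
  qed
  have f: "has_bochner_integral lborel (f j) (bcoeff j * of_real (I j))" for j
    unfolding f_def using g by (intro has_bochner_integral_mult_right has_bochner_integral_of_real)
  have int: "integrable lborel (f j)" for j using f by (simp add: has_bochner_integral_iff)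
  have nint: "(\<integral>u. norm (f j u) \<partial>lborel) = norm (bcoeff j) * I j" for j
  proof -
    have "(\<lambda>u. norm (f j u)) = (\<lambda>u. norm (bcoeff j) * g j u)"
      using gnn by (simp add: f_def norm_mult)
    thus ?thesis using g[of j] by (simp add: has_bochner_integral_iff)
  qed
  have fs: "(\<lambda>j. f j u) sums (indicator {0<..<1} u *\<^sub>R (of_real (u powr (s - 1)) * Bexp (of_real (t + u))))"
    and fn: "summable (\<lambda>j. norm (f j u))" for u
  proof -
    show "(\<lambda>j. f j u) sums (indicator {0<..<1} u *\<^sub>R (of_real (u powr (s - 1)) * Bexp (of_real (t + u))))"
    proof (cases "u \<in> {0<..<1}")
      case True
      have "(\<lambda>j. bcoeff j * of_real (t + u) ^ j) sums Bexp (of_real (t + u))"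
        by (rule bcoeff_sums) (use True t in \<open>auto simp del: of_real_add\<close>)
      from sums_mult[OF this, of "of_real (u powr (s - 1))"] show ?thesis
        using True by (simp add: f_def g_def mult_ac)
    qed (simp add: f_def g_def)
    show "summable (\<lambda>j. norm (f j u))"
    proof (cases "u \<in> {0<..<1}")
      case True
      have "norm (f j u) \<le> u powr (s - 1) * (norm (bcoeff j) * 2 ^ j)" for j
      proof -
        have "norm (f j u) = u powr (s - 1) * (norm (bcoeff j) * (t + u) ^ j)"
        proof -
          have "norm (f j u) = norm (bcoeff j) * g j u" using gnn by (simp add: f_def norm_mult)
          thus ?thesis using True by (simp add: g_def mult_ac)
        qed
        also have "\<dots> \<le> u powr (s - 1) * (norm (bcoeff j) * 2 ^ j)"
          using True t by (intro mult_left_mono power_mono) auto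
        finally show ?thesis .
      qed
      thus ?thesis
        by (intro summable_comparison_test'[OF summable_mult[OF bcoeff_summable]]) auto
    qed (simp add: f_def g_def)
  qed
  have sum_int: "summable (\<lambda>j. \<integral>u. norm (f j u) \<partial>lborel)"
  proof (rule summable_comparison_test'[OF summable_mult[OF bcoeff_summable, of "1 / s"]])
    fix j
    have "norm (bcoeff j) * I j \<le> norm (bcoeff j) * (1 / s * 2 ^ j)" using I by (intro mult_left_mono) auto
    thus "norm (\<integral>u. norm (f j u) \<partial>lborel) \<le> 1 / s * (norm (bcoeff j) * 2 ^ j)"
      unfolding nint using I0[of j] by (simp add: mult_ac)
  qed
  have eq: "(\<Sum>j. f j u) = indicator {0<..<1} u *\<^sub>R (of_real (u powr (s - 1)) * Bexp (of_real (t + u)))" for u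
    using fs[of u] by (simp add: sums_iff)
  show "set_integrable lborel {0<..<1} (\<lambda>u. of_real (u powr (s - 1)) * Bexp (of_real (t + u)))"
    unfolding set_integrable_def eq[symmetric]
    by (rule integrable_suminf[OF int _ sum_int]) (use fn in auto)
  have "(\<lambda>j. integral\<^sup>L lborel (f j)) sums (\<integral>u. (\<Sum>j. f j u) \<partial>lborel)"
    by (rule sums_integral[OF int _ sum_int]) (use fn in auto)
  hence 1: "(\<lambda>j. bcoeff j * of_real (I j)) sums
      (LINT u:{0<..<1}|lborel. of_real (u powr (s - 1)) * Bexp (of_real (t + u)))"
    using f unfolding eq set_lebesgue_integral_def by (simp add: has_bochner_integral_iff)
  define h where "h = (\<lambda>j k. bcoeff j * of_nat (j choose k) * of_real t ^ k / (of_real s + of_nat (j - k)))"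
  have h1: "(\<Sum>k\<le>j. h j k) = bcoeff j * of_real (I j)" for j
    unfolding h_def I_def by (simp add: sum_distrib_left mult_ac)
  have den: "norm (of_real s + of_nat n :: complex) = s + real n" for n
  proof -
    have "of_real s + of_nat n = complex_of_real (s + real n)" by simp
    thus ?thesis using s by (simp only: norm_of_real)
  qed
  have h2: "(\<Sum>k\<le>j. norm (h j k)) = norm (bcoeff j) * I j" for j
    unfolding h_def I_def sum_distrib_left using t
    by (intro sum.cong refl)
       (simp only: norm_mult norm_divide norm_power den norm_of_nat norm_of_real abs_of_nonneg
          times_divide_eq_right mult.assoc)
  have hs: "summable (\<lambda>j. \<Sum>k\<le>j. norm (h j k))"
    unfolding h2 using sum_int unfolding nint .
  show "summable (\<lambda>i. norm (bcoeff (i + k) * of_nat (i + k choose k) * of_real t ^ k / (of_real s + of_nat i)))"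
    using sums_swap_triangle(1)[OF hs, of k] by (simp add: h_def)
  show "(\<lambda>k. \<Sum>i. bcoeff (i + k) * of_nat (i + k choose k) * of_real t ^ k / (of_real s + of_nat i)) sums
         (LINT u:{0<..<1}|lborel. of_real (u powr (s - 1)) * Bexp (of_real (t + u)))"
    using sums_swap_triangle(2)[OF hs] 1 unfolding h1 by (simp add: h_def sums_iff)
qed

lemma exp_geometric_sums:
  assumes "x > 0"
  shows "(\<lambda>n. complex_of_real (exp (- (real (Suc n) * x)))) sums (1 / of_real x + Bexp (of_real x))"
proof -
  have "(\<lambda>n. exp (- x) * exp (- x) ^ n) sums (exp (- x) * (1 / (1 - exp (- x))))"
    by (intro sums_mult geometric_sums) (use assms in simp)
  also have "(\<lambda>n. exp (- x) * exp (- x) ^ n) = (\<lambda>n. exp (- (real (Suc n) * x)))"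
    unfolding exp_of_nat_mult[symmetric] exp_add[symmetric] by (simp add: fun_eq_iff field_simps)
  also have "exp (- x) * (1 / (1 - exp (- x))) = 1 / (exp x - 1)"
    using assms by (simp add: exp_minus field_simps)
  finally have "(\<lambda>n. complex_of_real (exp (- (real (Suc n) * x)))) sums of_real (1 / (exp x - 1))"
    by (rule sums_of_real)
  also have "of_real (1 / (exp x - 1)) = 1 / complex_of_real x + Bexp (of_real x)"
    by (simp add: Bexp_def exp_of_real)
  finally show ?thesis .
qed

text \<open>The moduli in the exponential series of \<open>exp (- (n * t))\<close> add up to
  \<open>exp (n * t) \<le> exp (n / 2)\<close>, which the decay \<open>exp (- n)\<close> of
  \<open>inc_Gamma\<close> outweighs, so the two summations commute.\<close>

lemma inc_Gamma_sum_swap: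
  assumes t: "0 \<le> t" "t \<le> 1 / 2"
  shows "(\<lambda>k. zcoeff_reg2 k s * of_real t ^ k) sums
           (\<Sum>n. of_real (exp (- (real (Suc n) * t))) * inc_Gamma 1 s (real (Suc n)))"
    and "summable (\<lambda>n. of_real (exp (- (real (Suc n) * t))) * inc_Gamma 1 s (real (Suc n)))"
proof -
  obtain C where C: "C \<ge> 0" "\<And>x. x \<ge> 1 \<Longrightarrow> norm (inc_Gamma 1 s x) \<le> C * exp (- x)"
    using inc_Gamma_bound_ball[of 1 "norm s"] by auto
  define f where "f = (\<lambda>m k. ((- of_nat (Suc m)) ^ k / fact k * inc_Gamma 1 s (real (Suc m))) * of_real t ^ k)"
  have fk: "(\<lambda>k. f m k) sums (of_real (exp (- (real (Suc m) * t))) * inc_Gamma 1 s (real (Suc m)))" for m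
  proof -
    define z :: complex where "z = - of_nat (Suc m)"
    have "(\<lambda>k. (z * of_real t) ^ k /\<^sub>R fact k * inc_Gamma 1 s (real (Suc m))) sums
        (exp (z * of_real t) * inc_Gamma 1 s (real (Suc m)))"
      by (intro sums_mult2 exp_converges)
    moreover have "(z * of_real t) ^ k /\<^sub>R fact k * inc_Gamma 1 s (real (Suc m)) = f m k" for k
      unfolding f_def z_def[symmetric]
      by (simp only: power_mult_distrib scaleR_conv_of_real divide_inverse of_real_inverse of_real_fact mult_ac)
    moreover have "exp (z * of_real t) = of_real (exp (- (real (Suc m) * t)))"
      unfolding exp_of_real[symmetric] z_def by (simp add: algebra_simps)
    ultimately show ?thesis by (simp only:)
  qed
  have fn: "(\<lambda>k. norm (f m k)) sums (exp (real (Suc m) * t) * norm (inc_Gamma 1 s (real (Suc m))))" for m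
  proof -
    have "(\<lambda>k. (real (Suc m) * t) ^ k /\<^sub>R fact k * norm (inc_Gamma 1 s (real (Suc m)))) sums
        (exp (real (Suc m) * t) * norm (inc_Gamma 1 s (real (Suc m))))"
      by (intro sums_mult2 exp_converges)
    moreover have "(real (Suc m) * t) ^ k /\<^sub>R fact k * norm (inc_Gamma 1 s (real (Suc m))) = norm (f m k)" for k
    proof -
      have "norm (f m k) = real (Suc m) ^ k / fact k * norm (inc_Gamma 1 s (real (Suc m))) * t ^ k"
        unfolding f_def using t
        by (simp only: norm_mult norm_divide norm_power norm_minus_cancel norm_of_nat norm_of_real abs_of_nonneg norm_fact)
      thus ?thesis by (simp only: power_mult_distrib real_scaleR_def divide_inverse mult_ac)
    qed
    ultimately show ?thesis by (simp only:)
  qed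
  have majorant: "exp (real (Suc m) * t) * norm (inc_Gamma 1 s (real (Suc m))) \<le> C * exp (- (real (Suc m) * (1/2)))" for m
  proof -
    have "exp (real (Suc m) * t) * norm (inc_Gamma 1 s (real (Suc m))) \<le>
        exp (real (Suc m) * (1/2)) * (C * exp (- real (Suc m)))"
      using t C(2)[of "real (Suc m)"] by (intro mult_mono) (auto simp del: of_nat_Suc)
    also have "\<dots> = C * (exp (real (Suc m) * (1/2)) * exp (- real (Suc m)))" by simp
    also have "\<dots> = C * exp (- (real (Suc m) * (1/2)))" unfolding exp_add[symmetric] by (simp add: field_simps)
    finally show ?thesis .
  qed
  have B: "summable (\<lambda>m. \<Sum>k. norm (f m k))"
  proof (rule summable_comparison_test'[OF summable_mult[OF summable_exp_nat[of "1/2"], of C]])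
    show "norm (\<Sum>k. norm (f m k)) \<le> C * exp (- (real (Suc m) * (1/2)))" for m
      using majorant[of m] unfolding sums_unique[OF fn, symmetric] by simp
  qed simp
  have A: "summable (\<lambda>k. norm (f m k))" for m by (rule sums_summable[OF fn])
  have eq: "(\<Sum>m. f m k) = zcoeff_reg2 k s * of_real t ^ k" for k
  proof (cases "t = 0 \<and> k > 0")
    case False
    show ?thesis
    proof (cases "k = 0")
      case True
      thus ?thesis by (simp add: f_def zcoeff_reg2_def)
    next
      case k: False
      hence "t > 0" using False t by auto
      hence T: "complex_of_real t ^ k \<noteq> 0" by simp
      \<comment> \<open>Summability of the coefficient series comes from that of \<open>f\<close> by
        dividing out \<open>t ^ k\<close>, hence the separate treatment of
        \<open>t = 0\<close>.\<close>
      have "summable (\<lambda>m. f m k * inverse (complex_of_real t ^ k))"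
        by (rule summable_mult2[OF summable_norm_cancel[OF sums_swap(1)[OF A B]]])
      also have "(\<lambda>m. f m k * inverse (complex_of_real t ^ k)) =
          (\<lambda>m. (- of_nat (Suc m)) ^ k / fact k * inc_Gamma 1 s (real (Suc m)))"
        unfolding f_def mult.assoc[of _ "complex_of_real t ^ k"] right_inverse[OF T] mult_1_right ..
      finally have "summable (\<lambda>m. (- of_nat (Suc m)) ^ k / fact k * inc_Gamma 1 s (real (Suc m)))" .
      thus ?thesis unfolding f_def zcoeff_reg2_def by (rule suminf_mult2[symmetric])
    qed
  qed (auto simp: f_def zero_power)
  show "(\<lambda>k. zcoeff_reg2 k s * of_real t ^ k) sums
           (\<Sum>n. of_real (exp (- (real (Suc n) * t))) * inc_Gamma 1 s (real (Suc n)))"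
    using sums_swap(2)[OF A B] unfolding eq sums_unique[OF fk, symmetric] .
  show "summable (\<lambda>n. of_real (exp (- (real (Suc n) * t))) * inc_Gamma 1 s (real (Suc n)))"
  proof (rule summable_comparison_test'[OF summable_mult[OF summable_exp_nat[of "1/2"], of C]])
    fix n
    have "norm (of_real (exp (- (real (Suc n) * t))) * inc_Gamma 1 s (real (Suc n))) \<le>
        exp (real (Suc n) * t) * norm (inc_Gamma 1 s (real (Suc n)))"
      unfolding norm_mult using t by (intro mult_right_mono) (auto simp: mult_nonneg_nonneg intro: order_trans[of _ 0])
    thus "norm (of_real (exp (- (real (Suc n) * t))) * inc_Gamma 1 s (real (Suc n))) \<le> C * exp (- (real (Suc n) * (1/2)))"
      using majorant[of n] by linarith
  qed simp
qed

text \<open>The pole of zeta(s - k) at \<open>s = Suc k\<close> is split off explicitly, so that its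
  residue \<open>(-1) ^ k * rGamma (Suc k)\<close> can be read off. At the pole itself, division by
  zero leaves the value \<open>zcoeff_reg k s\<close>.\<close>

definition zcoeff :: "nat \<Rightarrow> complex \<Rightarrow> complex" where
  "zcoeff k s = (-1) ^ k * rGamma s / (s - of_nat (Suc k)) + zcoeff_reg k s"

text \<open>The integral over (0, 1) of \<open>u powr (r - 1)\<close> times the sum of
  \<open>exp (- (n * (t + u)))\<close> is evaluated twice. Term by term it is
  \<open>Gamma s * expzeta s t\<close> minus weighted tails over u \<ge> 1; after summing the
  geometric series it is an integral involving \<open>1 / (t + u) + Bexp (t + u)\<close>, which
  expands in \<open>t\<close>. The beta integral confines the argument to \<open>r\<close> between 0
  and 1.\<close>

lemma expzeta_expansion_real:
  fixes r t :: real
  assumes r: "0 < r" "r < 1" and t: "0 < t" "t \<le> 1 / 2"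
  defines "s \<equiv> complex_of_real r"
  shows "(\<lambda>k. zcoeff k s * of_real t ^ k) sums (expzeta s t - Gamma (1 - s) * of_real t powr (s - 1))"
proof -
  define c where "c = (\<lambda>n. complex_of_real (exp (- (real (Suc n) * t))))"
  have s: "Re s > 0" using r by (simp add: s_def)
  have t1: "t < 1" using t by simp
  have powr_eq: "complex_of_real u powr (s - 1) = of_real (u powr (r - 1))" if "u > 0" for u
    using powr_of_real[of u "r - 1"] that by (simp add: s_def)
  have c1: "summable (\<lambda>n. norm (c n) * real (Suc n) powr (- Re s))"
  proof (rule summable_comparison_test'[OF summable_exp_nat[OF t(1)]])
    fix n
    have "real (Suc n) powr (- r) \<le> real (Suc n) powr 0" using r by (intro powr_mono) auto
    thus "norm (norm (c n) * real (Suc n) powr (- Re s)) \<le> exp (- (real (Suc n) * t))"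
      by (simp add: c_def s_def)
  qed
  have c2: "summable (\<lambda>n. norm (c n) * exp (- (real (Suc n) * u)))" if "u > 0" for u
  proof (rule summable_comparison_test'[OF summable_exp_nat[OF t(1)]])
    show "norm (norm (c n) * exp (- (real (Suc n) * u))) \<le> exp (- (real (Suc n) * t))" for n
      using that by (simp add: c_def)
  qed
  have A: "(\<lambda>n. c n * (Gamma s * of_nat (Suc n) powr (- s) - inc_Gamma 1 s (real (Suc n)))) sums
      (LINT u:{0<..<1}|lborel. of_real u powr (s - 1) * (\<Sum>n. c n * of_real (exp (- (real (Suc n) * u)))))"
    using mellin_exp_sum(2)[OF s _ _ _ c1 c2, of 1] by simp
  have "(LINT u:{0<..<1}|lborel. of_real u powr (s - 1) * (\<Sum>n. c n * of_real (exp (- (real (Suc n) * u))))) =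
      (LINT u:{0<..<1}|lborel. of_real (u powr (r - 1) / (t + u)) + of_real (u powr (r - 1)) * Bexp (of_real (t + u)))"
  proof (rule set_lebesgue_integral_cong)
    show "\<forall>u. u \<in> {0<..<1} \<longrightarrow> of_real u powr (s - 1) * (\<Sum>n. c n * of_real (exp (- (real (Suc n) * u)))) =
      of_real (u powr (r - 1) / (t + u)) + of_real (u powr (r - 1)) * Bexp (of_real (t + u))"
    proof (intro allI impI)
      fix u :: real assume u: "u \<in> {0<..<1}"
      have "c n * of_real (exp (- (real (Suc n) * u))) = of_real (exp (- (real (Suc n) * (t + u))))" for n
        unfolding c_def of_real_mult[symmetric] exp_add[symmetric] by (simp add: algebra_simps)
      hence "(\<Sum>n. c n * of_real (exp (- (real (Suc n) * u)))) = 1 / of_real (t + u) + Bexp (of_real (t + u))"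
        using exp_geometric_sums[of "t + u"] u t by (simp add: sums_iff del: of_real_add of_nat_Suc)
      thus "of_real u powr (s - 1) * (\<Sum>n. c n * of_real (exp (- (real (Suc n) * u)))) =
        of_real (u powr (r - 1) / (t + u)) + of_real (u powr (r - 1)) * Bexp (of_real (t + u))"
        using u powr_eq[of u] by (simp add: algebra_simps)
    qed
  qed simp
  also have "\<dots> = (LINT u:{0<..<1}|lborel. of_real (u powr (r - 1) / (t + u))) +
      (LINT u:{0<..<1}|lborel. of_real (u powr (r - 1)) * Bexp (of_real (t + u)))"
  proof (rule set_integral_add)
    show "set_integrable lborel {0<..<1} (\<lambda>u. complex_of_real (u powr (r - 1) / (t + u)))"
      using integrable_of_real[OF beta_head(1)[OF r t(1) t1, unfolded set_integrable_def], where 'a = complex]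
      unfolding set_integrable_def by (simp only: scaleR_conv_of_real of_real_mult of_real_eq_id id_apply)
    show "set_integrable lborel {0<..<1} (\<lambda>u. of_real (u powr (r - 1)) * Bexp (of_real (t + u)))"
      by (rule Bexp_head(1)) (use r t in auto)
  qed
  finally have A': "(LINT u:{0<..<1}|lborel. of_real u powr (s - 1) * (\<Sum>n. c n * of_real (exp (- (real (Suc n) * u))))) =
      of_real (LINT u:{0<..<1}|lborel. u powr (r - 1) / (t + u)) +
      (LINT u:{0<..<1}|lborel. of_real (u powr (r - 1)) * Bexp (of_real (t + u)))"
    by (simp only: set_integral_complex_of_real)
  define I1 where "I1 = (LINT u:{0<..<1}|lborel. u powr (r - 1) / (t + u))"
  define I2 where "I2 = (LINT u:{0<..<1}|lborel. of_real (u powr (r - 1)) * Bexp (of_real (t + u)))"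
  define J where "J = (\<Sum>n. c n * inc_Gamma 1 s (real (Suc n)))"
  have Jsums: "(\<lambda>n. c n * inc_Gamma 1 s (real (Suc n))) sums J"
    unfolding J_def c_def by (rule summable_sums[OF inc_Gamma_sum_swap(2)]) (use t in auto)
  have Lsums: "(\<lambda>n. c n * (Gamma s * of_nat (Suc n) powr (- s))) sums (Gamma s * expzeta s t)"
    using sums_mult[OF summable_sums[OF summable_norm_cancel[OF expzeta_norm_summable[OF t(1), of s]]], of "Gamma s"]
    unfolding expzeta_def c_def by (simp add: mult_ac del: of_nat_Suc)
  have "(\<lambda>n. c n * (Gamma s * of_nat (Suc n) powr (- s) - inc_Gamma 1 s (real (Suc n)))) sums (Gamma s * expzeta s t - J)"
    using sums_diff[OF Lsums Jsums] by (simp only: right_diff_distrib)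
  with A have B: "Gamma s * expzeta s t - J = of_real I1 + I2"
    unfolding A' I1_def[symmetric] I2_def[symmetric] using sums_unique2 by blast
  have e1: "(\<lambda>k. zcoeff_reg2 k s * of_real t ^ k) sums J"
    unfolding J_def c_def by (rule inc_Gamma_sum_swap(1)) (use t in auto)
  have e2: "(\<lambda>k. complex_of_real ((- t) ^ k / (r - real (Suc k)))) sums
      of_real (I1 - Gamma r * Gamma (1 - r) * t powr (r - 1))"
    unfolding I1_def by (rule sums_of_real[OF beta_head(2)[OF r t(1) t1]])
  have e3: "(\<lambda>k. \<Sum>i. bcoeff (i + k) * of_nat (i + k choose k) * of_real t ^ k / (s + of_nat i)) sums I2"
    unfolding I2_def s_def by (rule Bexp_head(2)) (use r t in auto)
  have sg: "rGamma s * Gamma s = 1"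
    using Gamma_real_pos[OF r(1)] by (simp add: rGamma_inverse_Gamma s_def Gamma_complex_of_real)
  have "(\<lambda>k. rGamma s * (zcoeff_reg2 k s * of_real t ^ k + complex_of_real ((- t) ^ k / (r - real (Suc k))) +
        (\<Sum>i. bcoeff (i + k) * of_nat (i + k choose k) * of_real t ^ k / (s + of_nat i)))) sums
      (rGamma s * (J + of_real (I1 - Gamma r * Gamma (1 - r) * t powr (r - 1)) + I2))"
    by (intro sums_mult sums_add e1 e2 e3)
  also have "(\<lambda>k. rGamma s * (zcoeff_reg2 k s * of_real t ^ k + complex_of_real ((- t) ^ k / (r - real (Suc k))) +
        (\<Sum>i. bcoeff (i + k) * of_nat (i + k choose k) * of_real t ^ k / (s + of_nat i)))) =
      (\<lambda>k. zcoeff k s * of_real t ^ k)"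
  proof
    fix k
    have si: "s + of_nat i \<noteq> 0" for i
      using r by (auto simp: s_def complex_eq_iff)
    have sm: "summable (\<lambda>i. bcoeff (i + k) * of_nat (i + k choose k) * of_real t ^ k / (s + of_nat i))"
      unfolding s_def by (rule summable_norm_cancel[OF Bexp_head(3)]) (use r t in auto)
    have "rGamma s * (\<Sum>i. bcoeff (i + k) * of_nat (i + k choose k) * of_real t ^ k / (s + of_nat i)) =
        (\<Sum>i. rGamma s * (bcoeff (i + k) * of_nat (i + k choose k) * of_real t ^ k / (s + of_nat i)))"
      by (rule suminf_mult[OF sm, symmetric])
    also have "\<dots> = (\<Sum>i. of_real t ^ k * (bcoeff (i + k) * of_nat (i + k choose k) * rGamma_div i s))"
      using si by (simp add: rGamma_div_eq mult_ac)
    also have "\<dots> = of_real t ^ k * zcoeff_reg1 k s"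
      unfolding zcoeff_reg1_def
    proof (rule suminf_mult)
      have "summable (\<lambda>i. rGamma s / of_real t ^ k * (bcoeff (i + k) * of_nat (i + k choose k) * of_real t ^ k / (s + of_nat i)))"
        by (intro summable_mult sm)
      thus "summable (\<lambda>i. bcoeff (i + k) * of_nat (i + k choose k) * rGamma_div i s)"
        using si t by (simp add: rGamma_div_eq mult_ac)
    qed
    finally have 1: "rGamma s * (\<Sum>i. bcoeff (i + k) * of_nat (i + k choose k) * of_real t ^ k / (s + of_nat i)) =
      of_real t ^ k * zcoeff_reg1 k s" .
    have 2: "complex_of_real ((- t) ^ k / (r - real (Suc k))) = (-1) ^ k * of_real t ^ k / (s - of_nat (Suc k))"
      using power_minus[of "complex_of_real t" k] by (simp add: s_def)
    show "rGamma s * (zcoeff_reg2 k s * of_real t ^ k + complex_of_real ((- t) ^ k / (r - real (Suc k))) +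
        (\<Sum>i. bcoeff (i + k) * of_nat (i + k choose k) * of_real t ^ k / (s + of_nat i))) = zcoeff k s * of_real t ^ k"
      unfolding distrib_left 1 unfolding 2 zcoeff_def zcoeff_reg_def by (simp add: algebra_simps)
  qed
  also have "rGamma s * (J + of_real (I1 - Gamma r * Gamma (1 - r) * t powr (r - 1)) + I2) =
      rGamma s * Gamma s * (expzeta s t - Gamma (1 - s) * of_real t powr (s - 1))"
  proof -
    have "J + of_real (I1 - Gamma r * Gamma (1 - r) * t powr (r - 1)) + I2 =
        Gamma s * expzeta s t - of_real (Gamma r * Gamma (1 - r) * t powr (r - 1))"
      using B by (simp add: algebra_simps)
    also have "of_real (Gamma r * Gamma (1 - r) * t powr (r - 1)) = Gamma s * Gamma (1 - s) * of_real t powr (s - 1)"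
      using powr_eq[OF t(1)] Gamma_complex_of_real[of r] Gamma_complex_of_real[of "1 - r"] by (simp add: s_def)
    finally have X: "J + of_real (I1 - Gamma r * Gamma (1 - r) * t powr (r - 1)) + I2 =
        Gamma s * expzeta s t - Gamma s * Gamma (1 - s) * of_real t powr (s - 1)" .
    show ?thesis unfolding X by (simp add: algebra_simps)
  qed
  finally show ?thesis by (simp only: sg mult_1)
qed

section \<open>Extension of the expansion to all s that are not positive integers\<close>

definition posints :: "complex set" where "posints = of_nat ` {1..}"

lemma closed_posints: "closed posints" unfolding posints_def by (rule closed_of_nat_image)

lemma open_Compl_posints: "open (- posints)" by (simp add: closed_posints open_Compl)

lemma connected_Compl_posints: "connected (- posints)"
proof -
  have "countable posints" unfolding posints_def by auto
  hence "connected (UNIV - posints)" by (intro connected_open_diff_countable) auto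
  thus ?thesis by (simp add: Compl_eq_Diff_UNIV)
qed

lemma of_nat_Suc_in_posints: "of_nat (Suc k) \<in> posints"
  unfolding posints_def by (intro imageI) simp

lemma not_posintsD: "s \<notin> posints \<Longrightarrow> s - of_nat (Suc k) \<noteq> 0"
  using of_nat_Suc_in_posints[of k] by (metis right_minus_eq)

lemma one_minus_notin_nonpos_Ints:
  assumes "s \<notin> posints"
  shows "1 - s \<notin> \<int>\<^sub>\<le>\<^sub>0"
proof
  assume "1 - s \<in> \<int>\<^sub>\<le>\<^sub>0"
  then obtain n where "1 - s = - of_nat n" by (rule nonpos_Ints_cases')
  hence "s = of_nat (Suc n)" by (simp add: algebra_simps)
  thus False using assms not_posintsD[of s n] by simp
qed

lemma zcoeff_holomorphic: "zcoeff k holomorphic_on - posints"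
  unfolding zcoeff_def using not_posintsD
  by (intro holomorphic_intros zcoeff_reg_holomorphic) auto

text \<open>Halving the radius of a ball that avoids all positive integers keeps every pole at
  distance at least \<open>r\<close>, which makes the bound uniform in \<open>k\<close>.\<close>

lemma zcoeff_bound_local:
  assumes "z \<notin> posints"
  shows "\<exists>r>0. cball z r \<subseteq> - posints \<and> (\<exists>C\<ge>0. \<forall>k. \<forall>w\<in>cball z r. norm (zcoeff k w) \<le> C * (4/3) ^ k)"
proof -
  obtain e where e: "e > 0" "ball z e \<subseteq> - posints"
    using assms open_Compl_posints open_contains_ball by blast
  define r where "r = e / 2"
  have r: "r > 0" using e by (simp add: r_def)
  have sub: "cball z r \<subseteq> - posints"
    using e by (force simp: r_def)
  have sep: "norm (w - of_nat (Suc k)) \<ge> r" if "w \<in> cball z r" for w k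
  proof (rule ccontr)
    assume "\<not> norm (w - of_nat (Suc k)) \<ge> r"
    hence "dist z (of_nat (Suc k)) < e"
      using that dist_triangle[of z "of_nat (Suc k)" w] by (simp add: r_def dist_norm)
    hence "of_nat (Suc k) \<in> - posints" using e by (metis mem_ball subsetD)
    thus False unfolding posints_def by (auto simp del: of_nat_Suc)
  qed
  define R where "R = norm z + r"
  have R: "norm w \<le> R" if "w \<in> cball z r" for w
    using that norm_triangle_ineq2[of w z] by (simp add: R_def dist_norm norm_minus_commute)
  obtain C where C: "C \<ge> 0" "\<forall>k s. norm s \<le> R \<longrightarrow> norm (zcoeff_reg k s) \<le> C * (4/3) ^ k"
    using zcoeff_reg_bound by blast
  obtain D where D: "D \<ge> 0" "\<forall>s. norm s \<le> R \<longrightarrow> norm (rGamma s :: complex) \<le> D"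
    using bounded_on_cball[OF holomorphic_on_imp_continuous_on[OF holomorphic_rGamma], of R] by blast
  have "norm (zcoeff k w) \<le> (D / r + C) * (4/3) ^ k" if w: "w \<in> cball z r" for k w
  proof -
    have "norm ((-1) ^ k * rGamma w / (w - of_nat (Suc k))) = norm (rGamma w) / norm (w - of_nat (Suc k))"
      by (simp add: norm_divide norm_mult norm_power)
    also have "\<dots> \<le> D / r" using D R[OF w] sep[OF w, of k] r by (intro frac_le) auto
    also have "\<dots> \<le> D / r * (4/3) ^ k" using D r mult_left_mono[of 1 "(4/3) ^ k" "D / r"] by simp
    finally have "norm (zcoeff k w) \<le> D / r * (4/3) ^ k + C * (4/3) ^ k"
      unfolding zcoeff_def using C(2) R[OF w] by (intro norm_triangle_le add_mono) auto
    thus ?thesis by (simp add: algebra_simps)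
  qed
  moreover have "D / r + C \<ge> 0" using D C r by simp
  ultimately show ?thesis using r sub by blast
qed

lemma zcoeff_summable:
  assumes "s \<notin> posints" "norm x \<le> 2 / 3"
  shows "summable (\<lambda>k. norm (zcoeff k s * x ^ k))"
proof -
  obtain r C where C: "r > 0" "\<forall>k. \<forall>w\<in>cball s r. norm (zcoeff k w) \<le> C * (4/3) ^ k"
    using zcoeff_bound_local[OF assms(1)] by blast
  have "norm (zcoeff k s * x ^ k) \<le> C * (8/9) ^ k" for k
  proof -
    have c: "norm (zcoeff k s) \<le> C * (4/3) ^ k" using C by simp
    have "norm (zcoeff k s * x ^ k) \<le> (C * (4/3) ^ k) * (2/3) ^ k"
      unfolding norm_mult norm_power using assms(2)
      by (intro mult_mono c power_mono order_trans[OF norm_ge_zero c]) auto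
    also have "\<dots> = C * (8/9) ^ k" by (simp add: mult.assoc flip: power_mult_distrib)
    finally show ?thesis .
  qed
  thus ?thesis by (intro summable_comparison_test'[OF summable_mult[OF summable_geometric[of "8/9"]]]) auto
qed

text \<open>Both sides are holomorphic on the connected complement of \<open>posints\<close> and
  agree on the real interval (0, 1), which accumulates at 1/2.\<close>

theorem expzeta_expansion:
  assumes t: "0 < t" "t \<le> 1 / 2" and s: "s \<notin> posints"
  shows "(\<lambda>k. zcoeff k s * of_real t ^ k) sums (expzeta s t - Gamma (1 - s) * of_real t powr (s - 1))"
proof -
  define f where "f = (\<lambda>s. (expzeta s t - Gamma (1 - s) * of_real t powr (s - 1)) - (\<Sum>k. zcoeff k s * of_real t ^ k))"
  have sm: "summable (\<lambda>k. zcoeff k s * of_real t ^ k)" if "s \<notin> posints" for s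
    by (rule summable_norm_cancel[OF zcoeff_summable[OF that]]) (use t in auto)
  have hol: "(\<lambda>s. \<Sum>k. zcoeff k s * of_real t ^ k) holomorphic_on - posints"
  proof (rule holomorphic_on_suminf[OF open_Compl_posints])
    show "(\<lambda>s. zcoeff k s * of_real t ^ k) holomorphic_on - posints" for k
      by (intro holomorphic_intros zcoeff_holomorphic)
    fix z assume "z \<in> - posints"
    then obtain r C where C: "r > 0" "cball z r \<subseteq> - posints" "C \<ge> 0" "\<forall>k. \<forall>w\<in>cball z r. norm (zcoeff k w) \<le> C * (4/3) ^ k"
      using zcoeff_bound_local[of z] by auto
    have "norm (zcoeff k w * of_real t ^ k) \<le> C * (2/3) ^ k" if "w \<in> cball z r" for k w
    proof -
      have "norm (zcoeff k w * of_real t ^ k) \<le> (C * (4/3) ^ k) * (1/2) ^ k"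
        unfolding norm_mult norm_power using C that t by (intro mult_mono power_mono) auto
      also have "\<dots> = C * (2/3) ^ k" by (simp add: mult.assoc flip: power_mult_distrib)
      finally show ?thesis .
    qed
    moreover have "summable (\<lambda>k. C * (2/3) ^ k)" by (intro summable_mult summable_geometric) auto
    ultimately show "\<exists>r>0. \<exists>M. cball z r \<subseteq> - posints \<and> summable M \<and>
        (\<forall>n. \<forall>w\<in>cball z r. norm (zcoeff n w * of_real t ^ n) \<le> M n)"
      using C(1,2) by blast
  qed
  have holf: "f holomorphic_on - posints"
    unfolding f_def using one_minus_notin_nonpos_Ints t
    by (intro holomorphic_intros hol expzeta_holomorphic) auto
  have half: "(1/2 :: complex) \<notin> posints"
  proof
    assume "1/2 \<in> posints"
    then obtain n where "1/2 = (of_nat n :: complex)" unfolding posints_def by blast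
    hence "of_nat 1 = (of_nat (2 * n) :: complex)" by (simp add: field_simps)
    hence "1 = 2 * n" by (simp only: of_nat_eq_iff)
    thus False by presburger
  qed
  have lim: "(1/2 :: complex) islimpt of_real ` {0<..<1}"
    unfolding islimpt_approachable
  proof (intro allI impI)
    fix e :: real assume e: "e > 0"
    define d where "d = min (e / 2) (1/4)"
    have d: "d > 0" "d < e" "d \<le> 1/4" using e by (auto simp: d_def)
    have "dist (complex_of_real (1/2 + d)) (1/2) = norm (complex_of_real d)"
      by (simp add: dist_norm)
    hence "dist (complex_of_real (1/2 + d)) (1/2) < e" using d by simp
    moreover have "complex_of_real (1/2 + d) \<noteq> 1/2"
      using d by (simp add: complex_eq_iff)
    moreover have "complex_of_real (1/2 + d) \<in> of_real ` {0<..<1}" using d by (intro imageI) auto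
    ultimately show "\<exists>x'\<in>of_real ` {0<..<1}. x' \<noteq> 1/2 \<and> dist x' (1/2 :: complex) < e" by blast
  qed
  have sub: "complex_of_real ` {0<..<1} \<subseteq> - posints"
  proof
    fix z assume "z \<in> complex_of_real ` {0<..<1}"
    then obtain r :: real where r: "z = of_real r" "0 < r" "r < 1" by auto
    show "z \<in> - posints"
    proof
      assume "z \<in> posints"
      then obtain n where n: "n \<ge> 1" "complex_of_real r = of_nat n" unfolding posints_def r(1) by auto
      from n(2) have "complex_of_real r = complex_of_real (real n)" by simp
      hence "r = real n" by (rule injD[OF inj_of_real])
      thus False using n(1) r(2,3) by simp
    qed
  qed
  have zero: "f z = 0" if z: "z \<in> complex_of_real ` {0<..<1}" for z
  proof -
    obtain r where r: "0 < r" "r < 1" "z = complex_of_real r" using z by auto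
    from sums_unique[OF expzeta_expansion_real[OF r(1,2) t]] show ?thesis
      unfolding f_def r(3) by simp
  qed
  have "1/2 \<in> - posints" "s \<in> - posints" using half s by simp_all
  hence "f s = 0"
    using analytic_continuation[OF holf open_Compl_posints connected_Compl_posints sub _ lim] zero by blast
  hence "(\<Sum>k. zcoeff k s * of_real t ^ k) = expzeta s t - Gamma (1 - s) * of_real t powr (s - 1)"
    unfolding f_def by simp
  thus ?thesis using summable_sums[OF sm[OF s]] by (simp only:)
qed

section \<open>The zeta function and its logarithmic derivative\<close>

lemma summable_Suc_powr: "a > 1 \<Longrightarrow> summable (\<lambda>n. real (Suc n) powr - a)"
  using summable_real_powr_iff[of "- a"] by (subst summable_Suc_iff) auto

definition dirichlet_zeta :: "complex \<Rightarrow> complex" where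
  "dirichlet_zeta s = (\<Sum>n. of_nat (Suc n) powr - s)"

lemma dirichlet_zeta_norm_summable: "Re s > 1 \<Longrightarrow> summable (\<lambda>n. norm (of_nat (Suc n) powr - s :: complex))"
  using summable_Suc_powr[of "Re s"] by (simp add: norm_nat_powr del: of_nat_Suc)

lemma dirichlet_zeta_sums: "Re s > 1 \<Longrightarrow> (\<lambda>n. of_nat (Suc n) powr - s) sums dirichlet_zeta s"
  unfolding dirichlet_zeta_def
  by (rule summable_sums[OF summable_norm_cancel[OF dirichlet_zeta_norm_summable]])

text \<open>Termwise differentiation on the half-plane to the right of the midpoint \<open>a\<close>
  between 1 and \<open>Re s\<close>, where \<open>n powr - a\<close> is a uniform majorant.\<close>

lemma dirichlet_zeta_deriv:
  assumes s: "Re s > 1"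
  shows "(dirichlet_zeta has_field_derivative - (\<Sum>n. of_real (ln (real (Suc n))) * of_nat (Suc n) powr - s)) (at s)"
    and "summable (\<lambda>n. of_real (ln (real (Suc n))) * of_nat (Suc n) powr - s)"
proof -
  define a where "a = (1 + Re s) / 2"
  define S where "S = {z. Re z > a}"
  have a: "a > 1" "s \<in> S" using s by (auto simp: a_def S_def)
  have opS: "open S" unfolding S_def by (intro open_Collect_less continuous_intros)
  obtain g g' where g: "\<forall>x\<in>S. ((\<lambda>n. of_nat (Suc n) powr - x) sums g x) \<and>
      ((\<lambda>n. - (of_real (ln (real (Suc n))) * of_nat (Suc n) powr - x)) sums g' x) \<and> (g has_field_derivative g' x) (at x)"
  proof (rule series_and_derivative_comparison[OF opS summable_Suc_powr[OF a(1)]])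
    show "((\<lambda>x. of_nat (Suc n) powr - x) has_field_derivative
        - (of_real (ln (real (Suc n))) * of_nat (Suc n) powr - x)) (at x)" if "x \<in> S" for n x
    proof -
      have L: "Ln (of_nat (Suc n)) = of_real (ln (real (Suc n)))" using Ln_of_nat[of "Suc n"] by simp
      have *: "of_nat (Suc n) powr - x = exp (- x * of_real (ln (real (Suc n))))" for x :: complex
        unfolding powr_def L by (simp del: of_nat_Suc)
      show ?thesis unfolding * by (auto intro!: derivative_eq_intros simp del: of_nat_Suc)
    qed
    have "norm (of_nat (Suc n) powr - x :: complex) \<le> real (Suc n) powr - a" if "x \<in> S" for n x
      unfolding norm_nat_powr using that by (intro powr_mono) (auto simp: S_def)
    thus "\<forall>\<^sub>F n in sequentially. \<forall>x\<in>S. norm (of_nat (Suc n) powr - x :: complex) \<le> real (Suc n) powr - a"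
      by (intro always_eventually) blast
  qed blast
  have "g x = dirichlet_zeta x" if "x \<in> S" for x
    using g that unfolding dirichlet_zeta_def by (simp add: sums_iff)
  moreover have "g' s = - (\<Sum>n. of_real (ln (real (Suc n))) * of_nat (Suc n) powr - s)"
    and sm: "summable (\<lambda>n. of_real (ln (real (Suc n))) * of_nat (Suc n) powr - s)"
  proof -
    have *: "(\<lambda>n. - (of_real (ln (real (Suc n))) * of_nat (Suc n) powr - s)) sums g' s" using g a(2) by blast
    from sums_minus[OF this] have **: "(\<lambda>n. of_real (ln (real (Suc n))) * of_nat (Suc n) powr - s) sums (- g' s)"
      by simp
    thus "summable (\<lambda>n. of_real (ln (real (Suc n))) * of_nat (Suc n) powr - s)" by (rule sums_summable)
    show "g' s = - (\<Sum>n. of_real (ln (real (Suc n))) * of_nat (Suc n) powr - s)"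
      unfolding sums_unique[OF **, symmetric] by simp
  qed
  moreover have "(g has_field_derivative g' s) (at s)" using g a(2) by blast
  ultimately have "(g has_field_derivative - (\<Sum>n. of_real (ln (real (Suc n))) * of_nat (Suc n) powr - s)) (at s)"
    by (simp only:)
  thus "(dirichlet_zeta has_field_derivative - (\<Sum>n. of_real (ln (real (Suc n))) * of_nat (Suc n) powr - s)) (at s)"
    by (rule has_field_derivative_transform_within_open[OF _ opS a(2)]) fact
  show "summable (\<lambda>n. of_real (ln (real (Suc n))) * of_nat (Suc n) powr - s)" by fact
qed

lemma dirichlet_zeta_holomorphic: "dirichlet_zeta holomorphic_on {s. Re s > 1}"
  using dirichlet_zeta_deriv(1) by (subst holomorphic_on_open) (auto intro: open_halfspace_Re_gt)

lemma dirichlet_zeta_2_nz: "dirichlet_zeta 2 \<noteq> 0"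
proof
  assume *: "dirichlet_zeta 2 = 0"
  have eq: "of_nat (Suc n) powr - 2 = complex_of_real (real (Suc n) powr - 2)" for n
    using powr_of_real[of "real (Suc n)" "- 2"] by simp
  have "(\<lambda>n. complex_of_real (real (Suc n) powr - 2)) sums 0"
    using dirichlet_zeta_sums[of 2] * unfolding eq by simp
  hence "(\<lambda>n. real (Suc n) powr - 2) sums 0" using sums_of_real_iff[of _ 0, where 'a = complex] by simp
  moreover have "(\<Sum>n. real (Suc n) powr - 2) > 0"
    by (rule suminf_pos) (use summable_Suc_powr[of 2] in auto)
  ultimately show False by (simp add: sums_iff)
qed

definition mangoldt_series :: "complex \<Rightarrow> complex" where
  "mangoldt_series s = (\<Sum>n. mangoldt (Suc n) * of_nat (Suc n) powr - s)"

lemma mangoldt_le_ln: "(mangoldt (Suc n) :: real) \<le> ln (real (Suc n))"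
  using mangoldt_le[of "Suc n"] by simp

text \<open>With \<open>b = (a - 1) / 2\<close>, the bound \<open>ln n \<le> n powr b / b\<close>
  consumes only half of the excess of \<open>a\<close> over 1.\<close>

lemma mangoldt_norm_summable_real:
  assumes "a > 1"
  shows "summable (\<lambda>n. mangoldt (Suc n) * real (Suc n) powr - a)"
proof -
  define b where "b = (a - 1) / 2"
  have b: "b > 0" "- a + b < -1" using assms by (auto simp: b_def field_simps)
  have "summable (\<lambda>n. 1 / b * (real (Suc n) powr - (a - b)))"
    by (intro summable_mult summable_Suc_powr) (use b in auto)
  thus ?thesis
  proof (rule summable_comparison_test')
    fix n
    have "ln (real (Suc n)) \<le> real (Suc n) powr b / b"
      using ln_powr_bound[of "real (Suc n)" b] b by simp
    hence "mangoldt (Suc n) * real (Suc n) powr - a \<le> (real (Suc n) powr b / b) * real (Suc n) powr - a"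
      using mangoldt_le_ln[of n] by (intro mult_right_mono) auto
    also have "\<dots> = 1 / b * (real (Suc n) powr - (a - b))"
      by (simp add: powr_add[symmetric] del: of_nat_Suc)
    finally show "norm (mangoldt (Suc n) * real (Suc n) powr - a) \<le> 1 / b * (real (Suc n) powr - (a - b))"
      using mangoldt_nonneg[of "Suc n"] by (simp del: of_nat_Suc)
  qed
qed

lemma mangoldt_norm_summable:
  "Re s > 1 \<Longrightarrow> summable (\<lambda>n. norm (mangoldt (Suc n) * of_nat (Suc n) powr - s :: complex))"
  using mangoldt_norm_summable_real[of "Re s"] by (simp add: norm_mult norm_nat_powr del: of_nat_Suc)

text \<open>The values of \<Lambda> over the divisors of n add up to log n. The array
  \<open>f\<close> is supported on pairs (divisor, multiple), all indices being shifted by one; its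
  rows sum to the terms of the product, its columns to those of the logarithmic series.\<close>

lemma mangoldt_series_times_zeta:
  assumes s: "Re s > 1"
  shows "mangoldt_series s * dirichlet_zeta s = (\<Sum>n. of_real (ln (real (Suc n))) * of_nat (Suc n) powr - s)"
proof -
  define f :: "nat \<Rightarrow> nat \<Rightarrow> complex" where
    "f = (\<lambda>a n. if Suc a dvd Suc n then mangoldt (Suc a) * of_nat (Suc n) powr - s else 0)"
  define g where "g = (\<lambda>a b. Suc a * Suc b - 1)"
  have Sg: "Suc (g a b) = Suc a * Suc b" for a b by (simp add: g_def)
  have g: "strict_mono (g a)" for a
    unfolding strict_mono_Suc_iff by (simp add: g_def)
  have range: "f a n = 0" if "n \<notin> range (g a)" for a n
  proof -
    have "\<not> Suc a dvd Suc n"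
    proof
      assume "Suc a dvd Suc n"
      then obtain c where c: "Suc n = Suc a * c" by (auto elim: dvdE)
      then obtain b where "c = Suc b" by (cases c) auto
      hence "n = g a b" using c by (simp add: g_def)
      thus False using that by blast
    qed
    thus ?thesis by (simp add: f_def)
  qed
  have fg: "f a (g a b) = (mangoldt (Suc a) * of_nat (Suc a) powr - s) * of_nat (Suc b) powr - s" for a b
  proof -
    have "of_nat (Suc a * Suc b) powr - s = of_nat (Suc a) powr - s * (of_nat (Suc b) powr - s :: complex)"
      unfolding of_nat_mult
      using powr_times_real[of "of_nat (Suc a)" "of_nat (Suc b)" "- s"] by (simp del: of_nat_Suc)
    thus ?thesis by (simp only: f_def Sg dvd_triv_left if_True mult.assoc)
  qed
  have fs: "(\<lambda>n. f a n) sums ((mangoldt (Suc a) * of_nat (Suc a) powr - s) * dirichlet_zeta s)" for a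
  proof -
    have "(\<lambda>b. f a (g a b)) sums ((mangoldt (Suc a) * of_nat (Suc a) powr - s) * dirichlet_zeta s)"
      unfolding fg by (intro sums_mult dirichlet_zeta_sums s)
    thus ?thesis by (subst (asm) sums_mono_reindex[OF g range]) auto
  qed
  define Z where "Z = (\<Sum>n. norm (of_nat (Suc n) powr - s :: complex))"
  have nfs: "(\<lambda>n. norm (f a n)) sums (norm (mangoldt (Suc a) * of_nat (Suc a) powr - s :: complex) * Z)" for a
  proof -
    have "(\<lambda>b. norm (f a (g a b))) sums (norm (mangoldt (Suc a) * of_nat (Suc a) powr - s :: complex) * Z)"
      unfolding fg norm_mult Z_def by (intro sums_mult summable_sums dirichlet_zeta_norm_summable s)
    thus ?thesis using sums_mono_reindex[OF g, of a "\<lambda>n. norm (f a n)"] range by simp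
  qed
  have A: "summable (\<lambda>n. norm (f a n))" for a by (rule sums_summable[OF nfs])
  have B: "summable (\<lambda>a. \<Sum>n. norm (f a n))"
    unfolding sums_unique[OF nfs, symmetric] by (intro summable_mult2 mangoldt_norm_summable s)
  have "(\<lambda>n. \<Sum>a. f a n) sums (\<Sum>a. \<Sum>n. f a n)" by (rule sums_swap(2)[OF A B])
  also have "(\<Sum>a. \<Sum>n. f a n) = mangoldt_series s * dirichlet_zeta s"
    unfolding sums_unique[OF fs, symmetric] mangoldt_series_def
    by (rule suminf_mult2[symmetric]) (rule summable_norm_cancel[OF mangoldt_norm_summable[OF s]])
  also have "(\<lambda>n. \<Sum>a. f a n) = (\<lambda>n. of_real (ln (real (Suc n))) * of_nat (Suc n) powr - s)"
  proof
    fix n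
    have "(\<Sum>a. f a n) = (\<Sum>a | Suc a dvd Suc n. f a n)"
    proof (rule suminf_finite)
      have "{a. Suc a dvd Suc n} \<subseteq> {..n}" by (auto dest: dvd_imp_le)
      thus "finite {a. Suc a dvd Suc n}" by (rule finite_subset) simp
    qed (auto simp: f_def)
    also have "\<dots> = (\<Sum>a | Suc a dvd Suc n. mangoldt (Suc a)) * of_nat (Suc n) powr - s"
      by (simp add: f_def sum_distrib_right)
    also have "(\<Sum>a | Suc a dvd Suc n. mangoldt (Suc a)) = (\<Sum>d | d dvd Suc n. mangoldt d :: complex)"
    proof (rule sum.reindex_bij_betw)
      have "{d. d dvd Suc n} = Suc ` {a. Suc a dvd Suc n}"
      proof (intro equalityI subsetI)
        fix d assume "d \<in> {d. d dvd Suc n}"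
        moreover from this have "d \<noteq> 0" by (intro notI) simp
        then obtain a where "d = Suc a" by (cases d) auto
        ultimately show "d \<in> Suc ` {a. Suc a dvd Suc n}" by auto
      qed auto
      thus "bij_betw Suc {a. Suc a dvd Suc n} {d. d dvd Suc n}" by (simp add: bij_betw_def)
    qed
    also have "\<dots> = of_real (ln (real (Suc n)))" by (rule mangoldt_sum) simp
    finally show "(\<Sum>a. f a n) = of_real (ln (real (Suc n))) * of_nat (Suc n) powr - s" .
  qed
  finally show ?thesis by (simp add: sums_iff)
qed

lemma mangoldt_series_holomorphic: "mangoldt_series holomorphic_on {s. Re s > 1}"
  unfolding mangoldt_series_def
proof (rule holomorphic_on_suminf)
  show "open {s. Re s > 1}" by (rule open_halfspace_Re_gt)
  show "(\<lambda>s. mangoldt (Suc n) * of_nat (Suc n) powr - s) holomorphic_on {s. Re s > 1}" for n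
    by (intro holomorphic_intros) (auto simp del: of_nat_Suc)
  fix z assume "z \<in> {s. Re s > 1}"
  hence z: "Re z > 1" by simp
  define r where "r = (Re z - 1) / 2"
  have r: "r > 0" "Re z - r > 1" using z by (auto simp: r_def field_simps)
  have Re: "Re w \<ge> Re z - r" if "w \<in> cball z r" for w
    using that abs_Re_le_cmod[of "z - w"] by (simp add: dist_norm)
  have "norm (mangoldt (Suc n) * of_nat (Suc n) powr - w :: complex) \<le> mangoldt (Suc n) * real (Suc n) powr - (Re z - r)"
    if "w \<in> cball z r" for n w
    unfolding norm_mult norm_nat_powr norm_mangoldt using Re[OF that]
    by (intro mult_left_mono powr_mono mangoldt_nonneg) auto
  thus "\<exists>r>0. \<exists>M. cball z r \<subseteq> {s. Re s > 1} \<and> summable M \<and>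
      (\<forall>n. \<forall>w\<in>cball z r. norm (mangoldt (Suc n) * of_nat (Suc n) powr - w :: complex) \<le> M n)"
    using mangoldt_norm_summable_real[OF r(2)] r Re
    by (intro exI[of _ r] exI[of _ "\<lambda>n. mangoldt (Suc n) * real (Suc n) powr - (Re z - r)"] conjI)
       (fastforce)+
qed

text \<open>\<open>D' = - M D\<close> for the Dirichlet series \<open>D\<close> of zeta and \<open>M\<close> of \<open>\<Lambda>\<close>, so \<open>D exp (\<integral>M)\<close> is constant.\<close>

lemma dirichlet_zeta_nz:
  assumes s: "Re s > 1"
  shows "dirichlet_zeta s \<noteq> 0"
proof
  assume zero: "dirichlet_zeta s = 0"
  define S where "S = {s. Re s > 1}"
  have S: "open S" "convex S" unfolding S_def by (auto intro: open_halfspace_Re_gt convex_halfspace_Re_gt)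
  obtain P where P: "\<And>x. x \<in> S \<Longrightarrow> (P has_field_derivative mangoldt_series x) (at x within S)"
    using holomorphic_convex_primitive'[OF S(2,1)] mangoldt_series_holomorphic unfolding S_def by blast
  have "((\<lambda>x. dirichlet_zeta x * exp (P x)) has_field_derivative 0) (at x within S)" if "x \<in> S" for x
  proof -
    have D: "(dirichlet_zeta has_field_derivative - (mangoldt_series x * dirichlet_zeta x)) (at x within S)"
      using dirichlet_zeta_deriv(1)[of x] that mangoldt_series_times_zeta[of x]
      by (auto simp: S_def intro: has_field_derivative_at_within)
    show ?thesis
      by (rule derivative_eq_intros D P that refl)+ simp
  qed
  hence "\<exists>c. \<forall>x\<in>S. dirichlet_zeta x * exp (P x) = c"
    by (rule has_field_derivative_zero_constant[OF S(2)])
  then obtain c where c: "\<And>x. x \<in> S \<Longrightarrow> dirichlet_zeta x * exp (P x) = c" by blast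
  have "c = 0" using c[of s] zero s by (simp add: S_def)
  thus False using c[of 2] dirichlet_zeta_2_nz by (simp add: S_def)
qed

section \<open>The entire function (s - 1) zeta(s) and the identification of zeta\<close>

definition zeta1 :: "complex \<Rightarrow> complex" where
  "zeta1 s = rGamma s + (s - 1) * zcoeff_reg 0 s"

lemma zeta1_holomorphic: "zeta1 holomorphic_on A"
  unfolding zeta1_def by (intro holomorphic_intros zcoeff_reg_holomorphic)

lemma zeta1_1 [simp]: "zeta1 1 = 1"
  by (simp add: zeta1_def)

lemma zcoeff_0: "s \<noteq> 1 \<Longrightarrow> zcoeff 0 s = zeta1 s / (s - 1)"
  by (simp add: zcoeff_def zeta1_def field_simps)

text \<open>Tannery's theorem, with the terms of the absolutely convergent zeta series as
  majorant.\<close>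

lemma expzeta_tendsto:
  assumes "Re s > 1"
  shows "((\<lambda>t. expzeta s t) \<longlongrightarrow> dirichlet_zeta s) (at_right 0)"
proof -
  have "eventually (\<lambda>t. summable (\<lambda>n. norm (of_nat (Suc n) powr - s * complex_of_real (exp (- (real (Suc n) * t)))))) (at_right 0) \<and>
      summable (\<lambda>n. norm (of_nat (Suc n) powr - s :: complex)) \<and>
      ((\<lambda>t. \<Sum>n. of_nat (Suc n) powr - s * complex_of_real (exp (- (real (Suc n) * t)))) \<longlongrightarrow> (\<Sum>n. of_nat (Suc n) powr - s)) (at_right 0)"
  proof (rule tannerys_theorem[OF _ _ dirichlet_zeta_norm_summable[OF assms]])
    show "((\<lambda>t. of_nat (Suc n) powr - s * complex_of_real (exp (- (real (Suc n) * t)))) \<longlongrightarrow> of_nat (Suc n) powr - s) (at_right 0)" for n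
      by (auto intro!: tendsto_eq_intros)
    have "eventually (\<lambda>t::real. t > 0) (at_right 0)" by (rule eventually_at_right_less)
    hence "eventually (\<lambda>(n::nat, t). t > 0) (at_top \<times>\<^sub>F at_right (0::real))"
      by (subst eventually_prod2) (simp_all add: trivial_limit_at_top_linorder)
    thus "\<forall>\<^sub>F (n, t) in at_top \<times>\<^sub>F at_right 0.
        norm (of_nat (Suc n) powr - s * complex_of_real (exp (- (real (Suc n) * t)))) \<le> norm (of_nat (Suc n) powr - s :: complex)"
      by eventually_elim (auto simp: norm_mult mult_left_le)
  qed simp
  thus ?thesis unfolding expzeta_def dirichlet_zeta_def by blast
qed

text \<open>Let \<open>t\<close> tend to 0 from the right in the expansion: for
  \<open>Re s > 1\<close> the term with \<open>t powr (s - 1)\<close> vanishes, and of the power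
  series only the coefficient of index 0 survives.\<close>

lemma dirichlet_zeta_eq_zcoeff:
  assumes s: "Re s > 1" "s \<notin> posints"
  shows "dirichlet_zeta s = zcoeff 0 s"
proof -
  define f where "f = (\<lambda>x. \<Sum>k. zcoeff k s * x ^ k)"
  have "(f \<longlongrightarrow> zcoeff 0 s) (at 0)"
    unfolding f_def
    by (rule powser_limit_0[of "1/2"])
       (auto intro!: summable_sums summable_norm_cancel[OF zcoeff_summable[OF s(2)]])
  moreover have "filterlim complex_of_real (at 0) (at_right 0)"
    unfolding filterlim_at by (auto intro!: tendsto_eq_intros simp: eventually_at_right_field intro: exI[of _ 1])
  ultimately have 1: "((\<lambda>t. f (of_real t)) \<longlongrightarrow> zcoeff 0 s) (at_right 0)"
    by (rule filterlim_compose)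
  have 2: "((\<lambda>t. Gamma (1 - s) * complex_of_real t powr (s - 1)) \<longlongrightarrow> Gamma (1 - s) * 0) (at_right 0)"
  proof (rule tendsto_mult[OF tendsto_const], rule tendsto_norm_zero_cancel)
    have "eventually (\<lambda>t::real. 0 \<le> t) (at_right 0)"
      using eventually_at_right_less[of "0::real"] by eventually_elim simp
    hence "((\<lambda>t::real. t powr (Re s - 1)) \<longlongrightarrow> 0) (at_right 0)"
      using s by (intro tendsto_zero_powrI[OF tendsto_ident_at tendsto_const]) simp_all
    moreover have "eventually (\<lambda>t. norm (complex_of_real t powr (s - 1)) = t powr (Re s - 1)) (at_right 0)"
      using eventually_at_right_less[of "0::real"] by eventually_elim (simp add: norm_powr_real_powr)
    ultimately show "((\<lambda>t. norm (complex_of_real t powr (s - 1))) \<longlongrightarrow> 0) (at_right 0)"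
      by (simp add: tendsto_cong)
  qed
  have "eventually (\<lambda>t::real. t \<in> {0<..<1/2}) (at_right 0)" by (rule eventually_at_rightI[of 0 "1/2"]) auto
  hence "eventually (\<lambda>t. expzeta s t - Gamma (1 - s) * complex_of_real t powr (s - 1) = f (of_real t)) (at_right 0)"
  proof eventually_elim
    case (elim t)
    thus ?case using expzeta_expansion[of t s] s(2) unfolding f_def by (auto simp: sums_iff)
  qed
  with tendsto_diff[OF expzeta_tendsto[OF s(1)] 2]
  have "((\<lambda>t. f (of_real t)) \<longlongrightarrow> dirichlet_zeta s - Gamma (1 - s) * 0) (at_right 0)"
    by (rule Lim_transform_eventually)
  thus ?thesis using tendsto_unique[OF _ 1] by simp
qed

text \<open>The expansion excludes positive integers \<open>s\<close>; the identity theorem fills in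
  those above 1.\<close>

lemma dirichlet_zeta_eq:
  assumes s: "Re s > 1"
  shows "dirichlet_zeta s = zeta1 s / (s - 1)"
proof (rule analytic_continuation_open[where s = "{s. Re s > 1} - posints" and s' = "{s. Re s > 1}" and f = dirichlet_zeta])
  show "{s. Re s > 1} - posints \<noteq> {}"
  proof -
    have "Complex 2 1 \<notin> posints" unfolding posints_def by (auto simp: complex_eq_iff)
    thus ?thesis by (intro ex_in_conv[THEN iffD1] exI[of _ "Complex 2 1"]) auto
  qed
  show "(\<lambda>s. zeta1 s / (s - 1)) holomorphic_on {s. Re s > 1}"
    by (intro holomorphic_intros zeta1_holomorphic) auto
  show "dirichlet_zeta z = zeta1 z / (z - 1)" if "z \<in> {s. Re s > 1} - posints" for z
    using that dirichlet_zeta_eq_zcoeff[of z] zcoeff_0[of z] by (cases "z = 1") auto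
qed (use s in \<open>auto intro!: dirichlet_zeta_holomorphic open_Diff open_halfspace_Re_gt closed_posints convex_connected convex_halfspace_Re_gt\<close>)

lemma zeta_infsum: "Re s > 1 \<Longrightarrow> (\<Sum>\<^sub>\<infinity>n\<in>{1::nat..}. 1 / of_nat n powr s) = dirichlet_zeta s"
proof -
  assume s: "Re s > 1"
  have "{1::nat..} = Suc ` UNIV" 
  proof (intro equalityI subsetI)
    fix n :: nat assume "n \<in> {1..}"
    thus "n \<in> Suc ` UNIV" by (intro image_eqI[of _ _ "n - 1"]) auto
  qed auto
  hence "(\<Sum>\<^sub>\<infinity>n\<in>{1::nat..}. 1 / of_nat n powr s) = (\<Sum>\<^sub>\<infinity>n. 1 / of_nat (Suc n) powr s)"
    using infsum_reindex[of Suc UNIV "\<lambda>n. 1 / of_nat n powr s"] by (simp add: o_def)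
  also have "\<dots> = (\<Sum>\<^sub>\<infinity>n. of_nat (Suc n) powr - s)"
    by (simp add: powr_minus divide_inverse del: of_nat_Suc)
  also have "\<dots> = dirichlet_zeta s"
    by (rule infsumI, rule norm_summable_imp_has_sum[OF dirichlet_zeta_norm_summable[OF s] dirichlet_zeta_sums[OF s]])
  finally show ?thesis .
qed

text \<open>The function \<open>zeta1 s / (s - 1)\<close> witnesses the existence of what
  \<open>zeta\<close> selects, and the identity theorem on the connected set \<open>- {1}\<close>
  shows that the selected function coincides with it there.\<close>

theorem zeta_eq:
  assumes s: "s \<noteq> 1"
  shows "zeta s = zeta1 s / (s - 1)"
proof -
  have "(\<lambda>s. zeta1 s / (s - 1)) holomorphic_on - {1} \<and>
      (\<forall>s. Re s > 1 \<longrightarrow> zeta1 s / (s - 1) = (\<Sum>\<^sub>\<infinity>n\<in>{1::nat..}. 1 / of_nat n powr s))"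
  proof (intro conjI allI impI)
    show "(\<lambda>s. zeta1 s / (s - 1)) holomorphic_on - {1}"
      by (intro holomorphic_intros zeta1_holomorphic) auto
  qed (simp only: zeta_infsum dirichlet_zeta_eq)
  hence "\<exists>f. f holomorphic_on - {1} \<and>
      (\<forall>s. Re s > 1 \<longrightarrow> f s = (\<Sum>\<^sub>\<infinity>n\<in>{1::nat..}. 1 / of_nat n powr s))"
    by (rule exI[where x = "\<lambda>s. zeta1 s / (s - 1)"])
  hence *: "zeta holomorphic_on - {1} \<and> (\<forall>s. Re s > 1 \<longrightarrow> zeta s = (\<Sum>\<^sub>\<infinity>n\<in>{1::nat..}. 1 / of_nat n powr s))"
    unfolding zeta_def by (rule someI_ex)
  show ?thesis
  proof (rule analytic_continuation_open[where s = "{s. Re s > 1}" and s' = "- {1}" and f = zeta])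
    show "connected (- {1 :: complex})" by (rule connected_punctured_universe) simp
    show "{s. Re s > 1} \<noteq> {}" by (intro ex_in_conv[THEN iffD1] exI[of _ 2]) simp
    show "(\<lambda>s. zeta1 s / (s - 1)) holomorphic_on - {1}"
      by (intro holomorphic_intros zeta1_holomorphic) auto
    show "zeta z = zeta1 z / (z - 1)" if "z \<in> {s. Re s > 1}" for z
      using that * by (simp add: zeta_infsum dirichlet_zeta_eq del: One_nat_def)
  qed (use s * in \<open>auto intro!: open_halfspace_Re_gt\<close>)
qed

text \<open>Double sums are enumerated by a pairing function so that the results on exponential sums
  over sequences apply to them; unconditional summability makes the value independent of the
  enumeration.\<close>

lemma prod_decode_product:
  fixes F G :: "nat \<Rightarrow> complex"
  assumes F: "summable (\<lambda>n. norm (F n))" and G: "summable (\<lambda>n. norm (G n))"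
  shows "summable (\<lambda>n. norm (F (fst (prod_decode n)) * G (snd (prod_decode n))))"
    and "(\<lambda>n. F (fst (prod_decode n)) * G (snd (prod_decode n))) sums ((\<Sum>n. F n) * (\<Sum>n. G n))"
proof -
  define P where "P = (\<lambda>p. F (fst p) * G (snd p))"
  have F': "(\<lambda>n. norm (F n)) summable_on UNIV" and G': "(\<lambda>n. norm (G n)) summable_on UNIV"
    using F G by (simp_all add: summable_on_UNIV_nonneg_real_iff)
  have "(\<lambda>p. norm (P p)) summable_on Sigma UNIV (\<lambda>_. UNIV)"
    unfolding Infinite_Sum.abs_summable_on_Sigma_iff
  proof (intro conjI ballI)
    show "(\<lambda>y. norm (P (x, y))) summable_on UNIV" for x
      unfolding P_def norm_mult fst_conv snd_conv by (rule summable_on_cmult_right[OF G'])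
    have "(\<Sum>\<^sub>\<infinity>y. norm (P (x, y))) = norm (F x) * (\<Sum>\<^sub>\<infinity>y. norm (G y))" for x
      unfolding P_def norm_mult fst_conv snd_conv by (rule infsum_cmult_right) (use G' in simp)
    moreover have "norm (norm (F x) * (\<Sum>\<^sub>\<infinity>y. norm (G y))) = norm (F x) * (\<Sum>\<^sub>\<infinity>y. norm (G y))" for x
      by (simp add: abs_mult infsum_nonneg)
    ultimately show "(\<lambda>x. norm (\<Sum>\<^sub>\<infinity>y. norm (P (x, y)))) summable_on UNIV"
      by (simp only:) (rule summable_on_cmult_left[OF F'])
  qed
  hence nP: "(\<lambda>p. norm (P p)) summable_on UNIV" by simp
  have "(\<lambda>n. norm (P (prod_decode n))) summable_on UNIV"
    using summable_on_reindex_bij_betw[OF bij_prod_decode, of "\<lambda>p. norm (P p)"] nP by simp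
  thus "summable (\<lambda>n. norm (F (fst (prod_decode n)) * G (snd (prod_decode n))))"
    unfolding P_def by (subst (asm) summable_on_UNIV_nonneg_real_iff) auto
  have sP: "P summable_on UNIV" using nP by (rule abs_summable_summable)
  have "infsum P UNIV = (\<Sum>\<^sub>\<infinity>x. \<Sum>\<^sub>\<infinity>y. P (x, y))"
    using infsum_Sigma'_banach[of "\<lambda>x y. P (x, y)" UNIV "\<lambda>_. UNIV"] sP by simp
  also have "\<dots> = (\<Sum>\<^sub>\<infinity>x. F x * (\<Sum>\<^sub>\<infinity>y. G y))"
    unfolding P_def fst_conv snd_conv
    by (intro infsum_cong infsum_cmult_right abs_summable_summable[OF G'])
  also have "\<dots> = (\<Sum>\<^sub>\<infinity>x. F x) * (\<Sum>\<^sub>\<infinity>y. G y)"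
    by (intro infsum_cmult_left abs_summable_summable[OF F'])
  also have "(\<Sum>\<^sub>\<infinity>x. F x) = (\<Sum>x. F x)"
    by (rule infsumI[OF norm_summable_imp_has_sum[OF F summable_sums[OF summable_norm_cancel[OF F]]]])
  also have "(\<Sum>\<^sub>\<infinity>x. G x) = (\<Sum>x. G x)"
    by (rule infsumI[OF norm_summable_imp_has_sum[OF G summable_sums[OF summable_norm_cancel[OF G]]]])
  finally have "(P has_sum ((\<Sum>n. F n) * (\<Sum>n. G n))) UNIV" using has_sum_infsum[OF sP] by simp
  hence "((\<lambda>n. P (prod_decode n)) has_sum ((\<Sum>n. F n) * (\<Sum>n. G n))) UNIV"
    using has_sum_reindex_bij_betw[OF bij_prod_decode, of P] by simp
  from has_sum_imp_sums[OF this]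
  show "(\<lambda>n. F (fst (prod_decode n)) * G (snd (prod_decode n))) sums ((\<Sum>n. F n) * (\<Sum>n. G n))"
    by (simp add: P_def)
qed

text \<open>The continuation of \<open>- \<zeta>' / \<zeta>\<close>, since \<open>\<zeta>(s) = zeta1 s / (s - 1)\<close>.\<close>

definition zM :: "complex \<Rightarrow> complex" where
  "zM s = 1 / (s - 1) - deriv zeta1 s / zeta1 s"

lemma zeta1_nz: "Re s > 1 \<Longrightarrow> zeta1 s \<noteq> 0"
  using dirichlet_zeta_nz[of s] dirichlet_zeta_eq[of s] by auto

lemma zeta1_has_deriv: "(zeta1 has_field_derivative deriv zeta1 s) (at s)"
  by (rule holomorphic_derivI[OF zeta1_holomorphic open_UNIV UNIV_I])

text \<open>Two derivatives of the same function are compared: the quotient rule for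
  \<open>zeta1 s / (s - 1)\<close>, and the differentiated Dirichlet series, which is minus the
  product of the von Mangoldt series with zeta.\<close>

lemma zM_eq_mangoldt_series:
  assumes s: "Re s > 1"
  shows "zM s = mangoldt_series s"
proof -
  have s1: "s - 1 \<noteq> 0" using s by auto
  have "((\<lambda>s. zeta1 s / (s - 1)) has_field_derivative
      (deriv zeta1 s * (s - 1) - zeta1 s * 1) / ((s - 1) * (s - 1))) (at s)"
    by (rule derivative_eq_intros zeta1_has_deriv refl s1)+ simp
  moreover have "((\<lambda>s. zeta1 s / (s - 1)) has_field_derivative - (mangoldt_series s * dirichlet_zeta s)) (at s)"
  proof (rule has_field_derivative_transform_within_open[OF _ open_halfspace_Re_gt[of 1]])
    show "(dirichlet_zeta has_field_derivative - (mangoldt_series s * dirichlet_zeta s)) (at s)"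
      using dirichlet_zeta_deriv(1)[OF s] mangoldt_series_times_zeta[OF s] by simp
  qed (use s in \<open>auto simp: dirichlet_zeta_eq\<close>)
  ultimately have "(deriv zeta1 s * (s - 1) - zeta1 s * 1) / ((s - 1) * (s - 1)) = - (mangoldt_series s * (zeta1 s / (s - 1)))"
    using DERIV_unique dirichlet_zeta_eq[OF s] by metis
  hence E: "(deriv zeta1 s * (s - 1) - zeta1 s * 1) / ((s - 1) * (s - 1)) = - (mangoldt_series s * (zeta1 s / (s - 1)))" .
  define u where "u = s - 1"
  have u0: "u \<noteq> 0" using s1 by (simp add: u_def)
  have "u * (deriv zeta1 s * u - zeta1 s) = u * (- (mangoldt_series s * zeta1 s * u))"
    using E u0 unfolding u_def[symmetric] by (simp add: field_simps)
  hence "deriv zeta1 s * u - zeta1 s = - (mangoldt_series s * zeta1 s * u)"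
    using mult_left_cancel[OF u0] by blast
  thus ?thesis using s1 zeta1_nz[OF s] unfolding zM_def u_def[symmetric] by (simp add: field_simps)
qed

section \<open>Poles of zeta'/zeta and the truncated Mellin transform of the von Mangoldt
  exponential sum\<close>

definition zM_poles :: "complex set" where "zM_poles = {s. s = 1 \<or> zeta1 s = 0}"

text \<open>A logarithmic derivative has only simple poles. The numerator \<open>\<mu>\<close> takes
  the value 1 at the pole 1 of zeta, minus the multiplicity at a zero of \<open>zeta1\<close>, and 0
  elsewhere; the cases are disjoint by \<open>zeta1_1\<close>.\<close>

lemma zM_local:
  "\<exists>e>0. \<exists>\<mu>. \<mu> holomorphic_on ball c e \<and>
     (\<forall>s\<in>ball c e - {c}. s \<notin> zM_poles \<and> zM s = \<mu> s / (s - c)) \<and> (\<mu> c \<noteq> 0 \<longleftrightarrow> c \<in> zM_poles)"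
proof (cases "zeta1 c = 0")
  case False
  have "open (zeta1 -` (- {0}))"
    by (rule open_vimage[OF _ holomorphic_on_imp_continuous_on[OF zeta1_holomorphic]]) (intro open_Compl closed_singleton)
  moreover have "c \<in> zeta1 -` (- {0})" using False by simp
  ultimately obtain e1 where e1: "e1 > 0" "ball c e1 \<subseteq> zeta1 -` (- {0})" by (rule openE)
  define e where "e = (if c = 1 then e1 else min e1 (dist c 1))"
  have e: "e > 0" "ball c e \<subseteq> ball c e1" using e1 by (auto simp: e_def)
  have nz: "zeta1 s \<noteq> 0" if "s \<in> ball c e" for s using e1 e that by blast
  have n1: "s \<noteq> 1" if "s \<in> ball c e - {c}" for s using that by (auto simp: e_def split: if_splits)
  define \<mu> where "\<mu> = (\<lambda>s. (if c = 1 then 1 else (s - c) / (s - 1)) - (s - c) * (deriv zeta1 s / zeta1 s))"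
  have "(\<lambda>s. (if c = 1 then 1 else (s - c) / (s - 1))) holomorphic_on ball c e"
  proof (cases "c = 1")
    case False
    hence "s \<noteq> 1" if "s \<in> ball c e" for s using n1[of s] that by (cases "s = c") auto
    thus ?thesis using False by (auto intro!: holomorphic_intros)
  qed auto
  hence "\<mu> holomorphic_on ball c e"
    unfolding \<mu>_def using nz by (intro holomorphic_intros holomorphic_deriv zeta1_holomorphic) auto
  moreover have "s \<notin> zM_poles \<and> zM s = \<mu> s / (s - c)" if s: "s \<in> ball c e - {c}" for s
  proof -
    have sc: "s - c \<noteq> 0" using s by auto
    have "\<mu> s / (s - c) = (if c = 1 then 1 else (s - c) / (s - 1)) / (s - c) - deriv zeta1 s / zeta1 s"
      unfolding \<mu>_def using sc by (subst diff_divide_distrib) simp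
    also have "\<dots> = zM s" using sc by (simp add: zM_def)
    finally show ?thesis using nz[of s] n1[OF s] s by (simp add: zM_poles_def)
  qed
  moreover have "\<mu> c \<noteq> 0 \<longleftrightarrow> c \<in> zM_poles" using False by (auto simp: \<mu>_def zM_poles_def)
  ultimately show ?thesis using e(1) by blast
next
  case True
  have c1: "c \<noteq> 1" using True by auto
  have nonconst: "\<not> zeta1 constant_on UNIV"
    using True c1 zeta1_1 unfolding constant_on_def by (metis UNIV_I zero_neq_one)
  obtain g r n where g: "0 < n" "0 < r" "g holomorphic_on ball c r"
      "\<And>w. w \<in> ball c r \<Longrightarrow> zeta1 w = (w - c) ^ n * g w" "\<And>w. w \<in> ball c r \<Longrightarrow> g w \<noteq> 0"
    using holomorphic_factor_zero_nonconstant[OF zeta1_holomorphic open_UNIV connected_UNIV UNIV_I True nonconst]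
    by metis
  define e where "e = min r (dist c 1)"
  have e: "e > 0" "ball c e \<subseteq> ball c r" using g c1 by (auto simp: e_def)
  have n1: "s \<noteq> 1" if "s \<in> ball c e" for s using that by (auto simp: e_def)
  define \<mu> where "\<mu> = (\<lambda>s. (s - c) / (s - 1) - of_nat n - (s - c) * (deriv g s / g s))"
  have holg: "g holomorphic_on ball c e" using g(3) e(2) holomorphic_on_subset by blast
  have "\<mu> holomorphic_on ball c e"
    unfolding \<mu>_def using n1 g(5) e(2) by (intro holomorphic_intros holomorphic_deriv holg) auto
  moreover have "s \<notin> zM_poles \<and> zM s = \<mu> s / (s - c)" if s: "s \<in> ball c e - {c}" for s
  proof -
    have sr: "s \<in> ball c r" "s \<in> ball c e" "s - c \<noteq> 0" using s e(2) by auto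
    have z: "zeta1 s = (s - c) ^ n * g s" "g s \<noteq> 0" using g(4,5) sr by auto
    have "((\<lambda>w. (w - c) ^ n * g w) has_field_derivative
        of_nat n * (s - c) ^ (n - 1) * g s + (s - c) ^ n * deriv g s) (at s)"
      using holomorphic_derivI[OF holg open_ball sr(2)]
      by (auto intro!: derivative_eq_intros simp: mult_ac)
    hence "(zeta1 has_field_derivative
        of_nat n * (s - c) ^ (n - 1) * g s + (s - c) ^ n * deriv g s) (at s)"
      by (rule has_field_derivative_transform_within_open[OF _ open_ball sr(1)]) (use g(4) in auto)
    hence d: "deriv zeta1 s = of_nat n * (s - c) ^ (n - 1) * g s + (s - c) ^ n * deriv g s"
      by (rule DERIV_imp_deriv)
    have aux: "(a * p * q + v * p * b) / (v * p * q) = a / v + b / q"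
      if "v \<noteq> 0" "p \<noteq> 0" "q \<noteq> 0" for a b p q v :: complex
      using that by (simp add: field_simps)
    have pw: "(s - c) ^ n = (s - c) * (s - c) ^ (n - 1)" using g(1) by (simp add: power_eq_if)
    have "deriv zeta1 s / zeta1 s = of_nat n / (s - c) + deriv g s / g s"
      unfolding d z(1) unfolding pw by (rule aux) (use z(2) sr(3) in auto)
    moreover have aux2: "(v / w - a - v * b) / v = 1 / w - (a / v + b)" if "v \<noteq> 0" for a b v w :: complex
      using that by (simp add: diff_divide_distrib)
    have "\<mu> s / (s - c) = 1 / (s - 1) - (of_nat n / (s - c) + deriv g s / g s)"
      unfolding \<mu>_def by (rule aux2[OF sr(3)])
    ultimately have "zM s = \<mu> s / (s - c)" by (simp add: zM_def)
    moreover have "s \<notin> zM_poles" using n1[OF sr(2)] z sr(3) by (simp add: zM_poles_def)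
    ultimately show ?thesis by simp
  qed
  moreover have "\<mu> c \<noteq> 0 \<longleftrightarrow> c \<in> zM_poles" using True g(1) by (auto simp: \<mu>_def zM_poles_def)
  ultimately show ?thesis using e(1) by blast
qed

definition expmangoldt :: "real \<Rightarrow> complex" where
  "expmangoldt t = (\<Sum>n. mangoldt (Suc n) * of_real (exp (- (real (Suc n) * t))))"

lemma mangoldt_le_real: "(mangoldt (Suc n) :: real) \<le> real (Suc n)"
  using mangoldt_le_ln[of n] ln_le_minus_one[of "real (Suc n)"] by simp

lemma expmangoldt_norm_summable:
  assumes "t > 0"
  shows "summable (\<lambda>n. norm (mangoldt (Suc n) :: complex) * exp (- (real (Suc n) * t)))"
proof (rule summable_comparison_test'[OF summable_poly_exp[OF assms, of 1]])
  show "norm (norm (mangoldt (Suc n) :: complex) * exp (- (real (Suc n) * t))) \<le> real (Suc n) ^ 1 * exp (- (real (Suc n) * t))" for n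
    using mangoldt_le_real[of n] mangoldt_nonneg[of "Suc n"] by (simp add: abs_mult del: of_nat_Suc)
qed

text \<open>The contribution of t \<ge> 1/2, to be subtracted from the full Mellin transform; the
  exponential decay of \<open>inc_Gamma\<close> makes it entire.\<close>

definition zE :: "complex \<Rightarrow> complex" where
  "zE s = (\<Sum>n. mangoldt (Suc n) * inc_Gamma (1/2) s (real (Suc n)))"

lemma zE_term_bound:
  assumes "norm (inc_Gamma (1/2) s (real (Suc n))) \<le> C * exp (- (1/2 * real (Suc n)))" "C \<ge> 0"
  shows "norm (mangoldt (Suc n) * inc_Gamma (1/2) s (real (Suc n))) \<le> C * (real (Suc n) ^ 1 * exp (- (real (Suc n) * (1/2))))"
proof -
  have "norm (mangoldt (Suc n) * inc_Gamma (1/2) s (real (Suc n))) \<le> real (Suc n) * (C * exp (- (1/2 * real (Suc n))))"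
    unfolding norm_mult norm_mangoldt using assms mangoldt_le_real[of n] by (intro mult_mono) auto
  thus ?thesis by (simp add: mult_ac del: of_nat_Suc)
qed

lemma zE_majorant:
  "\<exists>M. summable M \<and> (\<forall>n s. norm s \<le> R \<longrightarrow> norm (mangoldt (Suc n) * inc_Gamma (1/2) s (real (Suc n))) \<le> M n)"
proof -
  obtain C where C: "C \<ge> 0" "\<forall>s x. norm s \<le> R \<longrightarrow> x \<ge> 1 \<longrightarrow> norm (inc_Gamma (1/2) s x) \<le> C * exp (- (1/2 * x))"
    using inc_Gamma_bound_ball[of "1/2" R] by auto
  have "norm (mangoldt (Suc n) * inc_Gamma (1/2) s (real (Suc n))) \<le> C * (real (Suc n) ^ 1 * exp (- (real (Suc n) * (1/2))))"
    if "norm s \<le> R" for n s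
    by (rule zE_term_bound[OF _ C(1)]) (use C(2)[rule_format, OF that, of "real (Suc n)"] in simp)
  moreover have "summable (\<lambda>n. C * (real (Suc n) ^ 1 * exp (- (real (Suc n) * (1/2)))))"
    by (intro summable_mult summable_poly_exp) simp
  ultimately show ?thesis by (intro exI[of _ "\<lambda>n. C * (real (Suc n) ^ 1 * exp (- (real (Suc n) * (1/2))))"]) simp
qed

lemma zE_holomorphic: "zE holomorphic_on A"
proof -
  have "zE holomorphic_on UNIV" unfolding zE_def
    by (intro entire_suminf zE_majorant holomorphic_intros inc_Gamma_holomorphic) auto
  thus ?thesis by (rule holomorphic_on_subset) simp
qed

lemma zE_summable: "summable (\<lambda>n. mangoldt (Suc n) * inc_Gamma (1/2) s (real (Suc n)))"
  using zE_majorant[of "norm s"] by (auto intro: summable_comparison_test')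

definition zH :: "complex \<Rightarrow> complex" where "zH s = Gamma s * zM s - zE s"

text \<open>Termwise integration gives the full Mellin transform
  \<open>Gamma s * mangoldt_series s\<close> minus the tail \<open>zE s\<close>. Replacing the
  series by \<open>zM\<close> is what continues the integral beyond \<open>Re s > 1\<close>.\<close>

lemma zH_integral:
  assumes s: "Re s > 1"
  shows "set_integrable lborel {0<..<1/2} (\<lambda>t. of_real t powr (s - 1) * expmangoldt t)"
    and "(LINT t:{0<..<1/2}|lborel. of_real t powr (s - 1) * expmangoldt t) = zH s"
proof -
  have s0: "Re s > 0" using s by simp
  have c: "summable (\<lambda>n. norm (mangoldt (Suc n) :: complex) * real (Suc n) powr - Re s)"
    using mangoldt_norm_summable_real[OF s] by simp
  have x: "1 \<le> real (Suc n)" for n by simp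
  note ms = mellin_exp_sum[OF s0 x _ _ c expmangoldt_norm_summable, of "1/2"]
  show "set_integrable lborel {0<..<1/2} (\<lambda>t. of_real t powr (s - 1) * expmangoldt t)"
    unfolding expmangoldt_def by (rule ms(1)) auto
  have 1: "(\<lambda>n. mangoldt (Suc n) * (Gamma s * of_nat (Suc n) powr - s - inc_Gamma (1/2) s (real (Suc n)))) sums
     (LINT t:{0<..<1/2}|lborel. of_real t powr (s - 1) * expmangoldt t)"
    using ms(2) unfolding expmangoldt_def by simp
  have "(\<lambda>n. Gamma s * (mangoldt (Suc n) * of_nat (Suc n) powr - s) - mangoldt (Suc n) * inc_Gamma (1/2) s (real (Suc n))) sums
      (Gamma s * mangoldt_series s - zE s)"
    unfolding mangoldt_series_def zE_def
    by (intro sums_diff sums_mult summable_sums zE_summable summable_norm_cancel[OF mangoldt_norm_summable[OF s]])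
  also have "(\<lambda>n. Gamma s * (mangoldt (Suc n) * of_nat (Suc n) powr - s) - mangoldt (Suc n) * inc_Gamma (1/2) s (real (Suc n))) =
      (\<lambda>n. mangoldt (Suc n) * (Gamma s * of_nat (Suc n) powr - s - inc_Gamma (1/2) s (real (Suc n))))"
    by (simp add: algebra_simps del: of_nat_Suc)
  finally show "(LINT t:{0<..<1/2}|lborel. of_real t powr (s - 1) * expmangoldt t) = zH s"
    using sums_unique2[OF 1] zM_eq_mangoldt_series[OF s] by (simp add: zH_def)
qed

text \<open>Raising \<open>s\<close> by \<open>k\<close> multiplies the integrand by
  \<open>t ^ k \<le> (1/2) ^ k\<close>, and what remains is dominated by the integrand at the real
  point \<open>a\<close>.\<close>

lemma zH_bound:
  assumes "a > 1"
  shows "\<exists>C\<ge>0. \<forall>s k. Re s \<ge> a \<longrightarrow> norm (zH (s + of_nat k)) \<le> C * (1/2) ^ k"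
proof -
  define C where "C = (LINT t:{0<..<1/2}|lborel. norm (of_real t powr (complex_of_real a - 1) * expmangoldt t))"
  have inta: "set_integrable lborel {0<..<1/2} (\<lambda>t. norm (of_real t powr (complex_of_real a - 1) * expmangoldt t))"
    using zH_integral(1)[of "of_real a"] assms by (intro set_integrable_norm) auto
  have "norm (zH (s + of_nat k)) \<le> C * (1/2) ^ k" if s: "Re s \<ge> a" for s k
  proof -
    have s1: "Re (s + of_nat k) > 1" using s assms by simp
    have "norm (zH (s + of_nat k)) \<le> (LINT t:{0<..<1/2}|lborel. norm (of_real t powr (s + of_nat k - 1) * expmangoldt t))"
      unfolding zH_integral(2)[OF s1, symmetric] by (rule set_integral_norm_bound[OF zH_integral(1)[OF s1]])
    also have "\<dots> \<le> (LINT t:{0<..<1/2}|lborel. (1/2) ^ k * norm (of_real t powr (complex_of_real a - 1) * expmangoldt t))"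
    proof (rule set_integral_mono)
      show "set_integrable lborel {0<..<1/2} (\<lambda>t. (1/2) ^ k * norm (of_real t powr (complex_of_real a - 1) * expmangoldt t))"
        by (intro set_integrable_mult_right inta)
      fix t :: real assume t: "t \<in> {0<..<1/2}"
      have "t powr (Re s + real k - 1) \<le> t powr (a - 1 + real k)" using t s by (intro powr_mono') auto
      also have "\<dots> = t ^ k * t powr (a - 1)" using t by (simp add: powr_add powr_realpow)
      also have "\<dots> \<le> (1/2) ^ k * t powr (a - 1)" using t by (intro mult_right_mono power_mono) auto
      finally have "t powr (Re s + real k - 1) * norm (expmangoldt t) \<le> ((1/2) ^ k * t powr (a - 1)) * norm (expmangoldt t)"
        by (rule mult_right_mono) simp
      thus "norm (of_real t powr (s + of_nat k - 1) * expmangoldt t) \<le> (1/2) ^ k * norm (of_real t powr (complex_of_real a - 1) * expmangoldt t)"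
        using t by (simp add: norm_mult norm_powr_real_powr mult_ac)
    qed (rule set_integrable_norm[OF zH_integral(1)[OF s1]])
    also have "\<dots> = (1/2) ^ k * C" unfolding C_def by (rule set_integral_mult_right)
    finally show ?thesis by (simp add: mult_ac)
  qed
  moreover have "C \<ge> 0" unfolding C_def set_lebesgue_integral_def by (intro Bochner_Integration.integral_nonneg) auto
  ultimately show ?thesis by blast
qed

section \<open>The double series\<close>

abbreviation pdf :: "nat \<Rightarrow> nat" where "pdf n \<equiv> fst (prod_decode n)"
abbreviation pds :: "nat \<Rightarrow> nat" where "pds n \<equiv> snd (prod_decode n)"

text \<open>The double series is treated as a single one: the pair (m_1, m_2) is recovered from
  \<open>prod_decode n\<close> by raising both components by one.\<close>

definition dcoeff :: "complex \<Rightarrow> nat \<Rightarrow> complex" where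
  "dcoeff s n = of_nat (Suc (pdf n)) powr - s * mangoldt (Suc (pds n))"

definition dfreq :: "nat \<Rightarrow> real" where
  "dfreq n = real (Suc (pdf n)) + real (Suc (pds n))"

lemma dfreq_ge: "dfreq n \<ge> 1" by (simp add: dfreq_def)

definition zW :: "complex \<Rightarrow> complex \<Rightarrow> complex" where
  "zW s1 s2 = (\<Sum>n. dcoeff s1 n * inc_Gamma (1/2) s2 (dfreq n))"

lemma exp_dfreq: "exp (- (dfreq n * t)) = exp (- (real (Suc (pdf n)) * t)) * exp (- (real (Suc (pds n)) * t))"
  unfolding exp_add[symmetric] dfreq_def by (simp add: algebra_simps)

lemma dcoeff_exp_sums:
  assumes "t > 0"
  shows "summable (\<lambda>n. norm (dcoeff s n) * exp (- (dfreq n * t)))"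
    and "(\<lambda>n. dcoeff s n * of_real (exp (- (dfreq n * t)))) sums (expzeta s t * expmangoldt t)"
proof -
  define F where "F = (\<lambda>n. of_nat (Suc n) powr - s * complex_of_real (exp (- (real (Suc n) * t))))"
  define G where "G = (\<lambda>n. mangoldt (Suc n) * complex_of_real (exp (- (real (Suc n) * t))))"
  have F: "summable (\<lambda>n. norm (F n))" unfolding F_def by (rule expzeta_norm_summable[OF assms])
  have G: "summable (\<lambda>n. norm (G n))" unfolding G_def norm_mult
    using expmangoldt_norm_summable[OF assms] by (simp del: of_nat_Suc)
  have eq: "dcoeff s n * of_real (exp (- (dfreq n * t))) = F (pdf n) * G (pds n)" for n
    unfolding dcoeff_def exp_dfreq F_def G_def by (simp only: of_real_mult mult_ac)
  have "norm (dcoeff s n) * exp (- (dfreq n * t)) = norm (F (pdf n) * G (pds n))" for n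
    unfolding eq[symmetric] norm_mult by simp
  thus "summable (\<lambda>n. norm (dcoeff s n) * exp (- (dfreq n * t)))"
    using prod_decode_product(1)[OF F G] by simp
  show "(\<lambda>n. dcoeff s n * of_real (exp (- (dfreq n * t)))) sums (expzeta s t * expmangoldt t)"
    using prod_decode_product(2)[OF F G] unfolding eq by (simp add: F_def G_def expzeta_def expmangoldt_def)
qed

text \<open>The decay of the power of m_1 + m_2 is shared out: exponent \<open>1 + e\<close> goes to
  m_2, enough for the von Mangoldt sum, and \<open>Re s2 - 1 - e\<close> goes to m_1, where together
  with \<open>Re s1\<close> it exceeds 1.\<close>

lemma dcoeff_powr_summable:
  assumes s2: "Re s2 > 1" and s12: "Re (s1 + s2) > 2"
  shows "summable (\<lambda>n. norm (dcoeff s1 n) * dfreq n powr - Re s2)"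
proof -
  \<comment> \<open>Half of the smaller of the two margins in the hypotheses keeps both exponents
    admissible.\<close>
  define e where "e = min (Re s2 - 1) (Re (s1 + s2) - 2) / 2"
  have e: "e > 0" "Re s2 - 1 - e > 0" "Re s1 + Re s2 - 1 - e > 1"
    using s2 s12 by (auto simp: e_def min_def field_simps split: if_splits)
  define F where "F = (\<lambda>n. of_nat (Suc n) powr - (s1 + s2 - 1 - of_real e) :: complex)"
  define G where "G = (\<lambda>n. mangoldt (Suc n) * of_nat (Suc n) powr - (1 + of_real e) :: complex)"
  have F: "summable (\<lambda>n. norm (F n))" unfolding F_def
    by (rule dirichlet_zeta_norm_summable) (use e in simp)
  have G: "summable (\<lambda>n. norm (G n))" unfolding G_def
    by (rule mangoldt_norm_summable) (use e in simp)
  show ?thesis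
  proof (rule summable_comparison_test'[OF prod_decode_product(1)[OF F G]])
    fix n
    define x where "x = real (Suc (pdf n))"
    define y where "y = real (Suc (pds n))"
    have xy: "x \<ge> 1" "y \<ge> 1" by (auto simp: x_def y_def)
    have d: "dfreq n = x + y" by (simp add: dfreq_def x_def y_def)
    have "(x + y) powr - Re s2 = (x + y) powr - (Re s2 - 1 - e) * (x + y) powr - (1 + e)"
      by (simp add: powr_add[symmetric])
    also have "\<dots> \<le> x powr - (Re s2 - 1 - e) * y powr - (1 + e)"
      using xy e by (intro mult_mono powr_mono2') auto
    finally have "norm (dcoeff s1 n) * dfreq n powr - Re s2 \<le>
        (x powr - Re s1 * mangoldt (Suc (pds n))) * (x powr - (Re s2 - 1 - e) * y powr - (1 + e))"
      unfolding d dcoeff_def norm_mult norm_nat_powr norm_mangoldt x_def[symmetric]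
      by (intro mult_mono) (auto simp: x_def mangoldt_nonneg simp del: of_nat_Suc)
    also have "\<dots> = (x powr - Re s1 * x powr - (Re s2 - 1 - e)) * (mangoldt (Suc (pds n)) * y powr - (1 + e))"
      by (simp add: mult_ac)
    also have "x powr - Re s1 * x powr - (Re s2 - 1 - e) = x powr - (Re s1 + Re s2 - 1 - e)"
      unfolding powr_add[symmetric] by (rule arg_cong[where f = "(powr) x"]) simp
    also have "x powr - (Re s1 + Re s2 - 1 - e) * (mangoldt (Suc (pds n)) * y powr - (1 + e)) =
        norm (F (pdf n) * G (pds n))"
      unfolding norm_mult F_def G_def norm_nat_powr norm_mangoldt by (simp add: x_def y_def del: of_nat_Suc)
    finally show "norm (norm (dcoeff s1 n) * dfreq n powr - Re s2) \<le> norm (F (pdf n) * G (pds n))"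
      by simp
  qed
qed

lemma double_series_sums:
  assumes s2: "Re s2 > 1" and s12: "Re (s1 + s2) > 2"
  shows "(\<lambda>n. dcoeff s1 n * of_real (dfreq n) powr - s2) sums double_series (\<lambda>_. 1) mangoldt (s1, s2)"
proof -
  define h where "h = (\<lambda>n. (Suc (pdf n), Suc (pds n)))"
  define f where "f = (\<lambda>(m1, m2). 1 * mangoldt m2 / (of_nat m1 powr s1 * of_nat (m1 + m2) powr s2) :: complex)"
  have bij: "bij_betw h UNIV ({1..} \<times> {1..})"
  proof (rule bij_betwI)
    show "h \<in> UNIV \<rightarrow> {1..} \<times> {1..}" by (auto simp: h_def)
    show "(\<lambda>(a, b). prod_encode (a - 1, b - 1)) \<in> {1..} \<times> {1..} \<rightarrow> UNIV" by simp
    show "(\<lambda>(a, b). prod_encode (a - 1, b - 1)) (h x) = x" for x by (simp add: h_def)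
    show "h ((\<lambda>(a, b). prod_encode (a - 1, b - 1)) y) = y" if "y \<in> {1..} \<times> {1..}" for y
      using that by (auto simp: h_def)
  qed
  have fh: "f (h n) = dcoeff s1 n * of_real (dfreq n) powr - s2" for n
    unfolding f_def h_def dcoeff_def dfreq_def
    by (simp add: powr_minus divide_inverse mult_ac add_ac)
  have "norm (of_real (dfreq n) powr - s2 :: complex) = dfreq n powr - Re s2" for n
    using norm_powr_real_powr[of "of_real (dfreq n)" "- s2"] dfreq_ge[of n] by simp
  hence n: "summable (\<lambda>n. norm (dcoeff s1 n * of_real (dfreq n) powr - s2))"
    using dcoeff_powr_summable[OF assms] by (simp add: norm_mult)
  have "infsum f ({1..} \<times> {1..}) = (\<Sum>\<^sub>\<infinity>n. f (h n))"
    by (rule infsum_reindex_bij_betw[OF bij, symmetric])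
  also have "\<dots> = (\<Sum>n. dcoeff s1 n * of_real (dfreq n) powr - s2)"
    unfolding fh by (rule infsumI[OF norm_summable_imp_has_sum[OF n summable_sums[OF summable_norm_cancel[OF n]]]])
  finally have "double_series (\<lambda>_. 1) mangoldt (s1, s2) = (\<Sum>n. dcoeff s1 n * of_real (dfreq n) powr - s2)"
    unfolding double_series_def f_def by (simp add: case_prod_beta)
  thus ?thesis using summable_sums[OF summable_norm_cancel[OF n]] by simp
qed

lemma zW_term_bound:
  assumes C: "norm (inc_Gamma (1/2) s2 (dfreq n)) \<le> C * exp (- (1/2 * dfreq n))" "C \<ge> 0"
    and N: "\<bar>Re s1\<bar> \<le> real N"
  shows "norm (of_nat (Suc (pdf n)) powr - s1 :: complex) \<le> real (Suc (pdf n)) ^ N"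
    and "norm (mangoldt (Suc (pds n)) * inc_Gamma (1/2) s2 (dfreq n)) \<le>
      real (Suc (pds n)) * (C * exp (- (1/2 * dfreq n)))"
proof -
  show "norm (of_nat (Suc (pdf n)) powr - s1 :: complex) \<le> real (Suc (pdf n)) ^ N"
    unfolding norm_nat_powr by (rule nat_powr_le) (use N in simp)
  show "norm (mangoldt (Suc (pds n)) * inc_Gamma (1/2) s2 (dfreq n)) \<le>
      real (Suc (pds n)) * (C * exp (- (1/2 * dfreq n)))"
    unfolding norm_mult norm_mangoldt using C mangoldt_le_real[of "pds n"] by (intro mult_mono) auto
qed

lemma zW_majorant_summable:
  "summable (\<lambda>n. real (Suc (pdf n)) ^ N * (real (Suc (pds n)) * (C * exp (- (1/2 * dfreq n)))))"
proof -
  define F where "F = (\<lambda>n. complex_of_real (real (Suc n) ^ N * exp (- (real (Suc n) * (1/2)))))"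
  define G where "G = (\<lambda>n. complex_of_real (real (Suc n) ^ 1 * exp (- (real (Suc n) * (1/2)))))"
  have F: "summable (\<lambda>n. norm (F n))" unfolding F_def norm_of_real
    using summable_poly_exp[of "1/2" N] by (simp add: abs_mult del: of_nat_Suc)
  have G: "summable (\<lambda>n. norm (G n))" unfolding G_def norm_of_real
    using summable_poly_exp[of "1/2" 1] by (simp add: abs_mult del: of_nat_Suc)
  have "real (Suc (pdf n)) ^ N * (real (Suc (pds n)) * (C * exp (- (1/2 * dfreq n)))) =
      C * norm (F (pdf n) * G (pds n))" for n
    using exp_dfreq[of n "1/2"] unfolding F_def G_def norm_mult norm_of_real
    by (simp add: abs_mult mult_ac del: of_nat_Suc)
  thus ?thesis by (simp only:) (rule summable_mult[OF prod_decode_product(1)[OF F G]])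
qed

text \<open>In every term \<open>s1\<close> and \<open>s2\<close> occur in separate factors, so
  \<open>holomorphic2_on_suminf_mult\<close> applies on polydiscs around the origin, whose radius
  can be arbitrarily large.\<close>

lemma zW_holomorphic2: "holomorphic2_on (\<lambda>z. zW (fst z) (snd z)) UNIV"
proof -
  have "holomorphic2_on (\<lambda>z. zW (fst z) (snd z)) (ball 0 (real R / 2) \<times> ball 0 (real R / 2))" if R: "R > 0" for R :: nat
  proof -
    obtain C where C: "C \<ge> 0" "\<forall>s x. norm s \<le> real R \<longrightarrow> x \<ge> 1 \<longrightarrow> norm (inc_Gamma (1/2) s x) \<le> C * exp (- (1/2 * x))"
      using inc_Gamma_bound_ball[of "1/2" "real R"] by auto
    have "holomorphic2_on (\<lambda>z. \<Sum>n. of_nat (Suc (pdf n)) powr - fst z * (mangoldt (Suc (pds n)) * inc_Gamma (1/2) (snd z) (dfreq n)))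
       (ball 0 (real R / 2) \<times> ball 0 (real R / 2))"
    proof (rule holomorphic2_on_suminf_mult[where
          F = "\<lambda>n. real (Suc (pdf n)) ^ R" and G = "\<lambda>n. real (Suc (pds n)) * (C * exp (- (1/2 * dfreq n)))"])
      show "(\<lambda>s. of_nat (Suc (pdf n)) powr - s) holomorphic_on ball 0 (real R)" for n
        by (intro holomorphic_intros) (auto simp del: of_nat_Suc)
      show "(\<lambda>s. mangoldt (Suc (pds n)) * inc_Gamma (1/2) s (dfreq n)) holomorphic_on ball 0 (real R)" for n
        by (intro holomorphic_intros inc_Gamma_holomorphic dfreq_ge) auto
      show "norm (of_nat (Suc (pdf n)) powr - s :: complex) \<le> real (Suc (pdf n)) ^ R" if "s \<in> ball 0 (real R)" for n s
        \<comment> \<open>The constant is the quotient that turns the premise on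
          \<open>inc_Gamma\<close> into an equality.\<close>
        using zW_term_bound(1)[of 0 n "norm (inc_Gamma (1/2) 0 (dfreq n)) / exp (- (1/2 * dfreq n))" s R]
          that abs_Re_le_cmod[of s] by simp
      show "norm (mangoldt (Suc (pds n)) * inc_Gamma (1/2) s (dfreq n)) \<le> real (Suc (pds n)) * (C * exp (- (1/2 * dfreq n)))"
        if "s \<in> ball 0 (real R)" for n s
        by (rule zW_term_bound(2)[where N = 0 and ?s1.0 = 0]) (use C that dfreq_ge in auto)
    qed (use R zW_majorant_summable in auto)
    moreover have "of_nat (Suc (pdf n)) powr - s1 * (mangoldt (Suc (pds n)) * inc_Gamma (1/2) s2 (dfreq n)) =
        dcoeff s1 n * inc_Gamma (1/2) s2 (dfreq n)" for n s1 s2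
      by (simp only: dcoeff_def mult.assoc)
    ultimately show ?thesis unfolding zW_def by (simp only:)
  qed
  note hol = this
  have cover: "\<exists>R>0. z \<in> ball 0 (real R / 2) \<times> ball 0 (real R / 2)" for z :: "complex \<times> complex"
  proof -
    define a b where "a = norm (fst z)" and "b = norm (snd z)"
    obtain R :: nat where R: "2 * (a + b) < real R" using reals_Archimedean2 by blast
    have nn: "a \<ge> 0" "b \<ge> 0" by (simp_all add: a_def b_def)
    have "real R > 0" "2 * a < real R" "2 * b < real R" using R nn by simp_all
    thus ?thesis unfolding a_def b_def by (intro exI[of _ R]) (simp add: mem_Times_iff mult.commute)
  qed
  show ?thesis unfolding holomorphic2_on_def
  proof
    fix z :: "complex \<times> complex"
    from cover[of z] obtain R :: nat where R: "R > 0" "z \<in> ball 0 (real R / 2) \<times> ball 0 (real R / 2)"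
      by (elim exE conjE)
    show "\<exists>a b. ((\<lambda>z. zW (fst z) (snd z)) has_derivative (\<lambda>(u, v). a * u + b * v)) (at z)"
      by (rule bspec[OF hol[OF R(1), unfolded holomorphic2_on_def] R(2)])
  qed
qed

lemma zW_summable: "summable (\<lambda>n. dcoeff s1 n * inc_Gamma (1/2) s2 (dfreq n))"
proof -
  obtain N :: nat where N: "\<bar>Re s1\<bar> \<le> real N" using real_arch_simple by blast
  obtain C where C: "C \<ge> 0" "\<forall>s x. norm s \<le> norm s2 \<longrightarrow> x \<ge> 1 \<longrightarrow> norm (inc_Gamma (1/2) s x) \<le> C * exp (- (1/2 * x))"
    using inc_Gamma_bound_ball[of "1/2" "norm s2"] by auto
  show ?thesis
  proof (rule summable_comparison_test'[OF zW_majorant_summable[of N C]])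
    fix n
    have J: "norm (inc_Gamma (1/2) s2 (dfreq n)) \<le> C * exp (- (1/2 * dfreq n))" using C(2) dfreq_ge by simp
    have "norm (of_nat (Suc (pdf n)) powr - s1 * (mangoldt (Suc (pds n)) * inc_Gamma (1/2) s2 (dfreq n))) \<le>
        real (Suc (pdf n)) ^ N * (real (Suc (pds n)) * (C * exp (- (1/2 * dfreq n))))"
      unfolding norm_mult[of "of_nat (Suc (pdf n)) powr - s1"]
      by (intro mult_mono zW_term_bound[OF J C(1) N]) auto
    thus "norm (dcoeff s1 n * inc_Gamma (1/2) s2 (dfreq n)) \<le>
        real (Suc (pdf n)) ^ N * (real (Suc (pds n)) * (C * exp (- (1/2 * dfreq n))))"
      by (simp only: dcoeff_def mult.assoc)
  qed
qed

lemma powr_mult_same: "t > 0 \<Longrightarrow> complex_of_real t powr a * of_real t powr b = of_real t powr (a + b)"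
  by (simp add: powr_add)

text \<open>The double exponential sum factors as \<open>expzeta s1 t * expmangoldt t\<close>.
  Inserting the expansion of the first factor and integrating over (0, 1/2) term by term produces
  one value of \<open>zH\<close> per power of \<open>t\<close>.\<close>

theorem double_series_expansion:
  assumes s2: "Re s2 > 1" and s12: "Re (s1 + s2) > 2" and s1: "s1 \<notin> posints"
  shows "Gamma s2 * double_series (\<lambda>_. 1) mangoldt (s1, s2) =
     zW s1 s2 + Gamma (1 - s1) * zH (s1 + s2 - 1) + (\<Sum>k. zcoeff k s1 * zH (s2 + of_nat k))"
proof -
  have s20: "Re s2 > 0" using s2 by simp
  have A: "(\<lambda>n. dcoeff s1 n * (Gamma s2 * of_real (dfreq n) powr - s2 - inc_Gamma (1/2) s2 (dfreq n))) sums
     (LINT t:{0<..<1/2}|lborel. of_real t powr (s2 - 1) * (\<Sum>n. dcoeff s1 n * of_real (exp (- (dfreq n * t)))))"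
    by (rule mellin_exp_sum(2)[OF s20 dfreq_ge]) (use dcoeff_powr_summable[OF s2 s12] dcoeff_exp_sums(1) in auto)
  have "(\<lambda>n. Gamma s2 * (dcoeff s1 n * of_real (dfreq n) powr - s2) - dcoeff s1 n * inc_Gamma (1/2) s2 (dfreq n)) sums
     (Gamma s2 * double_series (\<lambda>_. 1) mangoldt (s1, s2) - zW s1 s2)"
    unfolding zW_def by (intro sums_diff sums_mult double_series_sums s2 s12 summable_sums zW_summable)
  also have "(\<lambda>n. Gamma s2 * (dcoeff s1 n * of_real (dfreq n) powr - s2) - dcoeff s1 n * inc_Gamma (1/2) s2 (dfreq n)) =
     (\<lambda>n. dcoeff s1 n * (Gamma s2 * of_real (dfreq n) powr - s2 - inc_Gamma (1/2) s2 (dfreq n)))"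
    by (simp add: algebra_simps)
  finally have 1: "Gamma s2 * double_series (\<lambda>_. 1) mangoldt (s1, s2) - zW s1 s2 =
     (LINT t:{0<..<1/2}|lborel. of_real t powr (s2 - 1) * (\<Sum>n. dcoeff s1 n * of_real (exp (- (dfreq n * t)))))"
    by (rule sums_unique2[OF _ A])
  define f where "f = (\<lambda>k t. zcoeff k s1 * (indicator {0<..<1/2} t *\<^sub>R (of_real t powr (s2 + of_nat k - 1) * expmangoldt t)))"
  have s2k: "Re (s2 + of_nat k) > 1" for k using s2 by simp
  have int: "integrable lborel (f k)" for k
    unfolding f_def using zH_integral(1)[OF s2k] unfolding set_integrable_def by (intro integrable_mult_right)
  have fi: "integral\<^sup>L lborel (f k) = zcoeff k s1 * zH (s2 + of_nat k)" for k
    unfolding f_def using zH_integral(2)[OF s2k, of k] unfolding set_lebesgue_integral_def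
    by (simp only: integral_mult_right_zero)
  define g where "g = (\<lambda>t. indicator {0<..<1/2} t *\<^sub>R (of_real t powr (s2 - 1) * expmangoldt t))"
  have fg: "f k t = (zcoeff k s1 * of_real t ^ k) * g t" for k t
  proof (cases "t \<in> {0<..<1/2}")
    case True
    hence "complex_of_real t powr (s2 + of_nat k - 1) = of_real t ^ k * of_real t powr (s2 - 1)"
      by (simp add: powr_add[symmetric] powr_nat' powr_diff powr_add mult_ac)
    thus ?thesis using True by (simp add: f_def g_def)
  qed (simp add: f_def g_def)
  have fn: "summable (\<lambda>k. norm (f k t))" for t
  proof (cases "t \<in> {0<..<1/2}")
    case True
    hence "norm (complex_of_real t) \<le> 2/3" by auto
    from summable_mult2[OF zcoeff_summable[OF s1 this], of "norm (g t)"] show ?thesis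
      unfolding fg norm_mult .
  qed (simp add: f_def)
  have sint: "summable (\<lambda>k. \<integral>t. norm (f k t) \<partial>lborel)"
  proof -
    have intg: "integrable lborel (\<lambda>t. norm (g t))"
      unfolding g_def using zH_integral(1)[OF s2] unfolding set_integrable_def by (rule integrable_norm)
    \<comment> \<open>On (0, 1/2) the factor \<open>t ^ k\<close> is at most
      \<open>(1/2) ^ k\<close>, and at 1/2 the coefficient series still converges
      absolutely.\<close>
    have "summable (\<lambda>k. norm (zcoeff k s1 * (1/2) ^ k) * (\<integral>t. norm (g t) \<partial>lborel))"
      by (intro summable_mult2 zcoeff_summable[OF s1]) auto
    thus ?thesis
    proof (rule summable_comparison_test')
      fix k
      have "(\<integral>t. norm (f k t) \<partial>lborel) \<le> (\<integral>t. norm (zcoeff k s1 * (1/2) ^ k) * norm (g t) \<partial>lborel)"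
      proof (rule integral_mono)
        show "integrable lborel (\<lambda>t. norm (f k t))" by (rule integrable_norm[OF int])
        show "integrable lborel (\<lambda>t. norm (zcoeff k s1 * (1/2) ^ k) * norm (g t))"
          by (rule integrable_mult_right[OF intg])
        fix t
        show "norm (f k t) \<le> norm (zcoeff k s1 * (1/2) ^ k) * norm (g t)"
        proof (cases "t \<in> {0<..<1/2}")
          case True
          thus ?thesis unfolding fg norm_mult norm_power
            by (intro mult_right_mono mult_left_mono power_mono) auto
        qed (simp add: f_def)
      qed
      thus "norm (\<integral>t. norm (f k t) \<partial>lborel) \<le> norm (zcoeff k s1 * (1/2) ^ k) * (\<integral>t. norm (g t) \<partial>lborel)"
        by simp
    qed
  qed
  have s121: "Re (s1 + s2 - 1) > 1" using s12 by simp
  have pw: "of_real t powr (s2 - 1) * (\<Sum>n. dcoeff s1 n * of_real (exp (- (dfreq n * t)))) =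
      Gamma (1 - s1) * (of_real t powr (s1 + s2 - 1 - 1) * expmangoldt t) + (\<Sum>k. f k t)" if t: "t \<in> {0<..<1/2}" for t
  proof -
    have t': "t > 0" "t \<le> 1/2" using t by auto
    have "(\<Sum>n. dcoeff s1 n * of_real (exp (- (dfreq n * t)))) = expzeta s1 t * expmangoldt t"
      using dcoeff_exp_sums(2)[OF t'(1)] by (simp add: sums_iff)
    moreover have "expzeta s1 t = Gamma (1 - s1) * of_real t powr (s1 - 1) + (\<Sum>k. zcoeff k s1 * of_real t ^ k)"
      using expzeta_expansion[OF t' s1] by (simp add: sums_iff)
    moreover have "(\<Sum>k. f k t) = (\<Sum>k. zcoeff k s1 * of_real t ^ k) * g t"
      unfolding fg by (rule suminf_mult2[symmetric]) (rule sums_summable[OF expzeta_expansion[OF t' s1]])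
    moreover have "g t = of_real t powr (s2 - 1) * expmangoldt t" using t by (simp add: g_def)
    moreover have "complex_of_real t powr (s1 + s2 - 1 - 1) = of_real t powr (s1 - 1) * of_real t powr (s2 - 1)"
      using powr_mult_same[OF t'(1), of "s1 - 1" "s2 - 1"] by (simp add: algebra_simps)
    ultimately show ?thesis by (simp add: algebra_simps)
  qed
  have "(LINT t:{0<..<1/2}|lborel. of_real t powr (s2 - 1) * (\<Sum>n. dcoeff s1 n * of_real (exp (- (dfreq n * t))))) =
      (\<integral>t. Gamma (1 - s1) * (indicator {0<..<1/2} t *\<^sub>R (of_real t powr (s1 + s2 - 1 - 1) * expmangoldt t)) + (\<Sum>k. f k t) \<partial>lborel)"
    unfolding set_lebesgue_integral_def
  proof (rule Bochner_Integration.integral_cong[OF refl])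
    fix t :: real
    show "indicator {0<..<1/2} t *\<^sub>R (of_real t powr (s2 - 1) * (\<Sum>n. dcoeff s1 n * of_real (exp (- (dfreq n * t))))) =
      Gamma (1 - s1) * (indicator {0<..<1/2} t *\<^sub>R (of_real t powr (s1 + s2 - 1 - 1) * expmangoldt t)) + (\<Sum>k. f k t)"
    proof (cases "t \<in> {0<..<1/2}")
      case True
      thus ?thesis using pw[OF True] by simp
    qed (simp add: f_def)
  qed
  also have "\<dots> = (\<integral>t. Gamma (1 - s1) * (indicator {0<..<1/2} t *\<^sub>R (of_real t powr (s1 + s2 - 1 - 1) * expmangoldt t)) \<partial>lborel) +
      (\<integral>t. (\<Sum>k. f k t) \<partial>lborel)"
  proof (rule Bochner_Integration.integral_add)
    show "integrable lborel (\<lambda>t. Gamma (1 - s1) * (indicator {0<..<1/2} t *\<^sub>R (of_real t powr (s1 + s2 - 1 - 1) * expmangoldt t)))"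
      using zH_integral(1)[OF s121] unfolding set_integrable_def by (intro integrable_mult_right)
    show "integrable lborel (\<lambda>t. \<Sum>k. f k t)"
      by (rule integrable_suminf[OF int _ sint]) (use fn in auto)
  qed
  also have "(\<integral>t. Gamma (1 - s1) * (indicator {0<..<1/2} t *\<^sub>R (of_real t powr (s1 + s2 - 1 - 1) * expmangoldt t)) \<partial>lborel) =
      Gamma (1 - s1) * zH (s1 + s2 - 1)"
    using zH_integral(2)[OF s121] unfolding set_lebesgue_integral_def by (simp only: integral_mult_right_zero)
  also have "(\<integral>t. (\<Sum>k. f k t) \<partial>lborel) = (\<Sum>k. zcoeff k s1 * zH (s2 + of_nat k))"
    unfolding fi[symmetric] by (rule integral_suminf[OF int _ sint]) (use fn in auto)
  finally show ?thesis using 1 by (simp add: algebra_simps)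
qed

section \<open>The functional equation and the trivial zeros\<close>

text \<open>The logarithmic derivative of the reflection formula for \<open>Gamma\<close>.\<close>

lemma Digamma_reflection_complex:
  fixes z :: complex
  assumes z: "z \<notin> \<int>"
  shows "Digamma (1 - z) - Digamma z = of_real pi * cos (of_real pi * z) / sin (of_real pi * z)"
proof -
  have nz: "z \<notin> \<int>\<^sub>\<le>\<^sub>0" "1 - z \<notin> \<int>\<^sub>\<le>\<^sub>0"
    using z nonpos_Ints_subset_Ints by (auto dest: Ints_diff[OF Ints_1])
  have s0: "sin (of_real pi * z) \<noteq> 0"
  proof
    assume "sin (of_real pi * z) = 0"
    then obtain n :: int where "of_real pi * z = of_real (of_int n * pi)" unfolding sin_eq_0 by blast
    hence "z = of_int n" by simp
    thus False using z by simp
  qed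
  have G: "Gamma z * Gamma (1 - z) = of_real pi / sin (of_real pi * z)"
    by (rule Gamma_reflection_complex)
  have "((\<lambda>z. Gamma z * Gamma (1 - z)) has_field_derivative
      Gamma z * Digamma z * Gamma (1 - z) + Gamma (1 - z) * Digamma (1 - z) * (- 1) * Gamma z) (at z)"
    using nz by (auto intro!: derivative_eq_intros)
  moreover have "((\<lambda>z. of_real pi / sin (of_real pi * z)) has_field_derivative
      - (of_real pi * (cos (of_real pi * z) * of_real pi)) / (sin (of_real pi * z) * sin (of_real pi * z))) (at z)"
    using s0 by (auto intro!: derivative_eq_intros)
  moreover have "(\<lambda>z. Gamma z * Gamma (1 - z)) = (\<lambda>z::complex. of_real pi / sin (of_real pi * z))"
    using Gamma_reflection_complex by (simp add: fun_eq_iff)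
  ultimately have "Gamma z * Digamma z * Gamma (1 - z) + Gamma (1 - z) * Digamma (1 - z) * (- 1) * Gamma z =
      - (of_real pi * (cos (of_real pi * z) * of_real pi)) / (sin (of_real pi * z) * sin (of_real pi * z))"
    using DERIV_unique by metis
  hence "(Gamma z * Gamma (1 - z)) * (Digamma (1 - z) - Digamma z) =
      of_real pi * (cos (of_real pi * z) * of_real pi) / (sin (of_real pi * z) * sin (of_real pi * z))"
    by (simp add: algebra_simps)
  hence eq: "of_real pi / sin (of_real pi * z) * (Digamma (1 - z) - Digamma z) =
      of_real pi * (cos (of_real pi * z) * of_real pi) / (sin (of_real pi * z) * sin (of_real pi * z))"
    unfolding G .
  have "X = P * C / S" if "P / S * X = P * (C * P) / (S * S)" "P \<noteq> 0" "S \<noteq> 0" for P S X C :: complex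
  proof -
    have "X = (P / S * X) * (S / P)" using that(2,3) by simp
    also have "\<dots> = P * C / S" unfolding that(1) using that(2,3) by (simp add: field_simps)
    finally show ?thesis .
  qed
  from this[OF eq _ s0] show ?thesis by simp
qed

text \<open>This is the partial fraction expansion of the cotangent at the imaginary point z = i
  u/(2 pi). It is read off from the series of \<open>Digamma (1 - z) - Digamma (1 + z)\<close>,
  which reflection and the recursion of \<open>Digamma\<close> turn into pi cot(pi z) - 1/z.\<close>

lemma Bexp_partial_fractions:
  assumes u: "(u::real) > 0"
  shows "(\<lambda>n. complex_of_real (2 * u / (u\<^sup>2 + (2 * pi * real (Suc n))\<^sup>2))) sums (Bexp (of_real u) + 1 / 2)"
proof -
  define y where "y = u / (2 * pi)"
  define z where "z = \<i> * complex_of_real y"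
  have y: "y > 0" using u by (simp add: y_def)
  have zInt: "z \<notin> \<int>"
  proof
    assume "z \<in> \<int>"
    then obtain n :: int where "z = of_int n" by (elim Ints_cases)
    hence "Im z = 0" by simp
    thus False using y by (simp add: z_def)
  qed
  have z0: "z \<noteq> 0" using y by (simp add: z_def)
  have zz: "z * z = - of_real (y\<^sup>2)"
    by (simp add: z_def power2_eq_square mult_ac)
  have z1: "1 + z \<noteq> 0" "1 - z \<noteq> 0" using y by (auto simp: z_def complex_eq_iff)
  define c where "c = cos (of_real pi * z) / sin (of_real pi * z)"
  have D: "Digamma (1 - z) - Digamma (1 + z) = of_real pi * c - 1 / z"
    using Digamma_reflection_complex[OF zInt] Digamma_plus1[OF z0] by (simp add: c_def add.commute)
  have s1: "(\<lambda>n. inverse (of_nat (Suc n)) - inverse (1 - z + of_nat n)) sums (Digamma (1 - z) + euler_mascheroni)"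
    unfolding Digamma_def using summable_sums[OF summable_Digamma[OF z1(2)]] by simp
  have s2: "(\<lambda>n. inverse (of_nat (Suc n)) - inverse (1 + z + of_nat n)) sums (Digamma (1 + z) + euler_mascheroni)"
    unfolding Digamma_def using summable_sums[OF summable_Digamma[OF z1(1)]] by simp
  have "(\<lambda>n. inverse (1 + z + of_nat n) - inverse (1 - z + of_nat n)) sums (of_real pi * c - 1 / z)"
    using sums_diff[OF s1 s2] D by simp
  hence "(\<lambda>n. (inverse (1 + z + of_nat n) - inverse (1 - z + of_nat n)) * (\<i> / of_real (2 * pi))) sums
      ((of_real pi * c - 1 / z) * (\<i> / of_real (2 * pi)))" by (rule sums_mult2)
  also have "(\<lambda>n. (inverse (1 + z + of_nat n) - inverse (1 - z + of_nat n)) * (\<i> / of_real (2 * pi))) =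
      (\<lambda>n. complex_of_real (2 * u / (u\<^sup>2 + (2 * pi * real (Suc n))\<^sup>2)))"
  proof
    fix n
    define k where "k = real (Suc n)"
    have k: "k > 0" by (simp add: k_def)
    have e1: "1 + z + of_nat n = of_real k + z" "1 - z + of_nat n = of_real k - z" by (simp_all add: k_def)
    have n0: "of_real k + z \<noteq> 0" "of_real k - z \<noteq> 0" using y by (auto simp: z_def complex_eq_iff)
    define Q where "Q = k\<^sup>2 + y\<^sup>2"
    have "inverse (of_real k + z) - inverse (of_real k - z) = - 2 * z / ((of_real k + z) * (of_real k - z))"
      using n0 by (simp add: divide_simps)
    also have "(of_real k + z) * (of_real k - z) = of_real Q"
      using zz by (simp add: Q_def algebra_simps power2_eq_square)
    finally have d: "inverse (of_real k + z) - inverse (of_real k - z) = - 2 * z / of_real Q" .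
    have "(inverse (of_real k + z) - inverse (of_real k - z)) * (\<i> / of_real (2 * pi)) =
        of_real (2 * y / (Q * (2 * pi)))"
      unfolding d by (simp add: z_def mult_ac)
    also have "2 * y / (Q * (2 * pi)) = 2 * u / (u\<^sup>2 + (2 * pi * k)\<^sup>2)"
    proof -
      have "u\<^sup>2 + (2 * pi * k)\<^sup>2 = (2 * pi)\<^sup>2 * Q" "u = 2 * pi * y"
        by (simp_all add: Q_def y_def power2_eq_square field_simps)
      moreover have "Q > 0" using k by (simp add: Q_def add_pos_nonneg)
      ultimately show ?thesis by (simp add: power2_eq_square field_simps)
    qed
    finally show "(inverse (1 + z + of_nat n) - inverse (1 - z + of_nat n)) * (\<i> / of_real (2 * pi)) =
      complex_of_real (2 * u / (u\<^sup>2 + (2 * pi * real (Suc n))\<^sup>2))" unfolding e1 k_def .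
  qed
  also have "(of_real pi * c - 1 / z) * (\<i> / of_real (2 * pi)) = Bexp (of_real u) + 1 / 2"
  proof -
    \<comment> \<open>In terms of \<open>E\<close> the cotangent at an imaginary point becomes (E +
      1/E)/(E - 1/E), the hyperbolic cotangent of u/2.\<close>
    define E where "E = exp (u / 2)"
    have E: "E > 1" using u by (simp add: E_def)
    have EE: "exp u = E * E" unfolding E_def exp_add[symmetric] by simp
    have "\<i> * (of_real pi * z) = of_real (- (u / 2))" "- (\<i> * (of_real pi * z)) = of_real (u / 2)"
      by (simp_all add: z_def y_def flip: mult.assoc)
    hence ex: "exp (\<i> * (of_real pi * z)) = of_real (inverse E)" "exp (- (\<i> * (of_real pi * z))) = of_real E"
      by (simp_all only: exp_of_real E_def exp_minus)
    have E2: "E - inverse E > 0" using E by (simp add: inverse_less_1_iff[THEN iffD2, THEN less_trans])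
    have aux: "(n / 2) / (\<i> * d / 2) = - \<i> * (n / d)" if "d \<noteq> 0" for n d :: complex
    proof -
      have "n / 2 = (- \<i> * (n / d)) * (\<i> * d / 2)" using that by (simp add: mult_ac)
      thus ?thesis using that by (subst nonzero_divide_eq_eq) auto
    qed
    have "complex_of_real (E - inverse E) \<noteq> 0" using E2 unfolding of_real_eq_0_iff by linarith
    hence d0: "complex_of_real E - of_real (inverse E) \<noteq> 0" unfolding of_real_diff .
    have "c = - \<i> * ((of_real (inverse E) + of_real E) / (of_real E - of_real (inverse E)))"
      unfolding c_def sin_exp_eq' cos_exp_eq ex by (rule aux[OF d0])
    also have "(of_real (inverse E) + of_real E) / (of_real E - of_real (inverse E)) =
        complex_of_real ((E + inverse E) / (E - inverse E))"
      by (simp only: of_real_divide of_real_add of_real_diff add.commute)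
    also have "(E + inverse E) / (E - inverse E) = (exp u + 1) / (exp u - 1)"
      unfolding EE using E E2 by (simp add: field_simps)
    finally have c: "c = - \<i> * of_real ((exp u + 1) / (exp u - 1))" .
    have aux2: "(P * (- \<i> * r) - 1 / (\<i> * Y)) * (\<i> / (2 * P)) = r / 2 - 1 / (2 * P * Y)"
      if "P \<noteq> 0" "Y \<noteq> 0" for P r Y :: complex
      using that by (simp add: field_simps)
    have "(of_real pi * c - 1 / z) * (\<i> / of_real (2 * pi)) =
        of_real ((exp u + 1) / (exp u - 1)) / 2 - 1 / (2 * of_real pi * of_real y)"
      unfolding c z_def of_real_mult of_real_numeral by (rule aux2) (use y in auto)
    also have "\<dots> = of_real ((exp u + 1) / (exp u - 1) / 2 - 1 / (2 * pi * y))" by simp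
    also have "2 * pi * y = u" by (simp add: y_def)
    also have "(exp u + 1) / (exp u - 1) / 2 - 1 / u = 1 / (exp u - 1) - 1 / u + 1 / 2"
      using u by (simp add: field_simps)
    finally show ?thesis using u by (simp add: Bexp_def exp_of_real)
  qed
  finally show ?thesis .
qed

text \<open>The substitution \<open>u = c * sqrt w\<close> reduces the integral to the beta integral
  with exponent \<open>p = (1 + s) / 2\<close>.\<close>

lemma quadratic_mellin:
  fixes s c :: real
  assumes s: "-1 < s" "s < 0" and c: "c > 0"
  defines "f \<equiv> (\<lambda>u. u powr (s - 1) * (2 * u / (u\<^sup>2 + c\<^sup>2)))"
  shows "set_integrable lborel {0<..} f"
    and "(LINT u:{0<..}|lborel. f u) = c powr (s - 1) * (Gamma ((1 + s) / 2) * Gamma ((1 - s) / 2))"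
proof -
  define p where "p = (1 + s) / 2"
  have p: "0 < p" "p < 1" using s by (auto simp: p_def)
  define h where "h = (\<lambda>w::real. w powr (p - 1) / (1 + w))"
  have hint: "set_integrable lborel {0<..} h" "(LINT u:{0<..}|lborel. h u) = Gamma p * Gamma (1 - p)"
    using beta_integral[OF p, of 1] unfolding h_def by simp_all
  have habs: "h absolutely_integrable_on {0<..}"
    using hint(1) unfolding set_integrable_def by (subst integrable_completion) auto
  have hval: "integral {0<..} h = Gamma p * Gamma (1 - p)"
    using set_borel_integral_eq_integral(2)[OF hint(1)] hint(2) by simp
  define g where "g = (\<lambda>w. c * sqrt w)"
  define g' where "g' = (\<lambda>w. c * (inverse (sqrt w) / 2))"
  have gd: "(g has_field_derivative g' w) (at w within {0<..})" if "w \<in> {0<..}" for w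
    unfolding g_def g'_def using that
    by (auto intro!: derivative_eq_intros simp: field_simps)
  have ginj: "inj_on g {0<..}" unfolding g_def using c by (auto simp: inj_on_def)
  have gim: "g ` {0<..} = {0<..}"
  proof (intro equalityI subsetI)
    fix u :: real assume "u \<in> {0<..}"
    hence "u = g ((u / c)\<^sup>2)" "(u / c)\<^sup>2 \<in> {0<..}" using c by (auto simp: g_def)
    thus "u \<in> g ` {0<..}" by blast
  qed (use c in \<open>auto simp: g_def\<close>)
  have key: "\<bar>g' w\<bar> * f (g w) = c powr (s - 1) * h w" if w: "w \<in> {0<..}" for w
  proof -
    define r where "r = sqrt w"
    have r: "r > 0" "w = r\<^sup>2" using w by (auto simp: r_def)
    have k1: "w powr (p - 1) = r powr (s - 1)"
    proof -
      have "w = r powr 2" using r by simp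
      hence "w powr (p - 1) = r powr (2 * (p - 1))" by (simp only: powr_powr)
      moreover have "2 * (p - 1) = s - 1" by (simp add: p_def field_simps)
      ultimately show ?thesis by (simp only:)
    qed
    have k2: "(c * r)\<^sup>2 + c\<^sup>2 = c\<^sup>2 * (1 + w)" using r by (simp add: power_mult_distrib algebra_simps)
    have k3: "(c * r) powr (s - 1) = c powr (s - 1) * r powr (s - 1)" using c r by (simp add: powr_mult)
    have k4: "f (g w) = (c powr (s - 1) * r powr (s - 1)) * (2 * (c * r) / (c\<^sup>2 * (1 + w)))"
      unfolding f_def g_def r_def[symmetric] k2 k3 ..
    have k5: "\<bar>g' w\<bar> = c / (2 * r)"
    proof -
      have "g' w = c / (2 * r)" unfolding g'_def r_def[symmetric] by (simp add: inverse_eq_divide)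
      thus ?thesis using c r(1) by simp
    qed
    have k6: "1 + w > 0" using w by simp
    have "c / (2 * r) * ((a * b) * (2 * (c * r) / (c\<^sup>2 * d))) = a * (b / d)" if "d > 0" for a b d
      using that c r(1) by (simp add: power2_eq_square)
    from this[OF k6] show ?thesis unfolding k4 k5 h_def k1 .
  qed
  have "(\<lambda>w. c powr (s - 1) * h w) absolutely_integrable_on {0<..}"
    by (rule set_integrable_mult_right[OF habs])
  moreover have "((\<lambda>w. \<bar>g' w\<bar> * f (g w)) absolutely_integrable_on {0<..}) = ((\<lambda>w. c powr (s - 1) * h w) absolutely_integrable_on {0<..})"
    by (rule set_integrable_cong) (use key in auto)
  moreover have "integral {0<..} (\<lambda>w. \<bar>g' w\<bar> * f (g w)) = c powr (s - 1) * (Gamma p * Gamma (1 - p))"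
  proof -
    have "integral {0<..} (\<lambda>w. \<bar>g' w\<bar> * f (g w)) = integral {0<..} (\<lambda>w. c powr (s - 1) * h w)"
      by (rule Henstock_Kurzweil_Integration.integral_cong) (use key in auto)
    thus ?thesis using hval by simp
  qed
  ultimately have "f absolutely_integrable_on (g ` {0<..}) \<and> integral (g ` {0<..}) f = c powr (s - 1) * (Gamma p * Gamma (1 - p))"
    using has_absolute_integral_change_of_variables_1'[OF _ gd ginj, of f "c powr (s - 1) * (Gamma p * Gamma (1 - p))"]
    by simp
  hence fa: "f absolutely_integrable_on {0<..}" "integral {0<..} f = c powr (s - 1) * (Gamma p * Gamma (1 - p))"
    unfolding gim by auto
  have "f \<in> borel_measurable borel" unfolding f_def by measurable
  thus int: "set_integrable lborel {0<..} f"
    using fa(1) unfolding set_integrable_def by (subst (asm) integrable_completion) auto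
  have e: "1 - p = (1 - s) / 2" by (simp add: p_def field_simps)
  show "(LINT u:{0<..}|lborel. f u) = c powr (s - 1) * (Gamma ((1 + s) / 2) * Gamma ((1 - s) / 2))"
    using set_borel_integral_eq_integral(2)[OF int] fa(2) unfolding e by (simp add: p_def)
qed

context
  fixes r :: real
  assumes r: "-1 < r" "r < 0"
begin

text \<open>The constant 1/2 cancels \<open>bcoeff 0\<close>, so that \<open>Bexp u + 1/2\<close> is
  of order u at 0 and bounded at infinity. The Mellin integral therefore converges on the strip
  \<open>-1 < r < 0\<close> fixed by the context.\<close>

private definition F :: "real \<Rightarrow> complex" where
  "F u = of_real (u powr (r - 1)) * (Bexp (of_real u) + 1 / 2)"

private definition K :: real where "K = Gamma ((1 + r) / 2) * Gamma ((1 - r) / 2)"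

text \<open>Termwise integration of the partial fractions; their terms are nonnegative, so
  summability of the integrals of the moduli is the convergence of the zeta series at
  \<open>1 - r > 1\<close>.\<close>

lemma Bexp_mellin:
  "set_integrable lborel {0<..} F"
  "(LINT u:{0<..}|lborel. F u) = of_real ((2 * pi) powr (r - 1) * K) * dirichlet_zeta (of_real (1 - r))"
proof -
  define c where "c = (\<lambda>n. 2 * pi * real (Suc n))"
  have c: "c n > 0" for n unfolding c_def by (simp del: of_nat_Suc)
  define q where "q = (\<lambda>n u. indicator {0<..} u *\<^sub>R (u powr (r - 1) * (2 * u / (u\<^sup>2 + (c n)\<^sup>2))))"
  define f where "f = (\<lambda>n u. complex_of_real (q n u))"
  have q: "integrable lborel (q n)" "integral\<^sup>L lborel (q n) = c n powr (r - 1) * K" for n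
    using quadratic_mellin[OF r c[of n]] unfolding q_def set_integrable_def set_lebesgue_integral_def K_def by auto
  have qnn: "q n u \<ge> 0" for n u
    unfolding q_def by (cases "u > 0") (auto intro!: mult_nonneg_nonneg divide_nonneg_nonneg)
  have f: "integrable lborel (f n)" for n unfolding f_def using q(1) by (rule integrable_of_real)
  have fi: "integral\<^sup>L lborel (f n) = of_real (c n powr (r - 1) * K)" for n
    unfolding f_def integral_complex_of_real q(2) ..
  have nf: "(\<integral>u. norm (f n u) \<partial>lborel) = c n powr (r - 1) * K" for n
    unfolding f_def norm_of_real using q(2)[of n] qnn by simp
  have fs: "(\<lambda>n. f n u) sums (indicator {0<..} u *\<^sub>R F u)" for u
  proof (cases "u > 0")
    case True
    from sums_mult[OF Bexp_partial_fractions[OF True], of "of_real (u powr (r - 1))"]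
    show ?thesis using True unfolding f_def q_def c_def F_def by simp
  qed (simp add: f_def q_def)
  have fn: "summable (\<lambda>n. norm (f n u))" for u
  proof (cases "u > 0")
    case True
    have "(\<lambda>n. complex_of_real (2 * u / (u\<^sup>2 + (c n)\<^sup>2))) sums (Bexp (of_real u) + 1 / 2)"
      using Bexp_partial_fractions[OF True] by (simp add: c_def)
    from sums_Re[OF this] have "summable (\<lambda>n. 2 * u / (u\<^sup>2 + (c n)\<^sup>2))" by (simp add: sums_iff)
    hence "summable (\<lambda>n. u powr (r - 1) * (2 * u / (u\<^sup>2 + (c n)\<^sup>2)))" by (rule summable_mult)
    thus ?thesis unfolding f_def norm_of_real abs_of_nonneg[OF qnn] using True by (simp add: q_def)
  qed (simp add: f_def q_def)
  have cpow: "c n powr (r - 1) = (2 * pi) powr (r - 1) * real (Suc n) powr - (1 - r)" for n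
    unfolding c_def by (subst powr_mult) auto
  have sint: "summable (\<lambda>n. \<integral>u. norm (f n u) \<partial>lborel)"
    unfolding nf cpow by (intro summable_mult summable_mult2 summable_Suc_powr) (use r in simp)
  have eq: "(\<Sum>n. f n u) = indicator {0<..} u *\<^sub>R F u" for u using fs[of u] by (simp add: sums_iff)
  show "set_integrable lborel {0<..} F"
    unfolding set_integrable_def eq[symmetric] by (rule integrable_suminf[OF f _ sint]) (use fn in auto)
  have "(\<lambda>n. integral\<^sup>L lborel (f n)) sums (\<integral>u. (\<Sum>n. f n u) \<partial>lborel)"
    by (rule sums_integral[OF f _ sint]) (use fn in auto)
  hence 1: "(\<lambda>n. complex_of_real (c n powr (r - 1) * K)) sums (LINT u:{0<..}|lborel. F u)"
    unfolding fi eq set_lebesgue_integral_def .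
  have "(\<lambda>n. of_real ((2 * pi) powr (r - 1) * K) * of_nat (Suc n) powr - of_real (1 - r)) sums
      (of_real ((2 * pi) powr (r - 1) * K) * dirichlet_zeta (of_real (1 - r)))"
    by (intro sums_mult dirichlet_zeta_sums) (use r in simp)
  also have "(\<lambda>n. of_real ((2 * pi) powr (r - 1) * K) * of_nat (Suc n) powr - of_real (1 - r)) =
      (\<lambda>n. complex_of_real (c n powr (r - 1) * K))"
  proof
    fix n
    have "of_nat (Suc n) powr - complex_of_real (1 - r) = of_real (real (Suc n) powr - (1 - r))"
      using powr_of_real[of "real (Suc n)" "- (1 - r)"] by (simp del: of_nat_Suc)
    thus "of_real ((2 * pi) powr (r - 1) * K) * of_nat (Suc n) powr - of_real (1 - r) = complex_of_real (c n powr (r - 1) * K)"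
      unfolding cpow by (simp del: of_nat_Suc)
  qed
  finally show "(LINT u:{0<..}|lborel. F u) = of_real ((2 * pi) powr (r - 1) * K) * dirichlet_zeta (of_real (1 - r))"
    by (rule sums_unique2[OF 1])
qed

text \<open>\<open>Bexp z + Bexp (- z)\<close> is constantly -1 near 0, so twice the limit at 0 is
  -1.\<close>

lemma bcoeff_0: "bcoeff 0 = - 1 / 2"
proof -
  have lim: "(Bexp \<longlongrightarrow> bcoeff 0) (at 0)"
    by (rule powser_limit_0_strong[of 6]) (auto intro: bcoeff_sums)
  have "filterlim uminus (at 0) (at (0::complex))"
    by (auto simp: filterlim_at eventually_at_filter intro!: tendsto_eq_intros)
  from filterlim_compose[OF lim this] have "((\<lambda>z. Bexp (- z)) \<longlongrightarrow> bcoeff 0) (at 0)" .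
  from tendsto_add[OF lim this] have 1: "((\<lambda>z. Bexp z + Bexp (- z)) \<longlongrightarrow> bcoeff 0 + bcoeff 0) (at 0)" .
  have "eventually (\<lambda>z. z \<in> ball 0 3 - {0}) (at (0::complex))"
    by (rule eventually_at_in_open) auto
  hence "eventually (\<lambda>z. Bexp z + Bexp (- z) = -1) (at 0)"
  proof eventually_elim
    case (elim z)
    have "exp z \<noteq> 1"
    proof
      assume "exp z = 1"
      then obtain n where n: "Re z = 0" "Im z = of_int (2 * n) * pi" using exp_eq_1 by blast
      have "n \<noteq> 0" using n elim by (auto simp: complex_eq_iff)
      hence "\<bar>of_int n\<bar> \<ge> (1::real)" by linarith
      hence "2 * pi * \<bar>of_int n\<bar> \<ge> 2 * pi * 1" by (intro mult_left_mono) auto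
      hence "\<bar>Im z\<bar> \<ge> 2 * pi" unfolding n by (simp add: abs_mult mult_ac)
      thus False using elim abs_Im_le_cmod[of z] pi_gt3 by auto
    qed
    have aux: "1 / d + 1 / (1 / e - 1) = -1" if "d \<noteq> 0" "e \<noteq> 0" "e = d + 1" for d e :: complex
    proof -
      have "1 / e - 1 = - d / e" using that by (simp add: field_simps)
      thus ?thesis using that(1,2) by (simp add: that(3) add_divide_distrib)
    qed
    have "1 / (exp z - 1) + 1 / (1 / exp z - 1) = -1"
      by (rule aux) (use \<open>exp z \<noteq> 1\<close> in auto)
    thus ?case by (simp add: Bexp_def exp_minus inverse_eq_divide)
  qed
  hence "((\<lambda>z. Bexp z + Bexp (- z)) \<longlongrightarrow> -1) (at 0)" by (simp add: tendsto_cong)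
  from tendsto_unique[OF _ 1 this] have "bcoeff 0 + bcoeff 0 = -1" by simp
  thus ?thesis by (simp add: field_simps)
qed

text \<open>The series starts at index 1 because the constant term is cancelled; then
  \<open>r + Suc j > 0\<close> makes every power integrable at 0 although
  \<open>r < 0\<close>.\<close>

lemma Bexp_mellin_head: "(\<lambda>j. bcoeff (Suc j) / (of_real r + of_nat (Suc j))) sums (LINT u:{0<..<1}|lborel. F u)"
proof -
  have e: "r + real (Suc j) > 0" for j using r by simp
  define f where "f = (\<lambda>j u. bcoeff (Suc j) * complex_of_real (indicator {0<..<1} u *\<^sub>R u powr (r + real (Suc j) - 1)))"
  have g: "integrable lborel (\<lambda>u. indicator {0<..<1} u *\<^sub>R u powr (r + real (Suc j) - 1))"
    "(\<integral>u. indicator {0<..<1} u *\<^sub>R u powr (r + real (Suc j) - 1) \<partial>lborel) = 1 / (r + real (Suc j))" for j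
    using powr_integral_head[OF e[of j]] unfolding set_integrable_def set_lebesgue_integral_def by auto
  have f: "integrable lborel (f j)" for j
    unfolding f_def by (intro integrable_mult_right integrable_of_real g)
  have fi: "integral\<^sup>L lborel (f j) = bcoeff (Suc j) / (of_real r + of_nat (Suc j))" for j
    unfolding f_def integral_mult_right_zero integral_complex_of_real g(2) by simp
  have nf: "(\<integral>u. norm (f j u) \<partial>lborel) = norm (bcoeff (Suc j)) / (r + real (Suc j))" for j
  proof -
    have "(\<lambda>u. norm (f j u)) = (\<lambda>u. norm (bcoeff (Suc j)) * (indicator {0<..<1} u *\<^sub>R u powr (r + real (Suc j) - 1)))"
      unfolding f_def norm_mult norm_of_real by (simp add: abs_mult)
    thus ?thesis using g(2)[of j] by (simp only: integral_mult_right_zero) simp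
  qed
  have smn: "summable (\<lambda>j. norm (bcoeff (Suc j)))"
  proof (rule summable_comparison_test'[OF summable_ignore_initial_segment[OF bcoeff_summable, of 1]])
    show "norm (norm (bcoeff (Suc j))) \<le> norm (bcoeff (j + 1)) * 2 ^ (j + 1)" for j
      using mult_left_mono[of 1 "2 ^ (j + 1)" "norm (bcoeff (j + 1))"] one_le_power[of "2::real" "j + 1"] by simp
  qed
  have sint: "summable (\<lambda>j. \<integral>u. norm (f j u) \<partial>lborel)"
  proof (rule summable_comparison_test'[OF summable_mult[OF smn, of "1 / (r + 1)"]])
    fix j
    have "norm (bcoeff (Suc j)) / (r + real (Suc j)) \<le> norm (bcoeff (Suc j)) / (r + 1)"
      using r by (intro divide_left_mono mult_pos_pos) auto
    thus "norm (\<integral>u. norm (f j u) \<partial>lborel) \<le> 1 / (r + 1) * norm (bcoeff (Suc j))"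
      unfolding nf using e[of j] by simp
  qed
  have fs: "(\<lambda>j. f j u) sums (indicator {0<..<1} u *\<^sub>R F u)" and fn: "summable (\<lambda>j. norm (f j u))" for u
  proof -
    show "(\<lambda>j. f j u) sums (indicator {0<..<1} u *\<^sub>R F u)"
    proof (cases "u \<in> {0<..<1}")
      case True
      have "(\<lambda>j. bcoeff j * of_real u ^ j) sums Bexp (of_real u)"
        by (rule bcoeff_sums) (use True in auto)
      hence "(\<lambda>j. bcoeff (Suc j) * of_real u ^ Suc j) sums (Bexp (of_real u) + 1 / 2)"
        by (subst sums_Suc_iff) (simp add: bcoeff_0)
      from sums_mult[OF this, of "of_real (u powr (r - 1))"]
      have "(\<lambda>j. of_real (u powr (r - 1)) * (bcoeff (Suc j) * of_real u ^ Suc j)) sums F u"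
        unfolding F_def .
      moreover have "of_real (u powr (r - 1)) * (bcoeff (Suc j) * of_real u ^ Suc j) = f j u" for j
      proof -
        have "u powr (r + real (Suc j) - 1) = u powr (r - 1) * u ^ Suc j"
          using True by (simp add: powr_realpow[symmetric] powr_add[symmetric] algebra_simps del: power_Suc)
        thus ?thesis using True by (simp add: f_def del: power_Suc of_nat_Suc)
      qed
      ultimately show ?thesis using True by simp
    qed (simp add: f_def)
    show "summable (\<lambda>j. norm (f j u))"
    proof (cases "u \<in> {0<..<1}")
      case True
      show ?thesis
      proof (rule summable_comparison_test'[OF summable_mult2[OF smn, of "u powr r"]])
        fix j
        have "u powr (r + real (Suc j) - 1) \<le> u powr r" using True by (intro powr_mono') auto
        thus "norm (norm (f j u)) \<le> norm (bcoeff (Suc j)) * u powr r"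
          using True by (simp add: f_def norm_mult mult_left_mono del: of_nat_Suc)
      qed
    qed (simp add: f_def)
  qed
  have eq: "(\<Sum>j. f j u) = indicator {0<..<1} u *\<^sub>R F u" for u using fs[of u] by (simp add: sums_iff)
  have "(\<lambda>j. integral\<^sup>L lborel (f j)) sums (\<integral>u. (\<Sum>j. f j u) \<partial>lborel)"
    by (rule sums_integral[OF f _ sint]) (use fn in auto)
  thus ?thesis unfolding fi eq set_lebesgue_integral_def .
qed

text \<open>On u \<ge> 1 the sum of \<open>exp (- (n * u))\<close> equals
  \<open>1 / u + Bexp u\<close>, which exceeds \<open>Bexp u + 1/2\<close> by
  \<open>1 / u - 1/2\<close>; the two rational terms are the integrals of these elementary
  parts.\<close>

lemma Bexp_mellin_tail:
  "(\<Sum>m. inc_Gamma 1 (of_real r) (real (Suc m))) =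
     (LINT u:{1..}|lborel. F u) - 1 / (of_real r - 1) + 1 / (2 * of_real r)"
proof -
  define g where "g = (\<lambda>m u. indicator {1..} u *\<^sub>R (u powr (r - 1) * exp (- (real (Suc m) * u))))"
  define f where "f = (\<lambda>m u. complex_of_real (g m u))"
  have me: "f m u = indicator {1..} u *\<^sub>R mellin_exp (of_real r) (real (Suc m)) u" for m u
  proof (cases "u \<ge> 1")
    case True
    thus ?thesis using powr_of_real[of u "r - 1"] by (simp add: f_def g_def mellin_exp_def)
  qed (simp add: f_def g_def)
  have f: "integrable lborel (f m)" for m
    unfolding me using mellin_exp_tail_integrable[of 1 "real (Suc m)" "of_real r"] by (simp add: set_integrable_def)
  have fi: "integral\<^sup>L lborel (f m) = inc_Gamma 1 (of_real r) (real (Suc m))" for m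
    unfolding me inc_Gamma_def set_lebesgue_integral_def ..
  have gnn: "g m u \<ge> 0" for m u by (simp add: g_def)
  have nf: "(\<integral>u. norm (f m u) \<partial>lborel) = norm (inc_Gamma 1 (of_real r) (real (Suc m)))" for m
  proof -
    have "inc_Gamma 1 (of_real r) (real (Suc m)) = of_real (integral\<^sup>L lborel (g m))"
      unfolding fi[symmetric] f_def by (rule integral_complex_of_real)
    hence "norm (inc_Gamma 1 (of_real r) (real (Suc m))) = integral\<^sup>L lborel (g m)"
      using Bochner_Integration.integral_nonneg[of lborel "g m"] gnn by simp
    thus ?thesis using gnn by (simp add: f_def)
  qed
  obtain C where C: "C \<ge> 0" "\<And>x. x \<ge> 1 \<Longrightarrow> norm (inc_Gamma 1 (of_real r) x) \<le> C * exp (- x)"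
    using inc_Gamma_bound_ball[of 1 "norm (complex_of_real r)"] by auto
  have sint: "summable (\<lambda>m. \<integral>u. norm (f m u) \<partial>lborel)"
  proof (rule summable_comparison_test'[OF summable_mult[OF summable_exp_nat[of 1], of C]])
    show "norm (\<integral>u. norm (f m u) \<partial>lborel) \<le> C * exp (- (real (Suc m) * 1))" for m
      unfolding nf using C(2)[of "real (Suc m)"] by simp
  qed simp
  have fs: "(\<lambda>m. f m u) sums (indicator {1..} u *\<^sub>R (F u + (of_real (u powr ((r - 1) - 1)) - of_real (1 / 2 * u powr (r - 1)))))"
    and fn: "summable (\<lambda>m. norm (f m u))" for u
  proof -
    show "(\<lambda>m. f m u) sums (indicator {1..} u *\<^sub>R (F u + (of_real (u powr ((r - 1) - 1)) - of_real (1 / 2 * u powr (r - 1)))))"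
    proof (cases "u \<ge> 1")
      case True
      have p: "u powr (r - 1 - 1) = u powr (r - 1) / u" using True by (simp add: powr_diff power2_eq_square)
      from True have "(\<lambda>m. complex_of_real (exp (- (real (Suc m) * u)))) sums (1 / of_real u + Bexp (of_real u))"
        by (intro exp_geometric_sums) auto
      from sums_mult[OF this, of "of_real (u powr (r - 1))"] show ?thesis
        using True unfolding p by (simp add: f_def g_def F_def algebra_simps)
    qed (simp add: f_def g_def)
    show "summable (\<lambda>m. norm (f m u))"
    proof (cases "u \<ge> 1")
      case True
      have "summable (\<lambda>m. u powr (r - 1) * exp (- (real (Suc m) * u)))"
        by (intro summable_mult summable_exp_nat) (use True in simp)
      thus ?thesis unfolding f_def norm_of_real abs_of_nonneg[OF gnn] using True by (simp add: g_def)
    qed (simp add: f_def g_def)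
  qed
  have Fint: "set_integrable lborel {1..} F"
    by (rule set_integrable_subset[OF Bexp_mellin(1)]) auto
  have pint: "set_integrable lborel {1..} (\<lambda>u. complex_of_real (u powr ((r - 1) - 1)))"
    "set_integrable lborel {1..} (\<lambda>u. complex_of_real (1 / 2 * u powr (r - 1)))"
  proof -
    have 1: "integrable lborel (\<lambda>u. indicator {1..} u *\<^sub>R u powr ((r - 1) - 1))"
      using powr_integral_tail(1)[of "r - 1"] r by (simp add: set_integrable_def)
    from integrable_of_real[OF this, where 'a = complex]
    show "set_integrable lborel {1..} (\<lambda>u. complex_of_real (u powr ((r - 1) - 1)))"
      by (simp add: set_integrable_def scaleR_conv_of_real)
    have 2: "integrable lborel (\<lambda>u. 1 / 2 * (indicator {1..} u *\<^sub>R u powr (r - 1)))"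
      using powr_integral_tail(1)[of r] r by (intro integrable_mult_right) (simp add: set_integrable_def)
    from integrable_of_real[OF this, where 'a = complex]
    show "set_integrable lborel {1..} (\<lambda>u. complex_of_real (1 / 2 * u powr (r - 1)))"
      by (simp add: set_integrable_def scaleR_conv_of_real mult_ac)
  qed
  have "(\<lambda>m. integral\<^sup>L lborel (f m)) sums (\<integral>u. (\<Sum>m. f m u) \<partial>lborel)"
    by (rule sums_integral[OF f _ sint]) (use fn in auto)
  hence "(\<Sum>m. inc_Gamma 1 (of_real r) (real (Suc m))) =
      (LINT u:{1..}|lborel. F u + (of_real (u powr ((r - 1) - 1)) - of_real (1 / 2 * u powr (r - 1))))"
    unfolding fi sums_unique[OF fs, symmetric] set_lebesgue_integral_def by (simp only: sums_unique[symmetric])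
  also have "\<dots> = (LINT u:{1..}|lborel. F u) + ((LINT u:{1..}|lborel. of_real (u powr ((r - 1) - 1))) -
      (LINT u:{1..}|lborel. of_real (1 / 2 * u powr (r - 1))))"
    by (subst set_integral_add(2)[OF Fint set_integral_diff(1)[OF pint]], subst set_integral_diff(2)[OF pint]) (rule refl)
  also have "(LINT u:{1..}|lborel. complex_of_real (u powr ((r - 1) - 1))) = of_real (- 1 / (r - 1))"
    unfolding set_integral_complex_of_real using powr_integral_tail(2)[of "r - 1"] r by simp
  also have "(LINT u:{1..}|lborel. complex_of_real (1 / 2 * u powr (r - 1))) = of_real (1 / 2 * (- 1 / r))"
    unfolding set_integral_complex_of_real set_integral_mult_right using powr_integral_tail(2)[of r] r by simp
  finally show ?thesis by (simp add: algebra_simps)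
qed

text \<open>The corrections of head and tail cancel: \<open>bcoeff 0 / r = - 1 / (2 * r)\<close>
  against the integral of the constant 1/2, and the explicit pole of \<open>zcoeff 0\<close> at 1
  against the integral of 1/u. What remains is one integral over the whole half-line.\<close>

lemma zcoeff_0_eq_integral: "zcoeff 0 (of_real r) = rGamma (of_real r) * (LINT u:{0<..}|lborel. F u)"
proof -
  let ?s = "complex_of_real r"
  have nz: "?s + of_nat j \<noteq> 0" for j
  proof
    assume "?s + of_nat j = 0"
    hence "complex_of_real (r + real j) = 0" by simp
    hence "r + real j = 0" unfolding of_real_eq_0_iff .
    thus False using r by (cases j) auto
  qed
  have "(LINT u:{0<..<1} \<union> {1..}|lborel. F u) = (LINT u:{0<..<1}|lborel. F u) + (LINT u:{1..}|lborel. F u)"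
    by (rule set_integral_Un) (auto intro: set_integrable_subset[OF Bexp_mellin(1)])
  moreover have "{0<..<1} \<union> {1..} = {0::real<..}" by auto
  ultimately have split: "(LINT u:{0<..}|lborel. F u) = (LINT u:{0<..<1}|lborel. F u) + (LINT u:{1..}|lborel. F u)" by simp
  have "(\<lambda>j. bcoeff j / (?s + of_nat j)) sums ((LINT u:{0<..<1}|lborel. F u) + bcoeff 0 / (?s + of_nat 0))"
    using Bexp_mellin_head by (subst (asm) sums_Suc_iff[of "\<lambda>j. bcoeff j / (?s + of_nat j)"]) simp
  from sums_mult[OF this, of "rGamma ?s"]
  have "(\<lambda>j. rGamma ?s * (bcoeff j / (?s + of_nat j))) sums
      (rGamma ?s * ((LINT u:{0<..<1}|lborel. F u) + bcoeff 0 / (?s + of_nat 0)))" .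
  also have "(\<lambda>j. rGamma ?s * (bcoeff j / (?s + of_nat j))) = (\<lambda>j. bcoeff (j + 0) * of_nat (j + 0 choose 0) * rGamma_div j ?s)"
    using nz by (simp add: rGamma_div_eq mult_ac)
  finally have 1: "zcoeff_reg1 0 ?s = rGamma ?s * ((LINT u:{0<..<1}|lborel. F u) - 1 / (2 * ?s))"
    unfolding zcoeff_reg1_def by (simp add: sums_iff bcoeff_0)
  have 2: "zcoeff_reg2 0 ?s = (LINT u:{1..}|lborel. F u) - 1 / (?s - 1) + 1 / (2 * ?s)"
    unfolding zcoeff_reg2_def using Bexp_mellin_tail by simp
  show ?thesis unfolding zcoeff_def zcoeff_reg_def 1 2 split by (simp add: algebra_simps)
qed

text \<open>With \<open>x = pi * r / 2\<close>, reflection gives \<open>K = pi / cos x\<close> and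
  \<open>rGamma r = Gamma (1 - r) * (2 * sin x * cos x) / pi\<close>. The cosines cancel and leave
  the sine of the functional equation.\<close>

lemma functional_equation_real:
  "zcoeff 0 (of_real r) = 2 * of_real (2 * pi) powr (of_real r - 1) * sin (of_real pi * of_real r / 2) *
      Gamma (1 - of_real r) * dirichlet_zeta (1 - of_real r)"
proof -
  let ?s = "complex_of_real r"
  define x where "x = of_real pi * ?s / 2"
  have K: "of_real K = of_real pi / cos x"
  proof -
    have "complex_of_real K = Gamma ((1 + ?s) / 2) * Gamma (1 - (1 + ?s) / 2)"
    proof -
      have "(1 + ?s) / 2 = of_real ((1 + r) / 2)" "1 - (1 + ?s) / 2 = of_real ((1 - r) / 2)"
        by (simp_all add: field_simps)
      thus ?thesis unfolding K_def by (simp only: Gamma_complex_of_real of_real_mult)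
    qed
    also have "\<dots> = of_real pi / sin (of_real pi * ((1 + ?s) / 2))" by (rule Gamma_reflection_complex)
    also have "of_real pi * ((1 + ?s) / 2) = x + of_real pi / 2" by (simp add: x_def field_simps)
    also have "sin (x + of_real pi / 2) = cos x" by (simp add: sin_add)
    finally show ?thesis .
  qed
  have cos0: "cos x \<noteq> 0"
  proof
    assume "cos x = 0"
    have x': "x = of_real (pi * r / 2)" by (simp add: x_def)
    have "pi * (- 1) < pi * r" using r by (intro mult_strict_left_mono) auto
    moreover have "pi * r < 0" using r by (simp add: mult_pos_neg)
    ultimately have "cos (pi * r / 2) > 0" using r by (intro cos_gt_zero_pi) auto
    thus False using \<open>cos x = 0\<close> unfolding x' cos_of_real by simp
  qed
  have rG: "rGamma ?s = Gamma (1 - ?s) * (2 * sin x * cos x) / of_real pi"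
  proof -
    have "1 - ?s \<notin> \<int>\<^sub>\<le>\<^sub>0"
      using r by (auto elim!: nonpos_Ints_cases' simp: complex_eq_iff)
    hence "rGamma (1 - ?s) * Gamma (1 - ?s) = 1"
      by (simp add: rGamma_inverse_Gamma Gamma_eq_zero_iff)
    hence "rGamma ?s = (rGamma ?s * rGamma (1 - ?s)) * Gamma (1 - ?s)" by (simp add: mult.assoc)
    also have "rGamma ?s * rGamma (1 - ?s) = sin (of_real pi * ?s) / of_real pi" by (rule rGamma_reflection_complex)
    also have "of_real pi * ?s = 2 * x" by (simp add: x_def)
    also have "sin (2 * x) = 2 * sin x * cos x" by (rule sin_double)
    finally show ?thesis by (simp add: mult_ac)
  qed
  have pw: "complex_of_real ((2 * pi) powr (r - 1)) = of_real (2 * pi) powr (?s - 1)"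
    using powr_of_real[of "2 * pi" "r - 1"] by simp
  have "zcoeff 0 ?s = rGamma ?s * (of_real ((2 * pi) powr (r - 1)) * of_real K * dirichlet_zeta (of_real (1 - r)))"
    unfolding zcoeff_0_eq_integral Bexp_mellin(2) by simp
  also have "\<dots> = 2 * of_real (2 * pi) powr (?s - 1) * sin x * Gamma (1 - ?s) * dirichlet_zeta (1 - ?s)"
    unfolding rG K pw using cos0 by simp
  finally show ?thesis unfolding x_def .
qed

end

text \<open>The identity theorem carries the equation from (-1, 0) to the half-plane
  \<open>Re s < 0\<close>, where \<open>1 - s\<close> lies in the domain of the Dirichlet
  series.\<close>

theorem functional_equation:
  assumes s: "Re s < 0"
  shows "zeta1 s = (s - 1) * (2 * of_real (2 * pi) powr (s - 1) * sin (of_real pi * s / 2) *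
      Gamma (1 - s) * dirichlet_zeta (1 - s))"
proof -
  define f where "f = (\<lambda>s. zeta1 s - (s - 1) * (2 * of_real (2 * pi) powr (s - 1) * sin (of_real pi * s / 2) *
      Gamma (1 - s) * dirichlet_zeta (1 - s)))"
  define S where "S = {s. Re s < 0}"
  have S: "open S" "connected S" unfolding S_def
    by (auto intro: open_halfspace_Re_lt convex_connected convex_halfspace_Re_lt)
  have dz: "(\<lambda>s. dirichlet_zeta (1 - s)) holomorphic_on S"
  proof -
    have "(dirichlet_zeta \<circ> (\<lambda>s. 1 - s)) holomorphic_on S"
      by (rule holomorphic_on_compose_gen[OF _ dirichlet_zeta_holomorphic])
         (auto intro!: holomorphic_intros simp: S_def)
    thus ?thesis by (simp add: o_def)
  qed
  have "1 - s \<notin> \<int>\<^sub>\<le>\<^sub>0" if "s \<in> S" for s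
    using that by (auto elim!: nonpos_Ints_cases' simp: S_def complex_eq_iff)
  hence holf: "f holomorphic_on S"
    unfolding f_def by (intro holomorphic_intros zeta1_holomorphic dz) auto
  have lim: "(- 1 / 2 :: complex) islimpt complex_of_real ` {-1<..<0}"
    unfolding islimpt_approachable
  proof (intro allI impI)
    fix e :: real assume e: "e > 0"
    define d where "d = min (e / 2) (1/4)"
    have d: "d > 0" "d < e" "d \<le> 1/4" using e by (auto simp: d_def)
    have "dist (complex_of_real (- 1/2 + d)) (- 1/2) = norm (complex_of_real d)"
      by (simp add: dist_norm)
    hence "dist (complex_of_real (- 1/2 + d)) (- 1/2) < e" using d by simp
    moreover have "complex_of_real (- 1/2 + d) \<noteq> - 1/2"
      using d by (simp add: complex_eq_iff)
    moreover have "complex_of_real (- 1/2 + d) \<in> complex_of_real ` {-1<..<0}" using d by (intro imageI) auto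
    ultimately show "\<exists>x'\<in>complex_of_real ` {-1<..<0}. x' \<noteq> - 1/2 \<and> dist x' (- 1/2 :: complex) < e" by blast
  qed
  have sub: "complex_of_real ` {-1<..<0} \<subseteq> S" by (auto simp: S_def)
  have zero: "f z = 0" if z: "z \<in> complex_of_real ` {-1<..<0}" for z
  proof -
    obtain r where r: "- 1 < r" "r < 0" "z = complex_of_real r" using z by auto
    have z1: "z \<noteq> 1" using r by (auto simp: complex_eq_iff)
    show ?thesis using functional_equation_real[OF r(1,2)] zcoeff_0[OF z1] z1
      unfolding f_def r(3)[symmetric] by (simp add: field_simps)
  qed
  have half: "- 1 / 2 \<in> S" by (simp add: S_def)
  have "s \<in> S" using s by (simp add: S_def)
  hence "f s = 0"
    using analytic_continuation[OF holf S sub half lim] zero by blast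
  thus ?thesis by (simp add: f_def)
qed

section \<open>Numerical estimates and nonvanishing of zeta'/zeta at nonpositive integers\<close>

lemma dirichlet_zeta_real_le:
  assumes h: "(h::real) > 0"
  shows "Re (dirichlet_zeta (of_real (1 + h))) \<le> 1 + 1 / h"
proof -
  have s: "(\<lambda>n. real (Suc n) powr - (1 + h)) sums Re (dirichlet_zeta (of_real (1 + h)))"
  proof -
    have "of_nat (Suc n) powr - complex_of_real (1 + h) = of_real (real (Suc n) powr - (1 + h))" for n
      using powr_of_real[of "real (Suc n)" "- (1 + h)"] by (simp del: of_nat_Suc)
    hence "(\<lambda>n. complex_of_real (real (Suc n) powr - (1 + h))) sums dirichlet_zeta (of_real (1 + h))"
      using dirichlet_zeta_sums[of "of_real (1 + h)"] h by simp
    from sums_Re[OF this] show ?thesis by simp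
  qed
  \<comment> \<open>By the mean value theorem for \<open>- (x powr - h) / h\<close>, each term is
    dominated by a telescoping difference; the differences add up to \<open>1 / h\<close>.\<close>
  have step: "real (Suc (Suc n)) powr - (1 + h) \<le> 1 / h * (real (Suc n) powr - h - real (Suc (Suc n)) powr - h)" for n
  proof -
    define f where "f = (\<lambda>x::real. - (x powr - h) / h)"
    have "\<exists>z>real (Suc n). z < real (Suc (Suc n)) \<and>
        f (real (Suc (Suc n))) - f (real (Suc n)) = (real (Suc (Suc n)) - real (Suc n)) * z powr - (1 + h)"
    proof (rule MVT2)
      fix x :: real assume "real (Suc n) \<le> x"
      hence "x > 0" by simp
      thus "(f has_real_derivative x powr - (1 + h)) (at x)" unfolding f_def using h
        by (auto intro!: derivative_eq_intros simp: powr_diff powr_add field_simps powr_minus)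
    qed simp
    then obtain z where z: "real (Suc n) < z" "z < real (Suc (Suc n))"
      "f (real (Suc (Suc n))) - f (real (Suc n)) = (real (Suc (Suc n)) - real (Suc n)) * z powr - (1 + h)" by blast
    have "real (Suc (Suc n)) powr - (1 + h) \<le> z powr - (1 + h)"
      using z h by (intro powr_mono2') auto
    also have "\<dots> = f (real (Suc (Suc n))) - f (real (Suc n))" using z(3) by simp
    also have "\<dots> = 1 / h * (real (Suc n) powr - h - real (Suc (Suc n)) powr - h)"
      unfolding f_def using h by (simp add: field_simps del: of_nat_Suc)
    finally show ?thesis .
  qed
  have "(\<lambda>n. real (Suc n) powr - h) \<longlonglongrightarrow> 0"
    using h by (intro tendsto_neg_powr filterlim_compose[OF filterlim_real_sequentially filterlim_Suc]) auto
  from telescope_sums'[OF this]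
  have "(\<lambda>n. real (Suc n) powr - h - real (Suc (Suc n)) powr - h) sums 1" by simp
  from sums_mult[OF this, of "1 / h"]
  have t: "(\<lambda>n. 1 / h * (real (Suc n) powr - h - real (Suc (Suc n)) powr - h)) sums (1 / h)" by simp
  have s': "(\<lambda>n. real (Suc (Suc n)) powr - (1 + h)) sums (Re (dirichlet_zeta (of_real (1 + h))) - 1)"
    using s by (subst sums_Suc_iff[of "\<lambda>n. real (Suc n) powr - (1 + h)"]) simp
  show ?thesis using sums_le[OF step s' t] by simp
qed

text \<open>The difference quotient at 1 + h is zeta(1 + h) - 1/h, which the preceding comparison
  bounds by 1. The exact value is the Euler-Mascheroni constant, but the bound leaves margin enough
  for \<open>zM_0_nz\<close>.\<close>

lemma deriv_zeta1_1_le: "Re (deriv zeta1 1) \<le> 1"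
proof -
  have "((\<lambda>s. (zeta1 s - zeta1 1) / (s - 1)) \<longlongrightarrow> deriv zeta1 1) (at 1)"
    using zeta1_has_deriv[of 1] by (simp add: has_field_derivative_iff)
  moreover have "filterlim (\<lambda>h. complex_of_real (1 + h)) (at 1) (at_right 0)"
    unfolding filterlim_at by (auto intro!: tendsto_eq_intros simp: eventually_at_right_field intro: exI[of _ 1])
  ultimately have "((\<lambda>h. (zeta1 (of_real (1 + h)) - zeta1 1) / (of_real (1 + h) - 1)) \<longlongrightarrow> deriv zeta1 1) (at_right 0)"
    by (rule filterlim_compose)
  hence lim: "((\<lambda>h. Re ((zeta1 (of_real (1 + h)) - zeta1 1) / (of_real (1 + h) - 1))) \<longlongrightarrow> Re (deriv zeta1 1)) (at_right 0)"
    by (rule tendsto_Re)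
  show ?thesis
  proof (rule tendsto_upperbound[OF lim])
    show "\<forall>\<^sub>F h in at_right 0. Re ((zeta1 (of_real (1 + h)) - zeta1 1) / (of_real (1 + h) - 1)) \<le> 1"
      using eventually_at_right_less[of "0::real"]
    proof eventually_elim
      case (elim h)
      let ?s = "complex_of_real (1 + h)"
      have "zeta1 ?s = of_real h * dirichlet_zeta ?s"
        using dirichlet_zeta_eq[of ?s] elim by simp
      hence "(zeta1 ?s - zeta1 1) / (?s - 1) = dirichlet_zeta ?s - of_real (1 / h)"
        using elim by (simp add: field_simps)
      thus ?case using dirichlet_zeta_real_le[OF elim] by simp
    qed
  qed simp
qed

text \<open>The certificates are exp(1)^7 < 2.72^7 < 6^4, and the quadratic Taylor polynomial of exp
  at 475/1000, a quarter of 19/10. Both constants are tuned to the sign decisions in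
  \<open>zM_0_nz\<close> and \<open>zM_neg_odd\<close>.\<close>

lemma ln_2pi_bounds: "ln (2 * pi) > 7 / 4" "ln (2 * pi) < 19 / 10"
proof -
  have "exp (7/4 :: real) ^ 4 = exp 1 ^ 7" unfolding exp_of_nat_mult[symmetric] by simp
  also have "\<dots> < (272/100) ^ 7" by (intro power_strict_mono e_less_272) auto
  also have "\<dots> < (6::real) ^ 4" by (simp add: eval_nat_numeral)
  finally have "exp (7/4 :: real) < 6" by (rule power_less_imp_less_base) simp
  also have "6 < 2 * pi" using pi_gt3 by simp
  finally have "ln (exp (7/4)) < ln (2 * pi)" by (subst ln_less_cancel_iff) auto
  thus "ln (2 * pi) > 7 / 4" by simp
  have "2 * pi < (1 + 475/1000 + (475/1000)\<^sup>2 / 2 :: real) ^ 4"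
    using pi_approx by (simp add: eval_nat_numeral)
  also have "\<dots> \<le> exp (475/1000) ^ 4"
    by (intro power_mono exp_lower_Taylor_quadratic) auto
  also have "\<dots> = exp (19/10)" unfolding exp_of_nat_mult[symmetric] by simp
  finally have "ln (2 * pi) < ln (exp (19/10))" by (subst ln_less_cancel_iff) auto
  thus "ln (2 * pi) < 19 / 10" by simp
qed

lemma powr_shift_has_deriv:
  assumes "w \<noteq> (0 :: complex)"
  shows "((\<lambda>s. w powr (s - 1)) has_field_derivative w powr (z - 1) * Ln w) (at z)"
  using assms unfolding powr_def by (auto intro!: derivative_eq_intros)

lemma Re_euler_mascheroni: "Re euler_mascheroni = euler_mascheroni"
  by (metis of_real_euler_mascheroni Re_complex_of_real)

text \<open>At 0 the zero of the sine cancels the pole of zeta(1 - s), so the functional equation is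
  first extended to \<open>Re s < 1\<close> with \<open>S s = sin (pi * s / 2) / s\<close>.
  Differentiation at 0 then gives
  \<open>zM 0 = - (ln (2 * pi) + euler_mascheroni - deriv zeta1 1)\<close>, whose real part is
  negative because that of \<open>deriv zeta1 1\<close> is at most 1.\<close>

lemma zM_0_nz: "zM 0 \<noteq> 0"
proof -
  define S where "S = (\<lambda>s. if s = 0 then deriv (\<lambda>s. sin (of_real pi * s / 2)) 0
      else (sin (of_real pi * s / 2) - sin (of_real pi * 0 / 2)) / (s - 0 :: complex))"
  have holS: "S holomorphic_on UNIV" unfolding S_def
    by (rule pole_lemma) (auto intro!: holomorphic_intros)
  have d: "((\<lambda>s. sin (of_real pi * s / 2)) has_field_derivative of_real pi / 2) (at (0::complex))"
    by (auto intro!: derivative_eq_intros)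
  have S0: "S 0 = of_real pi / 2" using DERIV_imp_deriv[OF d] by (simp add: S_def)
  have Seq: "S s * s = sin (of_real pi * s / 2)" for s by (simp add: S_def)
  \<comment> \<open>Evenness makes the derivative of \<open>S\<close> at 0 vanish, so only the value
    \<open>S 0\<close> enters the derivative of the product.\<close>
  have Seven: "S (- s) = S s" for s by (simp add: S_def)
  have Sd: "(S has_field_derivative deriv S 0) (at 0)"
    by (rule holomorphic_derivI[OF holS open_UNIV UNIV_I])
  have "((\<lambda>s. S (- s)) has_field_derivative deriv S 0 * (- 1)) (at 0)"
    by (rule DERIV_chain2[where f = S]) (use Sd in \<open>auto intro!: derivative_eq_intros\<close>)
  hence "(S has_field_derivative deriv S 0 * (- 1)) (at 0)" by (simp only: Seven)
  from DERIV_unique[OF Sd this] have S1: "deriv S 0 = 0" by simp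
  define R where "R = (\<lambda>s. - (s - 1) * (2 * of_real (2 * pi) powr (s - 1) * S s * Gamma (1 - s) * zeta1 (1 - s)))"
  have nint: "1 - s \<notin> \<int>\<^sub>\<le>\<^sub>0" if "Re s < 1" for s
    using that by (auto elim!: nonpos_Ints_cases' simp: complex_eq_iff)
  have hz: "(\<lambda>s. zeta1 (1 - s)) holomorphic_on A" for A
  proof -
    have "(zeta1 \<circ> (\<lambda>s. 1 - s)) holomorphic_on A"
      by (rule holomorphic_on_compose) (auto intro!: holomorphic_intros zeta1_holomorphic)
    thus ?thesis by (simp add: o_def)
  qed
  have holR: "R holomorphic_on {s. Re s < 1}"
    unfolding R_def using nint by (intro holomorphic_intros hz holomorphic_on_subset[OF holS]) auto
  have eq: "zeta1 s = R s" if s: "Re s < 1" for s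
  proof (rule analytic_continuation_open[where s = "{s. Re s < 0}" and s' = "{s. Re s < 1}" and f = zeta1 and g = R])
    show "{s. Re s < 0} \<noteq> {}" by (intro ex_in_conv[THEN iffD1] exI[of _ "-1"]) simp
    show "zeta1 z = R z" if "z \<in> {s. Re s < 0}" for z
    proof -
      have z: "Re z < 0" "z \<noteq> 0" using that by auto
      have "dirichlet_zeta (1 - z) = zeta1 (1 - z) / (- z)" using dirichlet_zeta_eq[of "1 - z"] z by simp
      moreover have "(z - 1) * (2 * W * (T * z) * G * (Z / - z)) = - (z - 1) * (2 * W * T * G * Z)" for W T G Z
        using z(2) by (simp add: field_simps)
      ultimately show ?thesis using functional_equation[OF z(1)] unfolding R_def Seq[of z, symmetric]
        by (simp only:)
    qed
  qed (use s holR zeta1_holomorphic in \<open>auto intro!: open_halfspace_Re_lt convex_connected convex_halfspace_Re_lt\<close>)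
  have R0: "R 0 = 1 / 2"
    by (simp add: R_def S0 powr_minus)
  have dz: "((\<lambda>s. zeta1 (1 - s)) has_field_derivative deriv zeta1 1 * (- 1)) (at 0)"
    by (rule DERIV_chain2[where f = zeta1]) (use zeta1_has_deriv[of 1] in \<open>auto intro!: derivative_eq_intros\<close>)
  define P where "P = (\<lambda>s. 2 * of_real (2 * pi) powr (s - 1) * S s :: complex)"
  have dP: "(P has_field_derivative (of_real (ln (2 * pi)) / 2)) (at 0)"
  proof -
    have L: "Ln (complex_of_real (2 * pi)) = of_real (ln (2 * pi))" by (rule Ln_of_real) simp
    have "((\<lambda>s. of_real (2 * pi) powr (s - 1)) has_field_derivative of_real (2 * pi) powr (0 - 1) * of_real (ln (2 * pi))) (at (0::complex))"
      unfolding L[symmetric] by (rule powr_shift_has_deriv) simp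
    from DERIV_mult[OF DERIV_cmult[OF this, of 2] Sd]
    show ?thesis unfolding P_def S1 S0 by (simp add: powr_minus field_simps)
  qed
  define Q where "Q = (\<lambda>s::complex. Gamma (1 - s) * zeta1 (1 - s))"
  have dQ: "(Q has_field_derivative (euler_mascheroni - deriv zeta1 1)) (at 0)"
  proof -
    have "((\<lambda>s::complex. Gamma (1 - s)) has_field_derivative euler_mascheroni) (at 0)"
      by (auto intro!: derivative_eq_intros)
    from DERIV_mult[OF this dz] show ?thesis unfolding Q_def by simp
  qed
  have P0: "P 0 = 1 / 2" by (simp add: P_def S0 powr_minus)
  have Q0: "Q 0 = 1" by (simp add: Q_def)
  have "R = (\<lambda>s. - (s - 1) * (P s * Q s))" by (simp add: R_def P_def Q_def mult_ac)
  hence "(R has_field_derivative (- 1) * (P 0 * Q 0) + (- (0 - 1)) * (of_real (ln (2 * pi)) / 2 * Q 0 + P 0 * (euler_mascheroni - deriv zeta1 1))) (at 0)"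
    by (auto intro!: derivative_eq_intros dP dQ simp: algebra_simps)
  hence "(R has_field_derivative - 1 / 2 + (of_real (ln (2 * pi)) + euler_mascheroni - deriv zeta1 1) / 2) (at 0)"
  proof (rule DERIV_cong)
    have "(- 1) * (1 / 2 * 1) + - (0 - 1) * (l / 2 * 1 + 1 / 2 * (e - d)) = - 1 / 2 + (l + e - d) / 2"
      for l e d :: complex by (simp add: field_simps)
    thus "(- 1) * (P 0 * Q 0) + - (0 - 1) * (of_real (ln (2 * pi)) / 2 * Q 0 + P 0 * (euler_mascheroni - deriv zeta1 1)) =
        - 1 / 2 + (of_real (ln (2 * pi)) + euler_mascheroni - deriv zeta1 1) / 2"
      unfolding P0 Q0 .
  qed
  hence "(zeta1 has_field_derivative - 1 / 2 + (of_real (ln (2 * pi)) + euler_mascheroni - deriv zeta1 1) / 2) (at 0)"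
    by (rule has_field_derivative_transform_within_open[OF _ open_halfspace_Re_lt[of 1]]) (auto simp: eq)
  hence d0: "deriv zeta1 0 = - 1 / 2 + (of_real (ln (2 * pi)) + euler_mascheroni - deriv zeta1 1) / 2"
    by (rule DERIV_imp_deriv)
  have z0: "zeta1 0 = 1 / 2" using eq[of 0] R0 by simp
  have "zM 0 = - (of_real (ln (2 * pi)) + euler_mascheroni - deriv zeta1 1)"
    unfolding zM_def d0 z0 by (simp add: field_simps)
  hence "Re (zM 0) = Re (deriv zeta1 1) - ln (2 * pi) - euler_mascheroni"
    by (simp add: Re_euler_mascheroni)
  also have "\<dots> < 0" using deriv_zeta1_1_le ln_2pi_bounds(1) euler_mascheroni_gt_19_over_33 by linarith
  finally show ?thesis by auto
qed

lemma zeta1_neg_even: "j > 0 \<Longrightarrow> zeta1 (- of_nat (2 * j)) = 0"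
proof -
  assume j: "j > 0"
  have "of_real pi * (- of_nat (2 * j)) / 2 = complex_of_real (- (real j * pi))" by simp
  hence "sin (of_real pi * (- of_nat (2 * j)) / 2 :: complex) = of_real (sin (- (real j * pi)))"
    by (simp only: sin_of_real)
  thus ?thesis using functional_equation[of "- of_nat (2 * j)"] j by simp
qed

text \<open>For m \<ge> 8 and n \<ge> 2, the bounds \<Lambda>(n) \<le> n and
  \<open>n ^ m \<ge> n ^ 8 \<ge> 32 * n ^ 3\<close> compare the series with 1/32 times the sum of
  \<open>1 / n\<^sup>2\<close> over n \<ge> 2, which is below 1.\<close>

lemma mangoldt_series_real_bounds:
  assumes m: "m \<ge> 2"
  shows "Re (mangoldt_series (of_nat m)) \<ge> 0"
    and "m \<ge> 8 \<Longrightarrow> Re (mangoldt_series (of_nat m)) \<le> 1 / 32"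
proof -
  have pw: "of_nat (Suc n) powr - of_nat m = complex_of_real (inverse (real (Suc n) ^ m))" for n
    by (simp add: powr_minus powr_nat' del: of_nat_Suc)
  have "(\<lambda>n. mangoldt (Suc n) * of_nat (Suc n) powr - of_nat m) sums mangoldt_series (of_nat m)"
    unfolding mangoldt_series_def
    by (rule summable_sums[OF summable_norm_cancel[OF mangoldt_norm_summable]]) (use m in simp)
  from sums_Re[OF this] have s: "(\<lambda>n. mangoldt (Suc n) * inverse (real (Suc n) ^ m)) sums Re (mangoldt_series (of_nat m))"
    unfolding pw by (simp del: of_nat_Suc of_real_inverse of_real_power of_real_of_nat_eq)
  show "Re (mangoldt_series (of_nat m)) \<ge> 0"
    by (rule sums_le[OF _ sums_zero s]) (auto intro!: mult_nonneg_nonneg mangoldt_nonneg)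
  assume m8: "m \<ge> 8"
  have "(\<lambda>n. 1 / (real n + 1)\<^sup>2) sums (pi\<^sup>2 / 6)"
    using inverse_squares_sums by (simp add: add.commute)
  hence "(\<lambda>n. 1 / (real (Suc n) + 1)\<^sup>2) sums (pi\<^sup>2 / 6 - 1)"
    by (subst sums_Suc_iff[of "\<lambda>n. 1 / (real n + 1)\<^sup>2"]) simp
  from sums_mult[OF this, of "1/32"]
  have b: "(\<lambda>n. 1/32 * (1 / (real (Suc n) + 1)\<^sup>2)) sums (1/32 * (pi\<^sup>2 / 6 - 1))" .
  have s1: "(\<lambda>n. mangoldt (Suc (Suc n)) * inverse (real (Suc (Suc n)) ^ m)) sums Re (mangoldt_series (of_nat m))"
    using s by (subst sums_Suc_iff[of "\<lambda>n. mangoldt (Suc n) * inverse (real (Suc n) ^ m)"]) simp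
  have "Re (mangoldt_series (of_nat m)) \<le> 1/32 * (pi\<^sup>2 / 6 - 1)"
  proof (rule sums_le[OF _ s1 b])
    fix n
    define x where "x = real (Suc (Suc n))"
    have x: "x \<ge> 2" by (simp add: x_def)
    have "32 * x ^ 3 \<le> x ^ 5 * x ^ 3"
      using power_mono[of 2 x 5] x by (intro mult_right_mono) auto
    also have "\<dots> = x ^ 8" by (simp flip: power_add)
    also have "x ^ 8 \<le> x ^ m" using x m8 by (intro power_increasing) auto
    finally have "inverse (x ^ m) \<le> inverse (32 * x ^ 3)" using x by (intro le_imp_inverse_le) auto
    hence "mangoldt (Suc (Suc n)) * inverse (x ^ m) \<le> x * inverse (32 * x ^ 3)"
      using mangoldt_le_real[of "Suc n"] x unfolding x_def by (intro mult_mono) auto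
    also have "\<dots> = 1/32 * (1 / x\<^sup>2)" using x by (simp add: field_simps power2_eq_square power3_eq_cube)
    finally show "mangoldt (Suc (Suc n)) * inverse (real (Suc (Suc n)) ^ m) \<le> 1/32 * (1 / (real (Suc n) + 1)\<^sup>2)"
      by (simp add: x_def add.commute)
  qed
  also have "pi\<^sup>2 / 6 - 1 \<le> 1"
  proof -
    have "pi\<^sup>2 \<le> (3.1415926535899)\<^sup>2" using pi_approx pi_gt_zero by (intro power_mono) auto
    also have "\<dots> \<le> 12" by (simp add: power2_eq_square)
    finally show ?thesis by simp
  qed
  finally show "Re (mangoldt_series (of_nat m)) \<le> 1 / 32" by simp
qed

text \<open>The number ln(2 pi) + \<gamma> is about 2.415 and lies between the harmonic numbers H_5
  and H_7; among odd n the sign in \<open>zM_neg_odd\<close> therefore changes between 5 and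
  7.\<close>

lemma harm_bounds: "n \<le> 5 \<Longrightarrow> (harm n :: real) \<le> 137 / 60" "n \<ge> 7 \<Longrightarrow> (harm n :: real) \<ge> 363 / 140"
proof -
  have "(harm 5 :: real) = 137 / 60" "(harm 7 :: real) = 363 / 140"
    by (simp_all add: harm_expand)
  thus "n \<le> 5 \<Longrightarrow> (harm n :: real) \<le> 137 / 60" "n \<ge> 7 \<Longrightarrow> (harm n :: real) \<ge> 363 / 140"
    using harm_mono[where 'a = real, of n 5] harm_mono[where 'a = real, of 7 n] by auto
qed

text \<open>At an odd negative integer the sine factor of the functional equation is stationary, so
  up to sign the value is ln(2 pi) - Digamma(n + 1) plus the von Mangoldt series at n + 1, where
  Digamma(n + 1) = H_n - \<gamma>. For n \<le> 5 the nonnegative series reinforces the positive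
  rest; for n \<ge> 7 it is too small to offset the negative one.\<close>

lemma zM_neg_odd:
  assumes n: "odd n"
  shows "zM (- of_nat n) \<noteq> 0"
proof -
  define s where "s = - complex_of_nat n"
  have n1: "n \<ge> 1" using n by (cases n) auto
  have s: "Re s < 0" using n1 by (simp add: s_def)
  have s1: "1 - s = of_nat (Suc n)" by (simp add: s_def)
  obtain j where j: "n = 2 * j + 1" using n by (elim oddE)
  define x where "x = of_real pi * s / 2"
  have xr: "x = of_real (- (real j * pi + pi / 2))" unfolding x_def s_def j by (simp add: field_simps)
  have cos0: "cos x = 0" unfolding xr cos_of_real cos_minus by (simp add: cos_add)
  have sin0: "sin x \<noteq> 0" using sin_cos_squared_add[of x] cos0 by auto
  define A where "A = (\<lambda>s. 2 * of_real (2 * pi) powr (s - 1) :: complex)"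
  define B where "B = (\<lambda>s. sin (of_real pi * s / 2) :: complex)"
  define C where "C = (\<lambda>s. Gamma (1 - s) :: complex)"
  define D where "D = (\<lambda>s. dirichlet_zeta (1 - s))"
  define M where "M = mangoldt_series (1 - s)"
  have nint: "1 - s \<notin> \<int>\<^sub>\<le>\<^sub>0"
    using s by (auto elim!: nonpos_Ints_cases' simp: complex_eq_iff)
  have L: "Ln (complex_of_real (2 * pi)) = of_real (ln (2 * pi))" by (rule Ln_of_real) simp
  have dA: "(A has_field_derivative A s * of_real (ln (2 * pi))) (at s)"
    unfolding A_def L[symmetric] mult.assoc by (intro DERIV_cmult powr_shift_has_deriv) simp
  have dB: "(B has_field_derivative 0) (at s)"
    unfolding B_def using cos0[unfolded x_def] by (auto intro!: derivative_eq_intros)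
  have dC: "(C has_field_derivative - (C s * Digamma (1 - s))) (at s)"
    unfolding C_def using nint by (auto intro!: derivative_eq_intros)
  have Re1: "Re (1 - s) > 1" using s by simp
  have "(dirichlet_zeta has_field_derivative - (M * dirichlet_zeta (1 - s))) (at (1 - s))"
    using dirichlet_zeta_deriv(1)[OF Re1] mangoldt_series_times_zeta[OF Re1] by (simp add: M_def)
  hence "((\<lambda>s. dirichlet_zeta (1 - s)) has_field_derivative - (M * dirichlet_zeta (1 - s)) * (- 1)) (at s)"
    by (rule DERIV_chain2) (auto intro!: derivative_eq_intros)
  hence dD: "(D has_field_derivative M * D s) (at s)" unfolding D_def by simp
  define lam where "lam = of_real (ln (2 * pi)) - Digamma (1 - s) + M"
  define R where "R = (\<lambda>s. A s * B s * C s * D s)"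
  have "(R has_field_derivative
      ((A s * of_real (ln (2 * pi)) * B s + 0 * A s) * C s + - (C s * Digamma (1 - s)) * (A s * B s)) * D s + M * D s * (A s * B s * C s)) (at s)"
    unfolding R_def by (intro DERIV_mult dA dB dC dD)
  hence dR: "(R has_field_derivative R s * lam) (at s)"
    unfolding R_def lam_def by (simp add: algebra_simps)
  have "((\<lambda>s. (s - 1) * R s) has_field_derivative 1 * R s + R s * lam * (s - 1)) (at s)"
    by (intro DERIV_mult dR) (auto intro!: derivative_eq_intros)
  hence "(zeta1 has_field_derivative 1 * R s + R s * lam * (s - 1)) (at s)"
    by (rule has_field_derivative_transform_within_open[OF _ open_halfspace_Re_lt[of 0]])
       (use s in \<open>auto simp: functional_equation R_def A_def B_def C_def D_def\<close>)
  hence d: "deriv zeta1 s = R s + R s * lam * (s - 1)" by (simp add: DERIV_imp_deriv)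
  have z: "zeta1 s = (s - 1) * R s"
    using functional_equation[OF s] by (simp add: R_def A_def B_def C_def D_def)
  have "R s \<noteq> 0"
    unfolding R_def A_def B_def C_def D_def
    using sin0[unfolded x_def] nint dirichlet_zeta_nz[OF Re1] by (simp add: Gamma_eq_zero_iff)
  moreover have "s - 1 \<noteq> 0" using s by auto
  moreover have "1 / u - (R' + R' * l * u) / (u * R') = - l" if "R' \<noteq> 0" "u \<noteq> 0" for R' u l :: complex
    using that by (simp add: field_simps)
  ultimately have zm: "zM s = - lam" unfolding zM_def d z by blast
  have "Digamma (1 - s) = of_real (harm n - euler_mascheroni)"
    unfolding s1 Digamma_of_nat by (simp add: of_real_harm)
  hence Rl: "Re lam = ln (2 * pi) - harm n + euler_mascheroni + Re M" by (simp add: lam_def Re_euler_mascheroni)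
  have M: "M = mangoldt_series (of_nat (Suc n))" unfolding M_def s1 ..
  have "Re lam \<noteq> 0"
  proof (cases "n \<le> 5")
    case True
    have "Re M \<ge> 0" unfolding M by (rule mangoldt_series_real_bounds(1)) (use n1 in simp)
    thus ?thesis using harm_bounds(1)[OF True] ln_2pi_bounds(1) euler_mascheroni_gt_19_over_33 unfolding Rl by linarith
  next
    case False
    have n7: "n \<ge> 7" using False n by (cases "n = 6") auto
    have "Re M \<le> 1 / 32" unfolding M by (rule mangoldt_series_real_bounds(2)) (use n7 in auto)
    thus ?thesis using harm_bounds(2)[OF n7] ln_2pi_bounds(2) euler_mascheroni_less_13_over_22 unfolding Rl by linarith
  qed
  thus ?thesis using zm unfolding s_def by auto
qed

text \<open>Hence no pole of \<open>\<Gamma>\<close> is cancelled in \<^term>\<open>Gamma s * zM s\<close>.\<close>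

theorem zM_neg_int: "- of_nat n \<in> zM_poles \<or> zM (- of_nat n) \<noteq> 0"
proof (cases "even n")
  case True
  then obtain j where j: "n = 2 * j" by (elim evenE)
  show ?thesis
  proof (cases "j = 0")
    case True
    thus ?thesis using j zM_0_nz by simp
  next
    case False
    thus ?thesis using zeta1_neg_even[of j] j by (simp add: zM_poles_def)
  qed
qed (use zM_neg_odd in blast)

section \<open>Local behaviour of the factors\<close>

definition zH_poles :: "complex set" where "zH_poles = zM_poles \<union> \<int>\<^sub>\<le>\<^sub>0"

lemma ext_quotient:
  assumes "g holomorphic_on ball c e" "e > 0"
  obtains d where "d holomorphic_on ball c e" "\<And>s. s \<in> ball c e \<Longrightarrow> s \<noteq> c \<Longrightarrow> g s / (s - c) = g c / (s - c) + d s"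
proof -
  define d where "d = (\<lambda>s. if s = c then deriv g c else (g s - g c) / (s - c))"
  have "d holomorphic_on ball c e" unfolding d_def by (rule pole_lemma[OF assms(1)]) (use assms(2) in simp)
  moreover have "g s / (s - c) = g c / (s - c) + d s" if "s \<noteq> c" for s
    using that by (simp add: d_def diff_divide_distrib)
  ultimately show ?thesis using that by blast
qed

lemma nonpos_Ints_isolated:
  "\<exists>e>0. e \<le> 1 \<and> (\<forall>s\<in>ball c e - {c}. s \<notin> (\<int>\<^sub>\<le>\<^sub>0 :: complex set))"
proof -
  have "open (- (\<int>\<^sub>\<le>\<^sub>0 - {c}) :: complex set)"
    by (intro open_Compl closed_subset_Ints) (use nonpos_Ints_subset_Ints in auto)
  moreover have "c \<in> - (\<int>\<^sub>\<le>\<^sub>0 - {c})" by simp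
  ultimately obtain e where "e > 0" "ball c e \<subseteq> - (\<int>\<^sub>\<le>\<^sub>0 - {c})" by (rule openE)
  thus ?thesis by (intro exI[of _ "min e 1"]) (auto simp: subset_iff)
qed

lemma zM_holomorphic: "zM holomorphic_on - zM_poles"
proof -
  have "deriv zeta1 holomorphic_on - zM_poles"
    by (rule holomorphic_on_subset[OF holomorphic_deriv[OF zeta1_holomorphic open_UNIV]]) simp
  thus ?thesis unfolding zM_def
    by (intro holomorphic_on_diff holomorphic_on_divide holomorphic_on_const holomorphic_on_ident zeta1_holomorphic)
       (auto simp: zM_poles_def)
qed

lemma open_Compl_isolated:
  fixes P :: "complex set"
  assumes "\<And>c. \<exists>e>0. \<forall>s\<in>ball c e - {c}. s \<notin> P"
  shows "open (- P)"
  unfolding open_contains_ball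
proof
  fix c assume c: "c \<in> - P"
  obtain e where e: "e > 0" "\<forall>s\<in>ball c e - {c}. s \<notin> P" using assms by blast
  have "ball c e \<subseteq> - P"
  proof
    fix s assume "s \<in> ball c e"
    thus "s \<in> - P" using e(2) c by (cases "s = c") auto
  qed
  thus "\<exists>e>0. ball c e \<subseteq> - P" using e(1) by blast
qed

lemma zH_poles_isolated: "\<exists>e>0. \<forall>s\<in>ball c e - {c}. s \<notin> zH_poles"
proof -
  obtain e1 where e1: "e1 > 0" "\<forall>s\<in>ball c e1 - {c}. s \<notin> zM_poles" using zM_local[of c] by blast
  obtain e2 where e2: "e2 > 0" "\<forall>s\<in>ball c e2 - {c}. s \<notin> (\<int>\<^sub>\<le>\<^sub>0 :: complex set)"
    using nonpos_Ints_isolated[of c] by blast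
  show ?thesis using e1 e2 by (intro exI[of _ "min e1 e2"]) (auto simp: zH_poles_def)
qed

lemma open_Compl_zH_poles: "open (- zH_poles)"
  by (rule open_Compl_isolated[OF zH_poles_isolated])

lemma zH_holomorphic: "zH holomorphic_on - zH_poles"
proof -
  have "Gamma holomorphic_on - zH_poles" by (rule holomorphic_Gamma) (auto simp: zH_poles_def)
  moreover have "zM holomorphic_on - zH_poles"
    by (rule holomorphic_on_subset[OF zM_holomorphic]) (auto simp: zH_poles_def)
  ultimately show ?thesis
    unfolding zH_def by (intro holomorphic_on_diff holomorphic_on_mult zE_holomorphic)
qed

lemma zH_poles_Re: "s \<in> zH_poles \<Longrightarrow> Re s \<le> 1"
proof (rule ccontr)
  assume "s \<in> zH_poles" "\<not> Re s \<le> 1"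
  thus False using zeta1_nz[of s] by (auto simp: zH_poles_def zM_poles_def elim!: nonpos_Ints_cases')
qed

text \<open>Applying the recursion of \<open>Gamma\<close> \<open>Suc n\<close> times moves the
  argument from \<open>1 - s\<close> to \<open>a - s + 1\<close>, which is near 1, and exposes the
  one factor \<open>- (s - a)\<close> that vanishes at \<open>a\<close>.\<close>

lemma Gamma_reflected_posint:
  fixes a s :: complex
  assumes a: "a = of_nat (Suc n)" and s: "s \<in> ball a 1 - {a}"
  shows "Gamma (1 - s) = - (Gamma (a - s + 1) / pochhammer (1 - s) n) / (s - a)"
    and "pochhammer (1 - s) n \<noteq> 0"
proof -
  have sep: "1 - s + of_nat i \<noteq> 0" if "i \<le> n" for i
  proof
    assume "1 - s + of_nat i = 0"
    hence s': "s = of_nat (Suc i)" by (simp add: algebra_simps)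
    hence "i \<noteq> n" using s a by auto
    hence "norm (of_nat (Suc n) - of_nat (Suc i) :: complex) = real n - real i" using that
      by (metis norm_of_nat of_nat_Suc add_diff_cancel_left of_nat_diff)
    hence "dist a s \<ge> 1" using that \<open>i \<noteq> n\<close> by (simp add: dist_norm a s' del: of_nat_Suc)
    thus False using s by simp
  qed
  have p: "pochhammer (1 - s) k \<noteq> 0" if "k \<le> Suc n" for k
  proof
    assume "pochhammer (1 - s) k = 0"
    then obtain i where "i < k" "1 - s = - of_nat i" by (auto simp: pochhammer_eq_0_iff)
    thus False using sep[of i] that by simp
  qed
  show "pochhammer (1 - s) n \<noteq> 0" by (rule p) simp
  have np: "1 - s \<notin> \<int>\<^sub>\<le>\<^sub>0"
  proof
    assume "1 - s \<in> \<int>\<^sub>\<le>\<^sub>0"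
    then obtain i where i: "1 - s = - of_nat i" by (rule nonpos_Ints_cases')
    hence s': "s = of_nat (Suc i)" by (simp add: algebra_simps)
    have "i > n" using sep[of i] i by (cases "i \<le> n") auto
    hence "norm (of_nat (Suc n) - of_nat (Suc i) :: complex) = real i - real n"
      by (metis norm_minus_commute norm_of_nat of_nat_Suc add_diff_cancel_left of_nat_diff less_imp_le)
    hence "dist a s \<ge> 1" using \<open>i > n\<close> by (simp add: dist_norm a s' del: of_nat_Suc)
    thus False using s by simp
  qed
  have F1: "pochhammer (1 - s) (Suc n) * Gamma (1 - s) = Gamma (1 - s + of_nat (Suc n))"
    using pochhammer_Gamma[OF np, of "Suc n"] np by (simp add: Gamma_eq_zero_iff)
  have e1: "1 - s + of_nat (Suc n) = a - s + 1" by (simp add: a)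
  have e2: "pochhammer (1 - s) (Suc n) = pochhammer (1 - s) n * - (s - a)"
    by (simp add: pochhammer_Suc a)
  have "pochhammer (1 - s) n * - (s - a) * Gamma (1 - s) = Gamma (a - s + 1)"
    using F1 unfolding e1 e2 .
  thus "Gamma (1 - s) = - (Gamma (a - s + 1) / pochhammer (1 - s) n) / (s - a)"
    using p[of n] s by (simp add: divide_simps) (simp add: algebra_simps)
qed

lemma zcoeff_holomorphic_off_pole: "zcoeff k holomorphic_on - {of_nat (Suc k)}"
  unfolding zcoeff_def by (intro holomorphic_intros zcoeff_reg_holomorphic) auto

lemma posint_ball:
  assumes "(of_nat (Suc k) :: complex) \<in> ball (of_nat (Suc n)) 1"
  shows "k = n"
proof (rule ccontr)
  assume "k \<noteq> n"
  have "of_nat (Suc n) - of_nat (Suc k) = complex_of_int (int n - int k)" by simp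
  hence "dist (of_nat (Suc n)) (of_nat (Suc k) :: complex) = \<bar>of_int (int n - int k)\<bar>"
    unfolding dist_norm by (simp only: norm_of_int)
  moreover have "\<bar>of_int (int n - int k)\<bar> \<ge> (1::real)" using \<open>k \<noteq> n\<close> by linarith
  ultimately show False using assms by (simp del: of_nat_Suc)
qed

text \<open>The poles of \<open>\<Gamma>(1 - s)\<close> and of the coefficients \<^const>\<open>zcoeff\<close> at a positive integer have opposite
  residues.\<close>

lemma pole_cancellation:
  "\<exists>e>0. \<exists>\<kappa> w v. w holomorphic_on ball a e \<and> (\<forall>k. v k holomorphic_on ball a e) \<and>
     (\<forall>s\<in>ball a e - {a}. s \<notin> posints \<and> Gamma (1 - s) = w s - \<kappa> / (s - a) \<and>
        (\<forall>k. zcoeff k s = v k s + (if a = of_nat (Suc k) then \<kappa> / (s - a) else 0))) \<and>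
     (a \<in> posints \<longleftrightarrow> \<kappa> \<noteq> (0::complex))"
proof (cases "a \<in> posints")
  case False
  have "a \<in> - posints" using False by simp
  with open_Compl_posints obtain e where e: "e > 0" "ball a e \<subseteq> - posints" by (rule openE)
  have "(\<lambda>s. Gamma (1 - s)) holomorphic_on ball a e"
    using e(2) one_minus_notin_nonpos_Ints by (intro holomorphic_intros) auto
  moreover have "zcoeff k holomorphic_on ball a e" for k
    using zcoeff_holomorphic e(2) holomorphic_on_subset by blast
  moreover have "a \<noteq> of_nat (Suc k)" for k using False of_nat_Suc_in_posints[of k] by metis
  moreover have "s \<notin> posints" if "s \<in> ball a e - {a}" for s using e(2) that by blast
  ultimately have H: "(\<lambda>s. Gamma (1 - s)) holomorphic_on ball a e \<and> (\<forall>k. zcoeff k holomorphic_on ball a e) \<and>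
     (\<forall>s\<in>ball a e - {a}. s \<notin> posints \<and> Gamma (1 - s) = Gamma (1 - s) - 0 / (s - a) \<and>
        (\<forall>k. zcoeff k s = zcoeff k s + (if a = of_nat (Suc k) then 0 / (s - a) else 0))) \<and>
     (a \<in> posints \<longleftrightarrow> (0::complex) \<noteq> 0)"
    using False by simp
  show ?thesis
    by (rule exI[of _ e], rule conjI, rule e(1), rule exI[of _ 0], rule exI[of _ "\<lambda>s. Gamma (1 - s)"],
        rule exI[of _ zcoeff], rule H)
next
  case True
  then obtain m where m: "m \<ge> 1" "a = of_nat m" unfolding posints_def by auto
  then obtain n where a: "a = of_nat (Suc n)" by (cases m) auto
  \<comment> \<open>The residue of \<open>zcoeff n\<close> at \<open>Suc n\<close>. That of
    \<open>Gamma (1 - s)\<close> is \<open>- \<kappa>\<close>, because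
    \<open>pochhammer (1 - a) n = (-1) ^ n * fact n\<close>.\<close>
  define \<kappa> where "\<kappa> = (-1) ^ n * rGamma a"
  have "a \<notin> \<int>\<^sub>\<le>\<^sub>0" unfolding a by (auto elim!: nonpos_Ints_cases' simp: complex_eq_iff)
  hence \<kappa>0: "\<kappa> \<noteq> 0" by (simp add: \<kappa>_def rGamma_eq_zero_iff)
  define g where "g = (\<lambda>s. - (Gamma (a - s + 1) / pochhammer (1 - s) n))"
  have pa: "pochhammer (1 - a) n = (-1) ^ n * fact n"
    using pochhammer_same[of n, where 'a = complex] by (simp add: a)
  have ga: "g a = - \<kappa>"
  proof -
    have "rGamma a = 1 / fact n" by (simp add: a rGamma_inverse_Gamma Gamma_fact add.commute divide_inverse)
    moreover have "inverse ((-1) ^ n :: complex) = (-1) ^ n" by (simp add: power_inverse[symmetric])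
    ultimately show ?thesis by (simp add: g_def pa \<kappa>_def field_simps)
  qed
  have "g holomorphic_on ball a 1"
    unfolding g_def
  proof (intro holomorphic_intros)
    fix s assume s: "s \<in> ball a 1"
    have "\<bar>Re (a - s)\<bar> < 1" using s abs_Re_le_cmod[of "a - s"] by (simp add: dist_norm)
    hence "Re (a - s + 1) > 0" by auto
    thus "a - s + 1 \<notin> \<int>\<^sub>\<le>\<^sub>0" by (auto elim!: nonpos_Ints_cases' simp: complex_eq_iff)
    show "pochhammer (1 - s) n \<noteq> 0"
      using Gamma_reflected_posint(2)[OF a, of s] s pa by (cases "s = a") auto
  qed
  then obtain w where w: "w holomorphic_on ball a 1"
    "\<And>s. s \<in> ball a 1 \<Longrightarrow> s \<noteq> a \<Longrightarrow> g s / (s - a) = g a / (s - a) + w s"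
    using ext_quotient[of g a 1] by (metis zero_less_one)
  have "(\<lambda>s. (-1) ^ n * rGamma s :: complex) holomorphic_on ball a 1" by (intro holomorphic_intros)
  then obtain d where d: "d holomorphic_on ball a 1"
    "\<And>s. s \<in> ball a 1 \<Longrightarrow> s \<noteq> a \<Longrightarrow> (-1) ^ n * rGamma s / (s - a) = (-1) ^ n * rGamma a / (s - a) + d s"
    using ext_quotient[of "\<lambda>s. (-1) ^ n * rGamma s" a 1] by (metis zero_less_one)
  \<comment> \<open>At \<open>a = Suc n\<close> only the coefficient of index \<open>n\<close> has a
    pole in the unit disc around \<open>a\<close>.\<close>
  define v where "v = (\<lambda>k s. if k = n then d s + zcoeff_reg n s else zcoeff k s)"
  have "v k holomorphic_on ball a 1" for k
  proof (cases "k = n")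
    case True
    have "(\<lambda>s. d s + zcoeff_reg n s) holomorphic_on ball a 1"
      by (intro holomorphic_intros d zcoeff_reg_holomorphic)
    thus ?thesis using True by (simp add: v_def)
  next
    case False
    have "ball a 1 \<subseteq> - {of_nat (Suc k)}" using posint_ball[of k n] False a by auto
    thus ?thesis using False zcoeff_holomorphic_off_pole[of k] holomorphic_on_subset by (auto simp: v_def)
  qed
  moreover have "s \<notin> posints \<and> Gamma (1 - s) = w s - \<kappa> / (s - a) \<and>
        (\<forall>k. zcoeff k s = v k s + (if a = of_nat (Suc k) then \<kappa> / (s - a) else 0))" if s: "s \<in> ball a 1 - {a}" for s
  proof (intro conjI allI)
    show "s \<notin> posints"
    proof
      assume "s \<in> posints"
      then obtain m where m: "m \<ge> 1" "s = of_nat m" unfolding posints_def by auto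
      then obtain k where k: "s = of_nat (Suc k)" by (cases m) auto
      have "k = n" by (rule posint_ball) (use s k a in auto)
      thus False using s k a by auto
    qed
    show "Gamma (1 - s) = w s - \<kappa> / (s - a)"
    proof -
      have "Gamma (1 - s) = g s / (s - a)" using Gamma_reflected_posint(1)[OF a s] by (simp only: g_def)
      also have "\<dots> = - \<kappa> / (s - a) + w s" using w(2)[of s] s unfolding ga by simp
      finally show ?thesis by simp
    qed
    fix k
    show "zcoeff k s = v k s + (if a = of_nat (Suc k) then \<kappa> / (s - a) else 0)"
    proof (cases "k = n")
      case True
      thus ?thesis using d(2)[of s] s by (simp add: v_def zcoeff_def \<kappa>_def a)
    next
      case False
      hence "a \<noteq> of_nat (Suc k)" unfolding a of_nat_eq_iff by simp
      thus ?thesis using False by (simp add: v_def)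
    qed
  qed
  ultimately show ?thesis using w(1) \<kappa>0 True zero_less_one by blast
qed

text \<open>\<open>Gamma (s + k) / Gamma s\<close> is the polynomial \<open>pochhammer s k\<close>,
  so the poles of \<open>Gamma\<close> disappear and only those of \<open>zM\<close> are
  left.\<close>

lemma rGamma_zH:
  assumes "s + of_nat k \<notin> \<int>\<^sub>\<le>\<^sub>0"
  shows "rGamma s * zH (s + of_nat k) = pochhammer s k * zM (s + of_nat k) - rGamma s * zE (s + of_nat k)"
proof -
  have "rGamma s * Gamma (s + of_nat k) = pochhammer s k"
    using pochhammer_rGamma[of s k] assms by (simp add: rGamma_inverse_Gamma Gamma_eq_zero_iff)
  thus ?thesis unfolding zH_def by (simp add: algebra_simps flip: mult.assoc)
qed

text \<open>A pole of \<^const>\<open>zM\<close> at \<open>b + k = 1\<close> with \<open>k \<ge> 1\<close> is cancelled by the zero of \<^const>\<open>rGamma\<close> at \<open>b\<close>.\<close>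

lemma rGamma_zH_local:
  "\<exists>e>0. \<exists>\<kappa> q. q holomorphic_on ball b e \<and>
     (\<forall>s\<in>ball b e - {b}. s + of_nat k \<notin> zH_poles \<and> rGamma s * zH (s + of_nat k) = \<kappa> / (s - b) + q s) \<and>
     (\<kappa> \<noteq> 0 \<longleftrightarrow> b + of_nat k \<in> zM_poles \<and> \<not> (k \<ge> 1 \<and> b + of_nat k = 1))"
proof -
  define c where "c = b + of_nat k"
  obtain e1 \<mu> where e1: "e1 > 0" "\<mu> holomorphic_on ball c e1"
    "\<forall>s\<in>ball c e1 - {c}. s \<notin> zM_poles \<and> zM s = \<mu> s / (s - c)" "\<mu> c \<noteq> 0 \<longleftrightarrow> c \<in> zM_poles"
    using zM_local[of c] by blast
  obtain e2 where e2: "e2 > 0" "\<forall>s\<in>ball c e2 - {c}. s \<notin> zH_poles" using zH_poles_isolated by blast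
  define e where "e = min e1 e2"
  have e: "e > 0" using e1 e2 by (simp add: e_def)
  have sh: "s + of_nat k \<in> ball c e" if "s \<in> ball b e" for s using that by (simp add: c_def dist_norm)
  define g where "g = (\<lambda>s. pochhammer s k * \<mu> (s + of_nat k))"
  have "(\<lambda>s. \<mu> (s + of_nat k)) holomorphic_on ball b e"
  proof -
    have "(\<mu> \<circ> (\<lambda>s. s + of_nat k)) holomorphic_on ball b e"
      by (rule holomorphic_on_compose_gen[OF _ e1(2)]) (use sh in \<open>auto intro!: holomorphic_intros simp: e_def\<close>)
    thus ?thesis by (simp add: o_def)
  qed
  hence "g holomorphic_on ball b e" unfolding g_def by (intro holomorphic_intros)
  then obtain d where d: "d holomorphic_on ball b e"
    "\<And>s. s \<in> ball b e \<Longrightarrow> s \<noteq> b \<Longrightarrow> g s / (s - b) = g b / (s - b) + d s"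
    using ext_quotient[of g b e] e by metis
  have hE: "(\<lambda>s. zE (s + of_nat k)) holomorphic_on ball b e"
  proof -
    have "(zE \<circ> (\<lambda>s. s + of_nat k)) holomorphic_on ball b e"
      by (rule holomorphic_on_compose[OF _ zE_holomorphic]) (intro holomorphic_intros)
    thus ?thesis by (simp add: o_def)
  qed
  define q where "q = (\<lambda>s. d s - rGamma s * zE (s + of_nat k))"
  have "q holomorphic_on ball b e" unfolding q_def by (intro holomorphic_intros d hE)
  moreover have "s + of_nat k \<notin> zH_poles \<and> rGamma s * zH (s + of_nat k) = g b / (s - b) + q s"
    if s: "s \<in> ball b e - {b}" for s
  proof -
    have sk: "s + of_nat k \<in> ball c e - {c}" using sh[of s] s by (auto simp: c_def)
    hence np: "s + of_nat k \<notin> zH_poles" using e2(2) by (auto simp: e_def)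
    have "zM (s + of_nat k) = \<mu> (s + of_nat k) / (s - b)"
      using e1(3) sk by (auto simp: e_def c_def)
    hence "rGamma s * zH (s + of_nat k) = g s / (s - b) - rGamma s * zE (s + of_nat k)"
      using rGamma_zH[of s k] np by (simp add: g_def zH_poles_def)
    thus ?thesis using np d(2)[of s] s by (simp add: q_def)
  qed
  moreover have "g b \<noteq> 0 \<longleftrightarrow> b + of_nat k \<in> zM_poles \<and> \<not> (k \<ge> 1 \<and> b + of_nat k = 1)"
  proof (cases "c \<in> zM_poles")
    case False
    thus ?thesis using e1(4) by (auto simp: g_def c_def)
  next
    case True
    hence \<mu>: "\<mu> c \<noteq> 0" using e1(4) by blast
    \<comment> \<open>A zero \<open>b = - i\<close> with \<open>i < k\<close> makes
      \<open>c = k - i\<close> a positive integer; among these only 1 is a pole, since no pole has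
      real part above 1.\<close>
    have "pochhammer b k = 0 \<longleftrightarrow> k \<ge> 1 \<and> c = 1"
    proof
      assume "pochhammer b k = 0"
      then obtain i where i: "i < k" "b = - of_nat i" by (auto simp: pochhammer_eq_0_iff)
      hence c: "c = of_nat (k - i)" by (simp add: c_def of_nat_diff)
      have "k - i = 1"
      proof (rule ccontr)
        assume "k - i \<noteq> 1"
        hence "k - i \<ge> 2" using i by simp
        hence "Re c > 1" unfolding c by simp
        thus False using zH_poles_Re[of c] True by (simp add: zH_poles_def)
      qed
      thus "k \<ge> 1 \<and> c = 1" using i c by simp
    next
      assume k: "k \<ge> 1 \<and> c = 1"
      hence "b = - of_nat (k - 1)" by (simp add: c_def of_nat_diff algebra_simps)
      thus "pochhammer b k = 0" using k unfolding pochhammer_eq_0_iff by (intro exI[of _ "k - 1"]) auto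
    qed
    thus ?thesis using \<mu> True by (auto simp: g_def c_def)
  qed
  ultimately show ?thesis using e by blast
qed

text \<open>The order is at most two, one from \<open>Gamma\<close> and one from \<open>zM\<close>;
  both occur together at the negative even integers, where zeros of zeta meet poles of
  \<open>Gamma\<close>.\<close>

lemma zH_local_pole:
  "\<exists>e>0. \<exists>\<eta>. \<eta> holomorphic_on ball c e \<and> (\<forall>s\<in>ball c e - {c}. s \<notin> zH_poles \<and> zH s = \<eta> s / (s - c)\<^sup>2)"
proof -
  obtain e1 \<kappa> q where q: "e1 > 0" "q holomorphic_on ball c e1"
    "\<forall>s\<in>ball c e1 - {c}. s \<notin> zH_poles \<and> rGamma s * zH s = \<kappa> / (s - c) + q s"
    using rGamma_zH_local[of c 0] by auto
  obtain e2 \<mu> where \<mu>: "e2 > 0" "\<mu> holomorphic_on ball c e2" "\<forall>s\<in>ball c e2 - {c}. Gamma s = \<mu> s / (s - c)"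
  proof -
    \<comment> \<open>The behaviour of \<open>Gamma\<close> at \<open>c\<close> is taken from that
      of \<open>Gamma (1 - s)\<close> at \<open>1 - c\<close>.\<close>
    obtain e \<kappa>' w where w: "e > 0" "w holomorphic_on ball (1 - c) e"
      "\<forall>s\<in>ball (1 - c) e - {1 - c}. Gamma (1 - s) = w s - \<kappa>' / (s - (1 - c))"
      using pole_cancellation[of "1 - c"] by blast
    have "(w \<circ> (\<lambda>s. 1 - s)) holomorphic_on ball c e"
      by (rule holomorphic_on_compose_gen[OF _ w(2)]) (auto intro!: holomorphic_intros simp: dist_norm norm_minus_commute)
    hence hw: "(\<lambda>s. w (1 - s) * (s - c) + \<kappa>') holomorphic_on ball c e"
      by (intro holomorphic_intros) (simp add: o_def)
    show ?thesis
    proof (rule that[OF w(1) hw], rule)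
      fix s assume s: "s \<in> ball c e - {c}"
      hence "1 - s \<in> ball (1 - c) e - {1 - c}" by (auto simp: dist_norm norm_minus_commute)
      with w(3) have "Gamma (1 - (1 - s)) = w (1 - s) - \<kappa>' / (1 - s - (1 - c))" by blast
      thus "Gamma s = (w (1 - s) * (s - c) + \<kappa>') / (s - c)"
      proof -
        have e: "1 - s - (1 - c) = - (s - c)" by simp
        have "s - c \<noteq> 0" using s by auto
        moreover have "Gamma s = w (1 - s) + \<kappa>' / (s - c)"
          using \<open>Gamma (1 - (1 - s)) = _\<close> unfolding e by (simp only: divide_minus_right) simp
        ultimately show ?thesis by (simp add: add_divide_distrib)
      qed
    qed
  qed
  define e where "e = min e1 e2"
  have "(\<lambda>s. \<mu> s * (\<kappa> + q s * (s - c))) holomorphic_on ball c e"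
    by (intro holomorphic_intros holomorphic_on_subset[OF \<mu>(2)] holomorphic_on_subset[OF q(2)]) (auto simp: e_def)
  moreover have "s \<notin> zH_poles \<and> zH s = (\<mu> s * (\<kappa> + q s * (s - c))) / (s - c)\<^sup>2" if s: "s \<in> ball c e - {c}" for s
  proof -
    have 1: "s \<notin> zH_poles" "rGamma s * zH s = \<kappa> / (s - c) + q s" using q(3) s by (auto simp: e_def)
    have 2: "Gamma s = \<mu> s / (s - c)" using \<mu>(3) s by (auto simp: e_def)
    have sc: "s - c \<noteq> 0" using s by auto
    have "Gamma s \<noteq> 0" using 1(1) by (simp add: zH_poles_def Gamma_eq_zero_iff)
    hence "zH s = Gamma s * (rGamma s * zH s)" by (simp add: rGamma_inverse_Gamma)
    also have "\<dots> = (\<mu> s / (s - c)) * (\<kappa> / (s - c) + q s)" unfolding 1(2) 2 ..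
    also have "\<dots> = (\<mu> s * (\<kappa> + q s * (s - c))) / (s - c)\<^sup>2"
      using sc by (simp add: power2_eq_square add_divide_distrib distrib_left)
    finally show ?thesis using 1(1) by blast
  qed
  moreover have "e > 0" using q(1) \<mu>(1) by (simp add: e_def)
  ultimately show ?thesis by blast
qed

text \<open>A finite limit \<open>L\<close> of \<open>zH\<close> forces \<open>zM\<close> to tend to
  \<open>rGamma c * (L + zE c)\<close>. At a pole of \<open>zM\<close> this is absurd; at any other
  nonpositive integer \<open>rGamma c = 0\<close> gives \<open>zM c = 0\<close>, which
  \<open>zM_neg_int\<close> excludes.\<close>

lemma zH_no_limit:
  assumes c: "c \<in> zH_poles"
  shows "\<not> (zH \<longlongrightarrow> L) (at c)"
proof
  assume lim: "(zH \<longlongrightarrow> L) (at c)"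
  have cE: "(zE \<longlongrightarrow> zE c) (at c)"
    using holomorphic_on_imp_continuous_on[OF zE_holomorphic, of UNIV]
    by (simp add: continuous_on_eq_continuous_at continuous_at)
  have cG: "(rGamma \<longlongrightarrow> rGamma c) (at c)"
    using holomorphic_on_imp_continuous_on[OF holomorphic_rGamma, of UNIV]
    by (simp add: continuous_on_eq_continuous_at continuous_at)
  obtain e where e: "e > 0" "\<forall>s\<in>ball c e - {c}. s \<notin> zH_poles" using zH_poles_isolated by blast
  have "eventually (\<lambda>s. s \<in> ball c e - {c}) (at c)" using e(1) by (intro eventually_at_in_open) auto
  hence "eventually (\<lambda>s. rGamma s * (zH s + zE s) = zM s) (at c)"
  proof eventually_elim
    case (elim s)
    hence "s \<notin> zH_poles" using e(2) by blast
    thus ?case by (simp add: zH_def zH_poles_def rGamma_inverse_Gamma Gamma_eq_zero_iff)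
  qed
  with tendsto_mult[OF cG tendsto_add[OF lim cE]] have limM: "(zM \<longlongrightarrow> rGamma c * (L + zE c)) (at c)"
    by (rule Lim_transform_eventually)
  show False
  proof (cases "c \<in> zM_poles")
    case True
    obtain e1 \<mu> where e1: "e1 > 0" "\<mu> holomorphic_on ball c e1"
      "\<forall>s\<in>ball c e1 - {c}. s \<notin> zM_poles \<and> zM s = \<mu> s / (s - c)" "\<mu> c \<noteq> 0"
      using zM_local[of c] True by blast
    have T1: "(\<mu> \<longlongrightarrow> \<mu> c) (at c)"
      using holomorphic_on_imp_continuous_on[OF e1(2)] e1(1)
      by (simp add: continuous_on_eq_continuous_at continuous_at)
    have T2: "((\<lambda>s. zM s * (s - c)) \<longlongrightarrow> rGamma c * (L + zE c) * (c - c)) (at c)"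
      by (intro tendsto_intros limM)
    have T3: "eventually (\<lambda>s. zM s * (s - c) = \<mu> s) (at c)"
    proof -
      have "eventually (\<lambda>s. s \<in> ball c e1 - {c}) (at c)" using e1(1) by (intro eventually_at_in_open) auto
      thus ?thesis by eventually_elim (use e1(3) in auto)
    qed
    have "\<mu> c = rGamma c * (L + zE c) * (c - c)"
      by (rule tendsto_unique[OF at_neq_bot T1 Lim_transform_eventually[OF T2 T3]])
    thus False using e1(4) by simp
  next
    case False
    hence "c \<in> \<int>\<^sub>\<le>\<^sub>0" using c by (simp add: zH_poles_def)
    then obtain n where n: "c = - of_nat n" by (rule nonpos_Ints_cases')
    have "rGamma c = 0" using \<open>c \<in> \<int>\<^sub>\<le>\<^sub>0\<close> by (simp add: rGamma_eq_zero_iff)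
    hence l0: "(zM \<longlongrightarrow> 0) (at c)" using limM by simp
    have "open (- zM_poles)" using zM_local by (intro open_Compl_isolated) blast
    hence "(zM \<longlongrightarrow> zM c) (at c)"
      using holomorphic_on_imp_continuous_on[OF zM_holomorphic] False
      by (simp add: continuous_on_eq_continuous_at continuous_at)
    hence "zM c = 0" using l0 tendsto_unique[of "at c"] by simp
    thus False using zM_neg_int[of n] False n by simp
  qed
qed

section \<open>The meromorphic continuation\<close>

text \<open>The right-hand side of the expansion divided by \<open>Gamma\<close>. For
  \<open>fst z\<close> in \<open>posints\<close> the value stems from the conventions for
  \<open>Gamma\<close> and division at poles, so such points are kept apart below.\<close>

definition zF :: "complex \<times> complex \<Rightarrow> complex" where
  "zF z = rGamma (snd z) * (zW (fst z) (snd z) + Gamma (1 - fst z) * zH (fst z + snd z - 1)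
            + (\<Sum>k. zcoeff k (fst z) * zH (snd z + of_nat k)))"

text \<open>For \<open>k \<ge> R\<close> the pole \<open>Suc k\<close> has distance at least 1 from
  the disc of radius \<open>R\<close>.\<close>

lemma zcoeff_bound_large:
  "\<exists>C\<ge>0. \<forall>k s. norm s \<le> R \<and> R \<le> real k \<longrightarrow> norm (zcoeff k s) \<le> C * (4/3) ^ k"
proof -
  obtain C where C: "C \<ge> 0" "\<And>k s. norm s \<le> R \<Longrightarrow> norm (zcoeff_reg k s) \<le> C * (4/3) ^ k"
    using zcoeff_reg_bound[of R] by blast
  have "rGamma holomorphic_on UNIV" by (intro holomorphic_intros)
  then have "\<exists>B\<ge>0. \<forall>s\<in>cball 0 R. norm (rGamma s :: complex) \<le> B"
  proof -
    have "compact (rGamma ` cball (0::complex) R)"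
      by (intro compact_continuous_image continuous_intros) auto
    then obtain B where "\<forall>x\<in>rGamma ` cball (0::complex) R. norm x \<le> B"
      using compact_imp_bounded bounded_iff by blast
    then show ?thesis by (intro exI[of _ "max B 0"]) force
  qed
  then obtain B where B: "B \<ge> 0" "\<And>s. s \<in> cball 0 R \<Longrightarrow> norm (rGamma s :: complex) \<le> B" by blast
  show ?thesis
  proof (intro exI[of _ "B + C"] conjI allI impI)
    fix k and s :: complex assume s: "norm s \<le> R \<and> R \<le> real k"
    have "norm (s - of_nat (Suc k)) \<ge> norm (of_nat (Suc k) :: complex) - norm s"
      by (metis norm_minus_commute norm_triangle_ineq2)
    then have d: "norm (s - of_nat (Suc k)) \<ge> 1"
      using s by (simp only: norm_of_nat) simp
    have "norm (zcoeff k s) \<le> norm ((-1)^k * rGamma s / (s - of_nat (Suc k))) + norm (zcoeff_reg k s)"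
      unfolding zcoeff_def by (rule norm_triangle_ineq)
    also have "norm ((-1)^k * rGamma s / (s - of_nat (Suc k))) = norm (rGamma s) / norm (s - of_nat (Suc k))"
      by (simp add: norm_divide norm_mult norm_power)
    also have "\<dots> \<le> B / 1" using B(2)[of s] s d B(1) by (intro frac_le) auto
    also have "B / 1 \<le> B * (4/3)^k" using B(1) one_le_power[of "4/3::real" k] mult_left_mono[of 1 "(4/3::real)^k" B] by simp
    finally show "norm (zcoeff k s) \<le> (B + C) * (4/3)^k"
      using C(2)[of s k] s by (simp add: algebra_simps)
  qed (use B(1) C(1) in auto)
qed

text \<open>From some index on neither factor of a term has a pole near (a, b), and the ratio 4/3 *
  1/2 = 2/3 makes the remaining series holomorphic in both variables. The finitely many terms kept
  apart carry the possible singularities along s_2 = b.\<close>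

lemma zF_split:
  fixes a b :: complex
  obtains K T where "holomorphic2_on T (ball a (1/2) \<times> ball b (1/2))"
    "\<And>k s. k \<ge> K \<Longrightarrow> s \<in> ball b 1 \<Longrightarrow> s + of_nat k \<notin> zH_poles"
    "\<And>k s. k \<ge> K \<Longrightarrow> s \<in> ball a 1 \<Longrightarrow> s \<noteq> of_nat (Suc k)"
    "\<And>z. z \<in> ball a (1/2) \<times> ball b (1/2) \<Longrightarrow> zF z = T z + rGamma (snd z) * Gamma (1 - fst z) * zH (fst z + snd z - 1)
       + (\<Sum>k<K. zcoeff k (fst z) * (rGamma (snd z) * zH (snd z + of_nat k)))"
proof -
  \<comment> \<open>Large enough for \<open>Re (s + k) > 2\<close> on the disc around
    \<open>b\<close> and for \<open>Suc k\<close> to lie outside the disc around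
    \<open>a\<close>.\<close>
  obtain K :: nat where K: "real K > norm a + norm b + 6" using reals_Archimedean2 by blast
  have Kb: "Re s + real k > 2" if "k \<ge> K" "s \<in> ball b 1" for k s
  proof -
    have "norm s < norm b + 1" using that(2) norm_triangle_ineq2[of s b] by (auto simp: dist_norm norm_minus_commute)
    then have "Re s > - norm b - 1" using abs_Re_le_cmod[of s] by linarith
    moreover have "real k \<ge> real K" using that(1) by simp
    ultimately show ?thesis using K norm_ge_zero[of a] by linarith
  qed
  have Ka: "norm s \<le> norm a + 1" if "s \<in> ball a 1" for s
    using that norm_triangle_ineq2[of s a] by (auto simp: dist_norm norm_minus_commute)
  have pb: "s + of_nat k \<notin> zH_poles" if "k \<ge> K" "s \<in> ball b 1" for k s
    using zH_poles_Re[of "s + of_nat k"] Kb[OF that] by auto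
  have pa: "s \<noteq> of_nat (Suc k)" if "k \<ge> K" "s \<in> ball a 1" for k s
  proof
    assume "s = of_nat (Suc k)"
    then have "norm s = real (Suc k)" by (simp only: norm_of_nat)
    then show False using Ka[OF that(2)] that(1) K norm_ge_zero[of b] by simp
  qed
  obtain C where C: "C \<ge> 0" "\<And>k s. norm s \<le> norm a + 1 \<Longrightarrow> norm a + 1 \<le> real k \<Longrightarrow> norm (zcoeff k s) \<le> C * (4/3) ^ k"
    using zcoeff_bound_large[of "norm a + 1"] by blast
  obtain C' where C': "C' \<ge> 0" "\<And>s k. Re s \<ge> 2 \<Longrightarrow> norm (zH (s + of_nat k)) \<le> C' * (1/2) ^ k"
    using zH_bound[of 2] by auto
  define f where "f = (\<lambda>n. zcoeff (n + K))"
  define g where "g = (\<lambda>n s. zH (s + of_nat (n + K)))"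
  have f1: "f n holomorphic_on ball a 1" for n unfolding f_def
    using pa[of "n + K"] by (intro holomorphic_on_subset[OF zcoeff_holomorphic_off_pole]) (auto simp del: of_nat_Suc)
  have f2: "norm (f n s) \<le> C * (4/3)^(n+K)" if "s \<in> ball a 1" for n s
    unfolding f_def
  proof (rule C(2))
    have "real K \<le> real (n + K)" by simp
    then show "norm a + 1 \<le> real (n + K)" using K norm_ge_zero[of b] by linarith
  qed (rule Ka[OF that])
  have g1: "g n holomorphic_on ball b 1" for n unfolding g_def
  proof (intro holomorphic_on_compose_gen[of "\<lambda>s. s + of_nat (n+K)" _ zH "- zH_poles", unfolded o_def])
    show "(\<lambda>s. s + of_nat (n + K)) ` ball b 1 \<subseteq> - zH_poles" using pb[of "n+K"] by auto
  qed (auto intro!: holomorphic_intros zH_holomorphic)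
  have g2: "norm (g n s) \<le> C' * (1/2)^n" if "s \<in> ball b 1" for n s
    using C'(2)[of "s + of_nat K" n] Kb[OF le_refl that] unfolding g_def by (simp add: add_ac)
  have sm: "summable (\<lambda>n. C * (4/3)^(n+K) * (C' * (1/2)^n))"
  proof -
    have "summable (\<lambda>n. C * (4/3)^K * C' * (2/3::real)^n)" by (intro summable_mult summable_geometric) simp
    moreover have "C * (4/3)^(n+K) * (C' * (1/2)^n) = C * (4/3)^K * C' * (2/3::real)^n" for n
    proof -
      have "(4/3::real)^n * (1/2)^n = (2/3)^n" by (simp flip: power_mult_distrib)
      then show ?thesis by (simp add: power_add)
    qed
    ultimately show ?thesis by (simp only:)
  qed
  have hol: "holomorphic2_on (\<lambda>z. \<Sum>n. f n (fst z) * g n (snd z)) (ball a (1/2) \<times> ball b (1/2))"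
    by (rule holomorphic2_on_suminf_mult[OF _ f1 f2 g1 g2 sm]) auto
  have smt: "summable (\<lambda>n. f n s * g n t)" if "s \<in> ball a 1" "t \<in> ball b 1" for s t
  proof (rule summable_comparison_test[OF _ sm], intro exI[of _ 0] allI impI)
    fix n show "norm (f n s * g n t) \<le> C * (4/3)^(n+K) * (C' * (1/2)^n)"
      unfolding norm_mult using f2[OF that(1)] g2[OF that(2)] C(1) by (intro mult_mono) auto
  qed
  define T where "T = (\<lambda>z. rGamma (snd z) * (zW (fst z) (snd z) + (\<Sum>n. f n (fst z) * g n (snd z))))"
  show ?thesis
  proof
    show "holomorphic2_on T (ball a (1/2) \<times> ball b (1/2))" unfolding T_def
      by (intro holomorphic2_on_mult holomorphic2_on_add hol holomorphic2_on_subset[OF zW_holomorphic2]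
            holomorphic2_on_snd[of rGamma UNIV] holomorphic_intros) auto
  next
    fix z assume z: "z \<in> ball a (1/2) \<times> ball b (1/2)"
    have z1: "fst z \<in> ball a 1" "snd z \<in> ball b 1" using z by (auto simp: mem_Times_iff)
    have s: "summable (\<lambda>k. zcoeff k (fst z) * zH (snd z + of_nat k))"
      using smt[OF z1] summable_iff_shift[of "\<lambda>k. zcoeff k (fst z) * zH (snd z + of_nat k)" K] unfolding f_def g_def by simp
    have "(\<Sum>k. zcoeff k (fst z) * zH (snd z + of_nat k)) =
       (\<Sum>n. f n (fst z) * g n (snd z)) + (\<Sum>k<K. zcoeff k (fst z) * zH (snd z + of_nat k))"
      unfolding f_def g_def by (rule suminf_split_initial_segment[OF s])
    then show "zF z = T z + rGamma (snd z) * Gamma (1 - fst z) * zH (fst z + snd z - 1)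
       + (\<Sum>k<K. zcoeff k (fst z) * (rGamma (snd z) * zH (snd z + of_nat k)))"
      unfolding zF_def T_def by (simp add: algebra_simps sum_distrib_left)
  qed (use pa pb in auto)
qed

text \<open>With s = \<open>snd z + (c - b)\<close> and u = \<open>fst z - a\<close>, the Taylor
  expansion of (f(s + u) - f(s))/u in u has terms in which the two variables are separated. Cauchy's
  inequality on discs of radius \<open>2 * R\<close> against |u| < R yields the ratio 1/2. This
  makes the cancellation of poles at a positive integer \<open>a\<close> holomorphic in both
  variables.\<close>

lemma divided_difference_holomorphic2:
  assumes f: "f holomorphic_on ball c (4 * R)" and R: "R > 0"
  obtains D where "holomorphic2_on D (ball a (R/2) \<times> ball b (R/2))"
    "\<And>z. z \<in> ball a (R/2) \<times> ball b (R/2) \<Longrightarrow>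
       (fst z - a) * D z = f (snd z + (c - b) + (fst z - a)) - f (snd z + (c - b))"
proof -
  have hol3: "f holomorphic_on cball c (3 * R)" using f by (rule holomorphic_on_subset) (use R in auto)
  then have "compact (f ` cball c (3*R))"
    by (intro compact_continuous_image holomorphic_on_imp_continuous_on) auto
  then obtain B where B: "\<And>x. x \<in> cball c (3*R) \<Longrightarrow> norm (f x) \<le> B"
    using compact_imp_bounded bounded_iff by (metis imageI)
  have sub: "cball (s + (c - b)) (2*R) \<subseteq> cball c (3*R)" if "s \<in> ball b R" for s
  proof -
    have "dist (s + (c - b)) c = dist b s" by (simp add: dist_norm norm_minus_commute algebra_simps)
    with that have d: "dist (s + (c - b)) c \<le> R" by simp
    show ?thesis
    proof
      fix x assume "x \<in> cball (s + (c - b)) (2 * R)"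
      then show "x \<in> cball c (3 * R)"
        using d dist_triangle[of c x "s + (c - b)"] by (simp add: dist_commute)
    qed
  qed
  define g where "g = (\<lambda>m s. (deriv ^^ Suc m) f (s + (c - b)) / fact (Suc m))"
  have g1: "g m holomorphic_on ball b R" for m unfolding g_def
  proof (intro holomorphic_on_divide holomorphic_on_compose_gen[of "\<lambda>s. s + (c-b)" _ "(deriv ^^ Suc m) f" "ball c (4*R)", unfolded o_def])
    show "(deriv ^^ Suc m) f holomorphic_on ball c (4 * R)" by (intro holomorphic_higher_deriv f) auto
    show "(\<lambda>s. s + (c - b)) ` ball b R \<subseteq> ball c (4 * R)"
      using R by (auto simp: dist_norm algebra_simps)
  qed (auto intro!: holomorphic_intros simp del: fact_Suc)
  have g2: "norm (g m s) \<le> B / (2*R)^Suc m" if "s \<in> ball b R" for m s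
  proof -
    have "norm ((deriv ^^ Suc m) f (s + (c - b))) \<le> fact (Suc m) * B / (2*R)^Suc m"
    proof (rule Cauchy_inequality)
      show "f holomorphic_on ball (s + (c - b)) (2*R)"
        using hol3 sub[OF that] ball_subset_cball by (metis holomorphic_on_subset order_trans)
      show "continuous_on (cball (s + (c - b)) (2*R)) f"
        using hol3 sub[OF that] by (metis holomorphic_on_imp_continuous_on continuous_on_subset)
      show "norm (f x) \<le> B" if "norm (s + (c - b) - x) = 2*R" for x
      proof -
        have "x \<in> cball (s + (c - b)) (2*R)" using that by (simp add: dist_norm)
        then show ?thesis using B sub[OF \<open>s \<in> ball b R\<close>] by blast
      qed
    qed (use R in auto)
    then show ?thesis unfolding g_def norm_divide norm_fact by (simp only: field_simps fact_nonzero) (simp add: field_simps del: fact_Suc)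
  qed
  define h where "h = (\<lambda>m s. (s - a) ^ m)"
  have h1: "h m holomorphic_on ball a R" for m unfolding h_def by (intro holomorphic_intros)
  have h2: "norm (h m s) \<le> R ^ m" if "s \<in> ball a R" for m s
    unfolding h_def norm_power using that by (intro power_mono) (auto simp: dist_norm norm_minus_commute)
  have sm: "summable (\<lambda>m. R^m * (B / (2*R)^Suc m))"
  proof -
    have "R^m * (B / (2*R)^Suc m) = B / (2*R) * (1/2)^m" for m
      using R by (simp add: power_mult_distrib field_simps)
    then show ?thesis by (simp only:) (intro summable_mult summable_geometric, simp)
  qed
  show ?thesis
  proof
    show "holomorphic2_on (\<lambda>z. \<Sum>m. h m (fst z) * g m (snd z)) (ball a (R/2) \<times> ball b (R/2))"
      by (rule holomorphic2_on_suminf_mult[OF R h1 h2 g1 g2 sm])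
    fix z assume z: "z \<in> ball a (R/2) \<times> ball b (R/2)"
    then have z1: "fst z \<in> ball a R" "snd z \<in> ball b R" using R by (auto simp: mem_Times_iff)
    let ?s = "snd z + (c - b)" let ?u = "fst z - a"
    have "(\<lambda>m. (deriv ^^ m) f ?s / fact m * ((?s + ?u) - ?s)^m) sums f (?s + ?u)"
    proof (rule holomorphic_power_series)
      show "f holomorphic_on ball ?s (2*R)"
        using hol3 sub[OF z1(2)] ball_subset_cball by (metis holomorphic_on_subset order_trans)
      have "norm ?u < R" using z1(1) by (simp add: dist_norm norm_minus_commute)
      then show "?s + ?u \<in> ball ?s (2*R)" using R by (simp add: dist_norm norm_minus_commute)
    qed
    then have "(\<lambda>m. (deriv ^^ Suc m) f ?s / fact (Suc m) * ?u^Suc m) sums (f (?s + ?u) - f ?s)"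
      by (subst sums_Suc_iff) simp
    moreover have "(deriv ^^ Suc m) f ?s / fact (Suc m) * ?u^Suc m = ?u * (h m (fst z) * g m (snd z))" for m
      unfolding h_def g_def by (simp add: mult_ac del: fact_Suc)
    ultimately have 1: "(\<lambda>m. ?u * (h m (fst z) * g m (snd z))) sums (f (?s + ?u) - f ?s)" by simp
    have "summable (\<lambda>m. h m (fst z) * g m (snd z))"
    proof (rule summable_comparison_test[OF _ sm], intro exI[of _ 0] allI impI)
      fix m show "norm (h m (fst z) * g m (snd z)) \<le> R^m * (B / (2*R)^Suc m)"
        unfolding norm_mult using h2[OF z1(1)] g2[OF z1(2)] R by (intro mult_mono) auto
    qed
    then have "(\<lambda>m. ?u * (h m (fst z) * g m (snd z))) sums (?u * (\<Sum>m. h m (fst z) * g m (snd z)))"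
      by (intro sums_mult summable_sums)
    with 1 show "(fst z - a) * (\<Sum>m. h m (fst z) * g m (snd z)) = f (?s + ?u) - f ?s"
      by (rule sums_unique2[symmetric])
  qed
qed

text \<open>One polydisc on which all factors have normal forms at once: principal parts
  \<open>\<kappa> / (s - a)\<close> in the first variable and \<open>\<kappa>' k / (s - b)\<close>
  in the second, and a pole of order at most two in the sum. Meromorphy, regularity and singularity
  are all derived from it.\<close>

lemma zF_local:
  fixes a b :: complex
  obtains e K T \<kappa> w v \<kappa>' q \<eta> where
    "0 < e" "holomorphic2_on T (ball a e \<times> ball b e)"
    "w holomorphic_on ball a e" "\<And>k. v k holomorphic_on ball a e"
    "\<And>s. s \<in> ball a e - {a} \<Longrightarrow> s \<notin> posints \<and> Gamma (1 - s) = w s - \<kappa> / (s - a)"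
    "\<And>k s. s \<in> ball a e - {a} \<Longrightarrow> zcoeff k s = v k s + (if a = of_nat (Suc k) then \<kappa> / (s - a) else 0)"
    "a \<in> posints \<longleftrightarrow> \<kappa> \<noteq> 0"
    "\<And>k. k < K \<Longrightarrow> q k holomorphic_on ball b e"
    "\<And>k s. s \<in> ball b e - {b} \<Longrightarrow> s + of_nat k \<notin> zH_poles"
    "\<And>k s. k < K \<Longrightarrow> s \<in> ball b e - {b} \<Longrightarrow> rGamma s * zH (s + of_nat k) = \<kappa>' k / (s - b) + q k s"
    "\<And>k. \<kappa>' k \<noteq> 0 \<longleftrightarrow> b + of_nat k \<in> zM_poles \<and> \<not> (k \<ge> 1 \<and> b + of_nat k = 1)"
    "\<And>k. \<kappa>' k \<noteq> 0 \<Longrightarrow> k < K" "\<And>k. a = of_nat (Suc k) \<Longrightarrow> k < K"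
    "\<eta> holomorphic_on ball (a + b - 1) (2 * e)"
    "\<And>s. s \<in> ball (a + b - 1) (2 * e) - {a + b - 1} \<Longrightarrow> s \<notin> zH_poles \<and> zH s = \<eta> s / (s - (a + b - 1))\<^sup>2"
    "\<And>z. z \<in> ball a e \<times> ball b e \<Longrightarrow> zF z = T z + rGamma (snd z) * Gamma (1 - fst z) * zH (fst z + snd z - 1)
       + (\<Sum>k<K. zcoeff k (fst z) * (rGamma (snd z) * zH (snd z + of_nat k)))"
proof -
  obtain K T where KT: "holomorphic2_on T (ball a (1/2) \<times> ball b (1/2))"
    "\<And>k s. k \<ge> K \<Longrightarrow> s \<in> ball b 1 \<Longrightarrow> s + of_nat k \<notin> zH_poles"
    "\<And>k s. k \<ge> K \<Longrightarrow> s \<in> ball a 1 \<Longrightarrow> s \<noteq> of_nat (Suc k)"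
    "\<And>z. z \<in> ball a (1/2) \<times> ball b (1/2) \<Longrightarrow> zF z = T z + rGamma (snd z) * Gamma (1 - fst z) * zH (fst z + snd z - 1)
       + (\<Sum>k<K. zcoeff k (fst z) * (rGamma (snd z) * zH (snd z + of_nat k)))"
    by (rule zF_split[of a b]) (rule that, assumption+)
  obtain e1 \<kappa> w v where e1: "e1 > 0" "w holomorphic_on ball a e1" "\<forall>k. v k holomorphic_on ball a e1"
     "\<forall>s\<in>ball a e1 - {a}. s \<notin> posints \<and> Gamma (1 - s) = w s - \<kappa> / (s - a) \<and>
        (\<forall>k. zcoeff k s = v k s + (if a = of_nat (Suc k) then \<kappa> / (s - a) else 0))"
     "a \<in> posints \<longleftrightarrow> \<kappa> \<noteq> (0::complex)"
    using pole_cancellation[of a] by (elim exE conjE) (rule that; assumption)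
  obtain e2 \<eta> where e2: "e2 > 0" "\<eta> holomorphic_on ball (a+b-1) e2"
     "\<forall>s\<in>ball (a+b-1) e2 - {a+b-1}. s \<notin> zH_poles \<and> zH s = \<eta> s / (s - (a+b-1))\<^sup>2"
    using zH_local_pole[of "a+b-1"] by (elim exE conjE) (rule that; assumption)
  obtain E \<kappa>' q where q: "\<forall>k. E k > 0 \<and> q k holomorphic_on ball b (E k) \<and>
     (\<forall>s\<in>ball b (E k) - {b}. s + of_nat k \<notin> zH_poles \<and> rGamma s * zH (s + of_nat k) = \<kappa>' k / (s - b) + q k s) \<and>
     (\<kappa>' k \<noteq> 0 \<longleftrightarrow> b + of_nat k \<in> zM_poles \<and> \<not> (k \<ge> 1 \<and> b + of_nat k = 1))"
  proof -
    have "\<forall>k. \<exists>e \<kappa> q. e > 0 \<and> q holomorphic_on ball b e \<and>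
     (\<forall>s\<in>ball b e - {b}. s + of_nat k \<notin> zH_poles \<and> rGamma s * zH (s + of_nat k) = \<kappa> / (s - b) + q s) \<and>
     (\<kappa> \<noteq> 0 \<longleftrightarrow> b + of_nat k \<in> zM_poles \<and> \<not> (k \<ge> 1 \<and> b + of_nat k = 1))"
      using rGamma_zH_local[of b] by auto
    from choice[OF this] obtain E where "\<forall>k. \<exists>\<kappa> q. E k > 0 \<and> q holomorphic_on ball b (E k) \<and>
     (\<forall>s\<in>ball b (E k) - {b}. s + of_nat k \<notin> zH_poles \<and> rGamma s * zH (s + of_nat k) = \<kappa> / (s - b) + q s) \<and>
     (\<kappa> \<noteq> 0 \<longleftrightarrow> b + of_nat k \<in> zM_poles \<and> \<not> (k \<ge> 1 \<and> b + of_nat k = 1))" ..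
    from choice[OF this] obtain \<kappa>' where "\<forall>k. \<exists>q. E k > 0 \<and> q holomorphic_on ball b (E k) \<and>
     (\<forall>s\<in>ball b (E k) - {b}. s + of_nat k \<notin> zH_poles \<and> rGamma s * zH (s + of_nat k) = \<kappa>' k / (s - b) + q s) \<and>
     (\<kappa>' k \<noteq> 0 \<longleftrightarrow> b + of_nat k \<in> zM_poles \<and> \<not> (k \<ge> 1 \<and> b + of_nat k = 1))" ..
    from choice[OF this] obtain q where "\<forall>k. E k > 0 \<and> q k holomorphic_on ball b (E k) \<and>
     (\<forall>s\<in>ball b (E k) - {b}. s + of_nat k \<notin> zH_poles \<and> rGamma s * zH (s + of_nat k) = \<kappa>' k / (s - b) + q k s) \<and>
     (\<kappa>' k \<noteq> 0 \<longleftrightarrow> b + of_nat k \<in> zM_poles \<and> \<not> (k \<ge> 1 \<and> b + of_nat k = 1))" ..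
    then show ?thesis by (rule that)
  qed
  \<comment> \<open>Half of \<open>e2\<close>, because \<open>fst z + snd z - 1\<close> ranges over
    a disc of twice the radius.\<close>
  define e where "e = Min ({1/2, e1, e2/2} \<union> E ` {..<K})"
  have e0: "e > 0" unfolding e_def using e1(1) e2(1) q by (subst Min_gr_iff) auto
  have ele: "e \<le> x" if "x \<in> {1/2, e1, e2/2} \<union> E ` {..<K}" for x unfolding e_def using that by (intro Min_le) auto
  have l: "e \<le> 1/2" "e \<le> e1" "2 * e \<le> e2" "\<And>k. k < K \<Longrightarrow> e \<le> E k"
    using ele[of "1/2"] ele[of e1] ele[of "e2/2"] ele[of "E _"] by auto
  have kk: "k < K" if "\<kappa>' k \<noteq> 0" for k
  proof (rule ccontr)
    assume "\<not> k < K"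
    then have "b + of_nat k \<notin> zH_poles" by (intro KT(2)) auto
    with that q show False unfolding zH_poles_def by auto
  qed
  show ?thesis
  proof
    show "e > 0" by fact
    show "holomorphic2_on T (ball a e \<times> ball b e)" by (rule holomorphic2_on_subset[OF KT(1)]) (use l(1) in auto)
    show "w holomorphic_on ball a e" by (rule holomorphic_on_subset[OF e1(2)]) (use l(2) in auto)
    show "v k holomorphic_on ball a e" for k by (rule holomorphic_on_subset[OF e1(3)[rule_format]]) (use l(2) in auto)
    show "s \<notin> posints \<and> Gamma (1 - s) = w s - \<kappa> / (s - a)" if "s \<in> ball a e - {a}" for s
      using bspec[OF e1(4), of s] that l(2) by auto
    show "zcoeff k s = v k s + (if a = of_nat (Suc k) then \<kappa> / (s - a) else 0)" if "s \<in> ball a e - {a}" for k s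
      using bspec[OF e1(4), of s] that l(2) by auto
    show "a \<in> posints \<longleftrightarrow> \<kappa> \<noteq> 0" by (rule e1(5))
    show "q k holomorphic_on ball b e" if "k < K" for k
      by (rule holomorphic_on_subset[of _ "ball b (E k)"]) (use q l(4)[OF that] in auto)
    show "s + of_nat k \<notin> zH_poles" if "s \<in> ball b e - {b}" for k s
    proof (cases "k < K")
      case True
      have "s \<in> ball b (E k) - {b}" using that l(4)[OF True] by auto
      then show ?thesis using q by blast
    next
      case False
      have "s \<in> ball b 1" using that l(1) by auto
      then show ?thesis using KT(2)[of k s] False by auto
    qed
    show "rGamma s * zH (s + of_nat k) = \<kappa>' k / (s - b) + q k s" if "k < K" "s \<in> ball b e - {b}" for k s
    proof -
      have "s \<in> ball b (E k) - {b}" using that(2) l(4)[OF that(1)] by auto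
      then show ?thesis using q by blast
    qed
    show "\<kappa>' k \<noteq> 0 \<longleftrightarrow> b + of_nat k \<in> zM_poles \<and> \<not> (k \<ge> 1 \<and> b + of_nat k = 1)" for k using q by blast
    show "k < K" if "\<kappa>' k \<noteq> 0" for k using kk[OF that] .
    show "k < K" if "a = of_nat (Suc k)" for k using KT(3)[of k a] that by (auto simp: not_less[symmetric] simp del: of_nat_Suc)
    show "\<eta> holomorphic_on ball (a + b - 1) (2 * e)" by (rule holomorphic_on_subset[OF e2(2)]) (use l(3) in auto)
    show "s \<notin> zH_poles \<and> zH s = \<eta> s / (s - (a + b - 1))\<^sup>2" if "s \<in> ball (a + b - 1) (2 * e) - {a + b - 1}" for s
      using bspec[OF e2(3), of s] that l(3) by auto
    show "zF z = T z + rGamma (snd z) * Gamma (1 - fst z) * zH (fst z + snd z - 1)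
       + (\<Sum>k<K. zcoeff k (fst z) * (rGamma (snd z) * zH (snd z + of_nat k)))" if "z \<in> ball a e \<times> ball b e" for z
      using KT(4)[of z] that l(1) by (auto simp: mem_Times_iff)
  qed
qed

lemma holomorphic2_on_sum_minus_one:
  assumes "f holomorphic_on S" "open S" "\<And>z. z \<in> U \<Longrightarrow> fst z + snd z - 1 \<in> S"
  shows "holomorphic2_on (\<lambda>z. f (fst z + snd z - 1)) U"
  using holomorphic2_on_compose_affine[OF assms(1,2), of U 1 1 "-1"] assms(3) by simp

lemma sum_minus_one_in_ball:
  fixes a b :: complex
  assumes "z \<in> ball a e \<times> ball b e"
  shows "fst z + snd z - 1 \<in> ball (a + b - 1) (2 * e)"
proof -
  have "dist (a + b - 1) (fst z + snd z - 1) \<le> dist a (fst z) + dist b (snd z)"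
    using norm_triangle_ineq[of "a - fst z" "b - snd z"] by (simp add: dist_norm algebra_simps)
  also have "\<dots> < 2 * e" using assms by (auto simp: mem_Times_iff)
  finally show ?thesis by simp
qed

text \<open>Multiplication by (s_1 - a)(s_2 - b)(s_1 + s_2 - a - b)^2 clears all denominators; the
  square accounts for a possible double pole of \<open>zH\<close>.\<close>

lemma zF_meromorphic_at:
  fixes a b :: complex
  shows "\<exists>U g h. open U \<and> connected U \<and> (a, b) \<in> U \<and> holomorphic2_on g U \<and> holomorphic2_on h U \<and>
    (\<exists>z\<in>U. h z \<noteq> 0) \<and> (\<forall>z\<in>U. h z \<noteq> 0 \<longrightarrow> fst z \<notin> posints \<and> zF z = g z / h z)"
proof (rule zF_local[of a b])
  fix e K T \<kappa> w v \<kappa>' q \<eta>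
  assume e: "(0::real) < e" and T: "holomorphic2_on T (ball a e \<times> ball b e)"
    and w: "w holomorphic_on ball a e" and v: "\<And>k. v k holomorphic_on ball a e"
    and G: "\<And>s. s \<in> ball a e - {a} \<Longrightarrow> s \<notin> posints \<and> Gamma (1 - s) = w s - \<kappa> / (s - a)"
    and Z: "\<And>k s. s \<in> ball a e - {a} \<Longrightarrow> zcoeff k s = v k s + (if a = of_nat (Suc k) then \<kappa> / (s - a) else 0)"
    and q: "\<And>k. k < K \<Longrightarrow> q k holomorphic_on ball b e"
    and Q: "\<And>k s. k < K \<Longrightarrow> s \<in> ball b e - {b} \<Longrightarrow> rGamma s * zH (s + of_nat k) = \<kappa>' k / (s - b) + q k s"
    and \<eta>: "\<eta> holomorphic_on ball (a + b - 1) (2 * e)"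
    and H: "\<And>s. s \<in> ball (a + b - 1) (2 * e) - {a + b - 1} \<Longrightarrow> s \<notin> zH_poles \<and> zH s = \<eta> s / (s - (a + b - 1))\<^sup>2"
    and F: "\<And>z. z \<in> ball a e \<times> ball b e \<Longrightarrow> zF z = T z + rGamma (snd z) * Gamma (1 - fst z) * zH (fst z + snd z - 1)
       + (\<Sum>k<K. zcoeff k (fst z) * (rGamma (snd z) * zH (snd z + of_nat k)))"
  let ?U = "ball a e \<times> ball b e"
  define u where "u = (\<lambda>z. fst z + snd z - 1 - (a + b - 1))"
  define h where "h = (\<lambda>z. (fst z - a) * (snd z - b) * (u z * u z))"
  define \<delta> where "\<delta> = (\<lambda>k. if a = of_nat (Suc k) then \<kappa> else 0)"
  define g where "g = (\<lambda>z. T z * h z + rGamma (snd z) * (w (fst z) * (fst z - a) - \<kappa>) * (snd z - b) * \<eta> (fst z + snd z - 1)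
     + (\<Sum>k<K. (v k (fst z) * (fst z - a) + \<delta> k) * (\<kappa>' k + q k (snd z) * (snd z - b)) * (u z * u z)))"
  have hu: "holomorphic2_on u ?U" unfolding u_def
    by (rule holomorphic2_on_sum_minus_one[of "\<lambda>s. s - (a + b - 1)" UNIV]) (auto intro!: holomorphic_intros)
  have hx: "holomorphic2_on (\<lambda>z. fst z - a) ?U"
    by (rule holomorphic2_on_fst[of "\<lambda>s. s - a" UNIV]) (auto intro!: holomorphic_intros)
  have hy: "holomorphic2_on (\<lambda>z. snd z - b) ?U"
    by (rule holomorphic2_on_snd[of "\<lambda>s. s - b" UNIV]) (auto intro!: holomorphic_intros)
  have hh: "holomorphic2_on h ?U" unfolding h_def by (intro holomorphic2_on_mult hu hx hy)
  have hr: "holomorphic2_on (\<lambda>z. rGamma (snd z)) ?U"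
    by (rule holomorphic2_on_snd[of rGamma UNIV]) (auto intro!: holomorphic_intros)
  have hw: "holomorphic2_on (\<lambda>z. w (fst z)) ?U" by (rule holomorphic2_on_fst[OF w]) auto
  have hv: "holomorphic2_on (\<lambda>z. v k (fst z)) ?U" for k by (rule holomorphic2_on_fst[OF v]) auto
  have hq: "holomorphic2_on (\<lambda>z. q k (snd z)) ?U" if "k < K" for k by (rule holomorphic2_on_snd[OF q[OF that]]) auto
  have he: "holomorphic2_on (\<lambda>z. \<eta> (fst z + snd z - 1)) ?U"
    by (rule holomorphic2_on_sum_minus_one[OF \<eta> open_ball sum_minus_one_in_ball])
  have hg: "holomorphic2_on g ?U" unfolding g_def
    by (intro holomorphic2_on_add holomorphic2_on_mult holomorphic2_on_diff holomorphic2_on_sum holomorphic2_on_const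
          T hh hu hx hy hr hw hv hq he) auto
  have main: "fst z \<notin> posints \<and> zF z = g z / h z" if z: "z \<in> ?U" and nz: "h z \<noteq> 0" for z
  proof -
    have x0: "fst z - a \<noteq> 0" and y0: "snd z - b \<noteq> 0" and u0: "u z \<noteq> 0" using nz unfolding h_def by auto
    have s1: "fst z \<in> ball a e - {a}" using z x0 by (auto simp: mem_Times_iff)
    have s2: "snd z \<in> ball b e - {b}" using z y0 by (auto simp: mem_Times_iff)
    have s3: "fst z + snd z - 1 \<in> ball (a + b - 1) (2 * e) - {a + b - 1}"
      using sum_minus_one_in_ball[OF z] u0 unfolding u_def right_minus_eq by blast
    have zHe: "zH (fst z + snd z - 1) = \<eta> (fst z + snd z - 1) / (u z * u z)"
      using H[OF s3] unfolding u_def by (simp add: power2_eq_square)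
    have alg1: "r * (w' - \<kappa> / x) * (n / U) * (x * y * U) = r * (w' * x - \<kappa>) * y * n"
      if "x \<noteq> 0" "U \<noteq> 0" for r w' x n U y :: complex using that by (simp add: field_simps)
    have alg2: "(v' + d / x) * (k' / y + q') * (x * y * U) = (v' * x + d) * (k' + q' * y) * U"
      if "x \<noteq> 0" "y \<noteq> 0" for v' d x k' y q' U :: complex using that by (simp add: field_simps)
    have Zk: "zcoeff k (fst z) = v k (fst z) + \<delta> k / (fst z - a)" for k
      using Z[OF s1, of k] unfolding \<delta>_def by auto
    have t2: "rGamma (snd z) * Gamma (1 - fst z) * zH (fst z + snd z - 1) * h z =
      rGamma (snd z) * (w (fst z) * (fst z - a) - \<kappa>) * (snd z - b) * \<eta> (fst z + snd z - 1)"
      unfolding zHe h_def conjunct2[OF G[OF s1]] by (rule alg1[OF x0]) (use u0 in simp)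
    have t3: "zcoeff k (fst z) * (rGamma (snd z) * zH (snd z + of_nat k)) * h z =
      (v k (fst z) * (fst z - a) + \<delta> k) * (\<kappa>' k + q k (snd z) * (snd z - b)) * (u z * u z)" if "k < K" for k
      unfolding Q[OF that s2] Zk h_def by (rule alg2[OF x0 y0])
    have "zF z * h z = T z * h z + rGamma (snd z) * Gamma (1 - fst z) * zH (fst z + snd z - 1) * h z
       + (\<Sum>k<K. zcoeff k (fst z) * (rGamma (snd z) * zH (snd z + of_nat k)) * h z)"
      unfolding F[OF z] distrib_right sum_distrib_right ..
    also have "\<dots> = g z"
      unfolding g_def t2 by (intro arg_cong2[of _ _ _ _ "(+)"] refl sum.cong t3) auto
    finally have "zF z * h z = g z" .
    then show ?thesis using nz G[OF s1] by (simp add: field_simps)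
  qed
  have "\<exists>z\<in>?U. h z \<noteq> 0"
  proof
    \<comment> \<open>Moving both coordinates by the same positive amount leaves all three zero
      lines of \<open>h\<close>.\<close>
    show "(a + of_real (e/2), b + of_real (e/2)) \<in> ?U" using e by (simp add: dist_norm)
    have "u (a + of_real (e/2), b + of_real (e/2)) = of_real e" unfolding u_def by simp
    then show "h (a + of_real (e/2), b + of_real (e/2)) \<noteq> 0" unfolding h_def using e by simp
  qed
  then show ?thesis using hg hh main e
    by (intro exI[of _ ?U] exI[of _ g] exI[of _ h]) (auto intro!: open_Times connected_Times)
qed

text \<open>Under the hypotheses all residues \<open>\<kappa>' k\<close> vanish, so a pole could
  come only from s_1 = a with \<open>a = Suc n\<close>. There the two singular contributions combine
  to \<open>\<kappa> * rGamma (snd z)\<close> times the difference of \<open>zH (snd z + n)\<close>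
  and \<open>zH (fst z + snd z - 1)\<close> over \<open>fst z - a\<close>, a divided
  difference.\<close>

lemma zF_regular_at:
  fixes a b :: complex
  assumes ab: "a + b - 1 \<notin> zH_poles" and bk: "\<forall>k. b + of_nat k \<in> zM_poles \<longrightarrow> k \<ge> 1 \<and> b + of_nat k = 1"
  shows "\<exists>U G h. open U \<and> connected U \<and> (a, b) \<in> U \<and> holomorphic2_on G U \<and> holomorphic2_on h U \<and>
    (\<exists>z\<in>U. h z \<noteq> 0) \<and> (\<forall>z\<in>U. h z \<noteq> 0 \<longrightarrow> fst z \<notin> posints \<and> zF z = G z)"
proof (rule zF_local[of a b])
  fix e K T \<kappa> w v \<kappa>' q \<eta>
  assume e: "(0::real) < e" and T: "holomorphic2_on T (ball a e \<times> ball b e)"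
    and w: "w holomorphic_on ball a e" and v: "\<And>k. v k holomorphic_on ball a e"
    and G: "\<And>s. s \<in> ball a e - {a} \<Longrightarrow> s \<notin> posints \<and> Gamma (1 - s) = w s - \<kappa> / (s - a)"
    and Z: "\<And>k s. s \<in> ball a e - {a} \<Longrightarrow> zcoeff k s = v k s + (if a = of_nat (Suc k) then \<kappa> / (s - a) else 0)"
    and \<kappa>: "a \<in> posints \<longleftrightarrow> \<kappa> \<noteq> 0"
    and q: "\<And>k. k < K \<Longrightarrow> q k holomorphic_on ball b e"
    and Q: "\<And>k s. k < K \<Longrightarrow> s \<in> ball b e - {b} \<Longrightarrow> rGamma s * zH (s + of_nat k) = \<kappa>' k / (s - b) + q k s"
    and \<kappa>': "\<And>k. \<kappa>' k \<noteq> 0 \<longleftrightarrow> b + of_nat k \<in> zM_poles \<and> \<not> (k \<ge> 1 \<and> b + of_nat k = 1)"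
    and aK: "\<And>k. a = of_nat (Suc k) \<Longrightarrow> k < K"
    and F: "\<And>z. z \<in> ball a e \<times> ball b e \<Longrightarrow> zF z = T z + rGamma (snd z) * Gamma (1 - fst z) * zH (fst z + snd z - 1)
       + (\<Sum>k<K. zcoeff k (fst z) * (rGamma (snd z) * zH (snd z + of_nat k)))"
  have \<kappa>'0: "\<kappa>' k = 0" for k using \<kappa>'[of k] bk by blast
  obtain R0 where R0: "R0 > 0" "ball (a + b - 1) R0 \<subseteq> - zH_poles"
    using open_Compl_zH_poles ab by (metis ComplI open_contains_ball)
  define R where "R = R0 / 4"
  have R: "R > 0" and Rsub: "ball (a + b - 1) (4 * R) \<subseteq> - zH_poles" using R0 unfolding R_def by auto
  have zHh: "zH holomorphic_on ball (a + b - 1) (4 * R)" by (rule holomorphic_on_subset[OF zH_holomorphic Rsub])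
  obtain D where D: "holomorphic2_on D (ball a (R/2) \<times> ball b (R/2))"
    "\<And>z. z \<in> ball a (R/2) \<times> ball b (R/2) \<Longrightarrow>
       (fst z - a) * D z = zH (snd z + (a + b - 1 - b) + (fst z - a)) - zH (snd z + (a + b - 1 - b))"
    by (rule divided_difference_holomorphic2[OF zHh R, of a b]) (rule that)
  define r where "r = min e (R/2)"
  have r: "r > 0" "r \<le> e" "r \<le> R/2" unfolding r_def using e R by auto
  let ?U = "ball a r \<times> ball b r"
  have Ue: "?U \<subseteq> ball a e \<times> ball b e" and UR: "?U \<subseteq> ball a (R/2) \<times> ball b (R/2)" using r by auto
  define h where "h = (\<lambda>z. (fst z - a) * (snd z - b))"
  define g where "g = (\<lambda>z. T z + rGamma (snd z) * w (fst z) * zH (fst z + snd z - 1)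
     + (\<Sum>k<K. v k (fst z) * q k (snd z)) - \<kappa> * rGamma (snd z) * D z)"
  have hh: "holomorphic2_on h ?U" unfolding h_def
    by (intro holomorphic2_on_mult holomorphic2_on_fst[of "\<lambda>s. s - a" UNIV] holomorphic2_on_snd[of "\<lambda>s. s - b" UNIV])
      (auto intro!: holomorphic_intros)
  have hr: "holomorphic2_on (\<lambda>z. rGamma (snd z)) ?U"
    by (rule holomorphic2_on_snd[of rGamma UNIV]) (auto intro!: holomorphic_intros)
  have hw: "holomorphic2_on (\<lambda>z. w (fst z)) ?U" by (rule holomorphic2_on_fst[OF w]) (use r in auto)
  have hv: "holomorphic2_on (\<lambda>z. v k (fst z)) ?U" for k by (rule holomorphic2_on_fst[OF v]) (use r in auto)
  have hq: "holomorphic2_on (\<lambda>z. q k (snd z)) ?U" if "k < K" for k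
    by (rule holomorphic2_on_snd[OF q[OF that]]) (use r in auto)
  have he: "holomorphic2_on (\<lambda>z. zH (fst z + snd z - 1)) ?U"
  proof (rule holomorphic2_on_sum_minus_one[OF zHh])
    show "fst z + snd z - 1 \<in> ball (a + b - 1) (4 * R)" if "z \<in> ?U" for z
      using sum_minus_one_in_ball[OF that] r R by auto
  qed auto
  have hg: "holomorphic2_on g ?U" unfolding g_def
    by (intro holomorphic2_on_add holomorphic2_on_mult holomorphic2_on_diff holomorphic2_on_sum holomorphic2_on_const
          holomorphic2_on_subset[OF T Ue] holomorphic2_on_subset[OF D(1) UR] hr hw hv hq he) auto
  have main: "fst z \<notin> posints \<and> zF z = g z" if z: "z \<in> ?U" and nz: "h z \<noteq> 0" for z
  proof -
    have x0: "fst z - a \<noteq> 0" and y0: "snd z - b \<noteq> 0" using nz unfolding h_def by auto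
    have s1: "fst z \<in> ball a e - {a}" using z x0 r by (auto simp: mem_Times_iff)
    have s2: "snd z \<in> ball b e - {b}" using z y0 r by (auto simp: mem_Times_iff)
    let ?\<delta> = "\<lambda>k. (if a = of_nat (Suc k) then \<kappa> / (fst z - a) else 0) * (rGamma (snd z) * zH (snd z + of_nat k))"
    have t: "zcoeff k (fst z) * (rGamma (snd z) * zH (snd z + of_nat k)) = v k (fst z) * q k (snd z) + ?\<delta> k" if "k < K" for k
      using Z[OF s1, of k] Q[OF that s2] \<kappa>'0[of k] by (simp add: algebra_simps)
    \<comment> \<open>Only the index \<open>n\<close> with \<open>a = Suc n\<close> contributes, and
      \<open>a + b - 1 - b = n\<close> turns its \<open>zH\<close> value into the base value of the
      divided difference.\<close>
    have d: "(\<Sum>k<K. ?\<delta> k) = \<kappa> / (fst z - a) * (rGamma (snd z) * zH (snd z + (a + b - 1 - b)))"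
    proof (cases "a \<in> posints")
      case True
      then obtain m :: nat where "m \<ge> 1" "a = of_nat m" unfolding posints_def by auto
      then obtain n where n: "a = of_nat (Suc n)" by (metis Suc_pred' less_eq_Suc_le One_nat_def)
      have "(\<Sum>k<K. ?\<delta> k) = (\<Sum>k<K. if k = n then \<kappa> / (fst z - a) * (rGamma (snd z) * zH (snd z + of_nat n)) else 0)"
        unfolding n of_nat_eq_iff by (intro sum.cong) auto
      also have "\<dots> = \<kappa> / (fst z - a) * (rGamma (snd z) * zH (snd z + of_nat n))" using aK[OF n] by simp
      finally show ?thesis using n by simp
    next
      case False
      then show ?thesis using \<kappa> by (auto intro!: sum.neutral)
    qed
    have Dz: "(fst z - a) * D z = zH (fst z + snd z - 1) - zH (snd z + (a + b - 1 - b))"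
      using D(2)[of z] UR z by (auto simp: algebra_simps)
    have alg: "T' + r' * (w' - \<kappa> / x) * Z1 + (S + \<kappa> / x * (r' * Z0)) = T' + r' * w' * Z1 + S - \<kappa> * r' * D'"
      if "x \<noteq> 0" "x * D' = Z1 - Z0" for T' r' w' x Z1 S Z0 D' :: complex
    proof -
      have Z1: "Z1 = Z0 + x * D'" using that(2) by simp
      show ?thesis unfolding Z1 using that(1) by (simp add: field_simps)
    qed
    have "(\<Sum>k<K. zcoeff k (fst z) * (rGamma (snd z) * zH (snd z + of_nat k))) =
        (\<Sum>k<K. v k (fst z) * q k (snd z)) + (\<Sum>k<K. ?\<delta> k)"
      unfolding sum.distrib[symmetric] by (intro sum.cong refl t) auto
    then have "zF z = g z"
      unfolding F[OF subsetD[OF Ue z]] g_def d conjunct2[OF G[OF s1]] using alg[OF x0 Dz] by simp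
    then show ?thesis using G[OF s1] by simp
  qed
  have "\<exists>z\<in>?U. h z \<noteq> 0"
  proof
    show "(a + of_real (r/2), b + of_real (r/2)) \<in> ?U" using r(1) by (simp add: dist_norm)
    show "h (a + of_real (r/2), b + of_real (r/2)) \<noteq> 0" unfolding h_def using r(1) by simp
  qed
  then show ?thesis using hg hh main r(1)
    by (intro exI[of _ ?U] exI[of _ g] exI[of _ h]) (auto intro!: open_Times connected_Times)
qed

text \<open>Away from every candidate hyperplane all factors of the splitting are holomorphic.
  Continuity is the form in which this is used to pass from equality off a thin set to equality at
  each such point.\<close>

lemma zF_continuous_at_generic:
  fixes a b :: complex
  assumes a: "a \<notin> posints" and ab: "a + b - 1 \<notin> zH_poles" and bk: "\<And>k. b + of_nat k \<notin> zH_poles"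
  obtains W where "open W" "(a, b) \<in> W" "continuous_on W zF" "\<And>z. z \<in> W \<Longrightarrow> fst z \<notin> posints"
proof -
  obtain K T where KT: "holomorphic2_on T (ball a (1/2) \<times> ball b (1/2))"
    "\<And>z. z \<in> ball a (1/2) \<times> ball b (1/2) \<Longrightarrow> zF z = T z + rGamma (snd z) * Gamma (1 - fst z) * zH (fst z + snd z - 1)
       + (\<Sum>k<K. zcoeff k (fst z) * (rGamma (snd z) * zH (snd z + of_nat k)))"
    by (rule zF_split[of a b]) (rule that, assumption+)
  define W where "W = (ball a (1/2) \<times> ball b (1/2)) \<inter> (fst -` (- posints) \<inter> (\<lambda>z. fst z + snd z - 1) -` (- zH_poles) \<inter>
     (\<Inter>k\<in>{..<K}. (\<lambda>z. snd z + of_nat k) -` (- zH_poles)))"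
  have "open W" unfolding W_def
    by (intro open_Int open_Times open_ball open_INT ballI open_vimage open_Compl_posints open_Compl_zH_poles continuous_intros) auto
  moreover have "(a, b) \<in> W" unfolding W_def using a ab bk by auto
  moreover have "continuous_on W zF"
  proof -
    have hz: "holomorphic2_on (\<lambda>z. zH (snd z + of_nat k)) W" if "k < K" for k
      using holomorphic2_on_compose_affine[OF zH_holomorphic open_Compl_zH_poles, of W 0 1 "of_nat k"] that
      unfolding W_def by auto
    have hg: "holomorphic2_on (\<lambda>z. Gamma (1 - fst z)) W"
      by (rule holomorphic2_on_fst[of "\<lambda>s. Gamma (1 - s)" "- posints"])
        (auto intro!: holomorphic_intros open_Compl_posints one_minus_notin_nonpos_Ints simp: W_def)
    have "holomorphic2_on (\<lambda>z. T z + rGamma (snd z) * Gamma (1 - fst z) * zH (fst z + snd z - 1)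
       + (\<Sum>k<K. zcoeff k (fst z) * (rGamma (snd z) * zH (snd z + of_nat k)))) W"
      by (intro holomorphic2_on_add holomorphic2_on_mult holomorphic2_on_sum hg hz
            holomorphic2_on_sum_minus_one[OF zH_holomorphic open_Compl_zH_poles]
            holomorphic2_on_fst[OF zcoeff_holomorphic open_Compl_posints]
            holomorphic2_on_snd[of rGamma UNIV] holomorphic2_on_subset[OF KT(1)])
        (auto intro!: holomorphic_intros simp: W_def)
    then show ?thesis
      using KT(2) by (subst continuous_on_cong[OF refl]) (auto dest: holomorphic2_on_imp_continuous_on simp: W_def)
  qed
  moreover have "\<And>z. z \<in> W \<Longrightarrow> fst z \<notin> posints" unfolding W_def by auto
  ultimately show ?thesis by (rule that)
qed

section \<open>True singularities\<close>

lemma holomorphic2_on_isCont: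
  assumes "holomorphic2_on g U" "open U" "(x, y) \<in> U"
  shows "isCont (\<lambda>s. g (s, y)) x" "isCont (\<lambda>t. g (x, t)) y"
proof -
  have "isCont g (x, y)"
    using holomorphic2_on_imp_continuous_on[OF assms(1)] assms(2,3) continuous_on_eq_continuous_at by blast
  moreover have "isCont (\<lambda>s. (s, y)) x" "isCont (\<lambda>t. (x, t)) y" by (intro continuous_intros)+
  ultimately show "isCont (\<lambda>s. g (s, y)) x" "isCont (\<lambda>t. g (x, t)) y"
    using isCont_o2[of x "\<lambda>s. (s, y)" g] isCont_o2[of y "\<lambda>t. (x, t)" g] by auto
qed

text \<open>The pole at \<open>Suc l\<close> belongs to \<open>zcoeff l\<close> alone, so
  multiplication by \<open>s - Suc l\<close> isolates its nonzero residue; vanishing on an open set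
  would spread to the whole complement of \<open>posints\<close> and contradict this.\<close>

lemma zcoeff_combination_nonzero:
  assumes l: "\<kappa> l \<noteq> 0" "l < K" and V: "open V" "V \<noteq> {}" "V \<subseteq> - posints"
  shows "\<exists>s\<in>V. (\<Sum>k<K. \<kappa> k * zcoeff k s) \<noteq> 0"
proof (rule ccontr)
  assume "\<not> ?thesis"
  then have 0: "(\<Sum>k<K. \<kappa> k * zcoeff k s) = 0" if "s \<in> V" for s using that by blast
  have hol: "(\<lambda>s. \<Sum>k<K. \<kappa> k * zcoeff k s) holomorphic_on - posints"
    by (intro holomorphic_intros zcoeff_holomorphic)
  have S0: "(\<Sum>k<K. \<kappa> k * zcoeff k s) = 0" if "s \<in> - posints" for s
    by (rule analytic_continuation_open[of V "- posints" _ "\<lambda>_. 0"])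
      (use hol V open_Compl_posints connected_Compl_posints 0 that in auto)
  define c :: complex where "c = of_nat (Suc l)"
  have reg: "isCont (zcoeff k) c" if "k \<noteq> l" for k
  proof -
    have "c \<in> - {of_nat (Suc k)}" using that unfolding c_def by (simp del: of_nat_Suc)
    then show ?thesis using zcoeff_holomorphic_off_pole[of k]
      by (meson holomorphic_on_imp_continuous_on continuous_on_eq_continuous_at open_Compl closed_singleton)
  qed
  define L where "L = (\<lambda>k. if k = l then (-1)^l * rGamma c else 0)"
  have lim: "((\<lambda>s. zcoeff k s * (s - c)) \<longlongrightarrow> L k) (at c)" for k
  proof (cases "k = l")
    case True
    have "isCont (zcoeff_reg l) c"
      using zcoeff_reg_holomorphic[where A = UNIV and k = l] by (auto dest: holomorphic_on_imp_continuous_on simp: continuous_on_eq_continuous_at)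
    moreover have "isCont (rGamma :: complex \<Rightarrow> complex) c" by (intro continuous_intros)
    ultimately have "((\<lambda>s. (-1)^l * rGamma s + zcoeff_reg l s * (s - c)) \<longlongrightarrow> (-1)^l * rGamma c + zcoeff_reg l c * (c - c)) (at c)"
      by (intro tendsto_intros) (auto simp: isCont_def)
    moreover have "(-1)^l * rGamma s + zcoeff_reg l s * (s - c) = zcoeff l s * (s - c)" if "s \<noteq> c" for s
      unfolding zcoeff_def c_def[symmetric] using that by (simp add: distrib_right)
    then have "\<forall>\<^sub>F s in at c. (-1)^l * rGamma s + zcoeff_reg l s * (s - c) = zcoeff l s * (s - c)"
      unfolding eventually_at_filter by (intro always_eventually) blast
    ultimately show ?thesis using True unfolding L_def by (auto elim: Lim_transform_eventually)
  next
    case False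
    have "((\<lambda>s. zcoeff k s * (s - c)) \<longlongrightarrow> zcoeff k c * (c - c)) (at c)"
      using reg[OF False] by (intro tendsto_intros) (auto simp: isCont_def)
    then show ?thesis using False unfolding L_def by simp
  qed
  have lim_sum: "((\<lambda>s. \<Sum>k<K. \<kappa> k * (zcoeff k s * (s - c))) \<longlongrightarrow> (\<Sum>k<K. \<kappa> k * L k)) (at c)"
    by (intro tendsto_intros lim)
  have ev: "\<forall>\<^sub>F s in at c. (\<Sum>k<K. \<kappa> k * (zcoeff k s * (s - c))) = 0"
  proof -
    obtain e where e: "e > 0" "\<And>s. s \<in> ball c e - {c} \<Longrightarrow> s \<notin> posints"
    proof -
      obtain e \<kappa>' w v where "0 < e" "\<forall>s\<in>ball c e - {c}. s \<notin> posints \<and> Gamma (1 - s) = w s - \<kappa>' / (s - c) \<and>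
        (\<forall>k. zcoeff k s = v k s + (if c = of_nat (Suc k) then \<kappa>' / (s - c) else 0))"
        using pole_cancellation[of c] by (elim exE conjE) (rule that; assumption)
      then show ?thesis by (intro that[of e]) auto
    qed
    have "\<forall>\<^sub>F s in at c. s \<in> ball c e - {c}" using e(1) by (intro eventually_at_in_open) auto
    then show ?thesis
    proof eventually_elim
      case (elim s)
      have "(\<Sum>k<K. \<kappa> k * (zcoeff k s * (s - c))) = (\<Sum>k<K. \<kappa> k * zcoeff k s) * (s - c)"
        unfolding sum_distrib_right by (simp add: mult_ac)
      then show ?case using S0[of s] e(2)[OF elim] by simp
    qed
  qed
  have "((\<lambda>s. 0) \<longlongrightarrow> (\<Sum>k<K. \<kappa> k * L k)) (at c)"
    by (rule Lim_transform_eventually[OF lim_sum ev])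
  then have "(\<Sum>k<K. \<kappa> k * L k) = 0" by (rule LIM_unique[OF _ tendsto_const])
  moreover have "(\<Sum>k<K. \<kappa> k * L k) = (\<Sum>k<K. if k = l then \<kappa> l * ((-1)^l * rGamma c) else 0)"
    unfolding L_def by (intro sum.cong) auto
  ultimately have "rGamma c = 0" using l by simp
  then have "c \<in> \<int>\<^sub>\<le>\<^sub>0" by (simp add: rGamma_eq_zero_iff)
  then show False unfolding c_def of_nat_in_nonpos_Ints_iff by simp
qed

text \<open>At a generic point continuity of \<open>zF\<close> excludes any discrepancy from a
  regular extension \<open>G\<close>, even if \<open>h\<close> vanishes there.\<close>

lemma zF_eq_regular_extension:
  assumes F: "\<And>z. fst z \<notin> posints \<Longrightarrow> F z = zF z"
    and U: "open U" "connected U" "holomorphic2_on G U" "holomorphic2_on h U" "\<exists>z\<in>U. h z \<noteq> 0"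
    and eq: "\<And>z. z \<in> U \<Longrightarrow> h z \<noteq> 0 \<Longrightarrow> F z = G z"
    and z: "(s, t) \<in> U" "s \<notin> posints" "s + t - 1 \<notin> zH_poles" "\<And>k. t + of_nat k \<notin> zH_poles"
  shows "zF (s, t) = G (s, t)"
proof -
  obtain W where W: "open W" "(s, t) \<in> W" "continuous_on W zF" "\<And>z. z \<in> W \<Longrightarrow> fst z \<notin> posints"
    by (rule zF_continuous_at_generic[OF z(2,3,4)]) (rule that)
  have c: "continuous_on W F" using W(3) by (subst continuous_on_cong[OF refl F]) (use W(4) in auto)
  have "F (s, t) = G (s, t)" by (rule regular2_at_imp_eq_on[OF U eq z(1) c W(1,2)])
  then show ?thesis using F[of "(s, t)"] z(2) by simp
qed

text \<open>Regularity at (a, b) persists nearby, so \<open>a\<close> may be moved to a point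
  \<open>a'\<close> where the total residue along s_2 = b is nonzero. Then
  \<open>(t - b) * G (a', t)\<close> would tend both to this residue and to 0.\<close>

lemma zF_singular_snd:
  fixes a b :: complex
  assumes F: "\<And>z. fst z \<notin> posints \<Longrightarrow> F z = zF z"
    and l: "b + of_nat l \<in> zM_poles" "\<not> (l \<ge> 1 \<and> b + of_nat l = 1)"
  shows "\<not> regular2_at F (a, b)"
proof
  assume "regular2_at F (a, b)"
  then obtain U G h where U: "open U" "connected U" "(a, b) \<in> U" "holomorphic2_on G U" "holomorphic2_on h U"
    "\<exists>z\<in>U. h z \<noteq> 0" and FG': "\<forall>z\<in>U. h z \<noteq> 0 \<longrightarrow> F z = G z" unfolding regular2_at_def by (elim exE conjE) (rule that; assumption)
  have FG: "F z = G z" if "z \<in> U" "h z \<noteq> 0" for z using FG' that by blast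
  show False
  proof (rule zF_local[of a b])
    fix e K T \<kappa> w v \<kappa>' q \<eta>
    assume e: "(0::real) < e" and T: "holomorphic2_on T (ball a e \<times> ball b e)"
      and G: "\<And>s. s \<in> ball a e - {a} \<Longrightarrow> s \<notin> posints \<and> Gamma (1 - s) = w s - \<kappa> / (s - a)"
      and q: "\<And>k. k < K \<Longrightarrow> q k holomorphic_on ball b e"
      and bk: "\<And>k s. s \<in> ball b e - {b} \<Longrightarrow> s + of_nat k \<notin> zH_poles"
      and Q: "\<And>k s. k < K \<Longrightarrow> s \<in> ball b e - {b} \<Longrightarrow> rGamma s * zH (s + of_nat k) = \<kappa>' k / (s - b) + q k s"
      and \<kappa>': "\<And>k. \<kappa>' k \<noteq> 0 \<longleftrightarrow> b + of_nat k \<in> zM_poles \<and> \<not> (k \<ge> 1 \<and> b + of_nat k = 1)"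
      and kK: "\<And>k. \<kappa>' k \<noteq> 0 \<Longrightarrow> k < K"
      and H: "\<And>s. s \<in> ball (a + b - 1) (2 * e) - {a + b - 1} \<Longrightarrow> s \<notin> zH_poles \<and> zH s = \<eta> s / (s - (a + b - 1))\<^sup>2"
      and Fs: "\<And>z. z \<in> ball a e \<times> ball b e \<Longrightarrow> zF z = T z + rGamma (snd z) * Gamma (1 - fst z) * zH (fst z + snd z - 1)
         + (\<Sum>k<K. zcoeff k (fst z) * (rGamma (snd z) * zH (snd z + of_nat k)))"
    \<comment> \<open>Admissible first coordinates: inside the domain of \<open>G\<close> on the
      line s_2 = b, and different from \<open>a\<close>, hence outside \<open>posints\<close> and
      with \<open>a' + b - 1\<close> not a pole of \<open>zH\<close>.\<close>
    define V where "V = (ball a e - {a}) \<inter> (\<lambda>s. (s, b)) -` U"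
    have oU: "open ((\<lambda>s. (s, b)) -` U)" by (intro open_vimage U(1) continuous_intros)
    have V: "open V" unfolding V_def using oU by (intro open_Int open_Diff) auto
    have "V \<noteq> {}"
    proof -
      have "open (ball a e \<inter> (\<lambda>s. (s, b)) -` U)" using oU by auto
      then obtain d where d: "d > 0" "ball a d \<subseteq> ball a e \<inter> (\<lambda>s. (s, b)) -` U"
        using e U(3) by (metis IntI centre_in_ball open_contains_ball vimageI)
      have "a + of_real (d/2) \<in> ball a d - {a}" using d(1) by (simp add: dist_norm)
      then show ?thesis using d(2) unfolding V_def by blast
    qed
    moreover have "V \<subseteq> - posints" using G unfolding V_def by blast
    moreover have l': "\<kappa>' l \<noteq> 0" using \<kappa>' l by blast
    ultimately obtain a' where a': "a' \<in> V" "(\<Sum>k<K. \<kappa>' k * zcoeff k a') \<noteq> 0"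
      using zcoeff_combination_nonzero[of \<kappa>', OF l' kK[OF l'] V] by blast
    have a1: "a' \<in> ball a e" "a' \<noteq> a" "(a', b) \<in> U" "a' \<notin> posints" using a'(1) G unfolding V_def by auto
    have ab: "a' + b - 1 \<notin> zH_poles"
    proof -
      have "a' + b - 1 \<in> ball (a + b - 1) (2 * e) - {a + b - 1}"
        using sum_minus_one_in_ball[of "(a', b)" a e b] a1 e by auto
      then show ?thesis using H by blast
    qed
    define S where "S = (\<lambda>t. (t - b) * (T (a', t) + rGamma t * Gamma (1 - a') * zH (a' + t - 1))
        + (\<Sum>k<K. zcoeff k a' * (\<kappa>' k + q k t * (t - b))))"
    have cz: "isCont (\<lambda>t. zH (a' + t - 1)) b"
    proof -
      have "isCont zH (a' + b - 1)"
        using holomorphic_on_imp_continuous_on[OF zH_holomorphic] open_Compl_zH_poles ab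
        by (simp add: continuous_on_eq_continuous_at)
      moreover have "isCont (\<lambda>t. a' + t - 1) b" by (intro continuous_intros)
      ultimately show ?thesis by (rule isCont_o2[rotated])
    qed
    have cq: "isCont (q k) b" if "k < K" for k
      using holomorphic_on_imp_continuous_on[OF q[OF that]] e by (simp add: continuous_on_eq_continuous_at)
    have cT: "isCont (\<lambda>t. T (a', t)) b" using a1 e by (intro holomorphic2_on_isCont(2)[OF T]) (auto intro: open_Times)
    have cG: "isCont (\<lambda>t. G (a', t)) b" using a1 by (intro holomorphic2_on_isCont(2)[OF U(4,1)])
    have cr: "isCont (\<lambda>t. rGamma t :: complex) b" by (intro continuous_intros)
    have "(S \<longlongrightarrow> (b - b) * (T (a', b) + rGamma b * Gamma (1 - a') * zH (a' + b - 1))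
        + (\<Sum>k<K. zcoeff k a' * (\<kappa>' k + q k b * (b - b)))) (at b)"
      unfolding S_def using cz cq cT cr unfolding isCont_def by (intro tendsto_intros) auto
    then have lim1: "(S \<longlongrightarrow> (\<Sum>k<K. \<kappa>' k * zcoeff k a')) (at b)" by (simp add: mult.commute)
    have lim2: "((\<lambda>t. (t - b) * G (a', t)) \<longlongrightarrow> (b - b) * G (a', b)) (at b)"
      using cG unfolding isCont_def by (intro tendsto_intros)
    have ev: "\<forall>\<^sub>F t in at b. S t = (t - b) * G (a', t)"
    proof -
      have "open ((\<lambda>t. (a', t)) -` U)" by (intro open_vimage U(1) continuous_intros)
      then have "\<forall>\<^sub>F t in at b. t \<in> (\<lambda>t. (a', t)) -` U" using a1 by (intro eventually_at_in_open') auto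
      moreover have "\<forall>\<^sub>F t in at b. t \<in> (\<lambda>t. a' + t - 1) -` (- zH_poles)"
        using ab by (intro eventually_at_in_open' open_vimage open_Compl_zH_poles continuous_intros) auto
      moreover have "\<forall>\<^sub>F t in at b. t \<in> ball b e - {b}" using e by (intro eventually_at_in_open) auto
      ultimately show ?thesis
      proof eventually_elim
        case (elim t)
        have "zF (a', t) = G (a', t)"
          by (rule zF_eq_regular_extension[OF F U(1,2,4,5,6) FG]) (use elim a1 bk in auto)
        moreover have "zF (a', t) = T (a', t) + rGamma t * Gamma (1 - a') * zH (a' + t - 1)
             + (\<Sum>k<K. zcoeff k a' * (rGamma t * zH (t + of_nat k)))"
          using Fs[of "(a', t)"] a1 elim by simp
        moreover have "(t - b) * (zcoeff k a' * (rGamma t * zH (t + of_nat k))) = zcoeff k a' * (\<kappa>' k + q k t * (t - b))"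
          if "k < K" for k
          unfolding Q[OF that elim(3)] using elim(3) by (simp add: field_simps)
        ultimately show ?case unfolding S_def
          by (metis (no_types, lifting) distrib_left lessThan_iff sum.cong sum_distrib_left)
      qed
    qed
    have "((\<lambda>t. (t - b) * G (a', t)) \<longlongrightarrow> (\<Sum>k<K. \<kappa>' k * zcoeff k a')) (at b)"
      using lim1 ev by (rule Lim_transform_eventually)
    then have "(\<Sum>k<K. \<kappa>' k * zcoeff k a') = (b - b) * G (a', b)" using lim2 by (rule LIM_unique)
    then show False using a'(2) by simp
  qed
qed

text \<open>After a shift along the hyperplane the other terms are regular and \<open>rGamma\<close>
  does not vanish. The splitting can then be solved for \<open>zH (s + b' - 1)\<close>, which would
  have a finite limit at a pole.\<close>

lemma zF_singular_sum:
  fixes a b :: complex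
  assumes F: "\<And>z. fst z \<notin> posints \<Longrightarrow> F z = zF z" and c: "a + b - 1 \<in> zH_poles"
  shows "\<not> regular2_at F (a, b)"
proof
  assume "regular2_at F (a, b)"
  then obtain U G h where U: "open U" "connected U" "(a, b) \<in> U" "holomorphic2_on G U" "holomorphic2_on h U"
    "\<exists>z\<in>U. h z \<noteq> 0" and FG': "\<forall>z\<in>U. h z \<noteq> 0 \<longrightarrow> F z = G z" unfolding regular2_at_def by (elim exE conjE) (rule that; assumption)
  have FG: "F z = G z" if "z \<in> U" "h z \<noteq> 0" for z using FG' that by blast
  show False
  proof (rule zF_local[of a b])
    fix e K T \<kappa> w v \<kappa>' q \<eta>
    assume e: "(0::real) < e" and T: "holomorphic2_on T (ball a e \<times> ball b e)"
      and G: "\<And>s. s \<in> ball a e - {a} \<Longrightarrow> s \<notin> posints \<and> Gamma (1 - s) = w s - \<kappa> / (s - a)"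
      and bk: "\<And>k s. s \<in> ball b e - {b} \<Longrightarrow> s + of_nat k \<notin> zH_poles"
      and H: "\<And>s. s \<in> ball (a + b - 1) (2 * e) - {a + b - 1} \<Longrightarrow> s \<notin> zH_poles \<and> zH s = \<eta> s / (s - (a + b - 1))\<^sup>2"
      and Fs: "\<And>z. z \<in> ball a e \<times> ball b e \<Longrightarrow> zF z = T z + rGamma (snd z) * Gamma (1 - fst z) * zH (fst z + snd z - 1)
         + (\<Sum>k<K. zcoeff k (fst z) * (rGamma (snd z) * zH (snd z + of_nat k)))"
    have "open ((\<lambda>d. (a - d, b + d)) -` U)" by (intro open_vimage U(1) continuous_intros)
    then obtain d0 where d0: "d0 > 0" "ball 0 d0 \<subseteq> (\<lambda>d. (a - d, b + d)) -` U"
      using U(3) open_contains_ball[of "(\<lambda>d. (a - d, b + d)) -` U"] by force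
    \<comment> \<open>A small nonzero displacement to (a - d, b + d) keeps the sum fixed and leaves
      the lines s_1 = a and s_2 = b, on which the other singularities of the factors near the point
      lie.\<close>
    define d :: complex where "d = of_real (min d0 e / 2)"
    have d: "d \<noteq> 0" "norm d < d0" "norm d < e" unfolding d_def norm_of_real using d0(1) e by auto
    define a' b' where "a' = a - d" and "b' = b + d"
    have abU: "(a', b') \<in> U" using d(2) d0(2) unfolding a'_def b'_def by (auto simp: subset_eq)
    have a1: "a' \<in> ball a e - {a}" and b1: "b' \<in> ball b e - {b}"
      using d unfolding a'_def b'_def by (auto simp: dist_norm)
    have ab: "a' + b' - 1 = a + b - 1" unfolding a'_def b'_def by simp
    have rb: "rGamma b' \<noteq> 0"
      using bk[OF b1, of 0] unfolding rGamma_eq_zero_iff zH_poles_def by auto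
    have ga: "1 - a' \<notin> \<int>\<^sub>\<le>\<^sub>0" by (rule one_minus_notin_nonpos_Ints) (use G[OF a1] in auto)
    define S where "S = (\<lambda>s. (G (s, b') - T (s, b') - (\<Sum>k<K. zcoeff k s * (rGamma b' * zH (b' + of_nat k))))
        / (rGamma b' * Gamma (1 - s)))"
    have "isCont S a'"
    proof -
      have "isCont (\<lambda>s. T (s, b')) a'" using a1 b1 by (intro holomorphic2_on_isCont(1)[OF T]) (auto intro: open_Times)
      moreover have "isCont (\<lambda>s. G (s, b')) a'" using abU by (intro holomorphic2_on_isCont(1)[OF U(4,1)])
      moreover have "isCont (zcoeff k) a'" for k
        using holomorphic_on_imp_continuous_on[OF zcoeff_holomorphic[of k]] open_Compl_posints G[OF a1]
        by (simp add: continuous_on_eq_continuous_at)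
      moreover have "isCont (\<lambda>s. Gamma (1 - s)) a'" using ga by (intro continuous_intros) auto
      moreover have "Gamma (1 - a') \<noteq> 0" using ga by (simp add: Gamma_eq_zero_iff)
      ultimately show ?thesis unfolding S_def using rb ga by (intro continuous_intros) auto
    qed
    then have lim: "(S \<longlongrightarrow> S a') (at a')" by (simp add: isCont_def)
    have ev: "\<forall>\<^sub>F s in at a'. S s = zH (s + b' - 1)"
    proof -
      have "open ((\<lambda>s. (s, b')) -` U)" by (intro open_vimage U(1) continuous_intros)
      then have "\<forall>\<^sub>F s in at a'. s \<in> (\<lambda>s. (s, b')) -` U" using abU by (intro eventually_at_in_open') auto
      moreover have "\<forall>\<^sub>F s in at a'. s \<in> ball a e - {a}" using a1 by (intro eventually_at_in_open') (auto intro: open_Diff)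
      moreover have "\<forall>\<^sub>F s in at a'. s \<in> UNIV - {a'}" by (intro eventually_at_in_open) auto
      ultimately show ?thesis
      proof eventually_elim
        case (elim s)
        have s: "s + b' - 1 \<in> ball (a + b - 1) (2 * e) - {a + b - 1}"
        proof -
          have "s + b' - 1 \<noteq> a + b - 1" unfolding ab[symmetric] using elim by simp
          then show ?thesis using sum_minus_one_in_ball[of "(s, b')" a e b] elim b1 by auto
        qed
        have "zF (s, b') = G (s, b')"
          by (rule zF_eq_regular_extension[OF F U(1,2,4,5,6) FG]) (use elim G[of s] H[OF s] bk[OF b1] in auto)
        moreover have "zF (s, b') = T (s, b') + rGamma b' * Gamma (1 - s) * zH (s + b' - 1)
             + (\<Sum>k<K. zcoeff k s * (rGamma b' * zH (b' + of_nat k)))"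
          using Fs[of "(s, b')"] b1 elim by simp
        moreover have "Gamma (1 - s) \<noteq> 0"
          using one_minus_notin_nonpos_Ints[of s] conjunct1[OF G[OF elim(2)]] by (simp add: Gamma_eq_zero_iff)
        ultimately show ?case unfolding S_def using rb by (simp add: field_simps)
      qed
    qed
    have "((\<lambda>s. zH (s + b' - 1)) \<longlongrightarrow> S a') (at a')" using lim ev by (rule Lim_transform_eventually)
    from LIM_offset[OF this, of "1 - b'"] have "(zH \<longlongrightarrow> S a') (at (a + b - 1))"
      using ab by (simp add: algebra_simps)
    then show False using zH_no_limit[OF c] by blast
  qed
qed

text \<open>\<open>meromorphic_continuation2\<close> demands equality at every point of the domain,
  which contains points with s_1 a positive integer, where \<open>zF\<close> has conventional
  values. Hence the series itself is used throughout the domain.\<close>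

definition zF1 :: "complex \<times> complex \<Rightarrow> complex" where
  "zF1 z = (if z \<in> double_series_domain then double_series (\<lambda>_. 1) mangoldt z else zF z)"

lemma zF1_eq:
  assumes "fst z \<notin> posints"
  shows "zF1 z = zF z"
proof (cases "z \<in> double_series_domain")
  case True
  obtain s1 s2 where z: "z = (s1, s2)" by fastforce
  have re: "Re s2 > 1" "Re (s1 + s2) > 2" using True unfolding z double_series_domain_def by auto
  have "s2 \<notin> \<int>\<^sub>\<le>\<^sub>0" using re(1) by (auto elim!: nonpos_Ints_cases)
  then have "rGamma s2 * Gamma s2 = 1" by (simp add: rGamma_inverse_Gamma Gamma_eq_zero_iff)
  then have "double_series (\<lambda>_. 1) mangoldt (s1, s2) = rGamma s2 * (Gamma s2 * double_series (\<lambda>_. 1) mangoldt (s1, s2))"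
    by (simp flip: mult.assoc)
  also have "\<dots> = zF (s1, s2)"
    using double_series_expansion[OF re] assms unfolding z zF_def by simp
  finally show ?thesis using True unfolding zF1_def z by simp
qed (simp add: zF1_def)

lemma zF1_meromorphic: "meromorphic2 zF1"
  unfolding meromorphic2_def
proof (intro allI)
  fix p :: "complex \<times> complex"
  obtain a b where p: "p = (a, b)" by fastforce
  obtain U g h where "open U" "connected U" "(a, b) \<in> U" "holomorphic2_on g U" "holomorphic2_on h U"
    "\<exists>z\<in>U. h z \<noteq> 0" "\<forall>z\<in>U. h z \<noteq> 0 \<longrightarrow> fst z \<notin> posints \<and> zF z = g z / h z"
    using zF_meromorphic_at[of a b] by (elim exE conjE) (rule that; assumption)
  then show "\<exists>U g h. open U \<and> connected U \<and> p \<in> U \<and> holomorphic2_on g U \<and> holomorphic2_on h U \<and> (\<exists>z\<in>U. h z \<noteq> 0) \<and>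
        (\<forall>z\<in>U. h z \<noteq> 0 \<longrightarrow> zF1 z = g z / h z)"
    unfolding p by (intro exI[of _ U] exI[of _ g] exI[of _ h]) (simp add: zF1_eq)
qed

lemma zF1_regular:
  assumes "a + b - 1 \<notin> zH_poles" "\<forall>k. b + of_nat k \<in> zM_poles \<longrightarrow> k \<ge> 1 \<and> b + of_nat k = 1"
  shows "regular2_at zF1 (a, b)"
proof -
  obtain U g h where "open U" "connected U" "(a, b) \<in> U" "holomorphic2_on g U" "holomorphic2_on h U"
    "\<exists>z\<in>U. h z \<noteq> 0" "\<forall>z\<in>U. h z \<noteq> 0 \<longrightarrow> fst z \<notin> posints \<and> zF z = g z"
    using zF_regular_at[OF assms] by (elim exE conjE) (rule that; assumption)
  then show ?thesis
    unfolding regular2_at_def by (intro exI[of _ U] exI[of _ g] exI[of _ h]) (simp add: zF1_eq)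
qed

lemma zF1_regular_iff:
  "regular2_at zF1 (a, b) \<longleftrightarrow>
     a + b - 1 \<notin> zH_poles \<and> (\<forall>k. b + of_nat k \<in> zM_poles \<longrightarrow> k \<ge> 1 \<and> b + of_nat k = 1)"
  using zF1_regular[of a b] zF_singular_sum[OF zF1_eq, of a b] zF_singular_snd[OF zF1_eq, of b _ a] by blast

text \<open>The function \<open>zF1\<close> shows that a continuation exists, so the selected one is
  a continuation too; by uniqueness the two are generically equal and therefore regular at the same
  points.\<close>

lemma Phi2_regular_iff: "regular2_at (Phi2 (\<lambda>_. 1) mangoldt) p \<longleftrightarrow> regular2_at zF1 p"
proof -
  let ?f = "double_series (\<lambda>_. 1) mangoldt"
  have "meromorphic_continuation2 ?f double_series_domain zF1"
    unfolding meromorphic_continuation2_def using zF1_meromorphic by (simp add: zF1_def)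
  then have "meromorphic_continuation2 ?f double_series_domain (Phi2 (\<lambda>_. 1) mangoldt)"
    unfolding Phi2_def by (rule someI[of "meromorphic_continuation2 ?f double_series_domain"])
  then have P: "meromorphic2 (Phi2 (\<lambda>_. 1) mangoldt)" "\<And>z. z \<in> double_series_domain \<Longrightarrow> Phi2 (\<lambda>_. 1) mangoldt z = zF1 z"
    unfolding meromorphic_continuation2_def zF1_def by auto
  have "double_series_domain = {z. Re (snd z) > 1} \<inter> {z :: complex \<times> complex. Re (fst z + snd z) > 2}"
    unfolding double_series_domain_def by auto
  moreover have "open ({z. Re (snd z) > 1} \<inter> {z :: complex \<times> complex. Re (fst z + snd z) > 2})"
    by (intro open_Int open_Collect_less continuous_intros)
  ultimately have "open double_series_domain" by simp
  moreover have "(2, 2) \<in> double_series_domain" unfolding double_series_domain_def by simp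
  ultimately have "generically_equal_at (Phi2 (\<lambda>_. 1) mangoldt) zF1 p"
    by (intro meromorphic_continuation2_unique[OF P(1) zF1_meromorphic _ _ P(2)]) auto
  then show ?thesis using regular2_at_cong generically_equal_at_sym by blast
qed

section \<open>Matching the poles with the list of hyperplanes\<close>

lemma zM_poles_iff:
  "s \<in> zM_poles \<longleftrightarrow> s = 1 \<or> s \<in> zeta_nontrivial_zeros \<or> (\<exists>j::nat. j \<ge> 1 \<and> s = - of_nat (2 * j))"
proof (cases "s = 1")
  case False
  have "zeta1 s = 0 \<longleftrightarrow> zeta s = 0" using zeta_eq[OF False] False by simp
  moreover have "zeta1 s = 0" if "j \<ge> 1" "s = - of_nat (2 * j)" for j :: nat
    unfolding that(2) by (rule zeta1_neg_even) (use that(1) in simp)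
  ultimately show ?thesis using False unfolding zM_poles_def zeta_nontrivial_zeros_def by auto
qed (simp add: zM_poles_def)

text \<open>In the list \<open>1 - l\<close>, index 0 is the pole of zeta and index
  \<open>Suc n\<close> is the pole of \<open>Gamma\<close> at \<open>- n\<close>; the trivial zeros
  are among the latter.\<close>

lemma zH_poles_iff:
  "s \<in> zH_poles \<longleftrightarrow> (\<exists>l::nat. s = 1 - of_nat l) \<or> s \<in> zeta_nontrivial_zeros"
proof
  assume "s \<in> zH_poles"
  then consider "s = 1" | "s \<in> zeta_nontrivial_zeros" | n :: nat where "s = - of_nat n"
    unfolding zH_poles_def Un_iff zM_poles_iff by (blast elim: nonpos_Ints_cases')
  then show "(\<exists>l::nat. s = 1 - of_nat l) \<or> s \<in> zeta_nontrivial_zeros"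
  proof cases
    case 1 then show ?thesis by (intro disjI1 exI[of _ 0]) simp
  next
    case 3 then show ?thesis by (intro disjI1 exI[of _ "Suc n"]) simp
  qed blast
next
  assume "(\<exists>l::nat. s = 1 - of_nat l) \<or> s \<in> zeta_nontrivial_zeros"
  then show "s \<in> zH_poles"
  proof
    assume "\<exists>l::nat. s = 1 - of_nat l"
    then obtain l :: nat where l: "s = 1 - of_nat l" ..
    show ?thesis
    proof (cases l)
      case 0 then show ?thesis using l unfolding zH_poles_def zM_poles_def by simp
    next
      case (Suc n)
      then have "s = - of_nat n" using l by simp
      then show ?thesis unfolding zH_poles_def by simp
    qed
  qed (simp add: zH_poles_def zM_poles_iff)
qed

text \<open>The trivial zeros -2j shifted by -k give exactly the integers \<le> -2, while the pole
  at 1 counts only for k = 0; this is why neither source yields s_2 = 0 or s_2 = -1.\<close>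

lemma shifted_zM_poles_iff:
  "(\<exists>k. b + of_nat k \<in> zM_poles \<and> \<not> (k \<ge> 1 \<and> b + of_nat k = 1)) \<longleftrightarrow>
     b = 1 \<or> (\<exists>l::nat. l \<ge> 2 \<and> b = - of_nat l) \<or> (\<exists>(l::nat) \<rho>. b = - of_nat l + \<rho> \<and> \<rho> \<in> zeta_nontrivial_zeros)"
    (is "?L = ?R")
proof
  assume ?L
  then obtain k where k: "b + of_nat k \<in> zM_poles" "\<not> (k \<ge> 1 \<and> b + of_nat k = 1)" by blast
  from k(1) consider "b + of_nat k = 1" | "b + of_nat k \<in> zeta_nontrivial_zeros" | j :: nat where "j \<ge> 1" "b + of_nat k = - of_nat (2 * j)"
    unfolding zM_poles_iff by blast
  then show ?R
  proof cases
    case 1 then have "k = 0" using k(2) by simp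
    then show ?thesis using 1 by simp
  next
    case 2
    have "b = - of_nat k + (b + of_nat k)" by simp
    then show ?thesis using 2 by blast
  next
    case 3
    have "b = - of_nat (k + 2 * j)" using 3(2) by (simp add: eq_neg_iff_add_eq_0 algebra_simps)
    moreover have "k + 2 * j \<ge> 2" using 3(1) by simp
    ultimately show ?thesis by blast
  qed
next
  assume ?R
  then consider "b = 1" | l :: nat where "l \<ge> 2" "b = - of_nat l" | l :: nat and \<rho> where "b = - of_nat l + \<rho>" "\<rho> \<in> zeta_nontrivial_zeros"
    by blast
  then show ?L
  proof cases
    case 1 then show ?thesis by (intro exI[of _ 0]) (simp add: zM_poles_def)
  next
    case 2
    \<comment> \<open>The trivial zero -2 alone, shifted by all \<open>k\<close>, already yields
      every \<open>l \<ge> 2\<close>.\<close>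
    have e: "b + of_nat (l - 2) = - of_nat (2 * 1)" using 2 by (simp add: of_nat_diff)
    moreover have "- of_nat (2 * 1) \<noteq> (1::complex)" by (simp add: complex_eq_iff)
    moreover have "- of_nat (2 * 1) \<in> zM_poles" unfolding zM_poles_iff by (metis le_refl)
    ultimately show ?thesis by (intro exI[of _ "l - 2"]) (simp only: simp_thms)
  next
    case 3
    have "b + of_nat l = \<rho>" using 3(1) by simp
    moreover have "\<rho> \<noteq> 1" "\<rho> \<in> zM_poles" using 3(2) by (auto simp: zM_poles_iff zeta_nontrivial_zeros_def)
    ultimately show ?thesis by (intro exI[of _ l]) simp
  qed
qed

lemma singularities2_Phi2: "singularities2 (Phi2 (\<lambda>_. 1) mangoldt) = \<Union> singular_hyperplanes"
proof (rule set_eqI)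
  fix p :: "complex \<times> complex"
  obtain a b where p: "p = (a, b)" by fastforce
  have "p \<in> singularities2 (Phi2 (\<lambda>_. 1) mangoldt) \<longleftrightarrow>
      (a + b - 1 \<in> zH_poles \<or> (\<exists>k. b + of_nat k \<in> zM_poles \<and> \<not> (k \<ge> 1 \<and> b + of_nat k = 1)))"
    unfolding singularities2_def mem_Collect_eq Phi2_regular_iff p zF1_regular_iff by blast
  also have "\<dots> \<longleftrightarrow> (\<exists>l::nat. a + b = 2 - of_nat l) \<or> (\<exists>\<rho>. a + b = 1 + \<rho> \<and> \<rho> \<in> zeta_nontrivial_zeros) \<or>
      b = 1 \<or> (\<exists>l::nat. l \<ge> 2 \<and> b = - of_nat l) \<or> (\<exists>(l::nat) \<rho>. b = - of_nat l + \<rho> \<and> \<rho> \<in> zeta_nontrivial_zeros)"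
  proof -
    have "a + b - 1 = 1 - of_nat l \<longleftrightarrow> a + b = 2 - of_nat l" for l :: nat
      by (simp add: diff_eq_eq algebra_simps)
    moreover have "a + b - 1 \<in> zeta_nontrivial_zeros \<longleftrightarrow> (\<exists>\<rho>. a + b = 1 + \<rho> \<and> \<rho> \<in> zeta_nontrivial_zeros)"
      by (metis add_diff_cancel_left' diff_add_cancel add.commute)
    ultimately show ?thesis unfolding shifted_zM_poles_iff zH_poles_iff by simp
  qed
  also have "\<dots> \<longleftrightarrow> p \<in> \<Union> singular_hyperplanes"
  proof -
    have 1: "p \<in> \<Union>{A l | l. P l} \<longleftrightarrow> (\<exists>l. P l \<and> p \<in> A l)" for A and P :: "nat \<Rightarrow> bool" by blast
    have 2: "p \<in> \<Union>{A l | l. P l} \<longleftrightarrow> (\<exists>l. P l \<and> p \<in> A l)" for A and P :: "complex \<Rightarrow> bool" by blast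
    have 3: "p \<in> \<Union>{A l r | l r. P l r} \<longleftrightarrow> (\<exists>l r. P l r \<and> p \<in> A l r)"
      for A and P :: "nat \<Rightarrow> complex \<Rightarrow> bool" by blast
    show ?thesis
      unfolding singular_hyperplanes_def Union_Un_distrib Un_iff 1 2 3 by (auto simp: p)
  qed
  finally show "p \<in> singularities2 (Phi2 (\<lambda>_. 1) mangoldt) \<longleftrightarrow> p \<in> \<Union> singular_hyperplanes" .
qed

theorem theorem2p2:
  "singularities2 (Phi2 (\<lambda>_. 1) mangoldt) \<subseteq> \<Union> singular_hyperplanes \<and>
   (\<forall>H\<in>singular_hyperplanes. H \<subseteq> singularities2 (Phi2 (\<lambda>_. 1) mangoldt))"
  unfolding singularities2_Phi2 by blast

end
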